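(* Let $R$ be a semilocal commutative ring of Krull dimension $0$ which is integral over an Artinian subring $R_0$, write $\mathcal{F}=\mathcal{F}(R_0,R)$, and let $S=\mathcal{F}\llbracket X_1,\ldots,X_n\rrbracket$. Then a proper ideal of $S$ is height-generated if and only if it is generated by a regular sequence.
   Context: All rings are commutative with identity, and subrings share the identity; semilocal means having finitely many maximal ideals (no Noetherian assumption). For a $0$-dimensional ring $R$ and an Artinian subring $R_0\subseteq R$ such that $R$ is integral over $R_0$, let $\mathcal{F}(R_0,R)=\{R_\alpha\}$ denote the family of all subrings of $R$ that are finitely generated as $R_0$-algebras; this family is directed, each $R_\alpha$ is Artinian, and $R=\bigcup_\alpha R_\alpha$. The ring of Artinian power series $\mathcal{F}\llbracket X_1,\ldots,X_n\rrbracket$ is the set of all $f\in R\llbracket X_1,\ldots,X_n\rrbracket$ such that all coefficients of $f$ lie in a single $R_\alpha\in\mathcal{F}$; equivalently, $\mathcal{F}\llbracket X_1,\ldots,X_n\rrbracket=\bigcup_\alpha R_\alpha\llbracket X_1,\ldots,X_n\rrbracket$, which is a subring of $R\llbracket X_1,\ldots,X_n\rrbracket$. A finitely generated ideal $I$ is height-generated if it can be generated by $\operatorname{ht}(I)$ elements. A regular sequence $f_1,\ldots,f_t$ in $S$ means $(f_1,\ldots,f_t)S\ne S$ and each $f_i$ is a non-zero-divisor on $S/(f_1,\ldots,f_{i-1})S$ (the empty sequence generates the zero ideal). *)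

theory Defs
  imports "HOL-Algebra.Ideal" "HOL-Algebra.Generated_Rings" "HOL-Algebra.Subrings" "HOL-Library.Extended_Nat"
begin

definition krull_dim_zero :: "('a, 'b) ring_scheme \<Rightarrow> bool" where
  "krull_dim_zero R \<longleftrightarrow> carrier R \<noteq> {\<zero>\<^bsub>R\<^esub>} \<and>
     (\<forall>P. primeideal P R \<longrightarrow> maximalideal P R)"

definition semilocal :: "('a, 'b) ring_scheme \<Rightarrow> bool" where
  "semilocal R \<longleftrightarrow> finite {M. maximalideal M R}"

definition artinian :: "('a, 'b) ring_scheme \<Rightarrow> bool" where
  "artinian A \<longleftrightarrow> cring A \<and>
     (\<forall>f :: nat \<Rightarrow> 'a set. (\<forall>k. ideal (f k) A) \<longrightarrow> (\<forall>k. f (Suc k) \<subseteq> f k)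
        \<longrightarrow> (\<exists>N. \<forall>k\<ge>N. f k = f N))"

definition integral_over :: "('a, 'b) ring_scheme \<Rightarrow> 'a set \<Rightarrow> bool" where
  "integral_over R R0 \<longleftrightarrow> (\<forall>x\<in>carrier R. \<exists>(d::nat) c. (\<forall>i<d. c i \<in> R0) \<and>
      x [^]\<^bsub>R\<^esub> d \<oplus>\<^bsub>R\<^esub> (\<Oplus>\<^bsub>R\<^esub>i\<in>{..<d}. c i \<otimes>\<^bsub>R\<^esub> x [^]\<^bsub>R\<^esub> i) = \<zero>\<^bsub>R\<^esub>)"

definition fg_subalgebra :: "('a, 'b) ring_scheme \<Rightarrow> 'a set \<Rightarrow> 'a set \<Rightarrow> bool" where
  "fg_subalgebra R R0 A \<longleftrightarrow>
     (\<exists>F. finite F \<and> F \<subseteq> carrier R \<and> A = generate_ring R (R0 \<union> F))"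

definition mexps :: "nat \<Rightarrow> (nat \<Rightarrow> nat) set" where
  "mexps n = {\<alpha>. \<forall>i\<ge>n. \<alpha> i = 0}"

definition mps_carrier :: "('a, 'b) ring_scheme \<Rightarrow> nat \<Rightarrow> ((nat \<Rightarrow> nat) \<Rightarrow> 'a) set" where
  "mps_carrier R n = {f. (\<forall>\<alpha>\<in>mexps n. f \<alpha> \<in> carrier R) \<and> (\<forall>\<alpha>. \<alpha> \<notin> mexps n \<longrightarrow> f \<alpha> = \<zero>\<^bsub>R\<^esub>)}"

definition mps :: "('a, 'b) ring_scheme \<Rightarrow> nat \<Rightarrow> ((nat \<Rightarrow> nat) \<Rightarrow> 'a) ring" where
  "mps R n = \<lparr> carrier = mps_carrier R n,
     mult = (\<lambda>f g \<alpha>. if \<alpha> \<in> mexps n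
        then (\<Oplus>\<^bsub>R\<^esub>\<beta>\<in>{\<beta>. \<forall>i. \<beta> i \<le> \<alpha> i}. f \<beta> \<otimes>\<^bsub>R\<^esub> g (\<lambda>i. \<alpha> i - \<beta> i))
        else \<zero>\<^bsub>R\<^esub>),
     one = (\<lambda>\<alpha>. if \<alpha> = (\<lambda>_. 0) then \<one>\<^bsub>R\<^esub> else \<zero>\<^bsub>R\<^esub>),
     zero = (\<lambda>_. \<zero>\<^bsub>R\<^esub>),
     add = (\<lambda>f g \<alpha>. f \<alpha> \<oplus>\<^bsub>R\<^esub> g \<alpha>) \<rparr>"

definition artinian_mps :: "('a, 'b) ring_scheme \<Rightarrow> 'a set \<Rightarrow> nat \<Rightarrow> ((nat \<Rightarrow> nat) \<Rightarrow> 'a) ring" where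
  "artinian_mps R R0 n = (mps R n) \<lparr> carrier :=
     {f \<in> mps_carrier R n. \<exists>A. fg_subalgebra R R0 A \<and> (\<forall>\<alpha>. f \<alpha> \<in> A)} \<rparr>"

definition prime_height :: "('a, 'b) ring_scheme \<Rightarrow> 'a set \<Rightarrow> enat" where
  "prime_height S P = (SUP k \<in> {k. \<exists>C :: nat \<Rightarrow> 'a set. (\<forall>i\<le>k. primeideal (C i) S) \<and>
        (\<forall>i<k. C i \<subset> C (Suc i)) \<and> C k = P}. enat k)"

definition ideal_height :: "('a, 'b) ring_scheme \<Rightarrow> 'a set \<Rightarrow> enat" where
  "ideal_height S I = (INF P \<in> {P. primeideal P S \<and> I \<subseteq> P}. prime_height S P)"

definition height_generated :: "('a, 'b) ring_scheme \<Rightarrow> 'a set \<Rightarrow> bool" where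
  "height_generated S I \<longleftrightarrow> (\<exists>xs. set xs \<subseteq> carrier S \<and> genideal S (set xs) = I \<and>
      enat (length xs) = ideal_height S I)"

definition regular_sequence :: "('a, 'b) ring_scheme \<Rightarrow> 'a list \<Rightarrow> bool" where
  "regular_sequence S fs \<longleftrightarrow> set fs \<subseteq> carrier S \<and> genideal S (set fs) \<noteq> carrier S \<and>
     (\<forall>i<length fs. \<forall>g\<in>carrier S.
        fs ! i \<otimes>\<^bsub>S\<^esub> g \<in> genideal S (set (take i fs)) \<longrightarrow> g \<in> genideal S (set (take i fs)))"

end

theory Submission
  imports Defs
begin

text \<open>Over one maximal ideal \<open>M\<close> of \<open>R\<close>, the ring \<open>S\<close> behaves like a local Cohen-Macaulay ring of dimension \<open>n\<close>.
  Since \<open>R\<close> is semilocal of dimension zero there are idempotents \<open>e\<close> lying in any prescribed set of maximal ideals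
  and no others, so regularity may be tested one \<open>M\<close> at a time after multiplication by such an \<open>e\<close>.
  Modulo the prime ideal of series with all coefficients in \<open>M\<close>, systems of parameters \<open>y\<^sub>1, \<dots>, y\<^sub>k\<close> make \<open>S\<close> integral
  over the series in \<open>y\<close>, which yields chains of primes of the expected length. A system of \<open>n\<close> series
  with nilpotent constant terms whose ideal contains powers of all variables is a regular sequence: the
  first Koszul homology vanishes because the powers of the variables form a regular sequence in the ideal.
  Height equal to the number of generators provides the parameters that complete the generators to such a system.\<close>

section \<open>Ideals and Koszul complexes\<close>

text \<open>\<open>S\<close> need be neither Noetherian nor complete: the coefficients of one series
  lie in a single member of the family, and an infinite sum of such series can leave
  \<open>S\<close>, so that Krull's height theorem and Nakayama's lemma are not at hand. Every limit
  is formed over one fixed coefficient subring \<open>B\<close>, and the outcome is carried to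
  \<open>S\<close> by directedness, because an ideal membership involves only finitely many series.
  Heights are controlled by counting parameters: a strict inclusion of primes over \<open>M\<close>
  saves one parameter, and a shortest system of \<open>k\<close> parameters yields a chain of
  \<open>k\<close> steps above the ideal. Regularity requires constant terms that are nilpotent in
  \<open>R\<close>, but those at hand lie in one \<open>M\<close> only. With \<open>e\<close> the
  idempotent lying in every maximal ideal except \<open>M\<close>, the series
  \<open>e f_j + (1 - e) X_j\<close> agree with the given ones at \<open>M\<close> and with the
  variables elsewhere, and their constant terms lie in every prime of \<open>R\<close>. The Artinian
  hypothesis acts through one consequence: a series with nilpotent coefficients in one member of the
  family is nilpotent.\<close>

lemma zero_mem_ideal: "ideal J R \<Longrightarrow> \<zero>\<^bsub>R\<^esub> \<in> J"
  by (rule additive_subgroup.zero_closed[OF ideal.axioms(1)])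

context cring
begin

lemma idealI_cring:
  assumes "J \<subseteq> carrier R" "\<zero> \<in> J" "\<And>x y. x \<in> J \<Longrightarrow> y \<in> J \<Longrightarrow> x \<oplus> y \<in> J"
    "\<And>c x. c \<in> carrier R \<Longrightarrow> x \<in> J \<Longrightarrow> c \<otimes> x \<in> J"
  shows "ideal J R"
proof (rule idealI)
  show "ring R" by (rule ring_axioms)
  show "subgroup J (add_monoid R)"
  proof (rule add.subgroupI)
    fix a assume a: "a \<in> J"
    have "\<ominus> a = (\<ominus> \<one>) \<otimes> a" using a assms(1) by (simp add: l_minus subsetD)
    then show "\<ominus> a \<in> J" using assms(4)[of "\<ominus> \<one>" a] a by simp
  qed (use assms in auto)
  show "x \<otimes> a \<in> J" if "a \<in> J" "x \<in> carrier R" for a x using that assms by auto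
  show "a \<otimes> x \<in> J" if "a \<in> J" "x \<in> carrier R" for a x
    using that assms by (metis m_comm subsetD)
qed

lemma ideal_minus:
  assumes "ideal J R" "x \<in> J" "y \<in> J" shows "x \<ominus> y \<in> J"
proof -
  interpret ideal J R by (rule assms(1))
  show ?thesis using assms by (simp add: minus_eq)
qed

lemma diff_add_cancel_cring: "x \<in> carrier R \<Longrightarrow> y \<in> carrier R \<Longrightarrow> (x \<ominus> y) \<oplus> y = x"
  by (simp add: minus_eq a_assoc l_neg)

lemma diff_diff_cancel_cring: "x \<in> carrier R \<Longrightarrow> y \<in> carrier R \<Longrightarrow> x \<ominus> (x \<ominus> y) = y"
  by (simp add: minus_eq minus_add a_assoc[symmetric] r_neg)

lemma ring_id1:
  assumes "a \<in> carrier R" "b \<in> carrier R" "c \<in> carrier R" "d \<in> carrier R" "y \<in> carrier R"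
  shows "(a \<oplus> c \<otimes> y) \<oplus> (b \<oplus> d \<otimes> y) = (a \<oplus> b) \<oplus> (c \<oplus> d) \<otimes> y"
  using assms by (simp add: l_distr a_ac)

lemma ring_id2:
  assumes "a \<in> carrier R" "b \<in> carrier R" "c \<in> carrier R" "d \<in> carrier R" "p \<in> carrier R" "q \<in> carrier R"
  shows "(p \<oplus> c \<otimes> a) \<otimes> (q \<oplus> d \<otimes> b) = (q \<oplus> d \<otimes> b) \<otimes> p \<oplus> (c \<otimes> a) \<otimes> q \<oplus> (c \<otimes> d) \<otimes> (a \<otimes> b)"
  using assms by (simp add: l_distr r_distr a_ac m_ac)

text \<open>This is the component without \<open>g\<close> of the homotopy identity for a cone:
  \<open>x\<close> and \<open>y\<close> are the two inner terms, \<open>w\<close> is the chain value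
  to be scaled, and \<open>h\<close> is the inner homotopy on the other component, which cancels.
  \<open>ring_id4\<close> is the component with \<open>g\<close>, where the inner differential
  \<open>k\<close> cancels.\<close>

lemma ring_id3:
  assumes "x \<in> carrier R" "y \<in> carrier R" "g \<in> carrier R" "c \<in> carrier R" "w \<in> carrier R" "h \<in> carrier R"
  shows "(x \<oplus> g \<otimes> (c \<otimes> w \<ominus> h)) \<oplus> (y \<oplus> g \<otimes> h) = c \<otimes> g \<otimes> w \<oplus> (x \<oplus> y)"
proof -
  have "(x \<oplus> (g \<otimes> (c \<otimes> w) \<oplus> (\<ominus> (g \<otimes> h)))) \<oplus> (y \<oplus> g \<otimes> h)
      = g \<otimes> (c \<otimes> w) \<oplus> (x \<oplus> y) \<oplus> (\<ominus> (g \<otimes> h) \<oplus> g \<otimes> h)"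
    using assms by (simp add: a_ac)
  then show ?thesis using assms by (simp add: minus_eq r_distr r_minus l_neg m_ac)
qed

lemma ring_id4:
  assumes "x \<in> carrier R" "y \<in> carrier R" "g \<in> carrier R" "c \<in> carrier R" "w \<in> carrier R" "k \<in> carrier R"
  shows "\<ominus> (c \<otimes> k \<ominus> x) \<oplus> (c \<otimes> (k \<oplus> g \<otimes> w) \<ominus> \<ominus> y) = c \<otimes> g \<otimes> w \<oplus> (x \<oplus> y)"
proof -
  have "(\<ominus> (c \<otimes> k) \<oplus> x) \<oplus> ((c \<otimes> k \<oplus> c \<otimes> (g \<otimes> w)) \<oplus> y)
      = c \<otimes> (g \<otimes> w) \<oplus> (x \<oplus> y) \<oplus> (\<ominus> (c \<otimes> k) \<oplus> c \<otimes> k)"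
    using assms by (simp add: a_ac)
  then show ?thesis using assms by (simp add: minus_eq minus_add r_distr l_neg m_assoc)
qed

lemma ideal_diff_mem:
  assumes "ideal J R" "x \<ominus> y \<in> J" "y \<in> J" "x \<in> carrier R" shows "x \<in> J"
proof -
  interpret ideal J R by (rule assms(1))
  show ?thesis using assms a_closed[of "x \<ominus> y" y] diff_add_cancel_cring Icarr by force
qed

lemma ideal_diff_mem':
  assumes "ideal J R" "x \<ominus> y \<in> J" "x \<in> J" "y \<in> carrier R" shows "y \<in> J"
proof -
  interpret ideal J R by (rule assms(1))
  show ?thesis using assms ideal_minus[of J x "x \<ominus> y"] diff_diff_cancel_cring Icarr by force
qed

lemma ideal_minus_closed2:
  assumes "ideal J R" "x \<in> J" shows "\<ominus> x \<in> J"
  using assms by (simp add: additive_subgroup.a_inv_closed ideal.axioms(1))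

lemma ideal_sum_set:
  assumes J: "ideal J R" and y: "y \<in> carrier R"
  shows "ideal {x \<oplus> c \<otimes> y | x c. x \<in> J \<and> c \<in> carrier R} R"
proof -
  interpret ideal J R by (rule J)
  show ?thesis
  proof (rule idealI_cring)
    show "{x \<oplus> c \<otimes> y |x c. x \<in> J \<and> c \<in> carrier R} \<subseteq> carrier R" using y Icarr by auto
    show "\<zero> \<in> {x \<oplus> c \<otimes> y |x c. x \<in> J \<and> c \<in> carrier R}"
      using y by (auto intro!: exI[of _ \<zero>])
  next
    fix u v assume "u \<in> {x \<oplus> c \<otimes> y |x c. x \<in> J \<and> c \<in> carrier R}" "v \<in> {x \<oplus> c \<otimes> y |x c. x \<in> J \<and> c \<in> carrier R}"
    then obtain a b c d where *: "u = a \<oplus> c \<otimes> y" "v = b \<oplus> d \<otimes> y" "a \<in> J" "b \<in> J" "c \<in> carrier R" "d \<in> carrier R"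
      by blast
    have "(a \<oplus> c \<otimes> y) \<oplus> (b \<oplus> d \<otimes> y) = (a \<oplus> b) \<oplus> (c \<oplus> d) \<otimes> y"
      using y Icarr[OF *(3)] Icarr[OF *(4)] *(5,6) by (intro ring_id1)
    then show "u \<oplus> v \<in> {x \<oplus> c \<otimes> y |x c. x \<in> J \<and> c \<in> carrier R}" using * a_closed by blast
  next
    fix r v assume "r \<in> carrier R" "v \<in> {x \<oplus> c \<otimes> y |x c. x \<in> J \<and> c \<in> carrier R}"
    then obtain b d where *: "v = b \<oplus> d \<otimes> y" "b \<in> J" "d \<in> carrier R" by blast
    have "r \<otimes> (b \<oplus> d \<otimes> y) = r \<otimes> b \<oplus> (r \<otimes> d) \<otimes> y"
      using y Icarr[OF *(2)] \<open>r \<in> carrier R\<close> *(3) by (simp add: r_distr m_assoc)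
    then show "r \<otimes> v \<in> {x \<oplus> c \<otimes> y |x c. x \<in> J \<and> c \<in> carrier R}"
      using * I_l_closed \<open>r \<in> carrier R\<close> by blast
  qed
qed

lemma genideal_insert:
  assumes A: "A \<subseteq> carrier R" and y: "y \<in> carrier R"
  shows "Idl (insert y A) = {x \<oplus> c \<otimes> y | x c. x \<in> Idl A \<and> c \<in> carrier R}" (is "?l = ?r")
proof
  have Il: "ideal (Idl A) R" by (rule genideal_ideal[OF A])
  have i: "ideal ?r R" by (rule ideal_sum_set[OF Il y])
  interpret l: ideal "Idl A" R by (rule Il)
  show "?l \<subseteq> ?r"
  proof (rule genideal_minimal[OF i])
    have "y = \<zero> \<oplus> \<one> \<otimes> y" using y by simp
    then have "y \<in> ?r" using l.zero_closed by blast
    moreover have "a \<in> ?r" if "a \<in> A" for a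
    proof -
      have "a = a \<oplus> \<zero> \<otimes> y" using y A that by auto
      then show ?thesis using genideal_self[OF A] that by blast
    qed
    ultimately show "insert y A \<subseteq> ?r" by blast
  qed
  have ia: "insert y A \<subseteq> carrier R" using assms by auto
  interpret L: ideal ?l R by (rule genideal_ideal[OF ia])
  have "Idl A \<subseteq> ?l" by (rule subset_Idl_subset[OF ia]) auto
  moreover have "y \<in> ?l" using genideal_self[OF ia] by auto
  ultimately show "?r \<subseteq> ?l" using L.a_closed L.I_l_closed by blast
qed

lemma genideal_empty [simp]: "Idl {} = {\<zero>}"
proof
  show "Idl {} \<subseteq> {\<zero>}" by (rule genideal_minimal[OF zeroideal]) auto
  show "{\<zero>} \<subseteq> Idl {}" using genideal_ideal[of "{}"] by (simp add: additive_subgroup.zero_closed ideal.axioms(1))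
qed

lemma genideal_of_ideal: "ideal J R \<Longrightarrow> Idl J = J"
  by (meson additive_subgroup.a_subset genideal_minimal genideal_self ideal.axioms(1) order_refl subset_antisym)

lemma genideal_mono:
  assumes "A \<subseteq> B" "B \<subseteq> carrier R" shows "Idl A \<subseteq> Idl B"
  by (rule subset_Idl_subset[OF assms(2,1)])

lemma ideal_smult_preimage:
  assumes J: "ideal J R" and e: "e \<in> carrier R"
  shows "ideal {x \<in> carrier R. e \<otimes> x \<in> J} R"
proof -
  interpret ideal J R by (rule J)
  show ?thesis
  proof (rule idealI_cring)
    show "c \<otimes> x \<in> {x \<in> carrier R. e \<otimes> x \<in> J}" if "c \<in> carrier R" "x \<in> {x \<in> carrier R. e \<otimes> x \<in> J}" for c x
    proof -
      have "e \<otimes> (c \<otimes> x) = c \<otimes> (e \<otimes> x)" using that e by (simp add: m_lcomm)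
      then show ?thesis using that I_l_closed by auto
    qed
  qed (use e in \<open>auto simp: r_distr\<close>)
qed

text \<open>Krull's argument with Zorn's lemma. The maximality of \<open>P\<close> is exported along
  with its primality: \<open>ideal_in_prime\<close> reads off a maximal ideal from it, and
  \<open>chain_above\<close> uses it to show that certain elements already belong to the chosen
  primes.\<close>

lemma prime_disjoint:
  assumes I: "ideal I R" and E: "E \<subseteq> carrier R" "\<one> \<in> E" "\<And>x y. x \<in> E \<Longrightarrow> y \<in> E \<Longrightarrow> x \<otimes> y \<in> E"
    and IE: "I \<inter> E = {}"
  obtains P where "primeideal P R" "I \<subseteq> P" "P \<inter> E = {}"
    "\<And>Q. ideal Q R \<Longrightarrow> P \<subseteq> Q \<Longrightarrow> Q \<inter> E = {} \<Longrightarrow> Q = P"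
proof -
  let ?A = "{Q. ideal Q R \<and> I \<subseteq> Q \<and> Q \<inter> E = {}}"
  have "\<exists>M\<in>?A. \<forall>X\<in>?A. M \<subseteq> X \<longrightarrow> X = M"
  proof (rule subset_Zorn_nonempty)
    show "?A \<noteq> {}" using I IE by auto
    fix C assume C: "C \<noteq> {}" "subset.chain ?A C"
    have CA: "C \<subseteq> ?A" using C(2) by (rule subset_chain_def[THEN iffD1, THEN conjunct1])
    have tot: "X \<subseteq> Y \<or> Y \<subseteq> X" if "X \<in> C" "Y \<in> C" for X Y
      using C(2)[unfolded subset_chain_def] that by metis
    have idl: "ideal X R" if "X \<in> C" for X using CA that by auto
    have "ideal (\<Union>C) R"
    proof (rule idealI_cring)
      show "\<Union>C \<subseteq> carrier R"
      proof
        fix x assume "x \<in> \<Union>C"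
        then obtain X where X: "X \<in> C" "x \<in> X" by blast
        show "x \<in> carrier R" by (rule ideal.Icarr[OF idl[OF X(1)] X(2)])
      qed
      obtain X where X: "X \<in> C" using C(1) by blast
      interpret X: ideal X R by (rule idl[OF X])
      show "\<zero> \<in> \<Union>C" using X X.zero_closed by blast
      show "x \<oplus> y \<in> \<Union>C" if "x \<in> \<Union>C" "y \<in> \<Union>C" for x y
      proof -
        obtain X Y where "X \<in> C" "Y \<in> C" "x \<in> X" "y \<in> Y" using \<open>x \<in> \<Union>C\<close> \<open>y \<in> \<Union>C\<close> by auto
        with tot[of X Y] obtain Z where Z: "Z \<in> C" "x \<in> Z" "y \<in> Z" by blast
        interpret Z: ideal Z R by (rule idl[OF Z(1)])
        show ?thesis using Z Z.a_closed by blast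
      qed
      show "c \<otimes> x \<in> \<Union>C" if "c \<in> carrier R" "x \<in> \<Union>C" for c x
      proof -
        obtain X where X: "X \<in> C" "x \<in> X" using \<open>x \<in> \<Union>C\<close> by blast
        interpret X: ideal X R by (rule idl[OF X(1)])
        show ?thesis using X X.I_l_closed[OF X(2) that(1)] by blast
      qed
    qed
    then show "\<Union>C \<in> ?A" using CA C(1) by blast
  qed
  then obtain P where PA: "P \<in> ?A" and mx: "\<forall>X\<in>?A. P \<subseteq> X \<longrightarrow> X = P" ..
  from PA have P: "ideal P R" "I \<subseteq> P" "P \<inter> E = {}" by simp_all
  have max: "Q = P" if "ideal Q R" "I \<subseteq> Q" "Q \<inter> E = {}" "P \<subseteq> Q" for Q
    using mx that by simp
  interpret P: ideal P R by (rule P(1))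
  \<comment> \<open>Adjoining \<open>a\<close> enlarges \<open>P\<close> strictly, so the larger
    ideal meets \<open>E\<close>. Two such elements multiply to an element of \<open>E\<close>,
    which would lie in \<open>P\<close> if \<open>a b\<close> did.\<close>
  have meet: "\<exists>p\<in>P. \<exists>c\<in>carrier R. p \<oplus> c \<otimes> a \<in> E" if a: "a \<in> carrier R" "a \<notin> P" for a
  proof (rule ccontr)
    assume n: "\<not> ?thesis"
    let ?Q = "{x \<oplus> c \<otimes> a |x c. x \<in> P \<and> c \<in> carrier R}"
    have iQ: "ideal ?Q R" by (rule ideal_sum_set[OF P(1) a(1)])
    have PQ: "P \<subseteq> ?Q"
    proof
      fix p assume p: "p \<in> P"
      have "p = p \<oplus> \<zero> \<otimes> a" using a(1) P.Icarr[OF p] by simp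
      then show "p \<in> ?Q" using p zero_closed by blast
    qed
    have "?Q \<inter> E = {}" using n unfolding disjoint_iff by force
    then have QP: "?Q = P" by (rule max[OF iQ subset_trans[OF P(2) PQ] _ PQ])
    have "a = \<zero> \<oplus> \<one> \<otimes> a" using a by simp
    then have "a \<in> ?Q" using P.zero_closed by blast
    then show False using a(2) unfolding QP by blast
  qed
  have "primeideal P R"
  proof (rule primeidealI[OF P(1)])
    show "cring R" by (rule is_cring)
    show "carrier R \<noteq> P" using P(3) E(1,2) by blast
    fix a b assume ab: "a \<in> carrier R" "b \<in> carrier R" "a \<otimes> b \<in> P"
    show "a \<in> P \<or> b \<in> P"
    proof (rule ccontr)
      assume n: "\<not> ?thesis"
      obtain p c where 1: "p \<in> P" "c \<in> carrier R" "p \<oplus> c \<otimes> a \<in> E" using meet ab n by blast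
      obtain q d where 2: "q \<in> P" "d \<in> carrier R" "q \<oplus> d \<otimes> b \<in> E" using meet ab n by blast
      have pq: "p \<in> carrier R" "q \<in> carrier R" using 1 2 P.Icarr by auto
      have "(p \<oplus> c \<otimes> a) \<otimes> (q \<oplus> d \<otimes> b) = (q \<oplus> d \<otimes> b) \<otimes> p \<oplus> (c \<otimes> a) \<otimes> q \<oplus> (c \<otimes> d) \<otimes> (a \<otimes> b)"
        using ab 1(2) 2(2) pq by (intro ring_id2)
      also have "\<dots> \<in> P"
        using 1 2 ab pq by (intro P.a_closed[OF P.a_closed[OF P.I_l_closed P.I_l_closed] P.I_l_closed]) simp_all
      finally show False using E(3)[OF 1(3) 2(3)] P(3) by blast
    qed
  qed
  then show thesis
  proof (rule that[OF _ P(2,3)])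
    show "Q = P" if "ideal Q R" "P \<subseteq> Q" "Q \<inter> E = {}" for Q
      using max[OF that(1) _ that(3,2)] P(2) that(2) by blast
  qed
qed

lemma ideal_in_prime:
  assumes I: "ideal I R" "I \<noteq> carrier R"
  obtains P where "primeideal P R" "maximalideal P R" "I \<subseteq> P"
proof -
  have 1: "\<one> \<notin> I" using I ideal.one_imp_carrier by blast
  obtain P where P: "primeideal P R" "I \<subseteq> P" "P \<inter> {\<one>} = {}"
    "\<And>Q. ideal Q R \<Longrightarrow> P \<subseteq> Q \<Longrightarrow> Q \<inter> {\<one>} = {} \<Longrightarrow> Q = P"
  proof (rule prime_disjoint[OF I(1), of "{\<one>}"])
    show "I \<inter> {\<one>} = {}" using 1 by blast
  qed simp_all
  have "maximalideal P R"
  proof (rule maximalidealI)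
    show "ideal P R" using P(1) by (simp add: primeideal.axioms(1))
    show "carrier R \<noteq> P" using P(3) by auto
    show "J = P \<or> J = carrier R" if "ideal J R" "P \<subseteq> J" "J \<subseteq> carrier R" for J
      using P(4)[of J] that ideal.one_imp_carrier by blast
  qed
  then show thesis using that P by blast
qed

text \<open>The radical is the intersection of the primes above: if no power of \<open>x\<close> lay
  in \<open>I\<close>, some prime over \<open>I\<close> would avoid the multiplicative set of powers
  of \<open>x\<close>.\<close>

lemma mem_primes_imp_power:
  assumes I: "ideal I R" and x: "x \<in> carrier R" and all: "\<And>P. primeideal P R \<Longrightarrow> I \<subseteq> P \<Longrightarrow> x \<in> P"
  shows "\<exists>k::nat. x [^] k \<in> I"
proof (rule ccontr)
  assume n: "\<not> ?thesis"
  let ?E = "range (\<lambda>k::nat. x [^] k)"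
  obtain P where P: "primeideal P R" "I \<subseteq> P" "P \<inter> ?E = {}"
  proof (rule prime_disjoint[OF I, of ?E])
    show "?E \<subseteq> carrier R" using x by auto
    show "\<one> \<in> ?E" by (rule image_eqI[of _ _ 0]) auto
    show "a \<otimes> b \<in> ?E" if "a \<in> ?E" "b \<in> ?E" for a b
      using that x by (auto simp: nat_pow_mult)
  qed (use n in auto)
  have "x [^] (1::nat) \<in> ?E" by blast
  then show False using all[OF P(1,2)] P(3) x by auto
qed

lemma primeideal_pow:
  assumes "primeideal P R" "x \<in> carrier R" "x [^] (k::nat) \<in> P" shows "x \<in> P"
  using assms(3)
proof (induction k)
  case 0
  then show ?case using assms by (metis ideal.one_imp_carrier nat_pow_0 primeideal.I_notcarr primeideal.axioms(1))
next
  case (Suc k)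
  then show ?case using assms primeideal.I_prime[OF assms(1), of "x [^] k" x] by auto
qed

lemma primeideal_pow_iff:
  assumes "primeideal P R" "x \<in> P" "k > (0::nat)" shows "x [^] k \<in> P"
proof -
  interpret primeideal P R by fact
  obtain m where "k = Suc m" using assms by (cases k) auto
  then show ?thesis using I_l_closed[of x "x [^] m"] assms Icarr by (simp)
qed

end

section \<open>The Koszul complex and its contracting homotopies\<close>

text \<open>Koszul chains on a list of length \<open>t\<close> are functions on Boolean lists of length \<open>t\<close> (subsets of the
  list); consing \<open>g\<close> realises the mapping cone of multiplication by \<open>g\<close>, which takes care of the signs.\<close>

fun koszul :: "('a, 'b) ring_scheme \<Rightarrow> 'a list \<Rightarrow> (bool list \<Rightarrow> 'a) \<Rightarrow> bool list \<Rightarrow> 'a" where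
  "koszul R [] w A = \<zero>\<^bsub>R\<^esub>"
| "koszul R (g # gs) w [] = \<zero>\<^bsub>R\<^esub>"
| "koszul R (g # gs) w (False # A) = koszul R gs (\<lambda>B. w (False # B)) A \<oplus>\<^bsub>R\<^esub> g \<otimes>\<^bsub>R\<^esub> w (True # A)"
| "koszul R (g # gs) w (True # A) = \<ominus>\<^bsub>R\<^esub> koszul R gs (\<lambda>B. w (True # B)) A"

text \<open>Exterior multiplication by the degree one chain with coordinates \<open>cs\<close>,
  written in the recursive form of \<open>koszul\<close>. The minus sign comes from moving the new
  basis vector past the inner factor.\<close>

fun homotopy :: "('a, 'b) ring_scheme \<Rightarrow> 'a list \<Rightarrow> (bool list \<Rightarrow> 'a) \<Rightarrow> bool list \<Rightarrow> 'a" where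
  "homotopy R [] w A = \<zero>\<^bsub>R\<^esub>"
| "homotopy R (c # cs) w [] = \<zero>\<^bsub>R\<^esub>"
| "homotopy R (c # cs) w (False # A) = homotopy R cs (\<lambda>B. w (False # B)) A"
| "homotopy R (c # cs) w (True # A) =
     c \<otimes>\<^bsub>R\<^esub> w (False # A) \<ominus>\<^bsub>R\<^esub> homotopy R cs (\<lambda>B. w (True # B)) A"

fun lincomb :: "('a, 'b) ring_scheme \<Rightarrow> 'a list \<Rightarrow> 'a list \<Rightarrow> 'a" where
  "lincomb R (c # cs) (g # gs) = c \<otimes>\<^bsub>R\<^esub> g \<oplus>\<^bsub>R\<^esub> lincomb R cs gs"
| "lincomb R _ _ = \<zero>\<^bsub>R\<^esub>"

definition chain_deg :: "bool list \<Rightarrow> nat" where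
  "chain_deg A = length (filter id A)"

lemma chain_deg_simps [simp]: "chain_deg [] = 0" "chain_deg (True # A) = Suc (chain_deg A)"
  "chain_deg (False # A) = chain_deg A"
  by (auto simp: chain_deg_def)

lemma chain_deg_le: "chain_deg A \<le> length A"
  by (simp add: chain_deg_def)

text \<open>Only lists of length \<open>t\<close> carry meaning; the values elsewhere are arbitrary.
  This is why equalities between chains are asserted pointwise, under a length assumption, and
  passed through congruence lemmas.\<close>

definition koszul_chain :: "('a, 'b) ring_scheme \<Rightarrow> nat \<Rightarrow> nat \<Rightarrow> (bool list \<Rightarrow> 'a) \<Rightarrow> bool" where
  "koszul_chain R t i w \<longleftrightarrow>
     (\<forall>A. length A = t \<longrightarrow> w A \<in> carrier R \<and> (chain_deg A \<noteq> i \<longrightarrow> w A = \<zero>\<^bsub>R\<^esub>))"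

text \<open>Vanishing of the \<open>i\<close>-th Koszul homology with coefficients in
  \<open>R / J\<close>. The quotient ring is not formed: cycles and boundaries are taken modulo
  \<open>J\<close> with representatives in \<open>R\<close>. Homogeneity, however, is exact and not
  modulo \<open>J\<close>, so lifted chains have to be zero outside their degree.\<close>

definition koszul_acyclic :: "('a, 'b) ring_scheme \<Rightarrow> 'a set \<Rightarrow> 'a list \<Rightarrow> nat \<Rightarrow> bool" where
  "koszul_acyclic R J gs i \<longleftrightarrow>
     (\<forall>w. koszul_chain R (length gs) i w \<longrightarrow> (\<forall>A. length A = length gs \<longrightarrow> koszul R gs w A \<in> J) \<longrightarrow>
       (\<exists>v. koszul_chain R (length gs) (Suc i) v \<and>
         (\<forall>A. length A = length gs \<longrightarrow> w A \<ominus>\<^bsub>R\<^esub> koszul R gs v A \<in> J)))"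

context cring
begin

lemma koszul_closed:
  assumes "set gs \<subseteq> carrier R" "\<And>A. length A = length gs \<Longrightarrow> w A \<in> carrier R" "length A = length gs"
  shows "koszul R gs w A \<in> carrier R"
  using assms
proof (induction gs arbitrary: w A)
  case (Cons g gs)
  obtain b B where A: "A = b # B" "length B = length gs" using Cons.prems(3) by (cases A) auto
  have "koszul R gs (\<lambda>B. w (b # B)) B \<in> carrier R"
    using Cons A by (intro Cons.IH) auto
  then show ?case using Cons.prems A by (cases b) auto
qed auto

lemma homotopy_closed:
  assumes "set cs \<subseteq> carrier R" "\<And>A. length A = length cs \<Longrightarrow> w A \<in> carrier R" "length A = length cs"
  shows "homotopy R cs w A \<in> carrier R"
  using assms
proof (induction cs arbitrary: w A)
  case (Cons g gs)
  obtain b B where A: "A = b # B" "length B = length gs" using Cons.prems(3) by (cases A) auto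
  have "homotopy R gs (\<lambda>B. w (b # B)) B \<in> carrier R"
    using Cons A by (intro Cons.IH) auto
  then show ?case using Cons.prems A by (cases b) auto
qed auto

lemma koszul_cong:
  assumes "\<And>A. length A = length gs \<Longrightarrow> w A = v A" "length A = length gs"
  shows "koszul R gs w A = koszul R gs v A"
  using assms
proof (induction gs arbitrary: w v A)
  case (Cons g gs)
  obtain b B where A: "A = b # B" "length B = length gs" using Cons.prems(2) by (cases A) auto
  have "koszul R gs (\<lambda>B. w (b # B)) B = koszul R gs (\<lambda>B. v (b # B)) B"
    using Cons A by (intro Cons.IH) auto
  then show ?case using Cons.prems A by (cases b) auto
qed auto

lemma homotopy_cong:
  assumes "\<And>A. length A = length gs \<Longrightarrow> w A = v A" "length A = length gs"
  shows "homotopy R gs w A = homotopy R gs v A"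
  using assms
proof (induction gs arbitrary: w v A)
  case (Cons g gs)
  obtain b B where A: "A = b # B" "length B = length gs" using Cons.prems(2) by (cases A) auto
  have "homotopy R gs (\<lambda>B. w (b # B)) B = homotopy R gs (\<lambda>B. v (b # B)) B"
    using Cons A by (intro Cons.IH) auto
  then show ?case using Cons.prems A by (cases b) auto
qed auto

lemma koszul_lin:
  assumes "set gs \<subseteq> carrier R" "\<And>A. length A = length gs \<Longrightarrow> w A \<in> carrier R"
    "\<And>A. length A = length gs \<Longrightarrow> v A \<in> carrier R" "c \<in> carrier R" "length A = length gs"
  shows "koszul R gs (\<lambda>A. w A \<oplus> c \<otimes> v A) A = koszul R gs w A \<oplus> c \<otimes> koszul R gs v A"
  using assms
proof (induction gs arbitrary: w v A)
  case (Cons g gs)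
  obtain b B where A: "A = b # B" "length B = length gs" using Cons.prems(5) by (cases A) auto
  have IH: "koszul R gs (\<lambda>B. w (b # B) \<oplus> c \<otimes> v (b # B)) B
      = koszul R gs (\<lambda>B. w (b # B)) B \<oplus> c \<otimes> koszul R gs (\<lambda>B. v (b # B)) B"
    using Cons.prems A by (intro Cons.IH) auto
  have cl: "koszul R gs (\<lambda>B. w (b # B)) B \<in> carrier R" "koszul R gs (\<lambda>B. v (b # B)) B \<in> carrier R"
    using Cons.prems A by (auto intro!: koszul_closed)
  have cl2: "w (True # B) \<in> carrier R" "v (True # B) \<in> carrier R" "g \<in> carrier R" "c \<in> carrier R"
    using Cons.prems A by auto
  have *: "(a \<oplus> c \<otimes> b) \<oplus> g \<otimes> (x \<oplus> c \<otimes> y) = (a \<oplus> g \<otimes> x) \<oplus> c \<otimes> (b \<oplus> g \<otimes> y)" if "a \<in> carrier R" "b \<in> carrier R" "x \<in> carrier R" "y \<in> carrier R" "g \<in> carrier R" "c \<in> carrier R" for a b x y g c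
      using that by algebra
  have **: "\<ominus> (a \<oplus> c \<otimes> b) = \<ominus> a \<oplus> c \<otimes> (\<ominus> b)" if "a \<in> carrier R" "b \<in> carrier R" "c \<in> carrier R" for a b c
      using that by algebra
  show ?case using IH *[OF cl cl2] **[OF cl cl2(4)] A by (cases b) simp_all
qed auto

lemma koszul_add:
  assumes "set gs \<subseteq> carrier R" "\<And>A. length A = length gs \<Longrightarrow> w A \<in> carrier R"
    "\<And>A. length A = length gs \<Longrightarrow> v A \<in> carrier R" "length A = length gs"
  shows "koszul R gs (\<lambda>A. w A \<oplus> v A) A = koszul R gs w A \<oplus> koszul R gs v A"
proof -
  have "koszul R gs (\<lambda>A. w A \<oplus> v A) A = koszul R gs (\<lambda>A. w A \<oplus> \<one> \<otimes> v A) A"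
    by (rule koszul_cong) (use assms in auto)
  then show ?thesis using koszul_lin[OF assms(1-3) one_closed assms(4)] koszul_closed[OF assms(1,3,4)] by simp
qed

lemma koszul_diff:
  assumes "set gs \<subseteq> carrier R" "\<And>A. length A = length gs \<Longrightarrow> w A \<in> carrier R"
    "\<And>A. length A = length gs \<Longrightarrow> v A \<in> carrier R" "length A = length gs"
  shows "koszul R gs (\<lambda>A. w A \<ominus> v A) A = koszul R gs w A \<ominus> koszul R gs v A"
proof -
  have e: "x \<ominus> y = x \<oplus> (\<ominus> \<one>) \<otimes> y" if "x \<in> carrier R" "y \<in> carrier R" for x y
    using that by algebra
  have "koszul R gs (\<lambda>A. w A \<ominus> v A) A = koszul R gs (\<lambda>A. w A \<oplus> (\<ominus> \<one>) \<otimes> v A) A"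
    by (rule koszul_cong) (use assms e in auto)
  then show ?thesis
    using koszul_lin[OF assms(1-3) _ assms(4), where c = "\<ominus> \<one>"] koszul_closed[OF assms(1,3,4)] koszul_closed[OF assms(1,2,4)]
      e by simp
qed

lemma koszul_zero:
  assumes "set gs \<subseteq> carrier R" "\<And>A. length A = length gs \<Longrightarrow> w A = \<zero>" "length A = length gs"
  shows "koszul R gs w A = \<zero>"
  using assms
proof (induction gs arbitrary: w A)
  case (Cons g gs)
  obtain b B where A: "A = b # B" "length B = length gs" using Cons.prems(3) by (cases A) auto
  have "koszul R gs (\<lambda>B. w (b # B)) B = \<zero>" using Cons.prems A by (intro Cons.IH) auto
  then show ?case using Cons.prems A by (cases b) auto
qed auto

lemma koszul_smult:
  assumes "set gs \<subseteq> carrier R" "\<And>A. length A = length gs \<Longrightarrow> v A \<in> carrier R" "c \<in> carrier R" "length A = length gs"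
  shows "koszul R gs (\<lambda>A. c \<otimes> v A) A = c \<otimes> koszul R gs v A"
proof -
  have "koszul R gs (\<lambda>A. c \<otimes> v A) A = koszul R gs (\<lambda>A. \<zero> \<oplus> c \<otimes> v A) A"
    by (rule koszul_cong) (use assms in auto)
  then show ?thesis using koszul_lin[OF assms(1) _ assms(2,3,4), of "\<lambda>_. \<zero>"] koszul_closed[OF assms(1,2,4)]
     koszul_zero[OF assms(1) _ assms(4), of "\<lambda>_. \<zero>"] assms by simp
qed

lemma koszul_ideal:
  assumes J: "ideal J R" and "set gs \<subseteq> carrier R" "\<And>A. length A = length gs \<Longrightarrow> w A \<in> J" "length A = length gs"
  shows "koszul R gs w A \<in> J"
  using assms(2-)
proof (induction gs arbitrary: w A)
  case Nil
  then show ?case using J by (simp add: additive_subgroup.zero_closed ideal.axioms(1))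
next
  case (Cons g gs)
  interpret ideal J R by (rule J)
  obtain b B where A: "A = b # B" "length B = length gs" using Cons.prems(3) by (cases A) auto
  have "koszul R gs (\<lambda>B. w (b # B)) B \<in> J" using Cons.prems A by (intro Cons.IH) auto
  then show ?case using Cons.prems A I_l_closed by (cases b) auto
qed

lemma homotopy_ideal:
  assumes J: "ideal J R" and "set gs \<subseteq> carrier R" "\<And>A. length A = length gs \<Longrightarrow> w A \<in> J" "length A = length gs"
  shows "homotopy R gs w A \<in> J"
  using assms(2-)
proof (induction gs arbitrary: w A)
  case Nil
  then show ?case using J by (simp add: additive_subgroup.zero_closed ideal.axioms(1))
next
  case (Cons g gs)
  interpret ideal J R by (rule J)
  obtain b B where A: "A = b # B" "length B = length gs" using Cons.prems(3) by (cases A) auto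
  have "homotopy R gs (\<lambda>B. w (b # B)) B \<in> J" using Cons.prems A by (intro Cons.IH) auto
  then show ?case using Cons.prems A I_l_closed ideal_minus[OF J] by (cases b) auto
qed

lemma koszul_degree:
  assumes "set gs \<subseteq> carrier R" "koszul_chain R (length gs) i w" "length A = length gs" "Suc (chain_deg A) \<noteq> i"
  shows "koszul R gs w A = \<zero>"
  using assms
proof (induction gs arbitrary: w A i)
  case (Cons g gs)
  obtain b B where A: "A = b # B" "length B = length gs" using Cons.prems(3) by (cases A) auto
  show ?case
  proof (cases b)
    case False
    have "koszul R gs (\<lambda>B. w (False # B)) B = \<zero>"
      using Cons.prems A False by (intro Cons.IH) (auto simp: koszul_chain_def)
    moreover have "w (True # B) = \<zero>" using Cons.prems A False by (auto simp: koszul_chain_def)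
    ultimately show ?thesis using Cons.prems A False by auto
  next
    case True
    show ?thesis
    proof (cases i)
      case 0
      have "koszul R gs (\<lambda>B. w (True # B)) B = \<zero>"
        using Cons.prems A True 0 by (intro koszul_zero) (auto simp: koszul_chain_def)
      then show ?thesis using A True by simp
    next
      case (Suc j)
      have "koszul R gs (\<lambda>B. w (True # B)) B = \<zero>"
        using Cons.prems A True Suc by (intro Cons.IH[of j]) (auto simp: koszul_chain_def)
      then show ?thesis using A True by simp
    qed
  qed
qed auto

lemma homotopy_chain:
  assumes "set cs \<subseteq> carrier R" "koszul_chain R (length cs) i w"
  shows "koszul_chain R (length cs) (Suc i) (homotopy R cs w)"
  using assms
proof (induction cs arbitrary: i w)
  case (Cons c cs)
  have cl: "homotopy R (c # cs) w A \<in> carrier R" if "length A = length (c # cs)" for A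
    using Cons.prems that by (intro homotopy_closed) (auto simp: koszul_chain_def)
  have "homotopy R (c # cs) w A = \<zero>" if AA: "length A = length (c # cs)" "chain_deg A \<noteq> Suc i" for A
  proof -
    obtain b B where A: "A = b # B" "length B = length cs" using AA by (cases A) auto
    show ?thesis
    proof (cases b)
      case False
      have "koszul_chain R (length cs) (Suc i) (homotopy R cs (\<lambda>B. w (False # B)))"
        using Cons.prems by (intro Cons.IH) (auto simp: koszul_chain_def)
      then show ?thesis using AA A False by (auto simp: koszul_chain_def)
    next
      case True
      have w0: "w (False # B) = \<zero>" using Cons.prems A AA True by (auto simp: koszul_chain_def)
      have "homotopy R cs (\<lambda>B. w (True # B)) B = \<zero>"
      proof (cases i)
        case 0
        show ?thesis
          using homotopy_ideal[OF zeroideal, of cs "\<lambda>B. w (True # B)" B] Cons.prems A 0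
          by (auto simp: koszul_chain_def)
      next
        case (Suc j)
        have "koszul_chain R (length cs) (Suc j) (homotopy R cs (\<lambda>B. w (True # B)))"
          using Cons.prems Suc by (intro Cons.IH) (auto simp: koszul_chain_def)
        then show ?thesis using AA A True Suc by (auto simp: koszul_chain_def)
      qed
      then show ?thesis using A True w0 Cons.prems by simp
    qed
  qed
  then show ?case using cl unfolding koszul_chain_def by blast
qed (auto simp: koszul_chain_def)

text \<open>The minus sign in the clause for \<open>True\<close> makes the two terms carrying
  \<open>g\<close> cancel.\<close>

lemma koszul_koszul:
  assumes "set gs \<subseteq> carrier R" "\<And>A. length A = length gs \<Longrightarrow> w A \<in> carrier R" "length A = length gs"
  shows "koszul R gs (koszul R gs w) A = \<zero>"
  using assms
proof (induction gs arbitrary: w A)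
  case (Cons g gs)
  obtain b B where A: "A = b # B" "length B = length gs" using Cons.prems(3) by (cases A) auto
  let ?k = "\<lambda>b. koszul R gs (\<lambda>B. w (b # B))"
  have kc: "?k b C \<in> carrier R" if "length C = length gs" for b C
    using Cons.prems that by (intro koszul_closed) auto
  have kk: "koszul R gs (?k b) B = \<zero>" for b
    using Cons.prems A by (intro Cons.IH) auto
  have g: "g \<in> carrier R" "set gs \<subseteq> carrier R" using Cons.prems by auto
  have wT: "w (True # C) \<in> carrier R" if "length C = length gs" for C using Cons.prems that by auto
  show ?case
  proof (cases b)
    case False
    have "koszul R gs (\<lambda>B. ?k False B \<oplus> g \<otimes> w (True # B)) B = koszul R gs (?k False) B \<oplus> g \<otimes> ?k True B"
      using g kc wT A by (intro koszul_lin) auto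
    then show ?thesis using A False kk kc[OF A(2), of True] g by (simp add: r_minus r_neg)
  next
    case True
    have "koszul R gs (\<lambda>C. \<ominus> ?k True C) B = koszul R gs (\<lambda>C. (\<ominus> \<one>) \<otimes> ?k True C) B"
      using kc by (intro koszul_cong) (auto simp: l_minus A)
    also have "\<dots> = (\<ominus> \<one>) \<otimes> koszul R gs (?k True) B"
      using kc g A by (intro koszul_smult) auto
    finally show ?thesis using A True kk by simp
  qed
qed auto

lemma homotopy_lin:
  assumes "set gs \<subseteq> carrier R" "\<And>A. length A = length gs \<Longrightarrow> w A \<in> carrier R"
    "\<And>A. length A = length gs \<Longrightarrow> v A \<in> carrier R" "c \<in> carrier R" "length A = length gs"
  shows "homotopy R gs (\<lambda>A. w A \<oplus> c \<otimes> v A) A = homotopy R gs w A \<oplus> c \<otimes> homotopy R gs v A"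
  using assms
proof (induction gs arbitrary: w v A)
  case (Cons g gs)
  obtain b B where A: "A = b # B" "length B = length gs" using Cons.prems(5) by (cases A) auto
  have IH: "homotopy R gs (\<lambda>B. w (b # B) \<oplus> c \<otimes> v (b # B)) B
      = homotopy R gs (\<lambda>B. w (b # B)) B \<oplus> c \<otimes> homotopy R gs (\<lambda>B. v (b # B)) B"
    using Cons.prems A by (intro Cons.IH) auto
  have cl: "homotopy R gs (\<lambda>B. w (b # B)) B \<in> carrier R" "homotopy R gs (\<lambda>B. v (b # B)) B \<in> carrier R"
    using Cons.prems A by (auto intro!: homotopy_closed)
  have cl2: "w (False # B) \<in> carrier R" "v (False # B) \<in> carrier R" "g \<in> carrier R" "c \<in> carrier R"
    using Cons.prems A by auto
  have *: "g \<otimes> (x \<oplus> c \<otimes> y) \<ominus> (a \<oplus> c \<otimes> b) = (g \<otimes> x \<ominus> a) \<oplus> c \<otimes> (g \<otimes> y \<ominus> b)" if "a \<in> carrier R" "b \<in> carrier R" "x \<in> carrier R" "y \<in> carrier R" "g \<in> carrier R" "c \<in> carrier R" for a b x y g c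
      using that by algebra
  show ?case using IH *[OF cl cl2] A by (cases b) simp_all
qed auto

text \<open>Induction along the cone; the mixed terms cancel by \<open>ring_id3\<close> and
  \<open>ring_id4\<close>. The consequence used later is that every element of the ideal generated
  by \<open>gs\<close> annihilates Koszul homology.\<close>

lemma homotopy_formula:
  assumes "set gs \<subseteq> carrier R" "set cs \<subseteq> carrier R" "length cs = length gs"
    "\<And>A. length A = length gs \<Longrightarrow> w A \<in> carrier R" "length A = length gs"
  shows "koszul R gs (homotopy R cs w) A \<oplus> homotopy R cs (koszul R gs w) A = lincomb R cs gs \<otimes> w A"
  using assms
proof (induction gs arbitrary: cs w A)
  case (Cons g gs cs0)
  obtain c cs where cs0: "cs0 = c # cs" "length cs = length gs" using Cons.prems(3) by (cases cs0) auto
  obtain b B where A: "A = b # B" "length B = length gs" using Cons.prems(5) by (cases A) auto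
  let ?w = "\<lambda>b B. w (b # B)"
  have cl: "set gs \<subseteq> carrier R" "set cs \<subseteq> carrier R" "g \<in> carrier R" "c \<in> carrier R" using Cons.prems cs0 by auto
  have wc: "?w b B \<in> carrier R" if "length B = length gs" for b B using that Cons.prems by auto
  have kc: "koszul R gs (?w b) C \<in> carrier R" if "length C = length gs" for b C
    using wc cl that by (intro koszul_closed) auto
  have hc: "homotopy R cs (?w b) C \<in> carrier R" if "length C = length gs" for b C
    using wc cl that cs0 by (intro homotopy_closed) auto
  have khc: "koszul R gs (homotopy R cs (?w b)) B \<in> carrier R" for b
    using hc cl A by (intro koszul_closed) auto
  have hkc: "homotopy R cs (koszul R gs (?w b)) B \<in> carrier R" for b
    using kc cl A cs0 by (intro homotopy_closed) auto
  have IH: "koszul R gs (homotopy R cs (?w b)) B \<oplus> homotopy R cs (koszul R gs (?w b)) B = lincomb R cs gs \<otimes> ?w b B" for b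
    using cl cs0 wc A by (intro Cons.IH) auto
  have lc: "lincomb R cs gs \<in> carrier R" using cl cs0(2)
  proof (induction cs gs rule: list_induct2') qed auto
  show ?case
  proof (cases b)
    case False
    have 1: "homotopy R cs (\<lambda>B. koszul R gs (?w False) B \<oplus> g \<otimes> ?w True B) B =
       homotopy R cs (koszul R gs (?w False)) B \<oplus> g \<otimes> homotopy R cs (?w True) B"
      using cl kc wc A cs0 by (intro homotopy_lin) auto
    note ring_id3[OF khc[of False] hkc[of False] cl(3,4) wc[OF A(2), of False] hc[OF A(2), of True]]
    then have "koszul R (g # gs) (homotopy R (c # cs) w) (False # B) \<oplus> homotopy R (c # cs) (koszul R (g # gs) w) (False # B)
      = c \<otimes> g \<otimes> ?w False B \<oplus> lincomb R cs gs \<otimes> ?w False B" using 1 IH by simp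
    then show ?thesis using A False cs0 cl wc[OF A(2)] lc by (simp add: l_distr)
  next
    case True
    have e: "x \<ominus> y = x \<oplus> (\<ominus> \<one>) \<otimes> y" if "x \<in> carrier R" "y \<in> carrier R" for x y
      using that by algebra
    have "koszul R gs (\<lambda>B. c \<otimes> ?w False B \<ominus> homotopy R cs (?w True) B) B
       = koszul R gs (\<lambda>B. c \<otimes> ?w False B) B \<ominus> koszul R gs (homotopy R cs (?w True)) B"
      using cl kc wc hc A cs0 by (intro koszul_diff) auto
    also have "koszul R gs (\<lambda>B. c \<otimes> ?w False B) B = c \<otimes> koszul R gs (?w False) B"
      using cl wc A by (intro koszul_smult) auto
    finally have 1: "koszul R gs (\<lambda>B. c \<otimes> ?w False B \<ominus> homotopy R cs (?w True) B) B
       = c \<otimes> koszul R gs (?w False) B \<ominus> koszul R gs (homotopy R cs (?w True)) B" .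
    have "homotopy R cs (\<lambda>B. \<ominus> koszul R gs (?w True) B) B = homotopy R cs (\<lambda>B. \<zero> \<oplus> (\<ominus> \<one>) \<otimes> koszul R gs (?w True) B) B"
      using kc A cs0 by (intro homotopy_cong) (auto simp: l_minus)
    also have "\<dots> = homotopy R cs (\<lambda>_. \<zero>) B \<oplus> (\<ominus> \<one>) \<otimes> homotopy R cs (koszul R gs (?w True)) B"
      using cl kc A cs0 by (intro homotopy_lin) auto
    also have "homotopy R cs (\<lambda>_. \<zero>) B = \<zero>"
      using homotopy_ideal[OF zeroideal, of cs "\<lambda>_. \<zero>" B] cl A cs0 by auto
    finally have 2: "homotopy R cs (\<lambda>B. \<ominus> koszul R gs (?w True) B) B = \<ominus> homotopy R cs (koszul R gs (?w True)) B"
      using hkc by (simp add: l_minus)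
    note ring_id4[OF khc[of True] hkc[of True] cl(3,4) wc[OF A(2), of True] kc[OF A(2), of False]]
    then have "koszul R (g # gs) (homotopy R (c # cs) w) (True # B) \<oplus> homotopy R (c # cs) (koszul R (g # gs) w) (True # B)
      = c \<otimes> g \<otimes> ?w True B \<oplus> lincomb R cs gs \<otimes> ?w True B" using 1 2 IH by simp
    then show ?thesis using A True cs0 cl wc[OF A(2)] lc by (simp add: l_distr)
  qed
qed auto

end

text \<open>The list is read from its end: the head is tested modulo the tail. Structural recursion
  then agrees with \<open>genideal_insert\<close> and with the cone recursion of
  \<open>koszul\<close>; the price is a \<open>rev\<close> when comparing with
  \<open>regular_sequence\<close>. The sequence is weak in that properness of its ideal is not
  demanded.\<close>

fun weakly_regular :: "('a, 'b) ring_scheme \<Rightarrow> 'a list \<Rightarrow> bool" where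
  "weakly_regular R [] = True"
| "weakly_regular R (a # as) = (weakly_regular R as \<and>
     (\<forall>z\<in>carrier R. a \<otimes>\<^bsub>R\<^esub> z \<in> genideal R (set as) \<longrightarrow> z \<in> genideal R (set as)))"

text \<open>Completeness is phrased by the recurrences that occur in \<open>koszul_drop\<close>. The
  first clause provides the sums \<open>u_s + g u_(s+1) + g^2 u_(s+2) + ...\<close> for all
  \<open>s\<close> at once, the second is separatedness. No topology has to be mentioned in this
  form.\<close>

definition adically_complete :: "('a, 'b) ring_scheme \<Rightarrow> 'a \<Rightarrow> bool" where
  "adically_complete R g \<longleftrightarrow>
     (\<forall>u::nat \<Rightarrow> 'a. (\<forall>s. u s \<in> carrier R) \<longrightarrow>
        (\<exists>V. \<forall>s. V s \<in> carrier R \<and> V s = u s \<oplus>\<^bsub>R\<^esub> g \<otimes>\<^bsub>R\<^esub> V (Suc s))) \<and>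
     (\<forall>V::nat \<Rightarrow> 'a. (\<forall>s. V s \<in> carrier R \<and> V s = g \<otimes>\<^bsub>R\<^esub> V (Suc s)) \<longrightarrow> V 0 = \<zero>\<^bsub>R\<^esub>)"

section \<open>Regular sequences detected by Koszul homology\<close>

context cring
begin

lemma lincomb_closed [simp]:
  "set cs \<subseteq> carrier R \<Longrightarrow> set gs \<subseteq> carrier R \<Longrightarrow> lincomb R cs gs \<in> carrier R"
  by (induction cs gs rule: list_induct2') auto

lemma genideal_lincomb:
  assumes "set gs \<subseteq> carrier R" "x \<in> Idl (set gs)"
  shows "\<exists>cs. set cs \<subseteq> carrier R \<and> length cs = length gs \<and> x = lincomb R cs gs"
  using assms
proof (induction gs arbitrary: x)
  case (Cons g gs)
  have "x \<in> Idl (insert g (set gs))" using Cons.prems by simp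
  then obtain y c where yc: "x = y \<oplus> c \<otimes> g" "y \<in> Idl (set gs)" "c \<in> carrier R"
    using genideal_insert[of "set gs" g] Cons.prems by auto
  obtain cs where cs: "set cs \<subseteq> carrier R" "length cs = length gs" "y = lincomb R cs gs"
    using Cons.IH[OF _ yc(2)] Cons.prems by auto
  have "x = lincomb R (c # cs) (g # gs)" using yc cs Cons.prems by (simp add: a_comm)
  then show ?case using cs yc by (intro exI[of _ "c # cs"]) auto
qed auto

lemma lincomb_in_genideal:
  assumes "set gs \<subseteq> carrier R" "set cs \<subseteq> carrier R" "set gs \<subseteq> J" "ideal J R"
  shows "lincomb R cs gs \<in> J"
proof -
  interpret ideal J R by fact
  show ?thesis using assms(1-3)
    by (induction cs gs rule: list_induct2') (auto intro!: I_l_closed a_closed)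
qed

lemma ideal_subset: "ideal J R \<Longrightarrow> J \<subseteq> carrier R"
  by (rule subsetI, rule ideal.Icarr)

lemma add_eq_imp_diff:
  assumes "a \<oplus> b = c" "a \<in> carrier R" "b \<in> carrier R" shows "c \<ominus> a = b"
proof -
  have "c = b \<oplus> a" using assms by (simp add: a_comm)
  then show ?thesis using assms by (simp add: minus_eq a_assoc r_neg)
qed

text \<open>This is the long exact homology sequence of
  \<open>0 -> R/J -> R/J -> R/(J + (a)) -> 0\<close>, whose first map is multiplication by
  \<open>a\<close>. That map is zero on Koszul homology because \<open>a\<close> lies in the ideal
  of \<open>gs\<close>, so the homology of \<open>R/J\<close> in degree \<open>i\<close> is a
  quotient of that of \<open>R/(J + (a))\<close> in degree \<open>i + 1\<close>. The proof performs
  the connecting map on representatives.\<close>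

lemma koszul_acyclic_step:
  assumes J: "ideal J R" and gs: "set gs \<subseteq> carrier R" and a: "a \<in> Idl (set gs)"
    and nzd: "\<And>z. z \<in> carrier R \<Longrightarrow> a \<otimes> z \<in> J \<Longrightarrow> z \<in> J"
    and ac: "koszul_acyclic R {x \<oplus> c \<otimes> a | x c. x \<in> J \<and> c \<in> carrier R} gs (Suc i)"
  shows "koszul_acyclic R J gs i"
  unfolding koszul_acyclic_def
proof (intro allI impI)
  fix w assume w: "koszul_chain R (length gs) i w" and dw: "\<forall>A. length A = length gs \<longrightarrow> koszul R gs w A \<in> J"
  let ?t = "length gs"
  let ?J' = "{x \<oplus> c \<otimes> a | x c. x \<in> J \<and> c \<in> carrier R}"
  interpret ideal J R by (rule J)
  obtain cs where cs: "set cs \<subseteq> carrier R" "length cs = ?t" "a = lincomb R cs gs"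
    using genideal_lincomb[OF gs a] by blast
  have ac': "a \<in> carrier R" using cs gs by simp
  have wc: "w A \<in> carrier R" if "length A = ?t" for A using w that by (simp add: koszul_chain_def)
  \<comment> \<open>By the homotopy formula the boundary of \<open>v0\<close> is \<open>a w\<close>
    modulo \<open>J\<close>, so \<open>v0\<close> is a cycle modulo \<open>J + (a)\<close> one
    degree higher.\<close>
  define v0 where "v0 = homotopy R cs w"
  have v0: "koszul_chain R ?t (Suc i) v0" unfolding v0_def using homotopy_chain[OF cs(1)] w cs(2) by simp
  have v0c: "v0 A \<in> carrier R" if "length A = ?t" for A using v0 that by (simp add: koszul_chain_def)
  have h: "a \<otimes> w A \<ominus> koszul R gs v0 A \<in> J" if A: "length A = ?t" for A
  proof -
    have "koszul R gs v0 A \<oplus> homotopy R cs (koszul R gs w) A = a \<otimes> w A"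
      unfolding v0_def cs(3) by (rule homotopy_formula[OF gs cs(1,2)]) (use wc A in auto)
    moreover have "homotopy R cs (koszul R gs w) A \<in> J"
      by (rule homotopy_ideal[OF J cs(1)]) (use dw cs A in auto)
    moreover have kc: "koszul R gs v0 A \<in> carrier R" by (rule koszul_closed[OF gs v0c A])
    ultimately show ?thesis
      using add_eq_imp_diff[OF _ kc Icarr] by metis
  qed
  have dv0: "koszul R gs v0 A \<in> ?J'" if A: "length A = ?t" for A
  proof -
    have kc: "koszul R gs v0 A \<in> carrier R" by (rule koszul_closed[OF gs v0c A])
    have "koszul R gs v0 A = (\<ominus> (a \<otimes> w A \<ominus> koszul R gs v0 A)) \<oplus> w A \<otimes> a"
      using diff_diff_cancel_cring[of "a \<otimes> w A" "koszul R gs v0 A"] kc ac' wc[OF A]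
      by (simp add: minus_eq m_comm[of a] a_comm)
    then show ?thesis using h[OF A] wc[OF A] a_inv_closed by blast
  qed
  obtain u where u: "koszul_chain R ?t (Suc (Suc i)) u"
    and u2: "\<And>A. length A = ?t \<Longrightarrow> v0 A \<ominus> koszul R gs u A \<in> ?J'"
    using ac v0 dv0 unfolding koszul_acyclic_def by blast
  have uc: "u A \<in> carrier R" if "length A = ?t" for A using u that by (simp add: koszul_chain_def)
  have kuc: "koszul R gs u A \<in> carrier R" if "length A = ?t" for A by (rule koszul_closed[OF gs uc that])
  \<comment> \<open>The quotient by \<open>a\<close> is not unique when \<open>a\<close> is not
    cancelled yet; outside degree \<open>i + 1\<close> it is chosen to be zero, so that
    \<open>v\<close> becomes exactly homogeneous.\<close>
  have "\<exists>x c. length A = ?t \<longrightarrow> x \<in> J \<and> c \<in> carrier R \<and> v0 A \<ominus> koszul R gs u A = x \<oplus> c \<otimes> a \<and>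
      (chain_deg A \<noteq> Suc i \<longrightarrow> c = \<zero>)" for A
  proof (cases "length A = ?t \<and> chain_deg A \<noteq> Suc i")
    case True
    have "koszul R gs u A = \<zero>" using koszul_degree[OF gs u] True by simp
    moreover have "v0 A = \<zero>" using v0 True by (simp add: koszul_chain_def)
    ultimately have "v0 A \<ominus> koszul R gs u A = \<zero> \<oplus> \<zero> \<otimes> a" using ac' by simp
    then show ?thesis using zero_closed by blast
  next
    case False
    then show ?thesis using u2[of A] by blast
  qed
  then obtain x v where xv: "\<And>A. length A = ?t \<Longrightarrow> x A \<in> J \<and> v A \<in> carrier R \<and>
      v0 A \<ominus> koszul R gs u A = x A \<oplus> v A \<otimes> a \<and> (chain_deg A \<noteq> Suc i \<longrightarrow> v A = \<zero>)"
    by metis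
  have vch: "koszul_chain R ?t (Suc i) v" using xv by (simp add: koszul_chain_def)
  have xc: "x A \<in> carrier R" if "length A = ?t" for A using xv[OF that] Icarr by blast
  have vc: "v A \<in> carrier R" if "length A = ?t" for A using xv[OF that] by blast
  have "w A \<ominus> koszul R gs v A \<in> J" if A: "length A = ?t" for A
  proof (rule nzd)
    have kv: "koszul R gs v A \<in> carrier R" by (rule koszul_closed[OF gs vc A])
    then show "w A \<ominus> koszul R gs v A \<in> carrier R" using wc[OF A] by simp
    have "koszul R gs v0 A = koszul R gs (\<lambda>A. koszul R gs u A \<oplus> (x A \<oplus> a \<otimes> v A)) A"
    proof (rule koszul_cong[OF _ A])
      fix B :: "bool list" assume B: "length B = ?t"
      have "v0 B = (v0 B \<ominus> koszul R gs u B) \<oplus> koszul R gs u B"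
        using diff_add_cancel_cring v0c[OF B] kuc[OF B] by simp
      also have "\<dots> = koszul R gs u B \<oplus> (x B \<oplus> a \<otimes> v B)"
        using xv[OF B] kuc[OF B] xc[OF B] ac' by (simp add: a_comm m_comm)
      finally show "v0 B = koszul R gs u B \<oplus> (x B \<oplus> a \<otimes> v B)" .
    qed
    also have "\<dots> = koszul R gs (koszul R gs u) A \<oplus> koszul R gs (\<lambda>A. x A \<oplus> a \<otimes> v A) A"
      by (rule koszul_add[OF gs _ _ A]) (use kuc xc vc ac' in auto)
    also have "koszul R gs (koszul R gs u) A = \<zero>" by (rule koszul_koszul[OF gs uc A])
    also have "koszul R gs (\<lambda>A. x A \<oplus> a \<otimes> v A) A = koszul R gs x A \<oplus> a \<otimes> koszul R gs v A"
      by (rule koszul_lin[OF gs _ _ ac' A]) (use xc vc in auto)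
    finally have e: "koszul R gs v0 A = koszul R gs x A \<oplus> a \<otimes> koszul R gs v A"
      using koszul_closed[OF gs xc A] kv ac' by simp
    have xJ: "koszul R gs x A \<in> J" by (rule koszul_ideal[OF J gs _ A]) (use xv in auto)
    \<comment> \<open>The boundary of \<open>u\<close> has disappeared from the boundary of
      \<open>v0\<close>; what remains shows that \<open>a\<close> times the error lies in
      \<open>J\<close>, and \<open>nzd\<close> removes the factor \<open>a\<close>.\<close>
    have "a \<otimes> (w A \<ominus> koszul R gs v A) = (a \<otimes> w A \<ominus> koszul R gs v0 A) \<oplus> koszul R gs x A"
    proof -
      have "(a \<otimes> w A \<oplus> (\<ominus> koszul R gs x A \<oplus> \<ominus> (a \<otimes> koszul R gs v A))) \<oplus> koszul R gs x A
        = (a \<otimes> w A \<oplus> \<ominus> (a \<otimes> koszul R gs v A)) \<oplus> (\<ominus> koszul R gs x A \<oplus> koszul R gs x A)"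
        using Icarr[OF xJ] ac' wc[OF A] kv by (simp add: a_ac)
      then show ?thesis
        unfolding e using Icarr[OF xJ] ac' wc[OF A] kv by (simp add: minus_eq r_distr r_minus minus_add l_neg)
    qed
    then show "a \<otimes> (w A \<ominus> koszul R gs v A) \<in> J" using h[OF A] xJ by simp
  qed
  then show "\<exists>v. koszul_chain R ?t (Suc i) v \<and> (\<forall>A. length A = ?t \<longrightarrow> w A \<ominus> koszul R gs v A \<in> J)"
    using vch by blast
qed

lemma koszul_acyclic_top:
  assumes "ideal J R" "set gs \<subseteq> carrier R" "length gs < i"
  shows "koszul_acyclic R J gs i"
  unfolding koszul_acyclic_def
proof (intro allI impI)
  fix w assume w: "koszul_chain R (length gs) i w"
  interpret ideal J R by fact
  have "w A \<ominus> koszul R gs (\<lambda>_. \<zero>) A \<in> J" if A: "length A = length gs" for A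
  proof -
    have "w A = \<zero>" using w A chain_deg_le[of A] assms(3) by (simp add: koszul_chain_def)
    then show ?thesis using koszul_zero[OF assms(2) _ A, of "\<lambda>_. \<zero>"] by (simp add: minus_eq)
  qed
  then show "\<exists>v. koszul_chain R (length gs) (Suc i) v \<and> (\<forall>A. length A = length gs \<longrightarrow> w A \<ominus> koszul R gs v A \<in> J)"
    by (intro exI[of _ "\<lambda>_. \<zero>"]) (simp add: koszul_chain_def)
qed

text \<open>Modulo all of \<open>as\<close> the homology vanishes above degree \<open>c\<close>, and
  each element removed from \<open>as\<close> lowers that bound by one. The truncated subtraction
  \<open>c - 1\<close> does no harm because only positive degrees are concerned.\<close>

lemma koszul_acyclic_descend:
  assumes gs: "set gs \<subseteq> carrier R" and "set as \<subseteq> Idl (set gs)" "weakly_regular R as"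
    and "\<And>i. i > c \<Longrightarrow> koszul_acyclic R (Idl (set as)) gs i" "c < i + length as" "i > 0"
  shows "koszul_acyclic R {\<zero>} gs i"
  using assms(2-)
proof (induction as arbitrary: c)
  case Nil
  then show ?case by simp
next
  case (Cons a as)
  have sub: "Idl (set gs) \<subseteq> carrier R"
    by (rule ideal_subset[OF genideal_ideal[OF gs]])
  have as: "set as \<subseteq> carrier R" "a \<in> carrier R" using Cons.prems sub by auto
  show ?case
  proof (rule Cons.IH[of "c - 1"])
    fix i assume i: "i > c - 1"
    show "koszul_acyclic R (Idl (set as)) gs i"
    proof (rule koszul_acyclic_step[OF genideal_ideal[OF as(1)] gs])
      show "a \<in> Idl (set gs)" using Cons.prems by simp
      show "z \<in> Idl (set as)" if "z \<in> carrier R" "a \<otimes> z \<in> Idl (set as)" for z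
        using Cons.prems that by simp
      have "koszul_acyclic R (Idl (set (a # as))) gs (Suc i)" by (rule Cons.prems) (use i in simp)
      then show "koszul_acyclic R {x \<oplus> c \<otimes> a |x c. x \<in> Idl (set as) \<and> c \<in> carrier R} gs (Suc i)"
        using genideal_insert[OF as] by simp
    qed
  qed (use Cons.prems in auto)
qed

text \<open>This takes the place of Nakayama's lemma. A cycle for \<open>gs\<close> is also a cycle
  for \<open>g # gs\<close>, hence equals a boundary for \<open>gs\<close> plus \<open>g\<close>
  times another cycle for \<open>gs\<close>. Iterating gives a geometric series of boundaries, which
  completeness sums, and separatedness shows that nothing is left over.\<close>

lemma koszul_drop:
  assumes gs: "set gs \<subseteq> carrier R" and g: "g \<in> carrier R" "adically_complete R g"
    and ac: "koszul_acyclic R {\<zero>} (g # gs) i"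
  shows "koszul_acyclic R {\<zero>} gs i"
  unfolding koszul_acyclic_def
proof (intro allI impI)
  fix w assume w: "koszul_chain R (length gs) i w" and dw: "\<forall>A. length A = length gs \<longrightarrow> koszul R gs w A \<in> {\<zero>}"
  let ?t = "length gs"
  let ?P = "\<lambda>w. koszul_chain R ?t i w \<and> (\<forall>A. length A = ?t \<longrightarrow> koszul R gs w A = \<zero>)"
  let ?Q = "\<lambda>w w' v. koszul_chain R ?t (Suc i) v \<and> (\<forall>A. length A = ?t \<longrightarrow> w A = koszul R gs v A \<oplus> g \<otimes> w' A)"
  have step: "\<exists>w' v. ?P w' \<and> ?Q w w' v" if w: "?P w" for w
  proof -
    define W where "W = (\<lambda>A. if hd A then \<zero> else w (tl A))"
    have W: "koszul_chain R (length (g # gs)) i W"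
      unfolding koszul_chain_def
    proof (intro allI impI)
      fix A :: "bool list" assume "length A = length (g # gs)"
      then obtain b B where A: "A = b # B" "length B = ?t" by (cases A) auto
      show "W A \<in> carrier R \<and> (chain_deg A \<noteq> i \<longrightarrow> W A = \<zero>)"
        using w A unfolding W_def koszul_chain_def by (cases b) auto
    qed
    have "koszul R (g # gs) W A = \<zero>" if "length A = length (g # gs)" for A
    proof -
      obtain b B where A: "A = b # B" "length B = ?t" using \<open>length A = length (g # gs)\<close> by (cases A) auto
      show ?thesis
      proof (cases b)
        case True
        then show ?thesis using A koszul_zero[OF gs _ A(2), of "\<lambda>_. \<zero>"] by (simp add: W_def)
      next
        case False
        then show ?thesis using A w g by (simp add: W_def)
      qed
    qed
    then obtain V where V: "koszul_chain R (Suc ?t) (Suc i) V"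
      and V2: "\<And>A. length A = Suc ?t \<Longrightarrow> W A \<ominus> koszul R (g # gs) V A = \<zero>"
      using ac W unfolding koszul_acyclic_def by force
    have Vc: "V A \<in> carrier R" if "length A = Suc ?t" for A using V that by (simp add: koszul_chain_def)
    let ?v = "\<lambda>B. V (False # B)" and ?w = "\<lambda>B. V (True # B)"
    have kw: "koszul R gs ?w A \<in> carrier R" "koszul R gs ?v A \<in> carrier R" if "length A = ?t" for A
      using that Vc by (auto intro!: koszul_closed[OF gs])
    have "koszul R gs ?w A = \<zero>" if A: "length A = ?t" for A
      using V2[of "True # A"] A kw[OF A] by (simp add: W_def minus_eq)
    moreover have "w A = koszul R gs ?v A \<oplus> g \<otimes> ?w A" if A: "length A = ?t" for A
    proof -
      have "w A \<ominus> (koszul R gs ?v A \<oplus> g \<otimes> ?w A) = \<zero>" using V2[of "False # A"] A by (simp add: W_def)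
      moreover have "w A \<in> carrier R" using w A by (simp add: koszul_chain_def)
      moreover have "koszul R gs ?v A \<oplus> g \<otimes> ?w A \<in> carrier R" using kw[OF A] Vc[of "True # A"] A g by simp
      ultimately show ?thesis by (metis diff_add_cancel_cring l_zero)
    qed
    moreover have "koszul_chain R ?t i ?w" "koszul_chain R ?t (Suc i) ?v" using V by (auto simp: koszul_chain_def)
    ultimately show ?thesis by blast
  qed
  \<comment> \<open>The start \<open>f 0 = w\<close> is kept inside the predicate, guarded by
    \<open>n = 0\<close>, so that dependent choice delivers it together with the recursion.\<close>
  have "\<exists>f. \<forall>n. (?P (f n) \<and> (n = (0::nat) \<longrightarrow> f n = w)) \<and> (\<exists>v. ?Q (f n) (f (Suc n)) v)"
  proof (rule dependent_nat_choice)
    show "\<exists>x. ?P x \<and> ((0::nat) = 0 \<longrightarrow> x = w)" using w dw by auto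
    fix x and n :: nat assume "?P x \<and> (n = 0 \<longrightarrow> x = w)"
    then have "?P x" by blast
    from step[OF this] obtain w' v where "?P w'" "?Q x w' v" by blast
    then show "\<exists>y. (?P y \<and> (Suc n = 0 \<longrightarrow> y = w)) \<and> (\<exists>v. ?Q x y v)"
      by (intro exI[of _ w'] conjI exI[of _ v]) simp_all
  qed
  then obtain f where ff: "\<forall>n. (?P (f n) \<and> (n = (0::nat) \<longrightarrow> f n = w)) \<and> (\<exists>v. ?Q (f n) (f (Suc n)) v)" ..
  have f: "?P (f n)" "\<exists>v. ?Q (f n) (f (Suc n)) v" for n using ff[THEN spec, of n] by (blast, blast)
  have f0: "f 0 = w" using ff[THEN spec, of 0] by blast
  have "\<exists>v. \<forall>n. ?Q (f n) (f (Suc n)) (v n)" by (rule choice) (rule allI, rule f(2))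
  then obtain v where v': "\<forall>n. ?Q (f n) (f (Suc n)) (v n)" ..
  note v = v'[THEN spec]
  have vc: "v n A \<in> carrier R" if "length A = ?t" for n A using v that by (simp add: koszul_chain_def)
  have fc: "f n A \<in> carrier R" if "length A = ?t" for n A using f(1) that by (simp add: koszul_chain_def)
  \<comment> \<open>The recurrence is solved separately at every list \<open>A\<close>; in the wrong
    degrees the solution is taken to be zero, which keeps the summed chain homogeneous.\<close>
  let ?S = "\<lambda>A V. \<forall>s. length A = ?t \<longrightarrow> V s \<in> carrier R \<and> V s = v s A \<oplus> g \<otimes> V (Suc s) \<and> (chain_deg A \<noteq> Suc i \<longrightarrow> V s = \<zero>)"
  have "\<exists>V. ?S A V" for A
  proof (cases "length A = ?t \<and> chain_deg A = Suc i")
    case True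
    have "(\<forall>s. v s A \<in> carrier R) \<longrightarrow> (\<exists>V. \<forall>s. V s \<in> carrier R \<and> V s = v s A \<oplus> g \<otimes> V (Suc s))"
      by (rule g(2)[unfolded adically_complete_def, THEN conjunct1, THEN spec])
    moreover have "\<forall>s. v s A \<in> carrier R" using True vc by blast
    ultimately obtain V where V: "\<forall>s. V s \<in> carrier R \<and> V s = v s A \<oplus> g \<otimes> V (Suc s)" by (elim impE exE)
    show ?thesis by (rule exI[of _ V]) (use True V in blast)
  next
    case False
    have "length A = ?t \<Longrightarrow> v s A = \<zero>" for s using False v[of s] by (simp add: koszul_chain_def)
    then show ?thesis using g(1) by (intro exI[of _ "\<lambda>_. \<zero>"]) simp
  qed
  then have "\<exists>V. \<forall>A. ?S A (V A)" by (intro choice) blast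
  then obtain V' where V': "\<forall>A. ?S A (V' A)" ..
  have V: "V' A s \<in> carrier R \<and> V' A s = v s A \<oplus> g \<otimes> V' A (Suc s) \<and> (chain_deg A \<noteq> Suc i \<longrightarrow> V' A s = \<zero>)"
    if "length A = ?t" for A s using V'[THEN spec, THEN spec, of A s] that by blast
  define Z where "Z = (\<lambda>s A. V' A s)"
  have Zc: "Z s A \<in> carrier R" if "length A = ?t" for s A unfolding Z_def using V[OF that] by blast
  have "w A \<ominus> koszul R gs (Z 0) A = \<zero>" if A: "length A = ?t" for A
  proof -
    let ?u = "\<lambda>s. f s A \<ominus> koszul R gs (Z s) A"
    have kZ: "koszul R gs (Z s) A \<in> carrier R" for s by (rule koszul_closed[OF gs Zc A])
    have kv: "koszul R gs (v s) A \<in> carrier R" for s by (rule koszul_closed[OF gs vc A])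
    have "?u s = g \<otimes> ?u (Suc s)" for s
    proof -
      have "koszul R gs (Z s) A = koszul R gs (\<lambda>A. v s A \<oplus> g \<otimes> Z (Suc s) A) A"
        by (rule koszul_cong[OF _ A]) (unfold Z_def, use V in blast)
      also have "\<dots> = koszul R gs (v s) A \<oplus> g \<otimes> koszul R gs (Z (Suc s)) A"
        by (rule koszul_lin[OF gs _ _ g(1) A]) (use vc Zc in auto)
      finally have 1: "koszul R gs (Z s) A = koszul R gs (v s) A \<oplus> g \<otimes> koszul R gs (Z (Suc s)) A" .
      have 2: "f s A = koszul R gs (v s) A \<oplus> g \<otimes> f (Suc s) A" using v A by blast
      have "(x \<oplus> y) \<ominus> (x \<oplus> z) = y \<ominus> z" if "x \<in> carrier R" "y \<in> carrier R" "z \<in> carrier R" for x y z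
      proof -
        have "(x \<oplus> y) \<oplus> (\<ominus> x \<oplus> \<ominus> z) = (y \<oplus> \<ominus> z) \<oplus> (\<ominus> x \<oplus> x)" using that by (simp add: a_ac)
        then show ?thesis using that by (simp add: minus_eq minus_add l_neg)
      qed
      then show ?thesis unfolding 1 2 using kv[of s] kZ[of "Suc s"] fc[OF A, of "Suc s"] g(1) by (simp add: r_distr r_minus minus_eq)
    qed
    moreover have "?u s \<in> carrier R" for s using fc[OF A] kZ by simp
    ultimately have u: "\<forall>s. ?u s \<in> carrier R \<and> ?u s = g \<otimes> ?u (Suc s)" by blast
    \<comment> \<open>Each error term is \<open>g\<close> times its successor, so the second clause
      of completeness forces the first one to vanish.\<close>
    have "?u 0 = \<zero>"
      by (rule g(2)[unfolded adically_complete_def, THEN conjunct2, THEN spec[of _ ?u], THEN mp, OF u])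
    then show ?thesis using f0 by simp
  qed
  moreover have "koszul_chain R ?t (Suc i) (Z 0)" unfolding koszul_chain_def Z_def using V by blast
  ultimately show "\<exists>v. koszul_chain R ?t (Suc i) v \<and> (\<forall>A. length A = ?t \<longrightarrow> w A \<ominus> koszul R gs v A \<in> {\<zero>})"
    by blast
qed

text \<open>A relation expressing \<open>g z\<close> through \<open>gs\<close> is a cycle of degree
  one with coordinate \<open>z\<close> at \<open>g\<close>. Once this cycle is a boundary, its
  coordinate at \<open>g\<close> is, up to sign, the inner differential of a degree one chain and
  therefore a combination of \<open>gs\<close>.\<close>

lemma koszul_nonzerodivisor:
  assumes gs: "set gs \<subseteq> carrier R" and g: "g \<in> carrier R"
    and ac: "koszul_acyclic R {\<zero>} (g # gs) 1"
    and z: "z \<in> carrier R" "g \<otimes> z \<in> Idl (set gs)"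
  shows "z \<in> Idl (set gs)"
proof -
  let ?t = "length gs"
  obtain cs where cs: "set cs \<subseteq> carrier R" "length cs = ?t" "g \<otimes> z = lincomb R cs gs"
    using genideal_lincomb[OF gs z(2)] by blast
  \<comment> \<open>The basis vector of degree zero; applying the homotopy to it produces the degree
    one chain \<open>h\<close> with coordinates \<open>cs\<close>.\<close>
  define u where "u = (\<lambda>A. if chain_deg A = 0 then \<one> else \<zero>)"
  have u: "koszul_chain R ?t 0 u" by (simp add: koszul_chain_def u_def)
  have uc: "u A \<in> carrier R" for A by (simp add: u_def)
  have ku: "koszul R gs u A = \<zero>" if "length A = ?t" for A
    by (rule koszul_degree[OF gs u that]) simp
  define h where "h = homotopy R cs u"
  have h: "koszul_chain R ?t 1 h" unfolding h_def using homotopy_chain[OF cs(1)] u cs(2) by simp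
  have hc: "h A \<in> carrier R" if "length A = ?t" for A using h that by (simp add: koszul_chain_def)
  have kh: "koszul R gs h A = (g \<otimes> z) \<otimes> u A" if A: "length A = ?t" for A
  proof -
    have "koszul R gs h A \<oplus> homotopy R cs (koszul R gs u) A = (g \<otimes> z) \<otimes> u A"
      unfolding h_def cs(3) by (rule homotopy_formula[OF gs cs(1,2)]) (use uc A in auto)
    moreover have "homotopy R cs (koszul R gs u) A \<in> {\<zero>}"
      by (rule homotopy_ideal[OF zeroideal cs(1)]) (use ku cs A in auto)
    ultimately show ?thesis using koszul_closed[OF gs hc A] by simp
  qed
  define W where "W = (\<lambda>A. if hd A then z \<otimes> u (tl A) else \<ominus> h (tl A))"
  have W: "koszul_chain R (length (g # gs)) 1 W"
    unfolding koszul_chain_def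
  proof (intro allI impI)
    fix A :: "bool list" assume "length A = length (g # gs)"
    then obtain b B where A: "A = b # B" "length B = ?t" by (cases A) auto
    show "W A \<in> carrier R \<and> (chain_deg A \<noteq> 1 \<longrightarrow> W A = \<zero>)"
      using h A z unfolding W_def koszul_chain_def u_def by (cases b) auto
  qed
  have "koszul R (g # gs) W A = \<zero>" if "length A = length (g # gs)" for A
  proof -
    obtain b B where A: "A = b # B" "length B = ?t" using \<open>length A = length (g # gs)\<close> by (cases A) auto
    show ?thesis
    proof (cases b)
      case True
      have "koszul R gs (\<lambda>C. z \<otimes> u C) B = z \<otimes> koszul R gs u B"
        by (rule koszul_smult[OF gs _ z(1) A(2)]) (use uc in auto)
      then show ?thesis using A True ku z by (simp add: W_def)
    next
      case False
      have "koszul R gs (\<lambda>C. \<ominus> h C) B = koszul R gs (\<lambda>C. (\<ominus> \<one>) \<otimes> h C) B"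
        by (rule koszul_cong[OF _ A(2)]) (use hc in \<open>simp add: l_minus\<close>)
      also have "\<dots> = (\<ominus> \<one>) \<otimes> koszul R gs h B"
        by (rule koszul_smult[OF gs _ _ A(2)]) (use hc in auto)
      finally have "koszul R gs (\<lambda>C. \<ominus> h C) B = \<ominus> (g \<otimes> z \<otimes> u B)" using kh[OF A(2)] uc z g by (simp add: l_minus)
      then show ?thesis using A False z g uc by (simp add: W_def m_assoc l_neg)
    qed
  qed
  then obtain V where V: "koszul_chain R (Suc ?t) (Suc 1) V"
    and V2: "\<And>A. length A = Suc ?t \<Longrightarrow> W A \<ominus> koszul R (g # gs) V A = \<zero>"
    using ac W unfolding koszul_acyclic_def by force
  \<comment> \<open>The empty subset of \<open>gs\<close>: evaluating at \<open>True # ?A\<close>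
    reads off the coordinate of the chain at \<open>g\<close>.\<close>
  let ?A = "replicate ?t False"
  have d: "chain_deg ?A = 0" by (simp add: chain_deg_def)
  let ?w = "\<lambda>B. V (True # B)"
  have wc: "?w B \<in> carrier R" if "length B = ?t" for B using V that by (simp add: koszul_chain_def)
  have kw: "koszul R gs ?w ?A \<in> carrier R" by (rule koszul_closed[OF gs wc]) auto
  have "z \<ominus> (\<ominus> koszul R gs ?w ?A) = \<zero>"
    using V2[of "True # ?A"] d z by (simp add: W_def u_def)
  then have "z = \<ominus> koszul R gs ?w ?A" using kw z
    by (metis a_inv_closed diff_add_cancel_cring l_zero)
  moreover have "koszul R gs w A \<in> Idl (set gs)" if "\<And>A. length A = length gs \<Longrightarrow> w A \<in> carrier R" "length A = length gs" for w A
    using gs that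
  proof (induction gs arbitrary: w A)
    case Nil
    then show ?case by simp
  next
    case (Cons g gs)
    obtain b B where A: "A = b # B" "length B = length gs" using Cons.prems(3) by (cases A) auto
    have sub: "set (g # gs) \<subseteq> carrier R" using Cons.prems by simp
    interpret I: ideal "Idl (set (g # gs))" R by (rule genideal_ideal[OF sub])
    have "koszul R gs (\<lambda>B. w (b # B)) B \<in> Idl (set gs)" using Cons.prems A by (intro Cons.IH) auto
    then have 1: "koszul R gs (\<lambda>B. w (b # B)) B \<in> Idl (set (g # gs))"
      using genideal_mono[of "set gs" "set (g # gs)"] sub by auto
    have "g \<in> Idl (set (g # gs))" using genideal_self[OF sub] by simp
    then have "g \<otimes> w (True # B) \<in> Idl (set (g # gs))" using I.I_r_closed Cons.prems(2)[of "True # B"] A by simp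
    then show ?case using 1 A I.a_inv_closed I.a_closed by (cases b) simp_all
  qed
  ultimately show ?thesis using wc genideal_ideal[OF gs] ideal_minus_closed2 by simp
qed

lemma weakly_regular_of_acyclic:
  assumes "set gs \<subseteq> carrier R" "\<forall>g\<in>set gs. adically_complete R g" "koszul_acyclic R {\<zero>} gs 1"
  shows "weakly_regular R gs"
  using assms
proof (induction gs)
  case (Cons g gs)
  then show ?case using koszul_drop[of gs g 1] koszul_nonzerodivisor[of gs g] by simp
qed simp

text \<open>There are no chains above degree \<open>length gs\<close>. A weakly regular sequence of
  the same length inside the ideal lowers this bound until degree one is included, and
  \<open>koszul_drop\<close> then strips elements from the front of \<open>gs\<close> while keeping
  the first homology zero.\<close>

theorem weakly_regular_exchange:
  assumes gs: "set gs \<subseteq> carrier R" "\<forall>g\<in>set gs. adically_complete R g"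
    and as: "weakly_regular R as" "length as = length gs" "set as \<subseteq> Idl (set gs)"
  shows "weakly_regular R gs"
proof (cases "gs = []")
  case False
  have sub: "set as \<subseteq> carrier R" by (rule subset_trans[OF as(3) ideal_subset[OF genideal_ideal[OF gs(1)]]])
  have "koszul_acyclic R {\<zero>} gs 1"
    by (rule koszul_acyclic_descend[OF gs(1) as(3,1), of "length gs"])
       (use as(2) koszul_acyclic_top[OF genideal_ideal[OF sub] gs(1)] in auto)
  then show ?thesis using weakly_regular_of_acyclic gs by blast
qed simp

end

section \<open>Integral dependence and chains of primes\<close>

text \<open>Values at \<open>s\<close> of polynomials with coefficients in \<open>E\<close> and
  degree below \<open>d\<close>. Working with values avoids a polynomial ring over
  \<open>E\<close>.\<close>

fun low :: "('a, 'b) ring_scheme \<Rightarrow> 'a set \<Rightarrow> 'a \<Rightarrow> nat \<Rightarrow> 'a set" where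
  "low R E s 0 = {\<zero>\<^bsub>R\<^esub>}"
| "low R E s (Suc d) = {l \<oplus>\<^bsub>R\<^esub> b \<otimes>\<^bsub>R\<^esub> s [^]\<^bsub>R\<^esub> d | l b. l \<in> low R E s d \<and> b \<in> E}"

text \<open>A sum by plain recursion. Unlike \<open>finsum\<close> it does not look at the carrier,
  so the same sum can be read in a ring and in any of its subrings, and it unfolds without closure
  side conditions.\<close>

fun sumr :: "('a, 'b) ring_scheme \<Rightarrow> (nat \<Rightarrow> 'a) \<Rightarrow> nat \<Rightarrow> 'a" where
  "sumr R f 0 = \<zero>\<^bsub>R\<^esub>"
| "sumr R f (Suc r) = sumr R f r \<oplus>\<^bsub>R\<^esub> f r"

section \<open>Polynomial values in one element and elimination\<close>

context cring
begin

context
  fixes E s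
  assumes E: "subring E R" and s: "s \<in> carrier R"
begin

lemma E_carr: "b \<in> E \<Longrightarrow> b \<in> carrier R"
  using subringE(1)[OF E] by blast

lemma low_carr: "l \<in> low R E s d \<Longrightarrow> l \<in> carrier R"
proof (induction d arbitrary: l)
  case (Suc d)
  obtain l' b where l: "l = l' \<oplus> b \<otimes> s [^] d" "l' \<in> low R E s d" "b \<in> E" using Suc.prems by auto
  show ?case unfolding l(1) using Suc.IH[OF l(2)] E_carr[OF l(3)] s by simp
qed simp

lemma low_zero: "\<zero> \<in> low R E s d"
proof (induction d)
  case (Suc d)
  have "\<zero> = \<zero> \<oplus> \<zero> \<otimes> s [^] d" using s by simp
  then show ?case using Suc subringE(2)[OF E] by auto
qed simp

lemma low_Suc: "l \<in> low R E s d \<Longrightarrow> l \<in> low R E s (Suc d)"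
proof -
  assume l: "l \<in> low R E s d"
  have "l = l \<oplus> \<zero> \<otimes> s [^] d" using s low_carr[OF l] by simp
  then show ?thesis using l subringE(2)[OF E] by auto
qed

lemma low_mono: "l \<in> low R E s d \<Longrightarrow> d \<le> d' \<Longrightarrow> l \<in> low R E s d'"
proof (induction d')
  case (Suc d')
  show ?case
  proof (cases "d = Suc d'")
    case True
    then show ?thesis using Suc.prems(1) by simp
  next
    case False
    then show ?thesis using Suc by (intro low_Suc) simp
  qed
qed simp

lemma low_add: "l \<in> low R E s d \<Longrightarrow> m \<in> low R E s d \<Longrightarrow> l \<oplus> m \<in> low R E s d"
proof (induction d arbitrary: l m)
  case (Suc d)
  obtain l' b where l: "l = l' \<oplus> b \<otimes> s [^] d" "l' \<in> low R E s d" "b \<in> E" using Suc.prems(1) by auto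
  obtain m' c where m: "m = m' \<oplus> c \<otimes> s [^] d" "m' \<in> low R E s d" "c \<in> E" using Suc.prems(2) by auto
  have "l \<oplus> m = (l' \<oplus> m') \<oplus> (b \<oplus> c) \<otimes> s [^] d"
    unfolding l(1) m(1) using low_carr[OF l(2)] low_carr[OF m(2)] E_carr[OF l(3)] E_carr[OF m(3)] s
    by (intro ring_id1) simp_all
  moreover have "l' \<oplus> m' \<in> low R E s d" by (rule Suc.IH[OF l(2) m(2)])
  moreover have "b \<oplus> c \<in> E" by (rule subringE(7)[OF E l(3) m(3)])
  ultimately show ?case by auto
qed simp

lemma low_smult: "l \<in> low R E s d \<Longrightarrow> b \<in> E \<Longrightarrow> b \<otimes> l \<in> low R E s d"
proof (induction d arbitrary: l)
  case 0
  then show ?case using E_carr by simp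
next
  case (Suc d)
  obtain l' c where l: "l = l' \<oplus> c \<otimes> s [^] d" "l' \<in> low R E s d" "c \<in> E" using Suc.prems(1) by auto
  have "b \<otimes> l = b \<otimes> l' \<oplus> (b \<otimes> c) \<otimes> s [^] d"
    unfolding l(1) using low_carr[OF l(2)] E_carr[OF l(3)] E_carr[OF Suc.prems(2)] s by (simp add: r_distr m_assoc)
  moreover have "b \<otimes> l' \<in> low R E s d" by (rule Suc.IH[OF l(2) Suc.prems(2)])
  moreover have "b \<otimes> c \<in> E" by (rule subringE(6)[OF E Suc.prems(2) l(3)])
  ultimately show ?case by auto
qed

lemma low_uminus: "l \<in> low R E s d \<Longrightarrow> \<ominus> l \<in> low R E s d"
  using low_smult[of l d "\<ominus> \<one>"] low_carr[of l d] subringE(3,5)[OF E] by (simp add: l_minus)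

lemma low_minus: "l \<in> low R E s d \<Longrightarrow> m \<in> low R E s d \<Longrightarrow> l \<ominus> m \<in> low R E s d"
  unfolding minus_eq by (rule low_add[OF _ low_uminus])

lemma low_shift: "l \<in> low R E s d \<Longrightarrow> l \<otimes> s \<in> low R E s (Suc d)"
proof (induction d arbitrary: l)
  case 0
  then show ?case using s low_zero[of "Suc 0"] by simp
next
  case (Suc d)
  obtain l' c where l: "l = l' \<oplus> c \<otimes> s [^] d" "l' \<in> low R E s d" "c \<in> E" using Suc.prems(1) by auto
  have "l \<otimes> s = l' \<otimes> s \<oplus> c \<otimes> s [^] (Suc d)"
    unfolding l(1) using low_carr[OF l(2)] E_carr[OF l(3)] s by (simp add: l_distr m_assoc)
  moreover have "l' \<otimes> s \<in> low R E s (Suc d)" by (rule Suc.IH[OF l(2)])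
  ultimately show ?case unfolding low.simps(2)[of R E s "Suc d"] using l(3) by blast
qed

lemma low_shift_pow: "l \<in> low R E s d \<Longrightarrow> l \<otimes> s [^] k \<in> low R E s (d + k)"
proof (induction k)
  case 0
  then show ?case using low_carr[of l d] by simp
next
  case (Suc k)
  have "l \<otimes> s [^] (Suc k) = (l \<otimes> s [^] k) \<otimes> s" using low_carr[OF Suc.prems] s by (simp add: m_assoc)
  then show ?case using low_shift[OF Suc.IH[OF Suc.prems]] by simp
qed

lemma low_mult: "l \<in> low R E s d \<Longrightarrow> m \<in> low R E s d' \<Longrightarrow> l \<otimes> m \<in> low R E s (d + d')"
proof (induction d' arbitrary: m)
  case 0
  then show ?case using low_zero low_carr[OF 0(1)] by simp
next
  case (Suc d')
  obtain m' c where m: "m = m' \<oplus> c \<otimes> s [^] d'" "m' \<in> low R E s d'" "c \<in> E" using Suc.prems(2) by auto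
  have "l \<otimes> m = l \<otimes> m' \<oplus> c \<otimes> (l \<otimes> s [^] d')"
    unfolding m(1) using low_carr[OF m(2)] low_carr[OF Suc.prems(1)] E_carr[OF m(3)] s by (simp add: r_distr m_lcomm)
  also have "\<dots> \<in> low R E s (d + d')"
    by (rule low_add[OF Suc.IH[OF Suc.prems(1) m(2)] low_smult[OF low_shift_pow[OF Suc.prems(1)] m(3)]])
  finally show ?case using low_Suc by simp
qed

lemma low_pow: "b \<in> E \<Longrightarrow> k < d \<Longrightarrow> b \<otimes> s [^] k \<in> low R E s d"
proof -
  assume b: "b \<in> E" and k: "k < d"
  have "b \<otimes> s [^] k = \<zero> \<oplus> b \<otimes> s [^] k" using E_carr[OF b] s by simp
  then have "b \<otimes> s [^] k \<in> low R E s (Suc k)" using b low_zero[of k] by auto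
  then show ?thesis by (rule low_mono) (use k in simp)
qed

lemma E_low: "b \<in> E \<Longrightarrow> b \<in> low R E s (Suc d)"
  using low_pow[of b 0 "Suc d"] E_carr[of b] by simp

lemma low_bottom: "l \<in> low R E s (Suc d) \<Longrightarrow> \<exists>b l'. b \<in> E \<and> l' \<in> low R E s d \<and> l = l' \<otimes> s \<oplus> b"
proof (induction d arbitrary: l)
  case 0
  then obtain b where b: "l = \<zero> \<oplus> b \<otimes> s [^] (0::nat)" "b \<in> E" by auto
  have "l = \<zero> \<otimes> s \<oplus> b" using b s E_carr[OF b(2)] by simp
  then show ?case using b by auto
next
  case (Suc d)
  obtain m c where l: "l = m \<oplus> c \<otimes> s [^] (Suc d)" "m \<in> low R E s (Suc d)" "c \<in> E"
    using Suc.prems unfolding low.simps(2)[of R E s "Suc d"] by blast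
  obtain b m' where m: "b \<in> E" "m' \<in> low R E s d" "m = m' \<otimes> s \<oplus> b" using Suc.IH[OF l(2)] by blast
  have "l = (m' \<oplus> c \<otimes> s [^] d) \<otimes> s \<oplus> b"
    unfolding l(1) m(3) using low_carr[OF m(2)] E_carr[OF m(1)] E_carr[OF l(3)] s
    by (simp add: l_distr m_assoc a_assoc a_comm[of b])
  moreover have "m' \<oplus> c \<otimes> s [^] d \<in> low R E s (Suc d)" using m l by auto
  ultimately show ?case using m(1) by blast
qed

definition "monic_in (d::nat) = {s [^] d \<oplus> l | l. l \<in> low R E s d}"

lemma mon_carr: "m \<in> monic_in d \<Longrightarrow> m \<in> carrier R"
  unfolding monic_in_def using s by (auto dest: low_carr)

lemma mon_mult: "x \<in> monic_in d \<Longrightarrow> y \<in> monic_in d' \<Longrightarrow> x \<otimes> y \<in> monic_in (d + d')"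
proof -
  assume "x \<in> monic_in d" "y \<in> monic_in d'"
  then obtain l m where l: "x = s [^] d \<oplus> l" "l \<in> low R E s d" and m: "y = s [^] d' \<oplus> m" "m \<in> low R E s d'"
    unfolding monic_in_def by auto
  have "x \<otimes> y = s [^] (d + d') \<oplus> (m \<otimes> s [^] d \<oplus> (l \<otimes> s [^] d' \<oplus> l \<otimes> m))"
    unfolding l(1) m(1) using low_carr[OF l(2)] low_carr[OF m(2)] s
    by (simp add: l_distr r_distr nat_pow_mult[symmetric] m_comm[of m] a_ac)
  moreover have "m \<otimes> s [^] d \<oplus> (l \<otimes> s [^] d' \<oplus> l \<otimes> m) \<in> low R E s (d + d')"
    using low_shift_pow[OF m(2), of d] low_shift_pow[OF l(2), of d'] low_mult[OF l(2) m(2)]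
    by (intro low_add) (simp_all add: add.commute)
  ultimately show ?thesis unfolding monic_in_def by blast
qed

lemma mon_low_mult: "x \<in> monic_in d \<Longrightarrow> m \<in> low R E s d' \<Longrightarrow> x \<otimes> m \<in> low R E s (d + d')"
proof -
  assume "x \<in> monic_in d" and m: "m \<in> low R E s d'"
  then obtain l where l: "x = s [^] d \<oplus> l" "l \<in> low R E s d" unfolding monic_in_def by auto
  have "x \<otimes> m = m \<otimes> s [^] d \<oplus> l \<otimes> m"
    unfolding l(1) using low_carr[OF l(2)] low_carr[OF m] s by (simp add: l_distr m_comm[of "s [^] d" m])
  then show ?thesis using low_add[OF low_shift_pow[OF m, of d, unfolded add.commute[of d']] low_mult[OF l(2) m]] by simp
qed

lemma mon_minus_low: "x \<in> monic_in d \<Longrightarrow> m \<in> low R E s d \<Longrightarrow> x \<ominus> m \<in> monic_in d"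
proof -
  assume "x \<in> monic_in d" and m: "m \<in> low R E s d"
  then obtain l where l: "x = s [^] d \<oplus> l" "l \<in> low R E s d" unfolding monic_in_def by auto
  have "x \<ominus> m = s [^] d \<oplus> (l \<ominus> m)" unfolding l(1) using low_carr[OF l(2)] low_carr[OF m] s by (simp add: minus_eq a_assoc)
  then show ?thesis unfolding monic_in_def using low_minus[OF l(2) m] by blast
qed

lemma sumr_closed: "(\<And>i. i < r \<Longrightarrow> f i \<in> carrier R) \<Longrightarrow> sumr R f r \<in> carrier R"
  by (induction r) auto

lemma sumr_lin:
  "(\<And>i. i < r \<Longrightarrow> f i \<in> carrier R) \<Longrightarrow> (\<And>i. i < r \<Longrightarrow> g i \<in> carrier R) \<Longrightarrow> a \<in> carrier R \<Longrightarrow> b \<in> carrier R \<Longrightarrow>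
    (\<And>i. i < r \<Longrightarrow> h i = a \<otimes> f i \<ominus> b \<otimes> g i) \<Longrightarrow> sumr R h r = a \<otimes> sumr R f r \<ominus> b \<otimes> sumr R g r"
proof (induction r)
  case 0
  then show ?case by (simp add: minus_eq)
next
  case (Suc r)
  have c: "sumr R f r \<in> carrier R" "sumr R g r \<in> carrier R" "f r \<in> carrier R" "g r \<in> carrier R"
    using Suc.prems by (auto intro!: sumr_closed)
  have IH: "sumr R h r = a \<otimes> sumr R f r \<ominus> b \<otimes> sumr R g r" using Suc by auto
  have "h r = a \<otimes> f r \<ominus> b \<otimes> g r" using Suc.prems by auto
  then show ?case using IH c Suc.prems(3,4) by (simp add: minus_eq r_distr minus_add a_ac)
qed

lemma sumr_annihilate:
  "(\<And>i. i < r \<Longrightarrow> p i \<in> carrier R) \<Longrightarrow> (\<And>i. i < r \<Longrightarrow> e i \<in> carrier R) \<Longrightarrow> q \<in> carrier R \<Longrightarrow>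
    (\<And>i. i < r \<Longrightarrow> q \<otimes> e i = \<zero>) \<Longrightarrow> q \<otimes> sumr R (\<lambda>i. p i \<otimes> e i) r = \<zero>"
proof (induction r)
  case (Suc r)
  have "q \<otimes> (p r \<otimes> e r) = p r \<otimes> (q \<otimes> e r)" using Suc.prems by (intro m_lcomm) auto
  moreover have "sumr R (\<lambda>i. p i \<otimes> e i) r \<in> carrier R" using Suc.prems by (intro sumr_closed) auto
  ultimately show ?case using Suc by (simp add: r_distr)
qed simp

text \<open>A substitute for determinants and Cayley-Hamilton. In a square system with monic
  diagonal of degree \<open>D\<close> and entries of lower degree elsewhere, cross multiplication
  eliminates the last unknown. The shape persists with \<open>D + D\<close>: a diagonal entry
  becomes a product of two monic values minus a product of two low ones.\<close>

lemma elimination: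
  "(\<And>i. i < r \<Longrightarrow> e i \<in> carrier R) \<Longrightarrow> (\<And>i. i < r \<Longrightarrow> p i i \<in> monic_in D) \<Longrightarrow>
   (\<And>i j. i < r \<Longrightarrow> j < r \<Longrightarrow> i \<noteq> j \<Longrightarrow> p i j \<in> low R E s D) \<Longrightarrow>
   (\<And>i. i < r \<Longrightarrow> sumr R (\<lambda>j. p i j \<otimes> e j) r = \<zero>) \<Longrightarrow>
   \<exists>D' q. q \<in> monic_in D' \<and> (\<forall>j<r. q \<otimes> e j = \<zero>)"
proof (induction r arbitrary: p D)
  case 0
  have "\<one> = s [^] (0::nat) \<oplus> \<zero>" by simp
  then have "\<one> \<in> monic_in 0" unfolding monic_in_def by auto
  then show ?case by blast
next
  case (Suc n)
  have pc: "p i j \<in> carrier R" if "i < Suc n" "j < Suc n" for i j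
    using Suc.prems(2)[OF that(1)] Suc.prems(3)[OF that] mon_carr low_carr by (cases "i = j") auto
  have ec: "e i \<in> carrier R" if "i < Suc n" for i using Suc.prems(1)[OF that] .
  have sc: "sumr R (\<lambda>j. p i j \<otimes> e j) n \<in> carrier R" if "i < Suc n" for i
    using pc ec that by (intro sumr_closed) auto
  have rel: "sumr R (\<lambda>j. p i j \<otimes> e j) n = \<ominus> (p i n \<otimes> e n)" if "i < Suc n" for i
    using Suc.prems(4)[OF that] sc[OF that] pc[OF that, of n] ec[of n] by (simp add: minus_equality)
  define p' where "p' = (\<lambda>i j. p n n \<otimes> p i j \<ominus> p i n \<otimes> p n j)"
  have "\<exists>D' q. q \<in> monic_in D' \<and> (\<forall>j<n. q \<otimes> e j = \<zero>)"
  proof (rule Suc.IH[of p' "D + D"])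
    show "e i \<in> carrier R" if "i < n" for i using ec that by simp
    show "p' i i \<in> monic_in (D + D)" if "i < n" for i
      unfolding p'_def using Suc.prems(2,3) that by (intro mon_minus_low mon_mult low_mult) auto
    show "p' i j \<in> low R E s (D + D)" if "i < n" "j < n" "i \<noteq> j" for i j
      unfolding p'_def using Suc.prems(2,3) that by (intro low_minus mon_low_mult low_mult) auto
    show "sumr R (\<lambda>j. p' i j \<otimes> e j) n = \<zero>" if i: "i < n" for i
    proof -
      have "sumr R (\<lambda>j. p' i j \<otimes> e j) n = p n n \<otimes> sumr R (\<lambda>j. p i j \<otimes> e j) n \<ominus> p i n \<otimes> sumr R (\<lambda>j. p n j \<otimes> e j) n"
      proof (rule sumr_lin)
        fix j assume j: "j < n"
        show "p' i j \<otimes> e j = p n n \<otimes> (p i j \<otimes> e j) \<ominus> p i n \<otimes> (p n j \<otimes> e j)"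
          unfolding p'_def using pc[of n n] pc[of i j] pc[of i n] pc[of n j] ec[of j] i j
          by (simp add: minus_eq l_distr l_minus m_assoc)
      qed (use pc ec i in auto)
      also have "\<dots> = p n n \<otimes> (\<ominus> (p i n \<otimes> e n)) \<ominus> p i n \<otimes> (\<ominus> (p n n \<otimes> e n))" using rel i by simp
      also have "\<dots> = \<zero>" using pc[of n n] pc[of i n] ec[of n] i by (simp add: minus_eq r_minus m_lcomm[of "p i n"] l_neg)
      finally show ?thesis .
    qed
  qed
  then obtain D' q where q: "q \<in> monic_in D'" "\<And>j. j < n \<Longrightarrow> q \<otimes> e j = \<zero>" by blast
  have qc: "q \<in> carrier R" by (rule mon_carr[OF q(1)])
  \<comment> \<open>The factor \<open>q\<close> already kills the first \<open>n\<close> unknowns,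
    so the last row multiplied by \<open>q\<close> leaves only the term with \<open>p n n\<close>,
    and \<open>q\<close> times \<open>p n n\<close> kills all of them.\<close>
  have "q \<otimes> p n n \<in> monic_in (D' + D)" by (rule mon_mult[OF q(1) Suc.prems(2)]) simp
  moreover have "(q \<otimes> p n n) \<otimes> e j = \<zero>" if j: "j < Suc n" for j
  proof (cases "j = n")
    case False
    have "(q \<otimes> p n n) \<otimes> e j = p n n \<otimes> (q \<otimes> e j)" using qc pc[of n n] ec[OF j] by (simp add: m_ac)
    then show ?thesis using q(2)[of j] False j pc[of n n] by simp
  next
    case True
    have "q \<otimes> sumr R (\<lambda>j. p n j \<otimes> e j) n = \<zero>"
      by (rule sumr_annihilate) (use pc ec qc q in auto)
    then have "q \<otimes> (\<ominus> (p n n \<otimes> e n)) = \<zero>" using rel[of n] by simp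
    then have "\<ominus> (q \<otimes> p n n \<otimes> e n) = \<zero>" using qc pc[of n n] ec[of n] by (simp add: r_minus m_assoc)
    then have "q \<otimes> p n n \<otimes> e n = \<zero>" using qc pc[of n n] ec[of n] by (metis a_inv_closed lessI m_closed minus_minus minus_zero)
    then show ?thesis using True by simp
  qed
  ultimately show ?case by blast
qed

text \<open>The system with matrix \<open>s - b\<close> has the form required by
  \<open>elimination\<close> with \<open>D = 1\<close>. The resulting monic value annihilates the
  generators, hence also \<open>1\<close>, and is therefore zero.\<close>

lemma integral_of_finite:
  assumes e: "\<And>i. i < r \<Longrightarrow> e i \<in> carrier R"
    and b: "\<And>i j. i < r \<Longrightarrow> j < r \<Longrightarrow> b i j \<in> E" "\<And>i. i < r \<Longrightarrow> s \<otimes> e i = sumr R (\<lambda>j. b i j \<otimes> e j) r"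
    and c: "\<And>j. j < r \<Longrightarrow> c j \<in> E" "\<one> = sumr R (\<lambda>j. c j \<otimes> e j) r"
  shows "\<exists>d l. l \<in> low R E s d \<and> s [^] d \<oplus> l = \<zero>"
proof -
  define p where "p = (\<lambda>i j. if i = j then s [^] (1::nat) \<oplus> \<ominus> b i j else \<ominus> b i j)"
  have nb: "\<ominus> b i j \<in> low R E s 1" if "i < r" "j < r" for i j
    using E_low[of "\<ominus> b i j" 0] subringE(5)[OF E b(1)[OF that]] by simp
  have bc: "b i j \<in> carrier R" if "i < r" "j < r" for i j using E_carr b that by simp
  \<comment> \<open>For partial sums the contribution \<open>s e_i\<close> of the diagonal is
    present exactly when the index \<open>i\<close> has been passed.\<close>
  have key: "sumr R (\<lambda>j. p i j \<otimes> e j) k = (if i < k then s \<otimes> e i else \<zero>) \<ominus> sumr R (\<lambda>j. b i j \<otimes> e j) k"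
    if "i < r" "k \<le> r" for i k
    using that(2)
  proof (induction k)
    case 0
    then show ?case by (simp add: minus_eq)
  next
    case (Suc k)
    have c1: "sumr R (\<lambda>j. b i j \<otimes> e j) k \<in> carrier R" using bc e Suc.prems that by (intro sumr_closed) auto
    have c2: "b i k \<in> carrier R" "e k \<in> carrier R" "e i \<in> carrier R" using bc e Suc.prems that by auto
    have IH: "sumr R (\<lambda>j. p i j \<otimes> e j) k = (if i < k then s \<otimes> e i else \<zero>) \<ominus> sumr R (\<lambda>j. b i j \<otimes> e j) k" using Suc by simp
    show ?case
    proof (cases "i = k")
      case True
      have "(\<zero> \<ominus> x) \<oplus> (s [^] (1::nat) \<oplus> \<ominus> y) \<otimes> z = s \<otimes> z \<ominus> (x \<oplus> y \<otimes> z)"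
        if "x \<in> carrier R" "y \<in> carrier R" "z \<in> carrier R" for x y z
        using that s by (simp add: minus_eq l_distr l_minus minus_add a_ac)
      then show ?thesis using IH c1 c2 True by (simp add: p_def)
    next
      case False
      have "(w \<ominus> x) \<oplus> (\<ominus> y) \<otimes> z = w \<ominus> (x \<oplus> y \<otimes> z)"
        if "x \<in> carrier R" "y \<in> carrier R" "z \<in> carrier R" "w \<in> carrier R" for x y z w
        using that s by (simp add: minus_eq l_distr l_minus minus_add a_ac)
      from this[OF c1 c2(1,2), of "if i < k then s \<otimes> e i else \<zero>"] show ?thesis using IH c2 s False by (simp add: p_def)
    qed
  qed
  have "\<exists>D' q. q \<in> monic_in D' \<and> (\<forall>j<r. q \<otimes> e j = \<zero>)"
  proof (rule elimination[of r e p 1])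
    show "p i i \<in> monic_in 1" if "i < r" for i unfolding monic_in_def p_def using nb[OF that that] by auto
    show "p i j \<in> low R E s 1" if "i < r" "j < r" "i \<noteq> j" for i j unfolding p_def using nb[OF that(1,2)] that by simp
    show "sumr R (\<lambda>j. p i j \<otimes> e j) r = \<zero>" if "i < r" for i
      using key[OF that, of r] that s e[OF that] by (simp add: b(2)[OF that, symmetric] minus_eq r_neg)
  qed (use e in auto)
  then obtain D' q where q: "q \<in> monic_in D'" "\<And>j. j < r \<Longrightarrow> q \<otimes> e j = \<zero>" by blast
  have qc: "q \<in> carrier R" by (rule mon_carr[OF q(1)])
  have "q \<otimes> \<one> = \<zero>" unfolding c(2) by (rule sumr_annihilate) (use c E_carr e qc q in auto)
  then have "q = \<zero>" using qc by simp
  then obtain l where "s [^] D' \<oplus> l = \<zero>" "l \<in> low R E s D'" using q(1) unfolding monic_in_def by fastforce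
  then show ?thesis by blast
qed

text \<open>As long as the constant term of the monic relation lies in \<open>P\<close>, a factor
  \<open>s\<close> can be cancelled from the relation modulo \<open>P\<close>. Degree zero is
  impossible because \<open>1\<close> is not in \<open>P\<close>, so a constant term
  \<open>b\<close> outside \<open>P\<close> appears; the relation places \<open>b\<close> in every
  ideal over \<open>P\<close> that contains \<open>s\<close>.\<close>

lemma incomparability:
  assumes P: "primeideal P R" and sP: "s \<notin> P" and l: "l \<in> low R E s d" "s [^] d \<oplus> l \<in> P"
  shows "\<exists>b\<in>E. b \<notin> P \<and> (\<forall>Q. ideal Q R \<longrightarrow> P \<subseteq> Q \<longrightarrow> s \<in> Q \<longrightarrow> b \<in> Q)"
  using l
proof (induction d arbitrary: l)
  case 0
  then have "\<one> \<in> P" by simp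
  then show ?case using P by (metis ideal.one_imp_carrier primeideal.I_notcarr primeideal.axioms(1))
next
  case (Suc d)
  obtain b l' where b: "b \<in> E" "l' \<in> low R E s d" "l = l' \<otimes> s \<oplus> b" using low_bottom[OF Suc.prems(1)] by blast
  have cl: "b \<in> carrier R" "l' \<in> carrier R" using E_carr b low_carr by auto
  have e: "s [^] (Suc d) \<oplus> l = (s [^] d \<oplus> l') \<otimes> s \<oplus> b"
    unfolding b(3) using cl s by (simp add: l_distr a_assoc)
  have iP: "ideal P R" using P by (simp add: primeideal.axioms(1))
  show ?case
  proof (cases "b \<in> P")
    case True
    have "((s [^] d \<oplus> l') \<otimes> s \<oplus> b) \<ominus> b = (s [^] d \<oplus> l') \<otimes> s"
      using cl s by (simp add: minus_eq a_assoc r_neg)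
    then have "(s [^] d \<oplus> l') \<otimes> s \<in> P" using ideal_minus[OF iP Suc.prems(2) True] e by simp
    then have "s [^] d \<oplus> l' \<in> P \<or> s \<in> P" by (intro primeideal.I_prime[OF P]) (use s cl in simp_all)
    then have "s [^] d \<oplus> l' \<in> P" using sP by blast
    then show ?thesis by (rule Suc.IH[OF b(2)])
  next
    case False
    have "b \<in> Q" if Q: "ideal Q R" "P \<subseteq> Q" "s \<in> Q" for Q
    proof -
      have 1: "(s [^] d \<oplus> l') \<otimes> s \<in> Q" by (rule ideal.I_l_closed[OF Q(1,3)]) (use s cl in simp)
      have "(s [^] d \<oplus> l') \<otimes> s \<oplus> b \<in> Q" using Suc.prems(2) Q(2) unfolding e by (rule subsetD[rotated])
      from ideal_minus[OF Q(1) this 1]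
      show ?thesis using add_eq_imp_diff[of "(s [^] d \<oplus> l') \<otimes> s" b] cl s by simp
    qed
    then show ?thesis using False b(1) by blast
  qed
qed

end

text \<open>The core of lying over. The integral equation of \<open>s\<close> is multiplied by the
  \<open>d\<close>-th power of the image of \<open>y\<close>. The product of that image with
  \<open>s\<close> may then be replaced by the image of \<open>h\<close>, and every lower term
  retains at least one factor from \<open>y\<close>. Hence a power of \<open>h\<close> is congruent
  to a multiple of \<open>y\<close> modulo the contraction of \<open>P\<close>.\<close>

lemma going_up_step:
  assumes hom: "ring_hom_cring A R \<phi>" and P: "ideal P R" and h: "h \<in> carrier A" and y: "y \<in> carrier A"
    and s: "s \<in> carrier R" and eq: "\<phi> y \<otimes> s \<ominus> \<phi> h \<in> P" and l: "l \<in> low R (\<phi> ` carrier A) s d" "s [^] d \<oplus> l \<in> P"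
  shows "\<exists>a\<in>carrier A. \<phi> (h [^]\<^bsub>A\<^esub> d \<oplus>\<^bsub>A\<^esub> y \<otimes>\<^bsub>A\<^esub> a) \<in> P"
proof -
  interpret \<phi>: ring_hom_cring A R \<phi> by (rule hom)
  interpret P: ideal P R by (rule P)
  let ?b = "\<phi> y" and ?u = "\<phi> h"
  have bc: "?b \<in> carrier R" "?u \<in> carrier R" using h y by auto
  have sub: "subring (\<phi> ` carrier A) R"
    using ring_hom_ring.img_is_subring[OF ring_hom_ringI2[OF \<phi>.R.ring_axioms ring_axioms \<phi>.homh] \<phi>.R.carrier_is_subring] .
  have tr: "x \<ominus> z \<in> P" if "x \<ominus> y' \<in> P" "y' \<ominus> z \<in> P" "x \<in> carrier R" "y' \<in> carrier R" "z \<in> carrier R" for x y' z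
  proof -
    have "(x \<oplus> \<ominus> y') \<oplus> (y' \<oplus> \<ominus> z) = (x \<oplus> \<ominus> z) \<oplus> (\<ominus> y' \<oplus> y')" using that by (simp add: a_ac)
    then have "(x \<ominus> y') \<oplus> (y' \<ominus> z) = x \<ominus> z" using that by (simp add: minus_eq l_neg)
    then show ?thesis using P.a_closed[OF that(1,2)] by simp
  qed
  have mul: "c \<otimes> x \<ominus> c \<otimes> z \<in> P" if "x \<ominus> z \<in> P" "c \<in> carrier R" "x \<in> carrier R" "z \<in> carrier R" for c x z
    using P.I_l_closed[OF that(1,2)] that by (simp add: minus_eq r_distr r_minus)
  have add: "(x \<oplus> x') \<ominus> (z \<oplus> z') \<in> P" if "x \<ominus> z \<in> P" "x' \<ominus> z' \<in> P" "x \<in> carrier R" "z \<in> carrier R" "x' \<in> carrier R" "z' \<in> carrier R" for x x' z z'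
  proof -
    have "(x \<oplus> x') \<ominus> (z \<oplus> z') = (x \<ominus> z) \<oplus> (x' \<ominus> z')" using that by (simp add: minus_eq minus_add a_ac)
    then show ?thesis using P.a_closed[OF that(1,2)] by simp
  qed
  have pow: "(?b \<otimes> s) [^] k \<ominus> ?u [^] k \<in> P" for k :: nat
  proof (induction k)
    case 0
    then show ?case by (simp add: minus_eq r_neg)
  next
    case (Suc k)
    have "(?b \<otimes> s) \<otimes> (?b \<otimes> s) [^] k \<ominus> (?b \<otimes> s) \<otimes> ?u [^] k \<in> P" by (rule mul[OF Suc]) (use bc s in auto)
    moreover have "?u [^] k \<otimes> (?b \<otimes> s) \<ominus> ?u [^] k \<otimes> ?u \<in> P" by (rule mul[OF eq]) (use bc s in auto)
    ultimately show ?case using tr[of "(?b \<otimes> s) [^] (Suc k)" "?u [^] k \<otimes> (?b \<otimes> s)" "?u [^] (Suc k)"] bc s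
      by (simp add: m_comm)
  qed
  \<comment> \<open>Every power of \<open>s\<close> occurring in \<open>m\<close> is below
    \<open>k\<close>, so after the substitution for \<open>?b \<otimes> s\<close> a factor
    \<open>?b\<close> is left over in each term.\<close>
  have "\<exists>a\<in>carrier A. ?b [^] k \<otimes> m \<ominus> \<phi> (y \<otimes>\<^bsub>A\<^esub> a) \<in> P" if "m \<in> low R (\<phi> ` carrier A) s k" for m k
    using that
  proof (induction k arbitrary: m)
    case 0
    have "?b [^] (0::nat) \<otimes> m \<ominus> \<phi> (y \<otimes>\<^bsub>A\<^esub> \<zero>\<^bsub>A\<^esub>) = \<zero>" using 0 y by (simp add: minus_eq)
    then have "?b [^] (0::nat) \<otimes> m \<ominus> \<phi> (y \<otimes>\<^bsub>A\<^esub> \<zero>\<^bsub>A\<^esub>) \<in> P" by simp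
    then show ?case by (rule bexI) simp
  next
    case (Suc k)
    obtain m' c where m: "m = m' \<oplus> \<phi> c \<otimes> s [^] k" "m' \<in> low R (\<phi> ` carrier A) s k" "c \<in> carrier A"
      using Suc.prems by auto
    obtain a where a: "a \<in> carrier A" "?b [^] k \<otimes> m' \<ominus> \<phi> (y \<otimes>\<^bsub>A\<^esub> a) \<in> P" using Suc.IH[OF m(2)] by blast
    have m'c: "m' \<in> carrier R" by (rule low_carr[OF sub s m(2)])
    have cc: "\<phi> c \<in> carrier R" "\<phi> (y \<otimes>\<^bsub>A\<^esub> a) \<in> carrier R" using m a y by auto
    let ?a = "y \<otimes>\<^bsub>A\<^esub> a \<oplus>\<^bsub>A\<^esub> c \<otimes>\<^bsub>A\<^esub> h [^]\<^bsub>A\<^esub> k"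
    have "?b [^] (Suc k) \<otimes> m = ?b \<otimes> (?b [^] k \<otimes> m') \<oplus> (?b \<otimes> \<phi> c) \<otimes> (?b \<otimes> s) [^] k"
      unfolding m(1) using bc s m'c cc by (simp add: r_distr nat_pow_distrib m_ac)
    moreover have "\<phi> (y \<otimes>\<^bsub>A\<^esub> ?a) = ?b \<otimes> \<phi> (y \<otimes>\<^bsub>A\<^esub> a) \<oplus> (?b \<otimes> \<phi> c) \<otimes> ?u [^] k"
      using y a m(3) h bc by (simp add: r_distr m_assoc)
    moreover have "(?b \<otimes> (?b [^] k \<otimes> m') \<oplus> (?b \<otimes> \<phi> c) \<otimes> (?b \<otimes> s) [^] k) \<ominus> (?b \<otimes> \<phi> (y \<otimes>\<^bsub>A\<^esub> a) \<oplus> (?b \<otimes> \<phi> c) \<otimes> ?u [^] k) \<in> P"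
      by (rule add[OF mul[OF a(2)] mul[OF pow]]) (use bc s m'c cc in auto)
    ultimately have "?b [^] (Suc k) \<otimes> m \<ominus> \<phi> (y \<otimes>\<^bsub>A\<^esub> ?a) \<in> P" by simp
    then show ?case by (rule bexI) (use y a m(3) h in simp)
  qed
  from this[OF l(1)] obtain a where a: "a \<in> carrier A" "?b [^] d \<otimes> l \<ominus> \<phi> (y \<otimes>\<^bsub>A\<^esub> a) \<in> P" by blast
  have lc: "l \<in> carrier R" by (rule low_carr[OF sub s l(1)])
  have "((?b \<otimes> s) [^] d \<oplus> ?b [^] d \<otimes> l) \<ominus> (?u [^] d \<oplus> \<phi> (y \<otimes>\<^bsub>A\<^esub> a)) \<in> P"
    by (rule add[OF pow a(2)]) (use bc s lc a y in auto)
  moreover have "(?b \<otimes> s) [^] d \<oplus> ?b [^] d \<otimes> l \<in> P"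
  proof -
    have "(?b \<otimes> s) [^] d \<oplus> ?b [^] d \<otimes> l = ?b [^] d \<otimes> (s [^] d \<oplus> l)" using bc s lc by (simp add: nat_pow_distrib r_distr)
    then show ?thesis using P.I_l_closed[OF l(2), of "?b [^] d"] bc by simp
  qed
  ultimately have "?u [^] d \<oplus> \<phi> (y \<otimes>\<^bsub>A\<^esub> a) \<in> P"
    using ideal_diff_mem'[OF P] bc a y by simp
  then have "\<phi> (h [^]\<^bsub>A\<^esub> d \<oplus>\<^bsub>A\<^esub> y \<otimes>\<^bsub>A\<^esub> a) \<in> P" using h y a by simp
  then show ?thesis using a by blast
qed

text \<open>The multiplicative set \<open>{f^k s | s \<notin> P}\<close> avoids the ideal of the earlier elements.\<close>

lemma weakly_regular_prime_chain:
  assumes "weakly_regular R fs" "set fs \<subseteq> carrier R" "primeideal P R" "set fs \<subseteq> P"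
  shows "\<exists>C :: nat \<Rightarrow> 'a set. (\<forall>i\<le>length fs. primeideal (C i) R) \<and> (\<forall>i<length fs. C i \<subset> C (Suc i)) \<and> C (length fs) = P"
  using assms
proof (induction fs arbitrary: P)
  case Nil
  then show ?case by (intro exI[of _ "\<lambda>_. P"]) simp
next
  case (Cons f fs)
  have f: "f \<in> carrier R" "set fs \<subseteq> carrier R" using Cons.prems by auto
  have nzd: "z \<in> Idl (set fs)" if "z \<in> carrier R" "f \<otimes> z \<in> Idl (set fs)" for z using Cons.prems(1) that by simp
  interpret P: primeideal P R by (rule Cons.prems)
  let ?E = "{f [^] k \<otimes> s | (k::nat) s. s \<in> carrier R \<and> s \<notin> P}"
  have IP: "Idl (set fs) \<subseteq> P" by (rule genideal_minimal[OF P.is_ideal]) (use Cons.prems in simp)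
  have one: "\<one> \<notin> P" using P.I_notcarr P.one_imp_carrier by blast
  have nE: "f [^] (k::nat) \<otimes> s \<notin> Idl (set fs)" if "s \<in> carrier R" "s \<notin> P" for s k
  proof (induction k)
    case 0
    then show ?case using that IP by auto
  next
    case (Suc k)
    have "f [^] (Suc k) \<otimes> s = f \<otimes> (f [^] k \<otimes> s)" using f that by (simp add: m_ac)
    then show ?case using Suc nzd[of "f [^] k \<otimes> s"] f that by auto
  qed
  obtain Q where Q: "primeideal Q R" "Idl (set fs) \<subseteq> Q" "Q \<inter> ?E = {}"
  proof (rule prime_disjoint[OF genideal_ideal[OF f(2)], of ?E])
    show "?E \<subseteq> carrier R" using f by auto
    have "\<one> = f [^] (0::nat) \<otimes> \<one>" by simp
    then show "\<one> \<in> ?E" using one by blast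
    show "x \<otimes> y \<in> ?E" if xy: "x \<in> ?E" "y \<in> ?E" for x y
    proof -
      obtain k s where x: "x = f [^] (k::nat) \<otimes> s" "s \<in> carrier R" "s \<notin> P" using xy(1) by blast
      obtain l t where y: "y = f [^] (l::nat) \<otimes> t" "t \<in> carrier R" "t \<notin> P" using xy(2) by blast
      have "x \<otimes> y = f [^] (k + l) \<otimes> (s \<otimes> t)" unfolding x(1) y(1) using x y f by (simp add: nat_pow_mult[symmetric] m_ac)
      moreover have "s \<otimes> t \<notin> P" using P.I_prime[OF x(2) y(2)] x y by blast
      moreover have "s \<otimes> t \<in> carrier R" using x y by simp
      ultimately show ?thesis by blast
    qed
    show "Idl (set fs) \<inter> ?E = {}" using nE by blast
  qed
  have fQ: "f \<notin> Q"
  proof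
    assume "f \<in> Q"
    moreover have "f = f [^] (1::nat) \<otimes> \<one>" using f by simp
    then have "f \<in> ?E" using one by blast
    ultimately show False using Q(3) by blast
  qed
  \<comment> \<open>Exponent zero puts the complement of \<open>P\<close> into the multiplicative
    set; exponent one with \<open>s\<close> equal to \<open>1\<close> has put \<open>f\<close>
    there, which makes the inclusion strict.\<close>
  have "Q \<subseteq> P"
  proof
    fix s assume s: "s \<in> Q"
    have sc: "s \<in> carrier R" using ideal.Icarr[OF primeideal.axioms(1)[OF Q(1)] s] .
    show "s \<in> P"
    proof (rule ccontr)
      assume "s \<notin> P"
      moreover have "s = f [^] (0::nat) \<otimes> s" using sc by simp
      ultimately have "s \<in> ?E" using sc by blast
      then show False using Q(3) s by blast
    qed
  qed
  then have QP: "Q \<subset> P" using fQ Cons.prems(4) by auto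
  have "set fs \<subseteq> Q" using Q(2) genideal_self[OF f(2)] by blast
  then obtain C :: "nat \<Rightarrow> 'a set" where C: "\<forall>i\<le>length fs. primeideal (C i) R" "\<forall>i<length fs. C i \<subset> C (Suc i)" "C (length fs) = Q"
    using Cons.IH[OF _ f(2) Q(1)] Cons.prems(1) by auto
  show ?case
  proof (intro exI[of _ "C(Suc (length fs) := P)"] conjI allI impI)
    show "primeideal ((C(Suc (length fs) := P)) i) R" if "i \<le> length (f # fs)" for i
      using that C Cons.prems(3) by (cases "i = Suc (length fs)") simp_all
    show "(C(Suc (length fs) := P)) i \<subset> (C(Suc (length fs) := P)) (Suc i)" if "i < length (f # fs)" for i
      using that C QP by (cases "i = length fs") simp_all
  qed simp
qed

text \<open>The translation between the two list orders: \<open>regular_sequence\<close> tests an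
  element modulo its predecessors, \<open>weakly_regular\<close> modulo its successors.\<close>

lemma weakly_regular_rev_iff:
  "weakly_regular R (rev fs) \<longleftrightarrow>
    (\<forall>i<length fs. \<forall>g\<in>carrier R. fs ! i \<otimes> g \<in> Idl (set (take i fs)) \<longrightarrow> g \<in> Idl (set (take i fs)))"
proof (induction fs rule: rev_induct)
  case (snoc f fs)
  have "(\<forall>i<length (fs @ [f]). \<forall>g\<in>carrier R. (fs @ [f]) ! i \<otimes> g \<in> Idl (set (take i (fs @ [f]))) \<longrightarrow> g \<in> Idl (set (take i (fs @ [f])))) \<longleftrightarrow>
     (\<forall>i<length fs. \<forall>g\<in>carrier R. fs ! i \<otimes> g \<in> Idl (set (take i fs)) \<longrightarrow> g \<in> Idl (set (take i fs))) \<and>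
     (\<forall>g\<in>carrier R. f \<otimes> g \<in> Idl (set fs) \<longrightarrow> g \<in> Idl (set fs))"
    by (auto simp: less_Suc_eq nth_append)
  then show ?case using snoc by simp
qed simp

end

section \<open>Power series\<close>

abbreviation eadd :: "(nat \<Rightarrow> nat) \<Rightarrow> (nat \<Rightarrow> nat) \<Rightarrow> nat \<Rightarrow> nat" where
  "eadd \<nu> \<beta> \<equiv> \<lambda>i. \<nu> i + \<beta> i"

abbreviation esub :: "(nat \<Rightarrow> nat) \<Rightarrow> (nat \<Rightarrow> nat) \<Rightarrow> nat \<Rightarrow> nat" where
  "esub \<nu> \<beta> \<equiv> \<lambda>i. \<nu> i - \<beta> i"

abbreviation ezero :: "nat \<Rightarrow> nat" where
  "ezero \<equiv> \<lambda>_. 0"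

definition eunit :: "nat \<Rightarrow> nat \<Rightarrow> nat \<Rightarrow> nat" where
  "eunit c i = (\<lambda>j. if j = i then c else 0)"

definition below :: "(nat \<Rightarrow> nat) \<Rightarrow> (nat \<Rightarrow> nat) set" where
  "below \<nu> = {\<beta>. \<forall>i. \<beta> i \<le> \<nu> i}"

definition edeg :: "nat \<Rightarrow> (nat \<Rightarrow> nat) \<Rightarrow> nat" where
  "edeg n \<nu> = (\<Sum>i<n. \<nu> i)"

definition homog_exps :: "nat \<Rightarrow> nat \<Rightarrow> (nat \<Rightarrow> nat) set" where
  "homog_exps k d = {\<beta> \<in> mexps k. edeg k \<beta> = d}"

lemma finite_bounded_exps: "finite {\<beta> \<in> mexps n. \<forall>i<n. \<beta> i \<le> N}"
proof -
  have "{\<beta> \<in> mexps n. \<forall>i<n. \<beta> i \<le> N} \<subseteq>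
      {f. \<forall>x. (x \<in> {..<n} \<longrightarrow> f x \<in> {..N}) \<and> (x \<notin> {..<n} \<longrightarrow> f x = 0)}"
    by (auto simp: mexps_def)
  then show ?thesis by (rule finite_subset) (rule finite_set_of_finite_funs; simp)
qed

lemma le_edeg: "i < n \<Longrightarrow> \<beta> i \<le> edeg n \<beta>"
  unfolding edeg_def by (rule member_le_sum) auto

lemma finite_homog_exps [simp]: "finite (homog_exps k d)"
  by (rule finite_subset[OF _ finite_bounded_exps[of k d]]) (auto simp: homog_exps_def intro: le_edeg)

lemma ezero_mexps [simp]: "ezero \<in> mexps n" by (simp add: mexps_def)

lemma eadd_mexps [simp]: "\<nu> \<in> mexps n \<Longrightarrow> \<beta> \<in> mexps n \<Longrightarrow> eadd \<nu> \<beta> \<in> mexps n"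
  by (simp add: mexps_def)

lemma esub_mexps [simp]: "\<nu> \<in> mexps n \<Longrightarrow> esub \<nu> \<beta> \<in> mexps n"
  by (simp add: mexps_def)

lemma eunit_mexps [simp]: "i < n \<Longrightarrow> eunit c i \<in> mexps n"
  by (simp add: mexps_def eunit_def)

lemma below_mexps: "\<nu> \<in> mexps n \<Longrightarrow> \<beta> \<in> below \<nu> \<Longrightarrow> \<beta> \<in> mexps n"
  unfolding mexps_def below_def mem_Collect_eq
proof (intro allI impI)
  fix i assume "\<forall>i\<ge>n. \<nu> i = 0" "\<forall>i. \<beta> i \<le> \<nu> i" "n \<le> i"
  then have "\<nu> i = 0" "\<beta> i \<le> \<nu> i" by blast+
  then show "\<beta> i = 0" by simp
qed

lemma finite_below: "\<nu> \<in> mexps n \<Longrightarrow> finite (below \<nu>)"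
proof (rule finite_subset[OF _ finite_bounded_exps[of n "edeg n \<nu>"]])
  assume a: "\<nu> \<in> mexps n"
  show "below \<nu> \<subseteq> {\<beta> \<in> mexps n. \<forall>i<n. \<beta> i \<le> edeg n \<nu>}"
    using below_mexps[OF a] le_edeg[of _ n \<nu>] by (auto simp: below_def intro: le_trans)
qed

lemma esub_below [simp]: "esub \<nu> \<beta> \<in> below \<nu>" by (simp add: below_def)

lemma ezero_below [simp]: "ezero \<in> below \<nu>" by (simp add: below_def)

lemma self_below [simp]: "\<nu> \<in> below \<nu>" by (simp add: below_def)

lemma esub_esub: "\<beta> \<in> below \<nu> \<Longrightarrow> esub \<nu> (esub \<nu> \<beta>) = \<beta>"
  by (auto simp: below_def fun_eq_iff)

lemma eadd_esub: "\<beta> \<in> below \<nu> \<Longrightarrow> eadd \<beta> (esub \<nu> \<beta>) = \<nu>"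
  by (auto simp: below_def fun_eq_iff)

lemma edeg_eadd: "edeg n (eadd \<nu> \<beta>) = edeg n \<nu> + edeg n \<beta>"
  by (simp add: edeg_def sum.distrib)

lemma edeg_ezero [simp]: "edeg n ezero = 0" by (simp add: edeg_def)

lemma edeg_eunit [simp]: "i < n \<Longrightarrow> edeg n (eunit c i) = c"
  by (simp add: edeg_def eunit_def)

lemma edeg_0_iff: "\<nu> \<in> mexps n \<Longrightarrow> edeg n \<nu> = 0 \<longleftrightarrow> \<nu> = ezero"
  by (auto simp: edeg_def mexps_def fun_eq_iff) (metis lessThan_iff not_le)

section \<open>The ring of formal power series\<close>

context cring
begin

lemma finsum_Sigma:
  assumes "finite A" "\<And>x. x \<in> A \<Longrightarrow> finite (B x)" "\<And>x y. x \<in> A \<Longrightarrow> y \<in> B x \<Longrightarrow> f x y \<in> carrier R"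
  shows "(\<Oplus>x\<in>A. \<Oplus>y\<in>B x. f x y) = (\<Oplus>p\<in>Sigma A B. f (fst p) (snd p))"
  using assms
proof (induction A rule: finite_induct)
  case (insert a A)
  have S: "Sigma (insert a A) B = (Pair a ` B a) \<union> Sigma A B" by auto
  have fin: "finite (Pair a ` B a)" "finite (Sigma A B)" using insert by auto
  have IH: "(\<Oplus>x\<in>A. \<Oplus>y\<in>B x. f x y) = (\<Oplus>p\<in>Sigma A B. f (fst p) (snd p))" using insert by auto
  have "(\<Oplus>p\<in>Sigma (insert a A) B. f (fst p) (snd p)) = (\<Oplus>p\<in>Pair a ` B a. f (fst p) (snd p)) \<oplus> (\<Oplus>p\<in>Sigma A B. f (fst p) (snd p))"
    unfolding S by (rule add.finprod_Un_disjoint) (use insert fin in auto)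
  also have "(\<Oplus>p\<in>Pair a ` B a. f (fst p) (snd p)) = (\<Oplus>y\<in>B a. f a y)"
    by (subst add.finprod_reindex) (use insert in \<open>auto simp: inj_on_def\<close>)
  also have "(\<Oplus>y\<in>B a. f a y) \<oplus> (\<Oplus>p\<in>Sigma A B. f (fst p) (snd p)) = (\<Oplus>x\<in>insert a A. \<Oplus>y\<in>B x. f x y)"
    using insert IH by (subst add.finprod_insert) (auto intro!: finsum_closed)
  finally show ?case by simp
qed simp

abbreviation PS :: "nat \<Rightarrow> ((nat \<Rightarrow> nat) \<Rightarrow> 'a) ring" where
  "PS n \<equiv> mps R n"

abbreviation PSC :: "nat \<Rightarrow> ((nat \<Rightarrow> nat) \<Rightarrow> 'a) set" where
  "PSC n \<equiv> carrier (PS n)"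

abbreviation ps_mult ("(_ \<otimes>[_] _)" [70, 0, 71] 70) where
  "f \<otimes>[n] g \<equiv> f \<otimes>\<^bsub>PS n\<^esub> g"
abbreviation ps_add ("(_ \<oplus>[_] _)" [65, 0, 66] 65) where
  "f \<oplus>[n] g \<equiv> f \<oplus>\<^bsub>PS n\<^esub> g"
abbreviation ps_minus ("(_ \<ominus>[_] _)" [65, 0, 66] 65) where
  "f \<ominus>[n] g \<equiv> f \<ominus>\<^bsub>PS n\<^esub> g"
abbreviation ps_uminus ("(\<ominus>[_] _)" [0, 81] 80) where
  "\<ominus>[n] f \<equiv> \<ominus>\<^bsub>PS n\<^esub> f"
abbreviation ps_pow ("(_ [^][_] _)" [76, 0, 75] 75) where
  "f [^][n] k \<equiv> f [^]\<^bsub>PS n\<^esub> k"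
abbreviation ps_zero ("\<zero>[_]") where
  "\<zero>[n] \<equiv> \<zero>\<^bsub>PS n\<^esub>"
abbreviation ps_one ("\<one>[_]") where
  "\<one>[n] \<equiv> \<one>\<^bsub>PS n\<^esub>"

lemma ps_carrier_iff: "f \<in> PSC n \<longleftrightarrow> (\<forall>\<nu>. f \<nu> \<in> carrier R) \<and> (\<forall>\<nu>. \<nu> \<notin> mexps n \<longrightarrow> f \<nu> = \<zero>)"
  unfolding mps_def mps_carrier_def by auto

lemma ps_coeff_closed: "f \<in> PSC n \<Longrightarrow> f \<nu> \<in> carrier R"
  by (simp add: ps_carrier_iff)

lemma ps_outside: "f \<in> PSC n \<Longrightarrow> \<nu> \<notin> mexps n \<Longrightarrow> f \<nu> = \<zero>"
  by (simp add: ps_carrier_iff)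

lemma ps_add [simp]: "(f \<oplus>[n] g) \<nu> = f \<nu> \<oplus> g \<nu>" by (simp add: mps_def)

lemma ps_zero [simp]: "\<zero>[n] \<nu> = \<zero>" by (simp add: mps_def)

lemma ps_one: "\<one>[n] \<nu> = (if \<nu> = ezero then \<one> else \<zero>)" by (simp add: mps_def)

lemma ps_mult: "\<nu> \<in> mexps n \<Longrightarrow> (f \<otimes>[n] g) \<nu> = (\<Oplus>\<beta>\<in>below \<nu>. f \<beta> \<otimes> g (esub \<nu> \<beta>))"
  by (simp add: mps_def below_def)

lemma ps_mult_outside: "\<nu> \<notin> mexps n \<Longrightarrow> (f \<otimes>[n] g) \<nu> = \<zero>"
  by (simp add: mps_def)

lemma ps_eqI:
  assumes "f \<in> PSC n" "g \<in> PSC n" "\<And>\<nu>. \<nu> \<in> mexps n \<Longrightarrow> f \<nu> = g \<nu>" shows "f = g"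
proof
  fix \<nu> show "f \<nu> = g \<nu>" using assms(3) ps_outside[OF assms(1)] ps_outside[OF assms(2)] by (cases "\<nu> \<in> mexps n") auto
qed

lemma ps_mult_closed:
  assumes "f \<in> PSC n" "g \<in> PSC n" shows "f \<otimes>[n] g \<in> PSC n"
  unfolding ps_carrier_iff
proof (intro conjI allI impI)
  fix \<nu>
  show "(f \<otimes>[n] g) \<nu> \<in> carrier R"
    using assms by (cases "\<nu> \<in> mexps n") (auto simp: ps_mult ps_mult_outside ps_coeff_closed intro!: finsum_closed)
qed (rule ps_mult_outside)

lemma ps_mult_comm:
  assumes "f \<in> PSC n" "g \<in> PSC n" shows "f \<otimes>[n] g = g \<otimes>[n] f"
proof (rule ps_eqI[OF ps_mult_closed[OF assms] ps_mult_closed[OF assms(2,1)]])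
  fix \<nu> assume a: "\<nu> \<in> mexps n"
  have im: "(\<lambda>\<beta>. esub \<nu> \<beta>) ` below \<nu> = below \<nu>"
  proof
    show "below \<nu> \<subseteq> (\<lambda>\<beta>. esub \<nu> \<beta>) ` below \<nu>"
    proof
      fix \<beta> assume "\<beta> \<in> below \<nu>"
      then show "\<beta> \<in> (\<lambda>\<beta>. esub \<nu> \<beta>) ` below \<nu>"
        using imageI[of "esub \<nu> \<beta>" "below \<nu>" "\<lambda>\<beta>. esub \<nu> \<beta>"] by (simp only: esub_esub esub_below simp_thms)
    qed
    show "(\<lambda>\<beta>. esub \<nu> \<beta>) ` below \<nu> \<subseteq> below \<nu>" by (rule image_subsetI) (rule esub_below)
  qed
  have inj: "inj_on (\<lambda>\<beta>. esub \<nu> \<beta>) (below \<nu>)" by (rule inj_on_inverseI[of _ "\<lambda>\<beta>. esub \<nu> \<beta>"]) (rule esub_esub)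
  have "(\<Oplus>\<beta>\<in>below \<nu>. f \<beta> \<otimes> g (esub \<nu> \<beta>)) = (\<Oplus>\<beta>\<in>(\<lambda>\<beta>. esub \<nu> \<beta>) ` below \<nu>. f \<beta> \<otimes> g (esub \<nu> \<beta>))"
    by (simp only: im)
  also have "\<dots> = (\<Oplus>\<beta>\<in>below \<nu>. f (esub \<nu> \<beta>) \<otimes> g (esub \<nu> (esub \<nu> \<beta>)))"
    by (rule add.finprod_reindex[OF _ inj]) (use assms in \<open>auto simp: ps_coeff_closed\<close>)
  also have "\<dots> = (\<Oplus>\<beta>\<in>below \<nu>. g \<beta> \<otimes> f (esub \<nu> \<beta>))"
    by (rule finsum_cong') (use assms esub_esub in \<open>auto simp: ps_coeff_closed m_comm\<close>)
  finally show "(f \<otimes>[n] g) \<nu> = (g \<otimes>[n] f) \<nu>" by (simp add: ps_mult[OF a])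
qed

text \<open>Both sides run over the decompositions of an exponent into three summands. One side
  groups them as \<open>\<beta>\<close> with \<open>\<mu>\<close> below it, the other as
  \<open>\<mu>\<close> with \<open>\<delta>\<close> below the rest; the bijection sends
  \<open>(\<mu>, \<delta>)\<close> to \<open>(\<mu> + \<delta>, \<mu>)\<close>.\<close>

lemma ps_mult_assoc:
  assumes "f \<in> PSC n" "g \<in> PSC n" "h \<in> PSC n"
  shows "(f \<otimes>[n] g) \<otimes>[n] h = f \<otimes>[n] (g \<otimes>[n] h)"
proof (rule ps_eqI)
  show "(f \<otimes>[n] g) \<otimes>[n] h \<in> PSC n" "f \<otimes>[n] (g \<otimes>[n] h) \<in> PSC n"
    using assms by (simp_all add: ps_mult_closed)
  fix \<nu> assume a: "\<nu> \<in> mexps n"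
  note c = ps_coeff_closed[OF assms(1)] ps_coeff_closed[OF assms(2)] ps_coeff_closed[OF assms(3)]
  have fin: "finite (below \<beta>)" if "\<beta> \<in> below \<nu>" for \<beta> using finite_below below_mexps[OF a that] by blast
  let ?F = "\<lambda>\<beta> \<mu>. f \<mu> \<otimes> g (esub \<beta> \<mu>) \<otimes> h (esub \<nu> \<beta>)"
  let ?G = "\<lambda>\<mu> \<delta>. f \<mu> \<otimes> (g \<delta> \<otimes> h (esub (esub \<nu> \<mu>) \<delta>))"
  have "((f \<otimes>[n] g) \<otimes>[n] h) \<nu> = (\<Oplus>\<beta>\<in>below \<nu>. \<Oplus>\<mu>\<in>below \<beta>. ?F \<beta> \<mu>)"
    unfolding ps_mult[OF a]
    by (rule finsum_cong') (use c fin a below_mexps[OF a] in \<open>auto simp: ps_mult finsum_ldistr intro!: finsum_closed\<close>)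
  also have "\<dots> = (\<Oplus>p\<in>Sigma (below \<nu>) below. ?F (fst p) (snd p))"
    by (rule finsum_Sigma) (use finite_below[OF a] fin c in auto)
  also have "Sigma (below \<nu>) below = (\<lambda>p. (eadd (fst p) (snd p), fst p)) ` Sigma (below \<nu>) (\<lambda>\<mu>. below (esub \<nu> \<mu>))" (is "_ = ?m ` ?S")
  proof
    show "Sigma (below \<nu>) below \<subseteq> ?m ` ?S"
    proof
      fix p assume "p \<in> Sigma (below \<nu>) below"
      then obtain \<beta> \<mu> where p: "p = (\<beta>, \<mu>)" "\<beta> \<in> below \<nu>" "\<mu> \<in> below \<beta>" by auto
      have "p = ?m (\<mu>, esub \<beta> \<mu>)" using p eadd_esub by simp
      moreover have "(\<mu>, esub \<beta> \<mu>) \<in> ?S" using p by (auto simp: below_def intro: diff_le_mono order_trans)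
      ultimately show "p \<in> ?m ` ?S" by blast
    qed
    show "?m ` ?S \<subseteq> Sigma (below \<nu>) below"
    proof
      fix p assume "p \<in> ?m ` ?S"
      then obtain \<mu> \<delta> where p: "p = (eadd \<mu> \<delta>, \<mu>)" "\<mu> \<in> below \<nu>" "\<delta> \<in> below (esub \<nu> \<mu>)" by auto
      have "\<mu> i + \<delta> i \<le> \<nu> i" for i
      proof -
        have "\<mu> i \<le> \<nu> i" using p(2) by (simp add: below_def)
        moreover have "\<delta> i \<le> \<nu> i - \<mu> i" using p(3) by (simp add: below_def)
        ultimately show ?thesis by simp
      qed
      then show "p \<in> Sigma (below \<nu>) below" using p(1) by (auto simp: below_def)
    qed
  qed
  also have "(\<Oplus>p\<in>?m ` ?S. ?F (fst p) (snd p)) = (\<Oplus>p\<in>?S. ?F (fst (?m p)) (snd (?m p)))"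
  proof (rule add.finprod_reindex)
    show "inj_on ?m ?S" by (auto simp: inj_on_def fun_eq_iff)
  qed (use c in auto)
  also have "\<dots> = (\<Oplus>p\<in>?S. ?G (fst p) (snd p))"
  proof (rule finsum_cong')
    fix p assume "p \<in> ?S"
    have "esub (eadd (fst p) (snd p)) (fst p) = snd p" by (auto simp: fun_eq_iff)
    moreover have "esub \<nu> (eadd (fst p) (snd p)) = esub (esub \<nu> (fst p)) (snd p)" by (auto simp: fun_eq_iff)
    ultimately show "?F (fst (?m p)) (snd (?m p)) = ?G (fst p) (snd p)" using c by (simp add: m_assoc)
  qed (use c in auto)
  also have "\<dots> = (\<Oplus>\<mu>\<in>below \<nu>. \<Oplus>\<delta>\<in>below (esub \<nu> \<mu>). ?G \<mu> \<delta>)"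
    by (rule finsum_Sigma[symmetric]) (use finite_below[OF a] fin c in auto)
  also have "\<dots> = (f \<otimes>[n] (g \<otimes>[n] h)) \<nu>"
    unfolding ps_mult[OF a]
    by (rule finsum_cong') (use c fin a in \<open>auto simp: ps_mult finsum_rdistr intro!: finsum_closed\<close>)
  finally show "((f \<otimes>[n] g) \<otimes>[n] h) \<nu> = (f \<otimes>[n] (g \<otimes>[n] h)) \<nu>" .
qed

lemma cring_ps: "cring (PS n)"
proof (rule cringI)
  show "abelian_group (PS n)"
  proof (rule abelian_groupI)
    show "\<exists>y\<in>carrier (PS n). y \<oplus>[n] x = \<zero>[n]" if "x \<in> PSC n" for x
    proof (rule bexI[of _ "\<lambda>\<nu>. \<ominus> x \<nu>"])
      show "(\<lambda>\<nu>. \<ominus> x \<nu>) \<oplus>[n] x = \<zero>[n]"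
        using that by (auto simp: fun_eq_iff ps_coeff_closed l_neg)
      show "(\<lambda>\<nu>. \<ominus> x \<nu>) \<in> PSC n" using that by (simp add: ps_carrier_iff)
    qed
  qed (auto simp: ps_carrier_iff fun_eq_iff a_ac)
  show "Group.comm_monoid (PS n)"
  proof (rule comm_monoidI)
    show one: "\<one>[n] \<in> PSC n" by (auto simp: ps_carrier_iff ps_one)
    show "\<one>[n] \<otimes>[n] x = x" if x: "x \<in> PSC n" for x
    proof (rule ps_eqI[OF ps_mult_closed[OF one x] x])
      fix \<nu> assume a: "\<nu> \<in> mexps n"
      have "(\<one>[n] \<otimes>[n] x) \<nu> = (\<Oplus>\<beta>\<in>below \<nu>. if ezero = \<beta> then x (esub \<nu> \<beta>) else \<zero>)"
        unfolding ps_mult[OF a] by (rule finsum_cong') (use x in \<open>auto simp: ps_one ps_coeff_closed\<close>)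
      also have "\<dots> = x (esub \<nu> ezero)"
        by (rule add.finprod_singleton) (use x finite_below[OF a] in \<open>auto simp: ps_coeff_closed\<close>)
      finally show "(\<one>[n] \<otimes>[n] x) \<nu> = x \<nu>" by simp
    qed
    show "x \<otimes>[n] y \<in> PSC n" if "x \<in> PSC n" "y \<in> PSC n" for x y
      using that by (rule ps_mult_closed)
    show "x \<otimes>[n] y \<otimes>[n] z = x \<otimes>[n] (y \<otimes>[n] z)"
      if "x \<in> PSC n" "y \<in> PSC n" "z \<in> PSC n" for x y z
      using that by (rule ps_mult_assoc)
    show "x \<otimes>[n] y = y \<otimes>[n] x" if "x \<in> PSC n" "y \<in> PSC n" for x y
      using that by (rule ps_mult_comm)
  qed
  show "(x \<oplus>[n] y) \<otimes>[n] z = x \<otimes>[n] z \<oplus>[n] y \<otimes>[n] z"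
    if xyz: "x \<in> PSC n" "y \<in> PSC n" "z \<in> PSC n" for x y z
  proof (rule ps_eqI)
    have xy: "x \<oplus>[n] y \<in> PSC n" using xyz by (auto simp: ps_carrier_iff)
    then show "(x \<oplus>[n] y) \<otimes>[n] z \<in> PSC n" using xyz by (simp add: ps_mult_closed)
    show "x \<otimes>[n] z \<oplus>[n] y \<otimes>[n] z \<in> PSC n"
      using ps_mult_closed[OF xyz(1,3)] ps_mult_closed[OF xyz(2,3)] by (auto simp: ps_carrier_iff)
    fix \<nu> assume a: "\<nu> \<in> mexps n"
    have "(\<Oplus>\<beta>\<in>below \<nu>. (x \<beta> \<oplus> y \<beta>) \<otimes> z (esub \<nu> \<beta>)) = (\<Oplus>\<beta>\<in>below \<nu>. x \<beta> \<otimes> z (esub \<nu> \<beta>) \<oplus> y \<beta> \<otimes> z (esub \<nu> \<beta>))"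
      by (rule finsum_cong') (use xyz in \<open>auto simp: ps_coeff_closed l_distr\<close>)
    also have "\<dots> = (\<Oplus>\<beta>\<in>below \<nu>. x \<beta> \<otimes> z (esub \<nu> \<beta>)) \<oplus> (\<Oplus>\<beta>\<in>below \<nu>. y \<beta> \<otimes> z (esub \<nu> \<beta>))"
      by (rule finsum_addf) (use xyz in \<open>auto simp: ps_coeff_closed\<close>)
    finally show "((x \<oplus>[n] y) \<otimes>[n] z) \<nu> = (x \<otimes>[n] z \<oplus>[n] y \<otimes>[n] z) \<nu>"
      by (simp add: ps_mult[OF a])
  qed
qed

lemma ps_uminus: "f \<in> PSC n \<Longrightarrow> (\<ominus>[n] f) \<nu> = \<ominus> f \<nu>"
proof -
  assume f: "f \<in> PSC n"
  interpret P: cring "PS n" by (rule cring_ps)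
  have nf: "\<ominus>[n] f \<in> PSC n" using f by simp
  have "(\<ominus>[n] f \<oplus>[n] f) \<nu> = \<zero>" using P.l_neg[OF f] by simp
  then have "(\<ominus>[n] f) \<nu> \<oplus> f \<nu> = \<zero>" by simp
  then show ?thesis using minus_equality ps_coeff_closed[OF f] ps_coeff_closed[OF nf] by metis
qed

lemma ps_minus: "f \<in> PSC n \<Longrightarrow> g \<in> PSC n \<Longrightarrow> (f \<ominus>[n] g) \<nu> = f \<nu> \<ominus> g \<nu>"
  by (simp add: a_minus_def ps_uminus)

lemma ps_finsum:
  assumes "finite A" "\<And>x. x \<in> A \<Longrightarrow> F x \<in> PSC n"
  shows "(\<Oplus>\<^bsub>PS n\<^esub>x\<in>A. F x) \<nu> = (\<Oplus>x\<in>A. F x \<nu>)"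
  using assms
proof (induction A rule: finite_induct)
  case empty
  interpret P: cring "PS n" by (rule cring_ps)
  show ?case by simp
next
  case (insert a A)
  interpret P: cring "PS n" by (rule cring_ps)
  have "(\<Oplus>\<^bsub>PS n\<^esub>x\<in>insert a A. F x) = F a \<oplus>[n] (\<Oplus>\<^bsub>PS n\<^esub>x\<in>A. F x)"
    by (rule P.add.finprod_insert) (use insert in auto)
  then have "(\<Oplus>\<^bsub>PS n\<^esub>x\<in>insert a A. F x) \<nu> = F a \<nu> \<oplus> (\<Oplus>x\<in>A. F x \<nu>)" using insert by simp
  also have "\<dots> = (\<Oplus>x\<in>insert a A. F x \<nu>)"
    by (rule add.finprod_insert[symmetric]) (use insert(1,2) ps_coeff_closed[OF insert.prems] in auto)
  finally show ?case .
qed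

definition pconst :: "'a \<Rightarrow> (nat \<Rightarrow> nat) \<Rightarrow> 'a" where
  "pconst c = (\<lambda>\<nu>. if \<nu> = ezero then c else \<zero>)"

definition pmono :: "(nat \<Rightarrow> nat) \<Rightarrow> (nat \<Rightarrow> nat) \<Rightarrow> 'a" where
  "pmono \<beta> = (\<lambda>\<nu>. if \<nu> = \<beta> then \<one> else \<zero>)"

lemma const_closed [simp]: "c \<in> carrier R \<Longrightarrow> pconst c \<in> PSC n"
  by (auto simp: ps_carrier_iff pconst_def)

lemma mono_closed [simp]: "\<beta> \<in> mexps n \<Longrightarrow> pmono \<beta> \<in> PSC n"
  by (auto simp: ps_carrier_iff pmono_def)

lemma const_mult:
  assumes "c \<in> carrier R" "f \<in> PSC n" shows "(pconst c \<otimes>[n] f) \<nu> = c \<otimes> f \<nu>"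
proof (cases "\<nu> \<in> mexps n")
  case a: True
  have "(pconst c \<otimes>[n] f) \<nu> = (\<Oplus>\<beta>\<in>below \<nu>. if ezero = \<beta> then c \<otimes> f (esub \<nu> \<beta>) else \<zero>)"
    unfolding ps_mult[OF a] by (rule finsum_cong') (use assms in \<open>auto simp: pconst_def ps_coeff_closed\<close>)
  also have "\<dots> = c \<otimes> f (esub \<nu> ezero)"
    by (rule add.finprod_singleton) (use assms finite_below[OF a] in \<open>auto simp: ps_coeff_closed\<close>)
  finally show ?thesis by simp
next
  case False
  then show ?thesis using assms by (simp add: ps_mult_outside ps_outside)
qed

lemma pmono_eq: "pmono \<beta> \<mu> = (if \<beta> = \<mu> then \<one> else \<zero>)"
  unfolding pmono_def by (rule if_cong) (rule eq_commute, rule refl, rule refl)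

lemma indicator_mult: "x \<in> carrier R \<Longrightarrow> (if c then \<one> else \<zero>) \<otimes> x = (if c then x else \<zero>)"
  by simp

lemma mono_mult:
  assumes "\<beta> \<in> mexps n" "f \<in> PSC n"
  shows "(pmono \<beta> \<otimes>[n] f) \<nu> = (if \<beta> \<in> below \<nu> then f (esub \<nu> \<beta>) else \<zero>)"
proof (cases "\<nu> \<in> mexps n")
  case a: True
  note fc = ps_coeff_closed[OF assms(2)]
  have h: "pmono \<beta> \<mu> \<otimes> f (esub \<nu> \<mu>) = (if \<beta> = \<mu> then f (esub \<nu> \<mu>) else \<zero>)" for \<mu>
    unfolding pmono_eq by (rule indicator_mult[OF fc])
  have e: "(pmono \<beta> \<otimes>[n] f) \<nu> = (\<Oplus>\<mu>\<in>below \<nu>. if \<beta> = \<mu> then f (esub \<nu> \<mu>) else \<zero>)"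
    unfolding ps_mult[OF a] h ..
  show ?thesis
  proof (cases "\<beta> \<in> below \<nu>")
    case True
    have "(\<Oplus>\<mu>\<in>below \<nu>. if \<beta> = \<mu> then f (esub \<nu> \<mu>) else \<zero>) = f (esub \<nu> \<beta>)"
      by (rule add.finprod_singleton) (use True assms finite_below[OF a] in \<open>auto simp: ps_coeff_closed\<close>)
    then show ?thesis using e True by simp
  next
    case False
    have "(\<Oplus>\<mu>\<in>below \<nu>. if \<beta> = \<mu> then f (esub \<nu> \<mu>) else \<zero>) = \<zero>"
      by (rule add.finprod_one_eqI) (use False in auto)
    then show ?thesis using e False by simp
  qed
next
  case False
  then obtain i where i: "i \<ge> n" "\<nu> i \<noteq> 0" by (auto simp: mexps_def)
  then have "esub \<nu> \<beta> \<notin> mexps n" using assms(1) by (auto simp: mexps_def)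
  then show ?thesis using False assms by (simp add: ps_mult_outside ps_outside)
qed

lemma mono_mono:
  assumes "\<beta> \<in> mexps n" "\<mu> \<in> mexps n" shows "pmono \<beta> \<otimes>[n] pmono \<mu> = pmono (eadd \<beta> \<mu>)"
proof
  fix \<nu>
  have "\<beta> \<in> below \<nu> \<and> esub \<nu> \<beta> = \<mu> \<longleftrightarrow> \<nu> = eadd \<beta> \<mu>"
  proof
    assume "\<beta> \<in> below \<nu> \<and> esub \<nu> \<beta> = \<mu>"
    then have e: "esub \<nu> \<beta> = \<mu>" and b: "\<beta> \<in> below \<nu>" by blast+
    show "\<nu> = eadd \<beta> \<mu>"
    proof
      fix i
      have "\<beta> i \<le> \<nu> i" using b by (simp add: below_def)
      then show "\<nu> i = eadd \<beta> \<mu> i" using fun_cong[OF e, of i] by simp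
    qed
  qed (simp add: below_def)
  then show "(pmono \<beta> \<otimes>[n] pmono \<mu>) \<nu> = pmono (eadd \<beta> \<mu>) \<nu>"
    unfolding mono_mult[OF assms(1) mono_closed[OF assms(2)]] by (auto simp: pmono_def)
qed

lemma mono_ezero: "pmono ezero = \<one>[n]"
  by (auto simp: pmono_def ps_one fun_eq_iff)

lemma const_one: "pconst \<one> = \<one>[n]"
  by (auto simp: pconst_def ps_one fun_eq_iff)

lemma const_zero: "pconst \<zero> = \<zero>[n]"
  by (auto simp: pconst_def fun_eq_iff)

lemma const_hom: "ring_hom_cring R (PS n) pconst"
proof (intro ring_hom_cring.intro is_cring cring_ps ring_hom_cring_axioms.intro ring_hom_memI)
  fix x y assume "x \<in> carrier R" "y \<in> carrier R"
  then show "pconst (x \<otimes> y) = pconst x \<otimes>[n] pconst y"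
    by (auto simp: fun_eq_iff const_mult[where n = n]) (auto simp: pconst_def)
  show "pconst (x \<oplus> y) = pconst x \<oplus>[n] pconst y"
    using \<open>x \<in> carrier R\<close> \<open>y \<in> carrier R\<close> by (auto simp: fun_eq_iff pconst_def)
qed (simp_all add: const_one)

lemma mono_pow:
  assumes "\<beta> \<in> mexps n" shows "pmono \<beta> [^][n] (k::nat) = pmono (\<lambda>i. k * \<beta> i)"
proof (induction k)
  case 0
  interpret P: cring "PS n" by (rule cring_ps)
  show ?case by (simp add: mono_ezero[where n = n])
next
  case (Suc k)
  interpret P: cring "PS n" by (rule cring_ps)
  have "(\<lambda>i. k * \<beta> i) \<in> mexps n" using assms by (simp add: mexps_def)
  then show ?case using Suc mono_mono[OF _ assms] by (simp add: algebra_simps)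
qed

lemma coeff_zero_mult:
  assumes "f \<in> PSC n" "g \<in> PSC n" shows "(f \<otimes>[n] g) ezero = f ezero \<otimes> g ezero"
proof -
  have "below ezero = {ezero}" by (auto simp: below_def fun_eq_iff)
  then show ?thesis using assms by (simp add: ps_mult ps_coeff_closed)
qed

lemma coeff_zero_hom: "ring_hom_cring (PS n) R (\<lambda>f. f ezero)"
  by (intro ring_hom_cring.intro is_cring cring_ps ring_hom_cring_axioms.intro ring_hom_memI)
    (auto simp: coeff_zero_mult ps_coeff_closed ps_one)

section \<open>The order filtration and series over a coefficient subring\<close>

definition fil :: "nat \<Rightarrow> nat \<Rightarrow> ((nat \<Rightarrow> nat) \<Rightarrow> 'a) set" where
  "fil n D = {f \<in> PSC n. \<forall>\<nu>. edeg n \<nu> < D \<longrightarrow> f \<nu> = \<zero>}"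

definition vals :: "'a set \<Rightarrow> nat \<Rightarrow> ((nat \<Rightarrow> nat) \<Rightarrow> 'a) set" where
  "vals B n = {f \<in> PSC n. \<forall>\<nu>. f \<nu> \<in> B}"

lemma fil_carr: "f \<in> fil n D \<Longrightarrow> f \<in> PSC n" by (simp add: fil_def)

lemma fil_coeff: "f \<in> fil n D \<Longrightarrow> edeg n \<nu> < D \<Longrightarrow> f \<nu> = \<zero>" by (simp add: fil_def)

lemma fil_0 [simp]: "fil n 0 = carrier (PS n)" by (simp add: fil_def)

lemma fil_anti: "D \<le> E \<Longrightarrow> f \<in> fil n E \<Longrightarrow> f \<in> fil n D" by (simp add: fil_def)

lemma edeg_split: "\<beta> \<in> below \<nu> \<Longrightarrow> edeg n \<beta> + edeg n (esub \<nu> \<beta>) = edeg n \<nu>"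
  using edeg_eadd[of n \<beta> "esub \<nu> \<beta>"] by (simp only: eadd_esub)

lemma fil_mult:
  assumes f: "f \<in> fil n D" and g: "g \<in> fil n E" shows "f \<otimes>[n] g \<in> fil n (D + E)"
proof -
  have "(f \<otimes>[n] g) \<nu> = \<zero>" if d: "edeg n \<nu> < D + E" for \<nu>
  proof (cases "\<nu> \<in> mexps n")
    case True
    have "f \<beta> \<otimes> g (esub \<nu> \<beta>) = \<zero>" if b: "\<beta> \<in> below \<nu>" for \<beta>
    proof (cases "edeg n \<beta> < D")
      case True
      then show ?thesis using fil_coeff[OF f True] ps_coeff_closed[OF fil_carr[OF g]] by simp
    next
      case False
      then have "edeg n (esub \<nu> \<beta>) < E" using edeg_split[OF b, of n] d by simp
      then show ?thesis using fil_coeff[OF g] ps_coeff_closed[OF fil_carr[OF f]] by simp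
    qed
    then show ?thesis unfolding ps_mult[OF True] by (rule add.finprod_one_eqI)
  qed (rule ps_mult_outside)
  then show ?thesis using ps_mult_closed[OF fil_carr[OF f] fil_carr[OF g]] by (simp add: fil_def)
qed

lemma fil_ideal: "ideal (fil n D) (PS n)"
proof -
  interpret P: cring "PS n" by (rule cring_ps)
  show ?thesis
  proof (rule P.idealI_cring)
    show "c \<otimes>[n] x \<in> fil n D" if "c \<in> PSC n" "x \<in> fil n D" for c x
      using fil_mult[of c n 0 x D] that by simp
  qed (auto simp: fil_def)
qed

lemma fil_Inter: "(\<And>D. f \<in> fil n D) \<Longrightarrow> f = \<zero>[n]"
proof
  fix \<nu> assume "\<And>D. f \<in> fil n D"
  then have "f \<in> fil n (Suc (edeg n \<nu>))" .
  then show "f \<nu> = \<zero>[n] \<nu>" by (simp add: fil_def)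
qed

lemma fil_1_iff: "f \<in> fil n 1 \<longleftrightarrow> f \<in> PSC n \<and> f ezero = \<zero>"
proof
  assume f: "f \<in> fil n 1"
  show "f \<in> PSC n \<and> f ezero = \<zero>" using fil_carr[OF f] fil_coeff[OF f, of ezero] by simp
next
  assume f: "f \<in> PSC n \<and> f ezero = \<zero>"
  have "f \<nu> = \<zero>" if "edeg n \<nu> < 1" for \<nu>
  proof (cases "\<nu> \<in> mexps n")
    case True
    then have "\<nu> = ezero" using that edeg_0_iff by simp
    then show ?thesis using f by simp
  next
    case False
    then show ?thesis using f ps_outside by blast
  qed
  then show "f \<in> fil n 1" using f by (simp add: fil_def)
qed

lemma fil_pow: "f \<in> fil n D \<Longrightarrow> f [^][n] (k::nat) \<in> fil n (k * D)"
proof (induction k)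
  case 0
  interpret P: cring "PS n" by (rule cring_ps)
  show ?case by simp
next
  case (Suc k)
  then show ?case using fil_mult[OF Suc.IH[OF Suc.prems] Suc.prems] by (simp add: add.commute)
qed

text \<open>The \<open>N\<close>-th power has zero constant term, so the order grows by at least one
  with every \<open>N\<close> factors.\<close>

lemma fil_pow_nilpotent_const:
  assumes f: "f \<in> PSC n" and N: "f ezero [^] (N::nat) = \<zero>"
  shows "f [^][n] (s::nat) \<in> fil n (s div N)"
proof -
  interpret P: cring "PS n" by (rule cring_ps)
  interpret h: ring_hom_cring "PS n" R "\<lambda>f. f ezero" by (rule coeff_zero_hom)
  have "(f [^][n] N) ezero = \<zero>" using N h.ring.hom_nat_pow[OF f] by simp
  then have "f [^][n] N \<in> fil n 1" unfolding fil_1_iff using f by simp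
  then have 1: "(f [^][n] N) [^][n] (s div N) \<in> fil n (s div N)" using fil_pow[of _ n 1 "s div N"] by simp
  have "f [^][n] s = (f [^][n] N) [^][n] (s div N) \<otimes>[n] f [^][n] (s mod N)"
    using f by (simp add: P.nat_pow_pow P.nat_pow_mult)
  then show ?thesis using ideal.I_r_closed[OF fil_ideal 1] f by simp
qed

lemma vals_carr: "f \<in> vals B n \<Longrightarrow> f \<in> PSC n" by (simp add: vals_def)

lemma finsum_in_subring:
  assumes "subring B R" "\<And>x. x \<in> A \<Longrightarrow> f x \<in> B" shows "(\<Oplus>x\<in>A. f x) \<in> B"
proof (cases "finite A")
  case True
  have Bc: "B \<subseteq> carrier R" by (rule subringE(1)[OF assms(1)])
  show ?thesis using True assms(2)
  proof (induction A rule: finite_induct)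
    case empty
    show ?case using subringE(2)[OF assms(1)] by simp
  next
    case (insert a A)
    have "(\<Oplus>x\<in>insert a A. f x) = f a \<oplus> (\<Oplus>x\<in>A. f x)"
      by (rule add.finprod_insert) (use insert Bc in auto)
    then show ?case using subringE(7)[OF assms(1)] insert by simp
  qed
next
  case False
  then show ?thesis using subringE(2)[OF assms(1)] by simp
qed

lemma vals_subring:
  assumes B: "subring B R" shows "subring (vals B n) (PS n)"
proof -
  interpret P: cring "PS n" by (rule cring_ps)
  show ?thesis
  proof (rule P.subringI)
    show "vals B n \<subseteq> PSC n" by (auto simp: vals_def)
    show "\<one>[n] \<in> vals B n" using subringE(2,3)[OF B] by (auto simp: vals_def ps_one)
    show "\<ominus>[n] f \<in> vals B n" if "f \<in> vals B n" for f
      using that subringE(5)[OF B] by (simp add: vals_def ps_uminus)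
    show "f \<oplus>[n] g \<in> vals B n" if "f \<in> vals B n" "g \<in> vals B n" for f g
      using that subringE(7)[OF B] by (simp add: vals_def)
    show "f \<otimes>[n] g \<in> vals B n" if f: "f \<in> vals B n" and g: "g \<in> vals B n" for f g
    proof -
      have "(f \<otimes>[n] g) \<nu> \<in> B" for \<nu>
      proof (cases "\<nu> \<in> mexps n")
        case True
        show ?thesis unfolding ps_mult[OF True]
          by (rule finsum_in_subring[OF B]) (use f g subringE(6)[OF B] in \<open>simp add: vals_def\<close>)
      next
        case False
        then show ?thesis using subringE(2)[OF B] by (simp add: ps_mult_outside)
      qed
      then show ?thesis using f g ps_mult_closed by (simp add: vals_def)
    qed
  qed
qed

text \<open>A restriction of the carrier of the full series ring, so that operations and elements
  are literally shared by all coefficient subrings; the passage between members of the family is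
  then inclusion of sets.\<close>

abbreviation PSB :: "'a set \<Rightarrow> nat \<Rightarrow> ((nat \<Rightarrow> nat) \<Rightarrow> 'a) ring" where
  "PSB B n \<equiv> (mps R n) \<lparr>carrier := vals B n\<rparr>"

lemma psb_simps:
  "carrier (PSB B n) = vals B n" "x \<oplus>\<^bsub>PSB B n\<^esub> y = x \<oplus>[n] y"
  "x \<otimes>\<^bsub>PSB B n\<^esub> y = x \<otimes>[n] y" "\<zero>\<^bsub>PSB B n\<^esub> = \<zero>[n]" "\<one>\<^bsub>PSB B n\<^esub> = \<one>[n]"
  by simp_all

lemma cring_psb: "subring B R \<Longrightarrow> cring (PSB B n)"
proof -
  assume B: "subring B R"
  interpret P: cring "PS n" by (rule cring_ps)
  show ?thesis using P.subcring_iff[OF subringE(1)[OF vals_subring[OF B]]] P.subcringI'[OF vals_subring[OF B]] by blast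
qed

lemma nat_pow_update_carrier [simp]: "x [^]\<^bsub>(S\<lparr>carrier := H\<rparr>)\<^esub> (k::nat) = x [^]\<^bsub>S\<^esub> k"
  by (simp add: nat_pow_def)

lemma pmono_vals [simp]: "subring B R \<Longrightarrow> \<beta> \<in> mexps n \<Longrightarrow> pmono \<beta> \<in> vals B n"
  using subringE(2,3)[of B R] mono_closed by (simp add: vals_def pmono_def)

lemma pconst_vals: "subring B R \<Longrightarrow> c \<in> B \<Longrightarrow> pconst c \<in> vals B n"
  using subringE(1,2)[of B R] by (auto simp: vals_def pconst_def[of c] const_closed[unfolded pconst_def])

section \<open>Infinite sums of series whose orders tend to infinity\<close>

definition convergent :: "nat \<Rightarrow> (nat \<Rightarrow> (nat \<Rightarrow> nat) \<Rightarrow> 'a) \<Rightarrow> bool" where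
  "convergent n u \<longleftrightarrow> (\<forall>s. u s \<in> PSC n) \<and> (\<forall>D. \<exists>T. \<forall>s\<ge>T. u s \<in> fil n D)"

text \<open>Each coefficient is a finite partial sum, cut where all later terms have order above the
  degree of the exponent. \<open>LEAST\<close> merely makes the cut definite;
  \<open>isum_coeff\<close> shows that every later cut gives the same value.\<close>

definition isum :: "nat \<Rightarrow> (nat \<Rightarrow> (nat \<Rightarrow> nat) \<Rightarrow> 'a) \<Rightarrow> (nat \<Rightarrow> nat) \<Rightarrow> 'a" where
  "isum n u = (\<lambda>\<nu>. sumr R (\<lambda>s. u s \<nu>) (LEAST T. \<forall>s\<ge>T. u s \<in> fil n (Suc (edeg n \<nu>))))"

lemma convergent_carr: "convergent n u \<Longrightarrow> u s \<in> PSC n" by (simp add: convergent_def)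

lemma convergentD: "convergent n u \<Longrightarrow> \<exists>T. \<forall>s\<ge>T. u s \<in> fil n D" by (simp add: convergent_def)

lemma sumr_closed': "(\<And>i. i < r \<Longrightarrow> f i \<in> carrier R) \<Longrightarrow> sumr R f r \<in> carrier R"
  by (induction r) auto

lemma sumr_stable:
  assumes "\<And>s. f s \<in> carrier R" "\<And>s. s \<ge> T \<Longrightarrow> f s = \<zero>" "T \<le> T'" shows "sumr R f T' = sumr R f T"
  using assms(3)
proof (induction T')
  case (Suc T')
  show ?case
  proof (cases "T = Suc T'")
    case False
    then show ?thesis using Suc assms(1,2) sumr_closed'[of _ f] by simp
  qed simp
qed simp

lemma sumr_ps: "sumr (PS n) u T \<nu> = sumr R (\<lambda>s. u s \<nu>) T"
  by (induction T) auto

lemma isum_coeff: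
  assumes u: "convergent n u" and T: "\<And>s. s \<ge> T \<Longrightarrow> u s \<in> fil n (Suc (edeg n \<nu>))"
  shows "isum n u \<nu> = sumr (PS n) u T \<nu>"
proof -
  let ?T = "LEAST T. \<forall>s\<ge>T. u s \<in> fil n (Suc (edeg n \<nu>))"
  have L: "\<forall>s\<ge>?T. u s \<in> fil n (Suc (edeg n \<nu>))" by (rule LeastI[of _ T]) (use T in blast)
  have "?T \<le> T" by (rule Least_le) (use T in blast)
  have "sumr R (\<lambda>s. u s \<nu>) T = sumr R (\<lambda>s. u s \<nu>) ?T"
  proof (rule sumr_stable[OF _ _ \<open>?T \<le> T\<close>])
    show "u s \<nu> \<in> carrier R" for s by (rule ps_coeff_closed[OF convergent_carr[OF u]])
    show "u s \<nu> = \<zero>" if "s \<ge> ?T" for s using L that fil_coeff by blast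
  qed
  then show ?thesis unfolding sumr_ps isum_def by simp
qed

lemma isum_closed:
  assumes u: "convergent n u" shows "isum n u \<in> PSC n"
  unfolding ps_carrier_iff
proof (intro conjI allI impI)
  fix \<nu>
  show "isum n u \<nu> \<in> carrier R"
    unfolding isum_def by (rule sumr_closed') (rule ps_coeff_closed[OF convergent_carr[OF u]])
  assume "\<nu> \<notin> mexps n"
  then have "u s \<nu> = \<zero>" for s using ps_outside[OF convergent_carr[OF u]] by simp
  then have "sumr R (\<lambda>s. u s \<nu>) T = \<zero>" for T by (induction T) auto
  then show "isum n u \<nu> = \<zero>" unfolding isum_def by simp
qed

lemma isum_vals:
  assumes B: "subring B R" and u: "convergent n u" "\<And>s. u s \<in> vals B n" shows "isum n u \<in> vals B n"
proof -
  have "sumr R (\<lambda>s. u s \<nu>) T \<in> B" for \<nu> T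
  proof (induction T)
    case 0
    show ?case using subringE(2)[OF B] by simp
  next
    case (Suc T)
    then show ?case using subringE(7)[OF B] u(2)[of T] by (simp add: vals_def)
  qed
  then show ?thesis using isum_closed[OF u(1)] by (simp add: vals_def isum_def)
qed

lemma sumr_ps_closed: "(\<And>s. u s \<in> PSC n) \<Longrightarrow> sumr (PS n) u T \<in> PSC n"
proof -
  interpret P: cring "PS n" by (rule cring_ps)
  show "(\<And>s. u s \<in> PSC n) \<Longrightarrow> sumr (PS n) u T \<in> PSC n" by (rule P.sumr_closed')
qed

lemma isum_approx:
  assumes u: "convergent n u" and T: "\<And>s. s \<ge> T \<Longrightarrow> u s \<in> fil n D"
  shows "isum n u \<ominus>[n] sumr (PS n) u T \<in> fil n D"
proof -
  interpret P: cring "PS n" by (rule cring_ps)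
  have c: "isum n u \<in> PSC n" "sumr (PS n) u T \<in> PSC n"
    using isum_closed[OF u] sumr_ps_closed[OF convergent_carr[OF u]] by auto
  have "(isum n u \<ominus>[n] sumr (PS n) u T) \<nu> = \<zero>" if d: "edeg n \<nu> < D" for \<nu>
  proof -
    have "isum n u \<nu> = sumr (PS n) u T \<nu>"
      by (rule isum_coeff[OF u]) (use T fil_anti[of "Suc (edeg n \<nu>)" D] d in auto)
    then show ?thesis using c ps_coeff_closed[OF c(2)] by (simp add: ps_minus minus_eq r_neg)
  qed
  then show ?thesis using c by (simp add: fil_def)
qed

lemma isum_unique:
  assumes u: "convergent n u" and U: "U \<in> PSC n"
    and a: "\<And>D. \<exists>T0. \<forall>T\<ge>T0. U \<ominus>[n] sumr (PS n) u T \<in> fil n D"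
  shows "U = isum n u"
proof
  fix \<nu>
  interpret P: cring "PS n" by (rule cring_ps)
  obtain T1 where T1: "\<And>s. s \<ge> T1 \<Longrightarrow> u s \<in> fil n (Suc (edeg n \<nu>))" using convergentD[OF u] by blast
  obtain T0 where T0: "\<And>T. T \<ge> T0 \<Longrightarrow> U \<ominus>[n] sumr (PS n) u T \<in> fil n (Suc (edeg n \<nu>))" using a by blast
  let ?T = "max T0 T1"
  have s: "sumr (PS n) u ?T \<in> PSC n" by (rule sumr_ps_closed[OF convergent_carr[OF u]])
  have "(U \<ominus>[n] sumr (PS n) u ?T) \<nu> = \<zero>" by (rule fil_coeff[OF T0]) auto
  then have "U \<nu> \<ominus> sumr (PS n) u ?T \<nu> = \<zero>" using U s by (simp add: ps_minus)
  then have "U \<nu> = sumr (PS n) u ?T \<nu>"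
    using diff_add_cancel_cring[of "U \<nu>" "sumr (PS n) u ?T \<nu>"] ps_coeff_closed[OF U] ps_coeff_closed[OF s] by simp
  also have "\<dots> = isum n u \<nu>" by (rule isum_coeff[OF u, symmetric]) (use T1 in auto)
  finally show "U \<nu> = isum n u \<nu>" .
qed

lemma convergent_Suc: "convergent n u \<Longrightarrow> convergent n (\<lambda>s. u (Suc s))"
  unfolding convergent_def by (metis Suc_leD le_SucI)

lemma isum_Suc:
  assumes u: "convergent n u" shows "isum n u = u 0 \<oplus>[n] isum n (\<lambda>s. u (Suc s))"
proof
  fix \<nu>
  obtain T where T: "\<And>s. s \<ge> T \<Longrightarrow> u s \<in> fil n (Suc (edeg n \<nu>))" using convergentD[OF u] by blast
  have cl: "u s \<nu> \<in> carrier R" for s by (rule ps_coeff_closed[OF convergent_carr[OF u]])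
  have "sumr R (\<lambda>s. u s \<nu>) (Suc k) = u 0 \<nu> \<oplus> sumr R (\<lambda>s. u (Suc s) \<nu>) k" for k
  proof (induction k)
    case 0
    show ?case using cl by simp
  next
    case (Suc k)
    have "sumr R (\<lambda>s. u (Suc s) \<nu>) k \<in> carrier R" by (rule sumr_closed') (rule cl)
    then show ?case using Suc cl by (simp add: a_assoc)
  qed
  moreover have "isum n u \<nu> = sumr R (\<lambda>s. u s \<nu>) (Suc T)"
    using isum_coeff[OF u, of "Suc T" \<nu>] T by (simp add: sumr_ps del: sumr.simps)
  moreover have "isum n (\<lambda>s. u (Suc s)) \<nu> = sumr R (\<lambda>s. u (Suc s) \<nu>) T"
    using isum_coeff[OF convergent_Suc[OF u], of T \<nu>] T by (simp add: sumr_ps del: sumr.simps)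
  ultimately show "isum n u \<nu> = (u 0 \<oplus>[n] isum n (\<lambda>s. u (Suc s))) \<nu>" by simp
qed

lemma convergent_mult:
  assumes "convergent n u" "g \<in> PSC n" shows "convergent n (\<lambda>s. g \<otimes>[n] u s)"
  unfolding convergent_def
proof (intro conjI allI)
  show "g \<otimes>[n] u s \<in> PSC n" for s using assms convergent_carr ps_mult_closed by blast
  fix D
  obtain T where "\<And>s. s \<ge> T \<Longrightarrow> u s \<in> fil n D" using convergentD[OF assms(1)] by blast
  then show "\<exists>T. \<forall>s\<ge>T. g \<otimes>[n] u s \<in> fil n D"
    using ideal.I_l_closed[OF fil_ideal _ assms(2)] by blast
qed

lemma isum_mult:
  assumes u: "convergent n u" and g: "g \<in> PSC n"
  shows "g \<otimes>[n] isum n u = isum n (\<lambda>s. g \<otimes>[n] u s)"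
proof (rule isum_unique[OF convergent_mult[OF u g]])
  interpret P: cring "PS n" by (rule cring_ps)
  have ic: "isum n u \<in> PSC n" by (rule isum_closed[OF u])
  then show "g \<otimes>[n] isum n u \<in> PSC n" using g by simp
  fix D
  obtain T0 where T0: "\<And>s. s \<ge> T0 \<Longrightarrow> u s \<in> fil n D" using convergentD[OF u] by blast
  have "g \<otimes>[n] isum n u \<ominus>[n] sumr (PS n) (\<lambda>s. g \<otimes>[n] u s) T \<in> fil n D" if "T \<ge> T0" for T
  proof -
    have sc: "sumr (PS n) u T \<in> PSC n" by (rule sumr_ps_closed[OF convergent_carr[OF u]])
    have "sumr (PS n) (\<lambda>s. g \<otimes>[n] u s) T = g \<otimes>[n] sumr (PS n) u T"
      using convergent_carr[OF u] g by (induction T) (auto simp: P.r_distr P.sumr_closed')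
    then have "g \<otimes>[n] isum n u \<ominus>[n] sumr (PS n) (\<lambda>s. g \<otimes>[n] u s) T
       = g \<otimes>[n] (isum n u \<ominus>[n] sumr (PS n) u T)" using g ic sc by (simp add: P.minus_eq P.r_distr P.r_minus)
    moreover have "isum n u \<ominus>[n] sumr (PS n) u T \<in> fil n D" by (rule isum_approx[OF u]) (use T0 that in auto)
    ultimately show ?thesis using ideal.I_l_closed[OF fil_ideal _ g] by simp
  qed
  then show "\<exists>T0. \<forall>T\<ge>T0. g \<otimes>[n] isum n u \<ominus>[n] sumr (PS n) (\<lambda>s. g \<otimes>[n] u s) T \<in> fil n D" by blast
qed

lemma convergent_add:
  assumes "convergent n u" "convergent n v" shows "convergent n (\<lambda>s. u s \<oplus>[n] v s)"
  unfolding convergent_def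
proof (intro conjI allI)
  interpret P: cring "PS n" by (rule cring_ps)
  show "u s \<oplus>[n] v s \<in> PSC n" for s using convergent_carr assms by blast
  fix D
  obtain T1 where T1: "\<And>s. s \<ge> T1 \<Longrightarrow> u s \<in> fil n D" using convergentD[OF assms(1)] by blast
  obtain T2 where T2: "\<And>s. s \<ge> T2 \<Longrightarrow> v s \<in> fil n D" using convergentD[OF assms(2)] by blast
  interpret I: ideal "fil n D" "PS n" by (rule fil_ideal)
  show "\<exists>T. \<forall>s\<ge>T. u s \<oplus>[n] v s \<in> fil n D"
    by (rule exI[of _ "max T1 T2"]) (use T1 T2 in simp)
qed

lemma isum_add:
  assumes u: "convergent n u" and v: "convergent n v"
  shows "isum n (\<lambda>s. u s \<oplus>[n] v s) = isum n u \<oplus>[n] isum n v"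
proof
  fix \<nu>
  obtain T1 where T1: "\<And>s. s \<ge> T1 \<Longrightarrow> u s \<in> fil n (Suc (edeg n \<nu>))" using convergentD[OF u] by blast
  obtain T2 where T2: "\<And>s. s \<ge> T2 \<Longrightarrow> v s \<in> fil n (Suc (edeg n \<nu>))" using convergentD[OF v] by blast
  let ?T = "max T1 T2"
  interpret I: ideal "fil n (Suc (edeg n \<nu>))" "PS n" by (rule fil_ideal)
  have "isum n (\<lambda>s. u s \<oplus>[n] v s) \<nu> = sumr R (\<lambda>s. u s \<nu> \<oplus> v s \<nu>) ?T"
    using isum_coeff[OF convergent_add[OF u v], of ?T \<nu>] T1 T2 by (simp add: sumr_ps)
  also have "\<dots> = sumr R (\<lambda>s. u s \<nu>) ?T \<oplus> sumr R (\<lambda>s. v s \<nu>) ?T"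
  proof -
    have cu: "u s \<nu> \<in> carrier R" "v s \<nu> \<in> carrier R" for s
      using ps_coeff_closed[OF convergent_carr[OF u]] ps_coeff_closed[OF convergent_carr[OF v]] by auto
    show "sumr R (\<lambda>s. u s \<nu> \<oplus> v s \<nu>) k = sumr R (\<lambda>s. u s \<nu>) k \<oplus> sumr R (\<lambda>s. v s \<nu>) k" for k
    proof (induction k)
      case (Suc k)
      have "sumr R (\<lambda>s. u s \<nu>) k \<in> carrier R" "sumr R (\<lambda>s. v s \<nu>) k \<in> carrier R"
        using cu by (auto intro!: sumr_closed')
      then show ?case using Suc cu by (simp add: a_ac)
    qed simp
  qed
  also have "\<dots> = isum n u \<nu> \<oplus> isum n v \<nu>"
    using isum_coeff[OF u, of ?T \<nu>] isum_coeff[OF v, of ?T \<nu>] T1 T2 by (simp add: sumr_ps)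
  finally show "isum n (\<lambda>s. u s \<oplus>[n] v s) \<nu> = (isum n u \<oplus>[n] isum n v) \<nu>" by simp
qed

text \<open>Powers of \<open>g\<close> have orders tending to infinity, since the constant term of
  \<open>g\<close> is nilpotent. The recurrence is solved by the sum of \<open>g^t u_(s+t)\<close>
  over \<open>t\<close>, whose coefficients stay in \<open>B\<close>; a solution of the homogeneous
  recurrence has infinite order.\<close>

lemma adically_complete_psb:
  assumes B: "subring B R" and g: "g \<in> vals B n" "g ezero [^] (N::nat) = \<zero>" "N > 0"
  shows "adically_complete (PSB B n) g"
  unfolding adically_complete_def
proof (intro conjI allI impI)
  interpret P: cring "PS n" by (rule cring_ps)
  interpret V: subring "vals B n" "PS n" by (rule vals_subring[OF B])
  have gc: "g \<in> PSC n" by (rule vals_carr[OF g(1)])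
  have gv: "g [^][n] (t::nat) \<in> vals B n" for t
    using g(1) by (induction t) auto
  have gp: "g [^][n] (t::nat) \<in> fil n D" if "t \<ge> D * N" for t D
  proof -
    have "D \<le> t div N" using that g(3) by (simp add: less_eq_div_iff_mult_less_eq)
    then show ?thesis using fil_pow_nilpotent_const[OF gc g(2)] fil_anti by blast
  qed
  show "\<exists>V. \<forall>s. V s \<in> carrier (PSB B n) \<and> V s = u s \<oplus>\<^bsub>PSB B n\<^esub> g \<otimes>\<^bsub>PSB B n\<^esub> V (Suc s)"
    if u: "\<forall>s. u s \<in> carrier (PSB B n)" for u :: "nat \<Rightarrow> _"
  proof -
    have uv: "u s \<in> vals B n" for s using u by simp
    have uc: "u s \<in> PSC n" for s by (rule vals_carr[OF uv])
    have conv: "convergent n (\<lambda>t. g [^][n] t \<otimes>[n] u (s + t))" for s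
      unfolding convergent_def
    proof (intro conjI allI)
      show "g [^][n] t \<otimes>[n] u (s + t) \<in> PSC n" for t using gc uc by simp
      show "\<exists>T. \<forall>t\<ge>T. g [^][n] t \<otimes>[n] u (s + t) \<in> fil n D" for D
        by (rule exI[of _ "D * N"]) (use gp ideal.I_r_closed[OF fil_ideal _ uc] in blast)
    qed
    define V where "V = (\<lambda>s. isum n (\<lambda>t. g [^][n] t \<otimes>[n] u (s + t)))"
    have "V s \<in> vals B n" for s
      unfolding V_def by (rule isum_vals[OF B conv]) (use gv uv in auto)
    moreover have "V s = u s \<oplus>[n] g \<otimes>[n] V (Suc s)" for s
    proof -
      have "V s = g [^][n] (0::nat) \<otimes>[n] u (s + 0) \<oplus>[n] isum n (\<lambda>t. g [^][n] Suc t \<otimes>[n] u (s + Suc t))"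
        unfolding V_def by (rule isum_Suc[OF conv])
      also have "(\<lambda>t. g [^][n] Suc t \<otimes>[n] u (s + Suc t)) = (\<lambda>t. g \<otimes>[n] (g [^][n] t \<otimes>[n] u (Suc s + t)))"
        using gc uc by (intro ext) (simp add: P.m_ac)
      also have "isum n \<dots> = g \<otimes>[n] V (Suc s)" unfolding V_def by (rule isum_mult[OF conv gc, symmetric])
      finally show ?thesis using uc by (simp del: ps_add)
    qed
    ultimately show ?thesis unfolding psb_simps by blast
  qed
  show "V 0 = \<zero>\<^bsub>PSB B n\<^esub>"
    if V: "\<forall>s. V s \<in> carrier (PSB B n) \<and> V s = g \<otimes>\<^bsub>PSB B n\<^esub> V (Suc s)" for V :: "nat \<Rightarrow> _"
  proof -
    have Vv: "V s \<in> vals B n" for s using V unfolding psb_simps by blast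
    have Vc: "V s \<in> PSC n" for s by (rule vals_carr[OF Vv])
    have V1: "V s = g \<otimes>[n] V (Suc s)" for s using V unfolding psb_simps by blast
    have e: "V 0 = g [^][n] t \<otimes>[n] V t" for t :: nat
    proof (induction t)
      case 0
      show ?case using Vc by simp
    next
      case (Suc t)
      have "V 0 = g [^][n] t \<otimes>[n] (g \<otimes>[n] V (Suc t))"
        by (rule Suc[unfolded V1[of t]])
      then show ?case using gc Vc by (simp add: P.m_assoc)
    qed
    have "V 0 = \<zero>[n]"
    proof (rule fil_Inter)
      fix D
      show "V 0 \<in> fil n D" unfolding e[of "D * N"] by (rule ideal.I_r_closed[OF fil_ideal gp Vc]) simp
    qed
    then show ?thesis by simp
  qed
qed

section \<open>Powers of the variables and the regularity of systems of parameters\<close>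

lemma split_var:
  assumes B: "subring B R" and f: "f \<in> vals B n" and i: "i < n"
  shows "(\<lambda>\<nu>. f (eadd \<nu> (eunit L i))) \<in> vals B n" "(\<lambda>\<nu>. if \<nu> i < L then f \<nu> else \<zero>) \<in> vals B n"
    "f = (\<lambda>\<nu>. if \<nu> i < L then f \<nu> else \<zero>) \<oplus>[n] pmono (eunit L i) \<otimes>[n] (\<lambda>\<nu>. f (eadd \<nu> (eunit L i)))"
proof -
  have "eadd \<nu> (eunit L i) \<notin> mexps n" if "\<nu> \<notin> mexps n" for \<nu> using that by (auto simp: mexps_def)
  then show 1: "(\<lambda>\<nu>. f (eadd \<nu> (eunit L i))) \<in> vals B n"
    using f unfolding vals_def by (auto simp: ps_carrier_iff)
  show "(\<lambda>\<nu>. if \<nu> i < L then f \<nu> else \<zero>) \<in> vals B n"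
    using f subringE(2)[OF B] unfolding vals_def by (auto simp: ps_carrier_iff)
  show "f = (\<lambda>\<nu>. if \<nu> i < L then f \<nu> else \<zero>) \<oplus>[n] pmono (eunit L i) \<otimes>[n] (\<lambda>\<nu>. f (eadd \<nu> (eunit L i)))"
  proof
    fix \<nu>
    have b: "eunit L i \<in> below \<nu> \<longleftrightarrow> \<not> \<nu> i < L" by (auto simp: below_def eunit_def)
    have m: "(pmono (eunit L i) \<otimes>[n] (\<lambda>\<nu>. f (eadd \<nu> (eunit L i)))) \<nu> =
        (if eunit L i \<in> below \<nu> then f (eadd (esub \<nu> (eunit L i)) (eunit L i)) else \<zero>)"
      by (rule mono_mult[OF eunit_mexps[OF i] vals_carr[OF 1]])
    have fc: "f \<nu> \<in> carrier R" by (rule ps_coeff_closed[OF vals_carr[OF f]])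
    show "f \<nu> = ((\<lambda>\<nu>. if \<nu> i < L then f \<nu> else \<zero>) \<oplus>[n] pmono (eunit L i) \<otimes>[n] (\<lambda>\<nu>. f (eadd \<nu> (eunit L i)))) \<nu>"
    proof (cases "\<nu> i < L")
      case True
      then show ?thesis using m b fc by simp
    next
      case False
      then have "eadd (esub \<nu> (eunit L i)) (eunit L i) = \<nu>" by (auto simp: fun_eq_iff eunit_def)
      then show ?thesis using m b fc False by simp
    qed
  qed
qed

definition xpows :: "nat \<Rightarrow> nat list \<Rightarrow> ((nat \<Rightarrow> nat) \<Rightarrow> 'a) list" where
  "xpows L js = map (\<lambda>i. pmono (eunit L i)) js"

lemma xpows_vals: "subring B R \<Longrightarrow> set js \<subseteq> {..<n} \<Longrightarrow> set (xpows L js) \<subseteq> vals B n"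
  by (auto simp: xpows_def)

text \<open>Membership in this monomial ideal is decided exponent by exponent, which turns the
  regularity of the powers into a statement about shifted exponents.\<close>

lemma genideal_xpows:
  assumes B: "subring B R" and "set js \<subseteq> {..<n}"
  shows "genideal (PSB B n) (set (xpows L js)) = {f \<in> vals B n. \<forall>\<nu>. f \<nu> \<noteq> \<zero> \<longrightarrow> (\<exists>i\<in>set js. L \<le> \<nu> i)}"
  using assms(2)
proof (induction "js")
  case Nil
  interpret Q: cring "PSB B n" by (rule cring_psb[OF B])
  have "f = \<zero>[n]" if "\<forall>\<nu>. f \<nu> = \<zero>" for f :: "_ \<Rightarrow> 'a" using that by (intro ext) simp
  moreover have "\<zero>[n] \<in> vals B n" using subringE(2)[OF vals_subring[OF B]] .
  ultimately show ?case by (auto simp: xpows_def)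
next
  case (Cons i js)
  interpret Q: cring "PSB B n" by (rule cring_psb[OF B])
  interpret P: cring "PS n" by (rule cring_ps)
  let ?J = "\<lambda>js. {f \<in> vals B n. \<forall>\<nu>. f \<nu> \<noteq> \<zero> \<longrightarrow> (\<exists>i\<in>set js. L \<le> \<nu> i)}"
  have i: "i < n" using Cons.prems by simp
  have IH: "genideal (PSB B n) (set (xpows L js)) = ?J js" using Cons by simp
  have "genideal (PSB B n) (set (xpows L (i # js))) = {x \<oplus>[n] c \<otimes>[n] pmono (eunit L i) | x c. x \<in> ?J js \<and> c \<in> vals B n}"
    using Q.genideal_insert[of "set (xpows L js)" "pmono (eunit L i)"] xpows_vals[OF B] B i Cons.prems IH
    by (simp add: xpows_def)
  also have "\<dots> = ?J (i # js)"
  proof (intro equalityI subsetI)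
    fix f assume "f \<in> {x \<oplus>[n] c \<otimes>[n] pmono (eunit L i) | x c. x \<in> ?J js \<and> c \<in> vals B n}"
    then obtain x c where f: "f = x \<oplus>[n] c \<otimes>[n] pmono (eunit L i)" "x \<in> ?J js" "c \<in> vals B n" by blast
    have fv: "f \<in> vals B n" unfolding f(1)
      using f(2,3) subringE(6,7)[OF vals_subring[OF B]] pmono_vals[OF B eunit_mexps[OF i]] by blast
    moreover have "\<exists>l\<in>set (i # js). L \<le> \<nu> l" if "f \<nu> \<noteq> \<zero>" for \<nu>
    proof (rule ccontr)
      assume n: "\<not> ?thesis"
      have "x \<nu> = \<zero>" using n f(2) by auto
      moreover have "(c \<otimes>[n] pmono (eunit L i)) \<nu> = \<zero>"
      proof -
        have "c \<otimes>[n] pmono (eunit L i) = pmono (eunit L i) \<otimes>[n] c"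
          by (rule P.m_comm) (use i vals_carr[OF f(3)] in auto)
        moreover have "eunit L i \<notin> below \<nu>" using n by (auto simp: below_def eunit_def)
        ultimately show ?thesis using mono_mult[OF eunit_mexps[OF i] vals_carr[OF f(3)]] by simp
      qed
      ultimately show False using that f(1) by simp
    qed
    ultimately show "f \<in> ?J (i # js)" by blast
  next
    fix f assume f: "f \<in> ?J (i # js)"
    then have fv: "f \<in> vals B n" by blast
    note s = split_var[OF B fv i, of L]
    have "(\<lambda>\<nu>. if \<nu> i < L then f \<nu> else \<zero>) \<in> ?J js"
      using s(2) f by (auto split: if_splits)
    moreover have "f = (\<lambda>\<nu>. if \<nu> i < L then f \<nu> else \<zero>) \<oplus>[n] (\<lambda>\<nu>. f (eadd \<nu> (eunit L i))) \<otimes>[n] pmono (eunit L i)"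
      using s(3) P.m_comm[OF mono_closed[OF eunit_mexps[OF i]] vals_carr[OF s(1)]] by simp
    ultimately show "f \<in> {x \<oplus>[n] c \<otimes>[n] pmono (eunit L i) | x c. x \<in> ?J js \<and> c \<in> vals B n}"
      using s(1) by blast
  qed
  finally show ?case .
qed

text \<open>Multiplication by a power of \<open>X_i\<close> changes only the \<open>i\<close>-th
  exponent. As \<open>i\<close> is distinct from the remaining indices, the divisibility condition
  for those is the same before and after the shift.\<close>

lemma weakly_regular_xpows:
  assumes B: "subring B R" and "distinct js" "set js \<subseteq> {..<n}"
  shows "weakly_regular (PSB B n) (xpows L js)"
  using assms(2,3)
proof (induction "js")
  case (Cons i js)
  have i: "i < n" "i \<notin> set js" "set js \<subseteq> {..<n}" using Cons.prems by auto
  have "z \<in> genideal (PSB B n) (set (xpows L js))"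
    if z: "z \<in> vals B n" "pmono (eunit L i) \<otimes>[n] z \<in> genideal (PSB B n) (set (xpows L js))" for z
  proof -
    have "\<exists>l\<in>set js. L \<le> \<nu> l" if za: "z \<nu> \<noteq> \<zero>" for \<nu>
    proof -
      have "(pmono (eunit L i) \<otimes>[n] z) (eadd \<nu> (eunit L i)) = z \<nu>"
        using mono_mult[OF eunit_mexps[OF i(1)] vals_carr[OF z(1)]] by (simp add: below_def)
      moreover have "(pmono (eunit L i) \<otimes>[n] z) (eadd \<nu> (eunit L i)) \<noteq> \<zero> \<longrightarrow> (\<exists>l\<in>set js. L \<le> eadd \<nu> (eunit L i) l)"
        using z(2) unfolding genideal_xpows[OF B i(3)] mem_Collect_eq by (elim conjE) (erule spec)
      ultimately obtain l where "l \<in> set js" "L \<le> eadd \<nu> (eunit L i) l" using za by auto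
      then show ?thesis using i(2) by (intro bexI[of _ l]) (auto simp: eunit_def split: if_splits)
    qed
    then show ?thesis unfolding genideal_xpows[OF B i(3)] using z(1) by blast
  qed
  then show ?case using Cons by (simp add: xpows_def)
qed (simp add: xpows_def)

text \<open>The exchange theorem compares \<open>gs\<close> with powers of the \<open>n\<close>
  variables, which are regular and lie in the ideal of \<open>gs\<close>. Nilpotent constant terms
  supply adic completeness for every element of \<open>gs\<close>.\<close>

theorem power_series_sop_regular:
  assumes B: "subring B R" and gs: "set gs \<subseteq> vals B n" "length gs = n"
    and nil: "\<And>g. g \<in> set gs \<Longrightarrow> \<exists>N::nat. g ezero [^] N = \<zero>"
    and sop: "\<And>i. i < n \<Longrightarrow> \<exists>L. pmono (eunit L i) \<in> genideal (PSB B n) (set gs)"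
  shows "weakly_regular (PSB B n) gs"
proof -
  interpret Q: cring "PSB B n" by (rule cring_psb[OF B])
  have gsc: "set gs \<subseteq> carrier (PSB B n)" using gs by simp
  from sop obtain L where L: "\<And>i. i < n \<Longrightarrow> pmono (eunit (L i) i) \<in> genideal (PSB B n) (set gs)" by metis
  \<comment> \<open>One exponent valid for all variables; inserting \<open>0\<close> covers the case
    of no variables.\<close>
  define M where "M = Max (insert 0 (L ` {..<n}))"
  have LM: "L i \<le> M" if "i < n" for i unfolding M_def by (rule Max_ge) (use that in auto)
  have "set (xpows M [0..<n]) \<subseteq> genideal (PSB B n) (set gs)"
  proof
    fix x assume "x \<in> set (xpows M [0..<n])"
    then obtain i where i: "i < n" "x = pmono (eunit M i)" by (auto simp: xpows_def)
    have "eunit M i = eadd (eunit (M - L i) i) (eunit (L i) i)" using LM[OF i(1)] by (auto simp: eunit_def fun_eq_iff)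
    then have "x = pmono (eunit (M - L i) i) \<otimes>[n] pmono (eunit (L i) i)"
      using mono_mono[of "eunit (M - L i) i" n "eunit (L i) i"] i by simp
    then show "x \<in> genideal (PSB B n) (set gs)"
      using ideal.I_l_closed[OF Q.genideal_ideal[OF gsc] L[OF i(1)], of "pmono (eunit (M - L i) i)"] B i by simp
  qed
  moreover have "\<forall>g\<in>set gs. adically_complete (PSB B n) g"
  proof
    fix g assume g: "g \<in> set gs"
    then obtain N :: nat where "g ezero [^] N = \<zero>" using nil by blast
    moreover have "g ezero \<in> carrier R" using g gs vals_carr ps_coeff_closed by blast
    ultimately have "g ezero [^] (Suc N) = \<zero>" by simp
    then show "adically_complete (PSB B n) g" by (intro adically_complete_psb[OF B]) (use g gs in auto)
  qed
  ultimately show ?thesis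
    using Q.weakly_regular_exchange[OF gsc _ weakly_regular_xpows[OF B, of "[0..<n]" n M]] gs(2)
    by (simp add: xpows_def atLeast_upt)
qed

end

section \<open>Substitution into power series\<close>

primrec wpow :: "('x, 'y) ring_scheme \<Rightarrow> (nat \<Rightarrow> 'x) \<Rightarrow> nat \<Rightarrow> (nat \<Rightarrow> nat) \<Rightarrow> 'x" where
  "wpow S w 0 \<beta> = \<one>\<^bsub>S\<^esub>"
| "wpow S w (Suc k) \<beta> = wpow S w k \<beta> \<otimes>\<^bsub>S\<^esub> w k [^]\<^bsub>S\<^esub> \<beta> k"

text \<open>The homogeneous part of degree \<open>d\<close> of a series evaluated at
  \<open>w\<close>. The coefficients \<open>y\<close> are arbitrary ring elements, not just
  constants, because the division in \<open>power_series_finite\<close> produces coefficients that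
  are themselves power series.\<close>

definition hs :: "('x, 'y) ring_scheme \<Rightarrow> (nat \<Rightarrow> 'x) \<Rightarrow> nat \<Rightarrow> nat \<Rightarrow> ((nat \<Rightarrow> nat) \<Rightarrow> 'x) \<Rightarrow> 'x" where
  "hs S w k d y = (\<Oplus>\<^bsub>S\<^esub>\<mu>\<in>homog_exps k d. wpow S w k \<mu> \<otimes>\<^bsub>S\<^esub> y \<mu>)"

lemma homog_0: "homog_exps k 0 = {ezero}"
  by (auto simp: homog_exps_def edeg_0_iff)

lemma homog_shift:
  assumes j: "j < k"
  shows "(\<lambda>\<mu>. eadd \<mu> (eunit 1 j)) ` homog_exps k d = {\<mu> \<in> homog_exps k (Suc d). \<mu> j > 0}"
proof (intro equalityI subsetI)
  fix x assume "x \<in> (\<lambda>\<mu>. eadd \<mu> (eunit 1 j)) ` homog_exps k d"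
  then obtain \<mu> where g: "x = eadd \<mu> (eunit 1 j)" "\<mu> \<in> mexps k" "edeg k \<mu> = d" by (auto simp: homog_exps_def)
  have "x \<in> mexps k" unfolding g(1) by (rule eadd_mexps[OF g(2) eunit_mexps[OF j]])
  moreover have "edeg k x = Suc d" unfolding g(1) edeg_eadd using g(3) j by simp
  moreover have "x j > 0" unfolding g(1) by (simp add: eunit_def)
  ultimately show "x \<in> {\<mu> \<in> homog_exps k (Suc d). \<mu> j > 0}" by (simp add: homog_exps_def)
next
  fix x assume x: "x \<in> {\<mu> \<in> homog_exps k (Suc d). \<mu> j > 0}"
  have e: "x = eadd (esub x (eunit 1 j)) (eunit 1 j)" using x by (auto simp: fun_eq_iff eunit_def)
  have "edeg k x = edeg k (esub x (eunit 1 j)) + 1"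
    using edeg_eadd[of k "esub x (eunit 1 j)" "eunit 1 j"] j unfolding e[symmetric] by simp
  then have "esub x (eunit 1 j) \<in> homog_exps k d" using x by (simp add: homog_exps_def)
  then show "x \<in> (\<lambda>\<mu>. eadd \<mu> (eunit 1 j)) ` homog_exps k d" by (rule rev_image_eqI) (rule e)
qed

context cring
begin

declare ps_add [simp del] ps_zero [simp del]

context
  fixes w :: "nat \<Rightarrow> 'a" and k :: nat
  assumes w: "\<And>j. j < k \<Longrightarrow> w j \<in> carrier R"
begin

lemma wpow_closed: "i \<le> k \<Longrightarrow> wpow R w i \<beta> \<in> carrier R"
  by (induction i) (auto simp: w)

lemma wpow_cong: "(\<And>j. j < i \<Longrightarrow> \<beta> j = \<mu> j) \<Longrightarrow> wpow R w i \<beta> = wpow R w i \<mu>"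
  by (induction i) auto

lemma wpow_ezero: "wpow R w i ezero = \<one>"
  by (induction i) auto

lemma wpow_eunit: "i \<le> k \<Longrightarrow> j < i \<Longrightarrow> wpow R w i (eadd \<beta> (eunit 1 j)) = w j \<otimes> wpow R w i \<beta>"
proof (induction i)
  case (Suc i)
  have c: "wpow R w i \<beta> \<in> carrier R" "w i \<in> carrier R" "w j \<in> carrier R"
    using Suc.prems w wpow_closed by auto
  show ?case
  proof (cases "j = i")
    case True
    have "wpow R w i (eadd \<beta> (eunit 1 i)) = wpow R w i \<beta>"
      by (rule wpow_cong) (simp add: eunit_def)
    then show ?thesis using c True by (simp add: eunit_def m_ac)
  next
    case False
    then show ?thesis using Suc c by (simp add: eunit_def m_ac)
  qed
qed simp

lemma hs_closed: "(\<And>\<mu>. y \<mu> \<in> carrier R) \<Longrightarrow> hs R w k d y \<in> carrier R"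
  unfolding hs_def by (rule finsum_closed) (use wpow_closed[OF order_refl] in auto)

lemma hs_cong:
  assumes "\<And>\<mu>. \<mu> \<in> homog_exps k d \<Longrightarrow> y \<mu> = z \<mu>" "\<And>\<mu>. y \<mu> \<in> carrier R" "\<And>\<mu>. z \<mu> \<in> carrier R"
  shows "hs R w k d y = hs R w k d z"
  unfolding hs_def by (rule finsum_cong') (use assms wpow_closed[OF order_refl] in auto)

lemma hs_add:
  assumes "\<And>\<mu>. y \<mu> \<in> carrier R" "\<And>\<mu>. z \<mu> \<in> carrier R"
  shows "hs R w k d (\<lambda>\<mu>. y \<mu> \<oplus> z \<mu>) = hs R w k d y \<oplus> hs R w k d z"
proof -
  have "hs R w k d (\<lambda>\<mu>. y \<mu> \<oplus> z \<mu>) = (\<Oplus>\<mu>\<in>homog_exps k d. wpow R w k \<mu> \<otimes> y \<mu> \<oplus> wpow R w k \<mu> \<otimes> z \<mu>)"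
    unfolding hs_def by (rule finsum_cong') (use assms wpow_closed[OF order_refl] in \<open>auto simp: r_distr\<close>)
  also have "\<dots> = hs R w k d y \<oplus> hs R w k d z"
    unfolding hs_def by (rule finsum_addf) (use assms wpow_closed[OF order_refl] in auto)
  finally show ?thesis .
qed

lemma hs_smult:
  assumes "\<And>\<mu>. y \<mu> \<in> carrier R" "c \<in> carrier R"
  shows "c \<otimes> hs R w k d y = hs R w k d (\<lambda>\<mu>. c \<otimes> y \<mu>)"
proof -
  have "c \<otimes> hs R w k d y = (\<Oplus>\<mu>\<in>homog_exps k d. c \<otimes> (wpow R w k \<mu> \<otimes> y \<mu>))"
    unfolding hs_def by (rule finsum_rdistr) (use assms wpow_closed[OF order_refl] in auto)
  also have "\<dots> = hs R w k d (\<lambda>\<mu>. c \<otimes> y \<mu>)"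
    unfolding hs_def by (rule finsum_cong') (use assms wpow_closed[OF order_refl] in \<open>auto simp: m_lcomm\<close>)
  finally show ?thesis .
qed

lemma hs_zero: "(\<And>\<mu>. \<mu> \<in> homog_exps k d \<Longrightarrow> y \<mu> = \<zero>) \<Longrightarrow> hs R w k d y = \<zero>"
  unfolding hs_def by (rule add.finprod_one_eqI) (use wpow_closed[OF order_refl] in auto)

lemma hs_0: "y ezero \<in> carrier R \<Longrightarrow> hs R w k 0 y = y ezero"
  unfolding hs_def homog_0 by (simp add: wpow_ezero)

lemma hs_shift:
  assumes y: "\<And>\<mu>. y \<mu> \<in> carrier R" and j: "j < k"
  shows "w j \<otimes> hs R w k d y = hs R w k (Suc d) (\<lambda>\<mu>. if \<mu> j > 0 then y (esub \<mu> (eunit 1 j)) else \<zero>)"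
proof -
  let ?z = "\<lambda>\<mu>. if \<mu> j > 0 then y (esub \<mu> (eunit 1 j)) else \<zero>"
  let ?s = "\<lambda>\<mu>. eadd \<mu> (eunit 1 j)"
  have zc: "?z \<mu> \<in> carrier R" for \<mu> using y by simp
  note c = wpow_closed[OF order_refl]
  have "hs R w k (Suc d) ?z = (\<Oplus>\<mu>\<in>{\<mu> \<in> homog_exps k (Suc d). \<mu> j > 0}. wpow R w k \<mu> \<otimes> ?z \<mu>)"
    unfolding hs_def by (rule add.finprod_mono_neutral_cong_right) (use c zc in auto)
  also have "\<dots> = (\<Oplus>\<mu>\<in>homog_exps k d. wpow R w k (?s \<mu>) \<otimes> ?z (?s \<mu>))"
    unfolding homog_shift[OF j, symmetric]
  proof (rule add.finprod_reindex)
    show "inj_on ?s (homog_exps k d)" by (auto simp: inj_on_def fun_eq_iff)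
  qed (use c zc in auto)
  also have "\<dots> = (\<Oplus>\<mu>\<in>homog_exps k d. w j \<otimes> (wpow R w k \<mu> \<otimes> y \<mu>))"
  proof (rule finsum_cong')
    fix \<mu> assume "\<mu> \<in> homog_exps k d"
    have e: "esub (?s \<mu>) (eunit 1 j) = \<mu>" by (simp add: fun_eq_iff)
    have p: "?s \<mu> j > 0" by (simp add: eunit_def)
    show "wpow R w k (?s \<mu>) \<otimes> ?z (?s \<mu>) = w j \<otimes> (wpow R w k \<mu> \<otimes> y \<mu>)"
      unfolding wpow_eunit[OF order_refl j] e using p c[of \<mu>] w[OF j] y[of \<mu>] by (simp add: m_assoc)
  qed (use c w[OF j] y in auto)
  also have "\<dots> = w j \<otimes> hs R w k d y"
    unfolding hs_def by (rule finsum_rdistr[symmetric]) (use c w[OF j] y in auto)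
  finally show ?thesis by simp
qed

lemma hs_subring:
  assumes B: "subring B R" and wB: "\<And>j. j < k \<Longrightarrow> w j \<in> B" and y: "\<And>\<mu>. y \<mu> \<in> B"
  shows "hs R w k d y \<in> B"
proof -
  have "w j [^] (e::nat) \<in> B" if "j < k" for j e
    using wB[OF that] subringE(3,6)[OF B] by (induction e) auto
  then have "wpow R w i \<mu> \<in> B" if "i \<le> k" for i \<mu>
    using that subringE(3,6)[OF B] by (induction i) auto
  then show ?thesis unfolding hs_def using y subringE(6)[OF B] by (intro finsum_in_subring[OF B]) auto
qed

end

text \<open>Vanishing constant terms: the condition under which the homogeneous parts of a
  substitution have growing order and can be summed.\<close>

definition small :: "nat \<Rightarrow> (nat \<Rightarrow> (nat \<Rightarrow> nat) \<Rightarrow> 'a) \<Rightarrow> nat \<Rightarrow> bool" where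
  "small n w k \<longleftrightarrow> (\<forall>j<k. w j \<in> fil n 1)"

lemma smallD: "small n w k \<Longrightarrow> j < k \<Longrightarrow> w j \<in> fil n 1" by (simp add: small_def)

lemma small_carr: "small n w k \<Longrightarrow> j < k \<Longrightarrow> w j \<in> PSC n"
  using smallD fil_carr by blast

lemma wpow_fil: "small n w k \<Longrightarrow> i \<le> k \<Longrightarrow> wpow (PS n) w i \<beta> \<in> fil n (edeg i \<beta>)"
proof (induction i)
  case 0
  interpret P: cring "PS n" by (rule cring_ps)
  show ?case by (simp add: edeg_def)
next
  case (Suc i)
  have "w i [^][n] \<beta> i \<in> fil n (\<beta> i * 1)" by (rule fil_pow[OF smallD[OF Suc.prems(1)]]) (use Suc.prems in simp)
  from fil_mult[OF Suc.IH this] show ?case using Suc.prems by (simp add: edeg_def)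
qed

lemma finsum_fil:
  assumes "finite A" "\<And>x. x \<in> A \<Longrightarrow> F x \<in> fil n D" shows "(\<Oplus>\<^bsub>PS n\<^esub>x\<in>A. F x) \<in> fil n D"
  using assms
proof (induction A rule: finite_induct)
  case empty
  interpret P: cring "PS n" by (rule cring_ps)
  interpret I: ideal "fil n D" "PS n" by (rule fil_ideal)
  show ?case using I.zero_closed by simp
next
  case (insert a A)
  interpret P: cring "PS n" by (rule cring_ps)
  interpret I: ideal "fil n D" "PS n" by (rule fil_ideal)
  have "(\<Oplus>\<^bsub>PS n\<^esub>x\<in>insert a A. F x) = F a \<oplus>[n] (\<Oplus>\<^bsub>PS n\<^esub>x\<in>A. F x)"
    by (rule P.add.finprod_insert) (use insert fil_carr in auto)
  then show ?case using insert I.a_closed by simp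
qed

lemma hs_fil:
  assumes "small n w k" "\<And>\<mu>. y \<mu> \<in> PSC n" shows "hs (PS n) w k d y \<in> fil n d"
  unfolding hs_def
proof (rule finsum_fil)
  fix \<mu> assume "\<mu> \<in> homog_exps k d"
  then have "edeg k \<mu> = d" by (simp add: homog_exps_def)
  then show "wpow (PS n) w k \<mu> \<otimes>[n] y \<mu> \<in> fil n d"
    using fil_mult[OF wpow_fil[OF assms(1) order_refl, of \<mu>], of "y \<mu>" 0] assms(2) by simp
qed simp

text \<open>Evaluation with series as coefficients, grouped by degree. Constant coefficients give
  the substitution homomorphism \<open>ev\<close>.\<close>

definition esum :: "nat \<Rightarrow> (nat \<Rightarrow> (nat \<Rightarrow> nat) \<Rightarrow> 'a) \<Rightarrow> nat \<Rightarrow> ((nat \<Rightarrow> nat) \<Rightarrow> (nat \<Rightarrow> nat) \<Rightarrow> 'a) \<Rightarrow> (nat \<Rightarrow> nat) \<Rightarrow> 'a" where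
  "esum n w k y = isum n (\<lambda>d. hs (PS n) w k d y)"

definition ev :: "nat \<Rightarrow> (nat \<Rightarrow> (nat \<Rightarrow> nat) \<Rightarrow> 'a) \<Rightarrow> nat \<Rightarrow> ((nat \<Rightarrow> nat) \<Rightarrow> 'a) \<Rightarrow> (nat \<Rightarrow> nat) \<Rightarrow> 'a" where
  "ev n w k s = esum n w k (\<lambda>\<mu>. pconst (s \<mu>))"

context
  fixes n w k
  assumes sm: "small n w k"
begin

interpretation P: cring "PS n" by (rule cring_ps)

lemma wc: "j < k \<Longrightarrow> w j \<in> PSC n" by (rule small_carr[OF sm])

lemma convergent_hs:
  assumes "\<And>\<mu>. y \<mu> \<in> PSC n" shows "convergent n (\<lambda>d. hs (PS n) w k d y)"
  unfolding convergent_def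
proof (intro conjI allI)
  show "hs (PS n) w k d y \<in> PSC n" for d by (rule P.hs_closed[OF wc]) (use assms in auto)
  show "\<exists>T. \<forall>d\<ge>T. hs (PS n) w k d y \<in> fil n D" for D
    by (intro exI[of _ D] allI impI) (erule fil_anti[OF _ hs_fil[where y = y, OF sm assms]])
qed

lemma esum_closed: "(\<And>\<mu>. y \<mu> \<in> PSC n) \<Longrightarrow> esum n w k y \<in> PSC n"
  unfolding esum_def by (rule isum_closed[OF convergent_hs])

lemma esum_cong:
  assumes "\<And>\<mu>. \<mu> \<in> mexps k \<Longrightarrow> y \<mu> = z \<mu>" "\<And>\<mu>. y \<mu> \<in> PSC n" "\<And>\<mu>. z \<mu> \<in> PSC n"
  shows "esum n w k y = esum n w k z"
proof -
  have "hs (PS n) w k d y = hs (PS n) w k d z" for d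
    by (rule P.hs_cong[OF wc]) (use assms in \<open>auto simp: homog_exps_def\<close>)
  then show ?thesis unfolding esum_def by simp
qed

lemma esum_add:
  assumes "\<And>\<mu>. y \<mu> \<in> PSC n" "\<And>\<mu>. z \<mu> \<in> PSC n"
  shows "esum n w k (\<lambda>\<mu>. y \<mu> \<oplus>[n] z \<mu>) = esum n w k y \<oplus>[n] esum n w k z"
proof -
  have "hs (PS n) w k d (\<lambda>\<mu>. y \<mu> \<oplus>[n] z \<mu>) = hs (PS n) w k d y \<oplus>[n] hs (PS n) w k d z" for d
    by (rule P.hs_add[OF wc assms])
  then show ?thesis unfolding esum_def using isum_add[OF convergent_hs[OF assms(1)] convergent_hs[OF assms(2)]]
    by simp
qed

lemma esum_smult:
  assumes "\<And>\<mu>. y \<mu> \<in> PSC n" "c \<in> PSC n"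
  shows "c \<otimes>[n] esum n w k y = esum n w k (\<lambda>\<mu>. c \<otimes>[n] y \<mu>)"
proof -
  have "c \<otimes>[n] hs (PS n) w k d y = hs (PS n) w k d (\<lambda>\<mu>. c \<otimes>[n] y \<mu>)" for d
    by (rule P.hs_smult[OF wc assms])
  then show ?thesis unfolding esum_def using isum_mult[OF convergent_hs[OF assms(1)] assms(2)] by simp
qed

lemma esum_shift:
  assumes y: "\<And>\<mu>. y \<mu> \<in> PSC n" and j: "j < k"
  shows "w j \<otimes>[n] esum n w k y = esum n w k (\<lambda>\<mu>. if \<mu> j > 0 then y (esub \<mu> (eunit 1 j)) else \<zero>[n])"
proof -
  let ?z = "\<lambda>\<mu>. if \<mu> j > 0 then y (esub \<mu> (eunit 1 j)) else \<zero>[n]"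
  have zc: "?z \<mu> \<in> PSC n" for \<mu> using y by simp
  have "esum n w k ?z = hs (PS n) w k 0 ?z \<oplus>[n] isum n (\<lambda>d. hs (PS n) w k (Suc d) ?z)"
    unfolding esum_def by (rule isum_Suc[OF convergent_hs[OF zc]])
  also have "hs (PS n) w k 0 ?z = \<zero>[n]" by (rule P.hs_zero[OF wc]) (simp_all add: homog_0)
  also have "(\<lambda>d. hs (PS n) w k (Suc d) ?z) = (\<lambda>d. w j \<otimes>[n] hs (PS n) w k d y)"
    using P.hs_shift[where w = w and k = k and y = y and j = j, OF wc y j] by simp
  also have "isum n \<dots> = w j \<otimes>[n] esum n w k y"
    unfolding esum_def by (rule isum_mult[OF convergent_hs[OF y] wc[OF j], symmetric])
  finally show ?thesis using esum_closed[OF y] wc[OF j] by simp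
qed

lemma esum_fil:
  assumes y: "\<And>\<mu>. y \<mu> \<in> PSC n" and z: "\<And>\<mu>. edeg k \<mu> < T \<Longrightarrow> y \<mu> = \<zero>[n]"
  shows "esum n w k y \<in> fil n T"
proof -
  have z: "hs (PS n) w k d y = \<zero>[n]" if "d < T" for d
    by (rule P.hs_zero[OF wc]) (use z that in \<open>auto simp: homog_exps_def\<close>)
  have "sumr (PS n) (\<lambda>d. hs (PS n) w k d y) i = \<zero>[n]" if "i \<le> T" for i
    using that z by (induction i) auto
  then have e: "sumr (PS n) (\<lambda>d. hs (PS n) w k d y) T = \<zero>[n]" by simp
  have "isum n (\<lambda>d. hs (PS n) w k d y) \<ominus>[n] sumr (PS n) (\<lambda>d. hs (PS n) w k d y) T \<in> fil n T"
    by (rule isum_approx[OF convergent_hs[OF y]]) (erule fil_anti[OF _ hs_fil[where y = y, OF sm y]])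
  then show ?thesis using esum_closed[OF y] unfolding e esum_def by (simp add: P.minus_eq)
qed

lemma esum_const: "c \<in> PSC n \<Longrightarrow> esum n w k (\<lambda>\<mu>. if \<mu> = ezero then c else \<zero>[n]) = c"
proof -
  assume c: "c \<in> PSC n"
  let ?y = "\<lambda>\<mu>. if \<mu> = ezero then c else \<zero>[n]"
  have yc: "?y \<mu> \<in> PSC n" for \<mu> using c by simp
  have "esum n w k ?y = hs (PS n) w k 0 ?y \<oplus>[n] isum n (\<lambda>d. hs (PS n) w k (Suc d) ?y)"
    unfolding esum_def by (rule isum_Suc[OF convergent_hs[OF yc]])
  also have "hs (PS n) w k 0 ?y = c" using P.hs_0[of k w ?y] wc c by simp
  also have "(\<lambda>d. hs (PS n) w k (Suc d) ?y) = (\<lambda>d. \<zero>[n])"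
  proof
    fix d show "hs (PS n) w k (Suc d) ?y = \<zero>[n]"
      by (rule P.hs_zero[OF wc]) (auto simp: homog_exps_def)
  qed
  also have "isum n (\<lambda>d. \<zero>[n]) = \<zero>[n]"
  proof (rule isum_unique[symmetric])
    have f: "\<zero>[n] \<in> fil n D" for D by (simp add: fil_def ps_zero)
    show "convergent n (\<lambda>d. \<zero>[n])" unfolding convergent_def using f by auto
    have "sumr (PS n) (\<lambda>d. \<zero>[n]) T = \<zero>[n]" for T by (induction T) auto
    then show "\<exists>T0. \<forall>T\<ge>T0. \<zero>[n] \<ominus>[n] sumr (PS n) (\<lambda>d. \<zero>[n]) T \<in> fil n D" for D
      using f by (simp add: P.minus_eq)
  qed simp
  finally show ?thesis using c by simp
qed

lemma pconst_coeff: assumes "s \<in> PSC k" shows "pconst (s \<mu>) \<in> PSC n"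
  by (rule const_closed[OF ps_coeff_closed[OF assms]])

lemma ev_closed: assumes "s \<in> PSC k" shows "ev n w k s \<in> PSC n"
  unfolding ev_def by (rule esum_closed[where y = "\<lambda>\<mu>. pconst (s \<mu>)", OF pconst_coeff[OF assms]])

lemma ev_add:
  assumes "s \<in> PSC k" "t \<in> PSC k"
  shows "ev n w k (s \<oplus>[k] t) = ev n w k s \<oplus>[n] ev n w k t"
proof -
  interpret h: ring_hom_cring R "PS n" pconst by (rule const_hom)
  have "(\<lambda>\<mu>. pconst ((s \<oplus>[k] t) \<mu>)) = (\<lambda>\<mu>. pconst (s \<mu>) \<oplus>[n] pconst (t \<mu>))"
  proof
    fix \<mu> show "pconst ((s \<oplus>[k] t) \<mu>) = pconst (s \<mu>) \<oplus>[n] pconst (t \<mu>)"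
      using h.hom_add[OF ps_coeff_closed[OF assms(1), of \<mu>] ps_coeff_closed[OF assms(2), of \<mu>]] ps_add[of k s t \<mu>] by simp
  qed
  then show ?thesis unfolding ev_def using esum_add[where y = "\<lambda>\<mu>. pconst (s \<mu>)" and z = "\<lambda>\<mu>. pconst (t \<mu>)", OF pconst_coeff[OF assms(1)] pconst_coeff[OF assms(2)]] by simp
qed

lemma ev_const_mult:
  assumes "s \<in> PSC k" "c \<in> carrier R"
  shows "ev n w k (pconst c \<otimes>[k] s) = pconst c \<otimes>[n] ev n w k s"
proof -
  interpret h: ring_hom_cring R "PS n" pconst by (rule const_hom)
  have "(\<lambda>\<mu>. pconst ((pconst c \<otimes>[k] s) \<mu>)) = (\<lambda>\<mu>. pconst c \<otimes>[n] pconst (s \<mu>))"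
  proof
    fix \<mu> show "pconst ((pconst c \<otimes>[k] s) \<mu>) = pconst c \<otimes>[n] pconst (s \<mu>)"
      unfolding const_mult[OF assms(2,1)] by (rule h.hom_mult[OF assms(2) ps_coeff_closed[OF assms(1)]])
  qed
  then show ?thesis unfolding ev_def using esum_smult[where y = "\<lambda>\<mu>. pconst (s \<mu>)" and c = "pconst c", OF pconst_coeff[OF assms(1)]] assms(2) by simp
qed

lemma ev_var_mult:
  assumes s: "s \<in> PSC k" and j: "j < k"
  shows "ev n w k (pmono (eunit 1 j) \<otimes>[k] s) = w j \<otimes>[n] ev n w k s"
proof -
  have "(\<lambda>\<mu>. pconst ((pmono (eunit 1 j) \<otimes>[k] s) \<mu>)) = (\<lambda>\<mu>. if \<mu> j > 0 then pconst (s (esub \<mu> (eunit 1 j))) else \<zero>[n])"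
  proof
    fix \<mu>
    have "eunit 1 j \<in> below \<mu> \<longleftrightarrow> \<mu> j > 0" by (auto simp: below_def eunit_def Suc_le_eq)
    then show "pconst ((pmono (eunit 1 j) \<otimes>[k] s) \<mu>) = (if \<mu> j > 0 then pconst (s (esub \<mu> (eunit 1 j))) else \<zero>[n])"
      unfolding mono_mult[OF eunit_mexps[OF j] s] by (simp add: const_zero[where n = n])
  qed
  then show ?thesis unfolding ev_def using esum_shift[where y = "\<lambda>\<mu>. pconst (s \<mu>)", OF pconst_coeff[OF s] j] by simp
qed

lemma ev_pmono_ezero: "ev n w k (pmono ezero) = \<one>[n]"
proof -
  have "(\<lambda>\<mu>. pconst (pmono ezero \<mu>)) = (\<lambda>\<mu>. if \<mu> = ezero then \<one>[n] else \<zero>[n])"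
    by (auto simp: pmono_def const_one[where n = n] const_zero[where n = n] fun_eq_iff)
  then show ?thesis unfolding ev_def using esum_const[of "\<one>[n]"] by simp
qed

lemma ev_fil: assumes s: "s \<in> fil k T" shows "ev n w k s \<in> fil n T"
  unfolding ev_def
proof (rule esum_fil[where y = "\<lambda>\<mu>. pconst (s \<mu>)", OF pconst_coeff[OF fil_carr[OF s]]])
  fix \<mu> assume "edeg k \<mu> < T"
  then show "pconst (s \<mu>) = \<zero>[n]" using fil_coeff[OF s] by (simp add: const_zero[where n = n])
qed

text \<open>Multiplicativity of substitution for a monomial factor, by peeling off one variable at a
  time with \<open>ev_var_mult\<close>. Additivity extends it to polynomial factors in
  \<open>ev_mult_finite\<close>, and truncation to all series in \<open>ev_mult\<close>.\<close>

lemma ev_mult_pmono: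
  "\<beta> \<in> mexps k \<Longrightarrow> t \<in> PSC k \<Longrightarrow> ev n w k (pmono \<beta> \<otimes>[k] t) = ev n w k (pmono \<beta>) \<otimes>[n] ev n w k t"
proof (induction "edeg k \<beta>" arbitrary: \<beta> t)
  case 0
  interpret K: cring "PS k" by (rule cring_ps)
  have "\<beta> = ezero" using 0 edeg_0_iff by simp
  then show ?case using ev_pmono_ezero ev_closed[OF 0(3)] 0(3) by (simp add: mono_ezero[where n = k])
next
  case (Suc d)
  interpret K: cring "PS k" by (rule cring_ps)
  have "\<exists>j<k. \<beta> j > 0"
  proof (rule ccontr)
    assume "\<not> ?thesis"
    then have "edeg k \<beta> = 0" by (auto simp: edeg_def)
    then show False using Suc by simp
  qed
  then obtain j where j: "j < k" "\<beta> j > 0" by blast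
  have "\<beta> \<in> homog_exps k (Suc d)" using Suc by (simp add: homog_exps_def)
  then obtain \<mu> where g: "\<beta> = eadd \<mu> (eunit 1 j)" "\<mu> \<in> mexps k" "edeg k \<mu> = d"
    using homog_shift[OF j(1), of d] j(2) by (auto simp: homog_exps_def)
  have X: "pmono (eunit 1 j) \<in> PSC k" "pmono \<mu> \<in> PSC k" using j g by auto
  have b: "pmono \<beta> = pmono (eunit 1 j) \<otimes>[k] pmono \<mu>"
    using mono_mono[OF eunit_mexps[OF j(1)] g(2), of 1] g(1) by (simp add: add.commute)
  have IH: "ev n w k (pmono \<mu> \<otimes>[k] t) = ev n w k (pmono \<mu>) \<otimes>[n] ev n w k t"
    using Suc.hyps(1)[of \<mu> t] g Suc.prems by simp
  show ?case
    unfolding b K.m_assoc[OF X Suc.prems(2)]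
    using ev_var_mult[OF X(2) j(1)] ev_var_mult[of "pmono \<mu> \<otimes>[k] t", OF _ j(1)] IH X Suc.prems(2)
      wc[OF j(1)] ev_closed[OF X(2)] ev_closed[OF Suc.prems(2)] by (simp add: P.m_assoc)
qed

lemma ev_mult_finite:
  assumes "finite A" "A \<subseteq> mexps k" "f \<in> PSC k" "\<And>\<nu>. \<nu> \<notin> A \<Longrightarrow> f \<nu> = \<zero>" and t: "t \<in> PSC k"
  shows "ev n w k (f \<otimes>[k] t) = ev n w k f \<otimes>[n] ev n w k t"
  using assms(1-4)
proof (induction A arbitrary: f rule: finite_induct)
  case empty
  interpret K: cring "PS k" by (rule cring_ps)
  have f: "f = \<zero>[k]" using empty by (auto simp: fun_eq_iff ps_zero)
  have "\<zero>[k] \<in> fil k D" for D by (simp add: fil_def ps_zero)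
  then have "ev n w k \<zero>[k] = \<zero>[n]" by (intro fil_Inter ev_fil)
  then show ?case using f t ev_closed[OF t] by simp
next
  case (insert a A)
  interpret K: cring "PS k" by (rule cring_ps)
  let ?g = "\<lambda>\<nu>. if \<nu> = a then \<zero> else f \<nu>"
  let ?m = "pconst (f a) \<otimes>[k] pmono a"
  have a: "a \<in> mexps k" using insert by simp
  have fa: "f a \<in> carrier R" by (rule ps_coeff_closed[OF insert(5)])
  have gc: "?g \<in> PSC k" using insert(5) by (auto simp: ps_carrier_iff)
  have ma: "pmono a \<in> PSC k" "pconst (f a) \<in> PSC k" using a fa by auto
  have mc: "?m \<in> PSC k" using ma by simp
  have f: "f = ?m \<oplus>[k] ?g"
  proof
    fix \<nu>
    have "f \<nu> \<in> carrier R" by (rule ps_coeff_closed[OF insert(5)])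
    with fa show "f \<nu> = (?m \<oplus>[k] ?g) \<nu>"
      unfolding ps_add const_mult[OF fa ma(1)] by (simp add: pmono_def)
  qed
  have IH: "ev n w k (?g \<otimes>[k] t) = ev n w k ?g \<otimes>[n] ev n w k t"
    by (rule insert.IH) (use insert.prems gc in auto)
  have "ev n w k (?m \<otimes>[k] t) = pconst (f a) \<otimes>[n] (ev n w k (pmono a) \<otimes>[n] ev n w k t)"
    unfolding K.m_assoc[OF ma(2,1) t] using ev_const_mult[OF _ fa, of "pmono a \<otimes>[k] t"] ma t ev_mult_pmono[OF a t] by simp
  also have "\<dots> = ev n w k ?m \<otimes>[n] ev n w k t"
    using ev_const_mult[OF ma(1) fa] ev_closed[OF ma(1)] ev_closed[OF t] const_closed[OF fa] by (simp add: P.m_assoc)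
  finally have M: "ev n w k (?m \<otimes>[k] t) = ev n w k ?m \<otimes>[n] ev n w k t" .
  have "ev n w k ((?m \<oplus>[k] ?g) \<otimes>[k] t) = ev n w k (?m \<oplus>[k] ?g) \<otimes>[n] ev n w k t"
    unfolding K.l_distr[OF mc gc t] ev_add[OF K.m_closed[OF mc t] K.m_closed[OF gc t]] ev_add[OF mc gc] M IH
    by (rule P.l_distr[symmetric]) (use ev_closed mc gc t in auto)
  then show ?case unfolding f[symmetric] .
qed

text \<open>Truncate \<open>s\<close> at degree \<open>D\<close>. The polynomial part is treated by
  \<open>ev_mult_finite\<close>, and both terms coming from the remainder have order at least
  \<open>D\<close>; since \<open>D\<close> is arbitrary, the difference is zero.\<close>

lemma ev_mult:
  assumes s: "s \<in> PSC k" and t: "t \<in> PSC k"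
  shows "ev n w k (s \<otimes>[k] t) = ev n w k s \<otimes>[n] ev n w k t"
proof -
  interpret K: cring "PS k" by (rule cring_ps)
  note cl = ev_closed[OF K.m_closed[OF s t]] ev_closed[OF s] ev_closed[OF t]
  have "ev n w k (s \<otimes>[k] t) \<ominus>[n] ev n w k s \<otimes>[n] ev n w k t \<in> fil n D" for D
  proof -
    let ?p = "\<lambda>\<nu>. if edeg k \<nu> < D then s \<nu> else \<zero>" and ?r = "\<lambda>\<nu>. if edeg k \<nu> < D then \<zero> else s \<nu>"
    have pc: "?p \<in> PSC k" using s by (auto simp: ps_carrier_iff)
    have rc: "?r \<in> PSC k" using s by (auto simp: ps_carrier_iff)
    have rf: "?r \<in> fil k D" using rc by (simp add: fil_def)
    have sp: "s = ?p \<oplus>[k] ?r"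
    proof
      fix \<nu> show "s \<nu> = (?p \<oplus>[k] ?r) \<nu>" unfolding ps_add using ps_coeff_closed[OF s, of \<nu>] by simp
    qed
    have "finite {\<beta> \<in> mexps k. edeg k \<beta> < D}"
      by (rule finite_subset[OF _ finite_bounded_exps[of k D]]) (auto dest: le_edeg[of _ k] intro: le_trans less_imp_le)
    then have pm: "ev n w k (?p \<otimes>[k] t) = ev n w k ?p \<otimes>[n] ev n w k t"
      by (rule ev_mult_finite[OF _ _ pc _ t]) (use ps_outside[OF s] in auto)
    have rt: "?r \<otimes>[k] t \<in> fil k D" by (rule ideal.I_r_closed[OF fil_ideal rf t])
    have e1: "ev n w k (s \<otimes>[k] t) = ev n w k ?p \<otimes>[n] ev n w k t \<oplus>[n] ev n w k (?r \<otimes>[k] t)"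
    proof -
      have "s \<otimes>[k] t = ?p \<otimes>[k] t \<oplus>[k] ?r \<otimes>[k] t"
        using K.l_distr[OF pc rc t] sp by simp
      then show ?thesis using ev_add[OF K.m_closed[OF pc t] K.m_closed[OF rc t]] pm by simp
    qed
    have e2: "ev n w k s \<otimes>[n] ev n w k t = ev n w k ?p \<otimes>[n] ev n w k t \<oplus>[n] ev n w k ?r \<otimes>[n] ev n w k t"
    proof -
      have "ev n w k s = ev n w k ?p \<oplus>[n] ev n w k ?r" using ev_add[OF pc rc] sp by simp
      then show ?thesis using P.l_distr[OF ev_closed[OF pc] ev_closed[OF rc] cl(3)] by simp
    qed
    have g: "(a \<oplus>[n] b) \<ominus>[n] (a \<oplus>[n] c) = b \<ominus>[n] c"
      if "a \<in> PSC n" "b \<in> PSC n" "c \<in> PSC n" for a b c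
    proof -
      have "(a \<oplus>[n] b) \<oplus>[n] (\<ominus>[n] a \<oplus>[n] \<ominus>[n] c) = (b \<oplus>[n] \<ominus>[n] c) \<oplus>[n] (\<ominus>[n] a \<oplus>[n] a)"
        using that by (simp add: P.a_ac)
      then show ?thesis using that by (simp add: P.minus_eq P.minus_add P.l_neg)
    qed
    have "ev n w k (s \<otimes>[k] t) \<ominus>[n] ev n w k s \<otimes>[n] ev n w k t
       = ev n w k (?r \<otimes>[k] t) \<ominus>[n] ev n w k ?r \<otimes>[n] ev n w k t"
      unfolding e1 e2 by (rule g) (use ev_closed pc rc t in auto)
    moreover have "ev n w k (?r \<otimes>[k] t) \<in> fil n D" by (rule ev_fil[OF rt])
    moreover have "ev n w k ?r \<otimes>[n] ev n w k t \<in> fil n D" by (rule ideal.I_r_closed[OF fil_ideal ev_fil[OF rf] cl(3)])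
    ultimately show ?thesis using P.ideal_minus[OF fil_ideal] by simp
  qed
  then have "ev n w k (s \<otimes>[k] t) \<ominus>[n] ev n w k s \<otimes>[n] ev n w k t = \<zero>[n]" by (rule fil_Inter)
  then show ?thesis using P.diff_add_cancel_cring[OF cl(1) P.m_closed[OF cl(2,3)]] P.l_zero[OF P.m_closed[OF cl(2,3)]] by simp
qed

lemma ev_hom: "ring_hom_cring (PS k) (PS n) (ev n w k)"
proof (intro ring_hom_cring.intro cring_ps ring_hom_cring_axioms.intro ring_hom_memI)
  show "ev n w k \<one>[k] = \<one>[n]" using ev_pmono_ezero by (simp add: mono_ezero[where n = k])
qed (simp_all add: ev_closed ev_add ev_mult)

lemma ev_vals:
  assumes B: "subring B R" and wB: "\<And>j. j < k \<Longrightarrow> w j \<in> vals B n" and s: "s \<in> vals B k"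
  shows "ev n w k s \<in> vals B n"
  unfolding ev_def esum_def
proof (rule isum_vals[OF B convergent_hs[where y = "\<lambda>\<mu>. pconst (s \<mu>)", OF pconst_coeff[OF vals_carr[OF s]]]])
  show "hs (PS n) w k d (\<lambda>\<mu>. pconst (s \<mu>)) \<in> vals B n" for d
    by (rule P.hs_subring[OF wc vals_subring[OF B]]) (use wB s pconst_vals[OF B] in \<open>auto simp: vals_def\<close>)
qed

lemma ev_var: "j < k \<Longrightarrow> ev n w k (pmono (eunit 1 j)) = w j"
  using ev_var_mult[of "pmono ezero" j] ev_pmono_ezero mono_mono[of "eunit 1 j" k ezero] wc by simp

end

end

section \<open>Congruence of substitutions and finiteness of the series ring over a
  substitution\<close>

context cring
begin

lemma sumr_add:
  assumes "\<And>i. i < r \<Longrightarrow> f i \<in> carrier R" "\<And>i. i < r \<Longrightarrow> g i \<in> carrier R"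
  shows "sumr R (\<lambda>i. f i \<oplus> g i) r = sumr R f r \<oplus> sumr R g r"
  using assms
proof (induction r)
  case (Suc r)
  have "sumr R f r \<in> carrier R" "sumr R g r \<in> carrier R" using Suc.prems by (auto intro!: sumr_closed')
  then show ?case using Suc by (simp add: a_ac)
qed simp

lemma sumr_mult:
  assumes "\<And>i. i < r \<Longrightarrow> f i \<in> carrier R" "c \<in> carrier R"
  shows "c \<otimes> sumr R f r = sumr R (\<lambda>i. c \<otimes> f i) r"
  using assms
proof (induction r)
  case (Suc r)
  have "sumr R f r \<in> carrier R" using Suc.prems by (auto intro!: sumr_closed')
  then show ?case using Suc by (simp add: r_distr)
qed simp

lemma sumr_cong: "(\<And>i. i < r \<Longrightarrow> f i = g i) \<Longrightarrow> sumr R f r = sumr R g r"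
  by (induction r) auto

lemma sumr_swap:
  assumes "\<And>i j. i < r \<Longrightarrow> j < s \<Longrightarrow> f i j \<in> carrier R"
  shows "sumr R (\<lambda>i. sumr R (f i) s) r = sumr R (\<lambda>j. sumr R (\<lambda>i. f i j) r) s"
  using assms
proof (induction r)
  case 0
  show ?case by (induction s) auto
next
  case (Suc r)
  have "sumr R (\<lambda>i. sumr R (f i) s) (Suc r) = sumr R (\<lambda>j. sumr R (\<lambda>i. f i j) r) s \<oplus> sumr R (f r) s"
    using Suc by simp
  also have "\<dots> = sumr R (\<lambda>j. sumr R (\<lambda>i. f i j) r \<oplus> f r j) s"
    by (rule sumr_add[symmetric]) (use Suc.prems in \<open>auto intro!: sumr_closed'\<close>)
  finally show ?case by simp
qed

lemma sumr_delta:
  assumes "x \<in> carrier R" "i < r" shows "sumr R (\<lambda>j. if j = i then x else \<zero>) r = x"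
proof -
  have z: "sumr R (\<lambda>j. if j = i then x else \<zero>) t = \<zero>" if "t \<le> i" for t using that by (induction t) auto
  have "sumr R (\<lambda>j. if j = i then x else \<zero>) r = sumr R (\<lambda>j. if j = i then x else \<zero>) (Suc i)"
    by (rule sumr_stable) (use assms in auto)
  then show ?thesis using z[of i] assms by simp
qed

lemma sumr_finsum:
  assumes "finite A" "\<And>i x. i < r \<Longrightarrow> x \<in> A \<Longrightarrow> f i x \<in> carrier R"
  shows "(\<Oplus>x\<in>A. sumr R (\<lambda>i. f i x) r) = sumr R (\<lambda>i. \<Oplus>x\<in>A. f i x) r"
  using assms(2)
proof (induction r)
  case (Suc r)
  have "(\<Oplus>x\<in>A. sumr R (\<lambda>i. f i x) r \<oplus> f r x) = (\<Oplus>x\<in>A. sumr R (\<lambda>i. f i x) r) \<oplus> (\<Oplus>x\<in>A. f r x)"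
    by (rule finsum_addf) (use Suc.prems in \<open>auto intro!: sumr_closed'\<close>)
  then show ?case using Suc by simp
qed simp

lemma sumr_subring:
  assumes "subring B R" "\<And>i. i < r \<Longrightarrow> f i \<in> B" shows "sumr R f r \<in> B"
  using assms(2) by (induction r) (auto simp: subringE(2)[OF assms(1)] subringE(7)[OF assms(1)])

lemma sumr_ideal:
  assumes "ideal J R" "\<And>i. i < r \<Longrightarrow> f i \<in> J" shows "sumr R f r \<in> J"
proof -
  interpret ideal J R by fact
  show ?thesis using assms(2) by (induction r) auto
qed

lemma convergent_zero: "convergent n (\<lambda>d. \<zero>[n])"
proof -
  interpret P: cring "PS n" by (rule cring_ps)
  have "\<zero>[n] \<in> fil n D" for D by (simp add: fil_def ps_zero)
  then show ?thesis unfolding convergent_def by auto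
qed

lemma isum_zero: "isum n (\<lambda>d. \<zero>[n]) = \<zero>[n]"
proof
  fix \<nu>
  interpret P: cring "PS n" by (rule cring_ps)
  have "\<zero>[n] \<in> fil n D" for D by (simp add: fil_def ps_zero)
  then show "isum n (\<lambda>d. \<zero>[n]) \<nu> = \<zero>[n] \<nu>" using isum_coeff[OF convergent_zero, of 0 n \<nu>] by simp
qed

lemma isum_sumr:
  assumes "\<And>j. j < r \<Longrightarrow> convergent n (u j)" "\<And>j. j < r \<Longrightarrow> D j \<in> PSC n"
  shows "convergent n (\<lambda>d. sumr (PS n) (\<lambda>j. D j \<otimes>[n] u j d) r) \<and>
    isum n (\<lambda>d. sumr (PS n) (\<lambda>j. D j \<otimes>[n] u j d) r) = sumr (PS n) (\<lambda>j. D j \<otimes>[n] isum n (u j)) r"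
  using assms
proof (induction r)
  case 0
  show ?case using convergent_zero isum_zero by simp
next
  case (Suc r)
  have 1: "convergent n (\<lambda>d. sumr (PS n) (\<lambda>j. D j \<otimes>[n] u j d) r)"
    "isum n (\<lambda>d. sumr (PS n) (\<lambda>j. D j \<otimes>[n] u j d) r) = sumr (PS n) (\<lambda>j. D j \<otimes>[n] isum n (u j)) r"
    using Suc by auto
  have 2: "convergent n (\<lambda>d. D r \<otimes>[n] u r d)" by (rule convergent_mult) (use Suc in auto)
  have 3: "isum n (\<lambda>d. D r \<otimes>[n] u r d) = D r \<otimes>[n] isum n (u r)"
    by (rule isum_mult[symmetric]) (use Suc in auto)
  show ?case using convergent_add[OF 1(1) 2] isum_add[OF 1(1) 2] 1(2) 3 by simp
qed

text \<open>A telescoping identity for monomials. The lower bound on the order of the quotients is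
  what later allows them to be summed over infinitely many exponents.\<close>

lemma wpow_difference:
  assumes B: "subring B R" and w: "small n w k" "\<And>j. j < k \<Longrightarrow> w j \<in> vals B n"
    and v: "small n v k" "\<And>j. j < k \<Longrightarrow> v j \<in> vals B n" and \<beta>: "\<beta> \<in> mexps k"
  shows "\<exists>q. (\<forall>j. q j \<in> vals B n \<and> q j \<in> fil n (edeg k \<beta> - 1)) \<and>
    wpow (PS n) w k \<beta> = wpow (PS n) v k \<beta> \<oplus>[n] sumr (PS n) (\<lambda>j. (w j \<ominus>[n] v j) \<otimes>[n] q j) k"
  using \<beta>
proof (induction "edeg k \<beta>" arbitrary: \<beta>)
  case 0
  interpret P: cring "PS n" by (rule cring_ps)
  have b: "\<beta> = ezero" using 0 edeg_0_iff by simp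
  have s: "sumr (PS n) (\<lambda>j. (w j \<ominus>[n] v j) \<otimes>[n] \<zero>[n]) k = \<zero>[n]"
    using P.sumr_ideal[OF P.zeroideal, of k "\<lambda>j. (w j \<ominus>[n] v j) \<otimes>[n] \<zero>[n]"] small_carr[OF w(1)] small_carr[OF v(1)] by simp
  have "wpow (PS n) w k ezero = \<one>[n]" "wpow (PS n) v k ezero = \<one>[n]"
    using P.wpow_ezero[OF small_carr[OF w(1)]] P.wpow_ezero[OF small_carr[OF v(1)]] by auto
  then show ?case unfolding b
    using s subringE(2)[OF vals_subring[OF B]] by (intro exI[of _ "\<lambda>_. \<zero>[n]"]) simp
next
  case (Suc d)
  interpret P: cring "PS n" by (rule cring_ps)
  have "\<exists>j<k. \<beta> j > 0"
  proof (rule ccontr)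
    assume "\<not> ?thesis"
    then have "edeg k \<beta> = 0" by (auto simp: edeg_def)
    then show False using Suc by simp
  qed
  then obtain i where i: "i < k" "\<beta> i > 0" by blast
  have "\<beta> \<in> homog_exps k (Suc d)" using Suc by (simp add: homog_exps_def)
  then obtain \<mu> where g: "\<beta> = eadd \<mu> (eunit 1 i)" "\<mu> \<in> mexps k" "edeg k \<mu> = d"
    using homog_shift[OF i(1), of d] i(2) by (auto simp: homog_exps_def)
  obtain q where q: "\<And>j. q j \<in> vals B n" "\<And>j. q j \<in> fil n (d - 1)"
    and e: "wpow (PS n) w k \<mu> = wpow (PS n) v k \<mu> \<oplus>[n] sumr (PS n) (\<lambda>j. (w j \<ominus>[n] v j) \<otimes>[n] q j) k"
    using Suc.hyps(1)[of \<mu>] g by auto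
  have wc: "w j \<in> PSC n" "v j \<in> PSC n" if "j < k" for j
    using that small_carr[OF w(1)] small_carr[OF v(1)] by auto
  have qc: "q j \<in> PSC n" for j by (rule vals_carr[OF q(1)])
  let ?W = "wpow (PS n) w k \<mu>" and ?V = "wpow (PS n) v k \<mu>"
  let ?D = "\<lambda>j. w j \<ominus>[n] v j"
  have Vc: "?V \<in> PSC n" by (rule P.wpow_closed[OF wc(2) order_refl]) auto
  have VB: "?V \<in> vals B n"
  proof -
    have "v j [^][n] (e::nat) \<in> vals B n" if "j < k" for j e
      using v(2)[OF that] subringE(3,6)[OF vals_subring[OF B]] by (induction e) auto
    then have "wpow (PS n) v t \<mu> \<in> vals B n" if "t \<le> k" for t
      using that subringE(3,6)[OF vals_subring[OF B]] by (induction t) auto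
    then show ?thesis by simp
  qed
  have Vf: "?V \<in> fil n d" using wpow_fil[OF v(1) order_refl, of \<mu>] g(3) by simp
  \<comment> \<open>From \<open>a (x + y) = b x + (a y + (a - b) x)\<close> with
    \<open>a = w i\<close> and \<open>b = v i\<close>: the previous quotients are multiplied by
    \<open>w i\<close>, and the monomial in \<open>v\<close> is added at position
    \<open>i\<close>.\<close>
  let ?q = "\<lambda>j. w i \<otimes>[n] q j \<oplus>[n] (if j = i then ?V else \<zero>[n])"
  have "?q j \<in> vals B n" for j
    using subringE(2,6,7)[OF vals_subring[OF B]] w(2)[OF i(1)] q(1)[of j] VB by simp
  moreover have "?q j \<in> fil n (edeg k \<beta> - 1)" for j
  proof -
    interpret I: ideal "fil n d" "PS n" by (rule fil_ideal)
    have "w i \<otimes>[n] q j \<in> fil n (1 + (d - 1))" by (rule fil_mult[OF smallD[OF w(1) i(1)] q(2)])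
    then have "w i \<otimes>[n] q j \<in> fil n d" by (rule fil_anti[rotated]) simp
    moreover have "(if j = i then ?V else \<zero>[n]) \<in> fil n d" using Vf by simp
    ultimately have "?q j \<in> fil n d" by (rule I.a_closed)
    moreover have "edeg k \<beta> - 1 = d" using Suc.hyps(2) by simp
    ultimately show ?thesis by (simp only:)
  qed
  moreover have "wpow (PS n) w k \<beta> = wpow (PS n) v k \<beta> \<oplus>[n] sumr (PS n) (\<lambda>j. ?D j \<otimes>[n] ?q j) k"
  proof -
    let ?S = "sumr (PS n) (\<lambda>j. ?D j \<otimes>[n] q j) k"
    have Sc: "?S \<in> PSC n" using wc qc by (intro P.sumr_closed') simp
    have "sumr (PS n) (\<lambda>j. ?D j \<otimes>[n] ?q j) k = sumr (PS n) (\<lambda>j. w i \<otimes>[n] (?D j \<otimes>[n] q j) \<oplus>[n] (if j = i then ?D i \<otimes>[n] ?V else \<zero>[n])) k"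
      by (rule P.sumr_cong) (use wc qc Vc i in \<open>auto simp: P.r_distr P.m_lcomm\<close>)
    also have "\<dots> = w i \<otimes>[n] ?S \<oplus>[n] ?D i \<otimes>[n] ?V"
      using P.sumr_add[of k "\<lambda>j. w i \<otimes>[n] (?D j \<otimes>[n] q j)" "\<lambda>j. if j = i then ?D i \<otimes>[n] ?V else \<zero>[n]"]
        P.sumr_mult[of k "\<lambda>j. ?D j \<otimes>[n] q j" "w i"] P.sumr_delta[of "?D i \<otimes>[n] ?V" i k] wc qc Vc i by simp
    finally have S': "sumr (PS n) (\<lambda>j. ?D j \<otimes>[n] ?q j) k = w i \<otimes>[n] ?S \<oplus>[n] ?D i \<otimes>[n] ?V" .
    have W: "wpow (PS n) w k \<beta> = w i \<otimes>[n] (?V \<oplus>[n] ?S)"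
      unfolding g(1) using P.wpow_eunit[where w = w and k = k and i = k and j = i and \<beta> = \<mu>, OF wc(1) order_refl i(1)] e by simp
    have V: "wpow (PS n) v k \<beta> = v i \<otimes>[n] ?V"
      unfolding g(1) using P.wpow_eunit[where w = v and k = k and i = k and j = i and \<beta> = \<mu>, OF wc(2) order_refl i(1)] by simp
    have id: "a \<otimes>[n] (x \<oplus>[n] y) = b \<otimes>[n] x \<oplus>[n] (a \<otimes>[n] y \<oplus>[n] (a \<ominus>[n] b) \<otimes>[n] x)"
      if "a \<in> PSC n" "b \<in> PSC n" "x \<in> PSC n" "y \<in> PSC n" for a b x y
    proof -
      have "b \<otimes>[n] x \<oplus>[n] (a \<otimes>[n] y \<oplus>[n] (a \<otimes>[n] x \<oplus>[n] \<ominus>[n] (b \<otimes>[n] x)))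
        = (a \<otimes>[n] x \<oplus>[n] a \<otimes>[n] y) \<oplus>[n] (b \<otimes>[n] x \<oplus>[n] \<ominus>[n] (b \<otimes>[n] x))"
        using that by (simp add: P.a_ac)
      then show ?thesis using that by (simp add: P.r_distr P.l_distr P.minus_eq P.l_minus P.r_neg)
    qed
    show ?thesis unfolding W V S' by (rule id) (use wc i Vc Sc in auto)
  qed
  ultimately show ?case by (intro exI[of _ ?q] conjI allI)
qed

text \<open>A first order Taylor formula with quotients over the same subring \<open>B\<close>. It
  is used to compare a series with its restriction to a curve, and to discard arguments that lie in
  a given ideal.\<close>

theorem ev_difference:
  assumes B: "subring B R" and w: "small n w k" "\<And>j. j < k \<Longrightarrow> w j \<in> vals B n"
    and v: "small n v k" "\<And>j. j < k \<Longrightarrow> v j \<in> vals B n" and s: "s \<in> vals B k"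
  shows "\<exists>h. (\<forall>j. h j \<in> vals B n) \<and>
    ev n w k s = ev n v k s \<oplus>[n] sumr (PS n) (\<lambda>j. (w j \<ominus>[n] v j) \<otimes>[n] h j) k"
proof -
  interpret P: cring "PS n" by (rule cring_ps)
  interpret V: subring "vals B n" "PS n" by (rule vals_subring[OF B])
  let ?D = "\<lambda>j. w j \<ominus>[n] v j"
  let ?Q = "\<lambda>\<beta> q. (\<forall>j. q j \<in> vals B n \<and> q j \<in> fil n (edeg k \<beta> - 1)) \<and>
    wpow (PS n) w k \<beta> = wpow (PS n) v k \<beta> \<oplus>[n] sumr (PS n) (\<lambda>j. ?D j \<otimes>[n] q j) k"
  have "\<forall>\<beta>. \<exists>q. \<beta> \<in> mexps k \<longrightarrow> ?Q \<beta> q"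
  proof (intro allI)
    fix \<beta>
    show "\<exists>q. \<beta> \<in> mexps k \<longrightarrow> ?Q \<beta> q"
    proof (cases "\<beta> \<in> mexps k")
      case True
      from wpow_difference[OF B w v True] obtain q where "?Q \<beta> q" ..
      then show ?thesis by (intro exI[of _ q] impI)
    qed simp
  qed
  then have "\<exists>q. \<forall>\<beta>. \<beta> \<in> mexps k \<longrightarrow> ?Q \<beta> (q \<beta>)" by (rule choice)
  then obtain q where q': "\<forall>\<beta>. \<beta> \<in> mexps k \<longrightarrow> ?Q \<beta> (q \<beta>)" ..
  have qv: "q \<beta> j \<in> vals B n" "q \<beta> j \<in> fil n (edeg k \<beta> - 1)" if "\<beta> \<in> mexps k" for \<beta> j
    using q'[THEN spec, THEN mp, OF that] by blast+
  have qe: "wpow (PS n) w k \<beta> = wpow (PS n) v k \<beta> \<oplus>[n] sumr (PS n) (\<lambda>j. ?D j \<otimes>[n] q \<beta> j) k"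
    if "\<beta> \<in> mexps k" for \<beta> using q'[THEN spec, THEN mp, OF that] by (rule conjunct2)
  have wc: "w j \<in> PSC n" "v j \<in> PSC n" if "j < k" for j
    using that small_carr[OF w(1)] small_carr[OF v(1)] by auto
  have hm: "\<mu> \<in> mexps k" "edeg k \<mu> = d" if "\<mu> \<in> homog_exps k d" for \<mu> d using that by (simp_all add: homog_exps_def)
  have qc: "q \<beta> j \<in> PSC n" if "\<beta> \<in> mexps k" for \<beta> j by (rule vals_carr[OF qv(1)[OF that]])
  have sB: "s \<mu> \<in> B" for \<mu> using s unfolding vals_def by blast
  have sv: "pconst (s \<mu>) \<in> vals B n" for \<mu> by (rule pconst_vals[OF B sB])
  have sc: "pconst (s \<mu>) \<in> PSC n" for \<mu> by (rule vals_carr[OF sv])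
  \<comment> \<open>The degree \<open>d\<close> part of the \<open>j\<close>-th quotient. It has
    order at least \<open>d - 1\<close>, so the parts form a convergent family.\<close>
  define u where "u = (\<lambda>j d. \<Oplus>\<^bsub>PS n\<^esub>\<mu>\<in>homog_exps k d. pconst (s \<mu>) \<otimes>[n] q \<mu> j)"
  have uv: "u j d \<in> vals B n" for j d
    unfolding u_def
    by (rule P.finsum_in_subring[OF vals_subring[OF B]]) (rule subringE(6)[OF vals_subring[OF B] sv qv(1)[OF hm(1)]])
  have uf: "u j d \<in> fil n (d - 1)" for j d
    unfolding u_def
  proof (rule finsum_fil)
    fix \<mu> assume g: "\<mu> \<in> homog_exps k d"
    have "q \<mu> j \<in> fil n (d - 1)" using qv(2)[OF hm(1)[OF g], of j] hm(2)[OF g] by simp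
    then show "pconst (s \<mu>) \<otimes>[n] q \<mu> j \<in> fil n (d - 1)"
      by (rule ideal.I_l_closed[OF fil_ideal]) (rule sc)
  qed simp
  have conv: "convergent n (u j)" for j
    unfolding convergent_def
  proof (intro conjI allI)
    show "u j d \<in> PSC n" for d by (rule vals_carr[OF uv])
    show "\<exists>T. \<forall>d\<ge>T. u j d \<in> fil n D" for D
    proof (intro exI[of _ "Suc D"] allI impI)
      fix d assume "Suc D \<le> d"
      then have "D \<le> d - 1" by simp
      then show "u j d \<in> fil n D" by (rule fil_anti) (rule uf)
    qed
  qed
  have wcl: "wpow (PS n) w k \<mu> \<in> PSC n" "wpow (PS n) v k \<mu> \<in> PSC n" for \<mu>
    by (rule P.wpow_closed[where w = w and k = k, OF wc(1) order_refl], assumption)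
       (rule P.wpow_closed[where w = v and k = k, OF wc(2) order_refl], assumption)
  have step: "hs (PS n) w k d (\<lambda>\<mu>. pconst (s \<mu>)) = hs (PS n) v k d (\<lambda>\<mu>. pconst (s \<mu>)) \<oplus>[n] sumr (PS n) (\<lambda>j. ?D j \<otimes>[n] u j d) k" for d
  proof -
    let ?T = "\<lambda>\<mu>. sumr (PS n) (\<lambda>j. ?D j \<otimes>[n] (pconst (s \<mu>) \<otimes>[n] q \<mu> j)) k"
    have Tc: "?T \<mu> \<in> PSC n" if "\<mu> \<in> homog_exps k d" for \<mu>
      by (rule P.sumr_closed') (use wc sc qc hm that in auto)
    have "hs (PS n) w k d (\<lambda>\<mu>. pconst (s \<mu>)) = (\<Oplus>\<^bsub>PS n\<^esub>\<mu>\<in>homog_exps k d. wpow (PS n) v k \<mu> \<otimes>[n] pconst (s \<mu>) \<oplus>[n] ?T \<mu>)"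
      unfolding hs_def
    proof (rule P.finsum_cong')
      fix \<mu> assume g: "\<mu> \<in> homog_exps k d"
      let ?S = "sumr (PS n) (\<lambda>j. ?D j \<otimes>[n] q \<mu> j) k"
      have Sc: "?S \<in> PSC n" by (rule P.sumr_closed') (use wc qc hm g in auto)
      have "pconst (s \<mu>) \<otimes>[n] ?S = ?T \<mu>"
        using P.sumr_mult[of k "\<lambda>j. ?D j \<otimes>[n] q \<mu> j" "pconst (s \<mu>)"]
          P.sumr_cong[of k "\<lambda>j. pconst (s \<mu>) \<otimes>[n] (?D j \<otimes>[n] q \<mu> j)" "\<lambda>j. ?D j \<otimes>[n] (pconst (s \<mu>) \<otimes>[n] q \<mu> j)"]
          wc qc hm g sc by (simp add: P.m_lcomm)
      then show "wpow (PS n) w k \<mu> \<otimes>[n] pconst (s \<mu>) = wpow (PS n) v k \<mu> \<otimes>[n] pconst (s \<mu>) \<oplus>[n] ?T \<mu>"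
        unfolding qe[OF hm(1)[OF g]] using wcl[of \<mu>] Sc sc[of \<mu>] by (simp add: P.l_distr P.m_comm[of ?S])
    next
      show "(\<lambda>\<mu>. wpow (PS n) v k \<mu> \<otimes>[n] pconst (s \<mu>) \<oplus>[n] ?T \<mu>) \<in> homog_exps k d \<rightarrow> carrier (PS n)"
        using wcl sc Tc by auto
    qed simp
    also have "\<dots> = hs (PS n) v k d (\<lambda>\<mu>. pconst (s \<mu>)) \<oplus>[n] (\<Oplus>\<^bsub>PS n\<^esub>\<mu>\<in>homog_exps k d. ?T \<mu>)"
      unfolding hs_def by (rule P.finsum_addf) (use wcl sc Tc in auto)
    also have "(\<Oplus>\<^bsub>PS n\<^esub>\<mu>\<in>homog_exps k d. ?T \<mu>) = sumr (PS n) (\<lambda>j. \<Oplus>\<^bsub>PS n\<^esub>\<mu>\<in>homog_exps k d. ?D j \<otimes>[n] (pconst (s \<mu>) \<otimes>[n] q \<mu> j)) k"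
      by (rule P.sumr_finsum) (use wc sc qc hm in auto)
    also have "\<dots> = sumr (PS n) (\<lambda>j. ?D j \<otimes>[n] u j d) k"
      unfolding u_def by (rule P.sumr_cong, rule P.finsum_rdistr[symmetric]) (use wc sc qc hm in auto)
    finally show ?thesis .
  qed
  have cv: "convergent n (\<lambda>d. hs (PS n) v k d (\<lambda>\<mu>. pconst (s \<mu>)))"
    by (rule convergent_hs[OF v(1) sc])
  have ism: "convergent n (\<lambda>d. sumr (PS n) (\<lambda>j. ?D j \<otimes>[n] u j d) k)"
    "isum n (\<lambda>d. sumr (PS n) (\<lambda>j. ?D j \<otimes>[n] u j d) k) = sumr (PS n) (\<lambda>j. ?D j \<otimes>[n] isum n (u j)) k"
    using isum_sumr[of k n u ?D] conv wc by auto
  have "ev n w k s = ev n v k s \<oplus>[n] sumr (PS n) (\<lambda>j. ?D j \<otimes>[n] isum n (u j)) k"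
    unfolding ev_def esum_def step isum_add[OF cv ism(1)] ism(2) ..
  then show ?thesis by (intro exI[of _ "\<lambda>j. isum n (u j)"] conjI allI isum_vals[OF B conv uv])
qed

text \<open>Monomials of degree above that of \<open>\<nu>\<close> cannot reach the coefficient at
  \<open>\<nu>\<close>. The resulting finite sum lets membership of coefficients in an ideal of
  \<open>R\<close> be checked term by term.\<close>

lemma ev_coeff:
  assumes sm: "small n w k" and s: "s \<in> PSC k"
  shows "ev n w k s \<nu> = (\<Oplus>\<mu>\<in>{\<mu> \<in> mexps k. edeg k \<mu> < Suc (edeg n \<nu>)}. s \<mu> \<otimes> wpow (PS n) w k \<mu> \<nu>)"
proof -
  interpret P: cring "PS n" by (rule cring_ps)
  have wc: "w j \<in> PSC n" if "j < k" for j by (rule small_carr[OF sm that])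
  have wcl: "wpow (PS n) w k \<mu> \<in> PSC n" for \<mu> by (rule P.wpow_closed[OF wc order_refl])
  note pc = pconst_coeff[OF sm s]
  note sc = ps_coeff_closed[OF s]
  have tc: "s \<mu> \<otimes> wpow (PS n) w k \<mu> \<nu> \<in> carrier R" for \<mu> using sc ps_coeff_closed[OF wcl] by simp
  have h: "hs (PS n) w k d (\<lambda>\<mu>. pconst (s \<mu>)) \<nu> = (\<Oplus>\<mu>\<in>homog_exps k d. s \<mu> \<otimes> wpow (PS n) w k \<mu> \<nu>)" for d
  proof -
    have "hs (PS n) w k d (\<lambda>\<mu>. pconst (s \<mu>)) \<nu> = (\<Oplus>\<mu>\<in>homog_exps k d. (wpow (PS n) w k \<mu> \<otimes>[n] pconst (s \<mu>)) \<nu>)"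
      unfolding hs_def by (rule ps_finsum) (use wcl pc in auto)
    also have "\<dots> = (\<Oplus>\<mu>\<in>homog_exps k d. s \<mu> \<otimes> wpow (PS n) w k \<mu> \<nu>)"
      using P.m_comm[OF wcl pc] const_mult[OF sc wcl] by simp
    finally show ?thesis .
  qed
  have fin: "finite {\<mu> \<in> mexps k. edeg k \<mu> < T}" for T
    by (rule finite_subset[OF _ finite_bounded_exps[of k T]]) (auto dest: le_edeg[of _ k] intro: le_trans less_imp_le)
  have "sumr R (\<lambda>d. \<Oplus>\<mu>\<in>homog_exps k d. s \<mu> \<otimes> wpow (PS n) w k \<mu> \<nu>) T = (\<Oplus>\<mu>\<in>{\<mu> \<in> mexps k. edeg k \<mu> < T}. s \<mu> \<otimes> wpow (PS n) w k \<mu> \<nu>)" for T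
  proof (induction T)
    case (Suc T)
    have "{\<mu> \<in> mexps k. edeg k \<mu> < Suc T} = {\<mu> \<in> mexps k. edeg k \<mu> < T} \<union> homog_exps k T"
      by (auto simp: homog_exps_def)
    moreover have "{\<mu> \<in> mexps k. edeg k \<mu> < T} \<inter> homog_exps k T = {}" by (auto simp: homog_exps_def)
    ultimately have "(\<Oplus>\<mu>\<in>{\<mu> \<in> mexps k. edeg k \<mu> < Suc T}. s \<mu> \<otimes> wpow (PS n) w k \<mu> \<nu>) =
      (\<Oplus>\<mu>\<in>{\<mu> \<in> mexps k. edeg k \<mu> < T}. s \<mu> \<otimes> wpow (PS n) w k \<mu> \<nu>) \<oplus> (\<Oplus>\<mu>\<in>homog_exps k T. s \<mu> \<otimes> wpow (PS n) w k \<mu> \<nu>)"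
      using add.finprod_Un_disjoint[OF fin[of T] finite_homog_exps[of k T]] tc by simp
    then show ?case using Suc by simp
  qed simp
  moreover have "ev n w k s \<nu> = sumr R (\<lambda>d. hs (PS n) w k d (\<lambda>\<mu>. pconst (s \<mu>)) \<nu>) (Suc (edeg n \<nu>))"
    using isum_coeff[OF convergent_hs[where y = "\<lambda>\<mu>. pconst (s \<mu>)", OF sm pc], of "Suc (edeg n \<nu>)" \<nu>]
      fil_anti[OF _ hs_fil[where y = "\<lambda>\<mu>. pconst (s \<mu>)", OF sm pc]]
    unfolding ev_def esum_def sumr_ps by blast
  ultimately show ?thesis unfolding h by (simp only:)
qed

definition xvar :: "nat \<Rightarrow> (nat \<Rightarrow> nat) \<Rightarrow> 'a" where
  "xvar j = pmono (eunit 1 j)"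

lemma small_xvar: "small n xvar n"
proof -
  have "xvar j \<in> fil n 1" if "j < n" for j
  proof -
    have "ezero \<noteq> eunit 1 j" by (auto simp: eunit_def fun_eq_iff)
    then have "pmono (eunit 1 j) ezero = \<zero>" by (simp add: pmono_def)
    then show ?thesis unfolding fil_1_iff xvar_def using mono_closed[OF eunit_mexps[OF that]] by blast
  qed
  then show ?thesis by (simp add: small_def)
qed

lemma xvar_vals: "subring B R \<Longrightarrow> j < n \<Longrightarrow> xvar j \<in> vals B n"
  by (simp add: xvar_def)

lemma wpow_monomials:
  assumes "\<And>j. j < k \<Longrightarrow> v j = pmono (m j)" "\<And>j. j < k \<Longrightarrow> m j \<in> mexps n" "i \<le> k"
  shows "wpow (PS n) v i \<beta> = pmono (\<lambda>l. \<Sum>j<i. \<beta> j * m j l)"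
  using assms(3)
proof (induction i)
  case 0
  show ?case by (simp add: mono_ezero[where n = n])
next
  case (Suc i)
  have mem: "(\<lambda>l. \<Sum>j<i. \<beta> j * m j l) \<in> mexps n" using Suc.prems assms(2) by (auto simp: mexps_def)
  have mem2: "(\<lambda>l. \<beta> i * m i l) \<in> mexps n" using Suc.prems assms(2)[of i] by (auto simp: mexps_def)
  have "wpow (PS n) v (Suc i) \<beta> = pmono (\<lambda>l. \<Sum>j<i. \<beta> j * m j l) \<otimes>[n] pmono (\<lambda>l. \<beta> i * m i l)"
    using Suc assms(1)[of i] mono_pow[OF assms(2), of i] by simp
  also have "\<dots> = pmono (eadd (\<lambda>l. \<Sum>j<i. \<beta> j * m j l) (\<lambda>l. \<beta> i * m i l))" by (rule mono_mono[OF mem mem2])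
  finally show ?case by simp
qed

lemma ev_xvar:
  assumes s: "s \<in> PSC n" shows "ev n xvar n s = s"
proof (rule ps_eqI[OF ev_closed[OF small_xvar s] s])
  fix \<nu> assume a: "\<nu> \<in> mexps n"
  have W: "wpow (PS n) xvar n \<mu> = pmono \<mu>" if "\<mu> \<in> mexps n" for \<mu>
  proof -
    have "(\<Sum>j<n. \<mu> j * eunit 1 j l) = \<mu> l" for l
    proof -
      have "(\<Sum>j<n. \<mu> j * eunit 1 j l) = (\<Sum>j<n. if j = l then \<mu> l else 0)"
        by (rule sum.cong) (auto simp: eunit_def)
      then show ?thesis using that by (auto simp: mexps_def)
    qed
    then show ?thesis using wpow_monomials[of n xvar "eunit 1" n n \<mu>] by (simp add: xvar_def)
  qed
  note sc = ps_coeff_closed[OF s]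
  let ?A = "{\<mu> \<in> mexps n. edeg n \<mu> < Suc (edeg n \<nu>)}"
  have fin: "finite ?A"
    by (rule finite_subset[OF _ finite_bounded_exps[of n "Suc (edeg n \<nu>)"]]) (auto dest: le_edeg[of _ n] intro: le_trans less_imp_le)
  have "ev n xvar n s \<nu> = (\<Oplus>\<mu>\<in>?A. if \<nu> = \<mu> then s \<mu> else \<zero>)"
    unfolding ev_coeff[OF small_xvar s]
  proof (rule finsum_cong')
    fix \<mu> assume "\<mu> \<in> ?A"
    then show "s \<mu> \<otimes> wpow (PS n) xvar n \<mu> \<nu> = (if \<nu> = \<mu> then s \<mu> else \<zero>)"
      using W[of \<mu>] sc[of \<mu>] by (simp add: pmono_def)
  qed (use sc in auto)
  also have "\<dots> = s \<nu>" by (rule add.finprod_singleton) (use a fin sc in auto)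
  finally show "ev n xvar n s \<nu> = s \<nu>" .
qed

lemma hs_sumr:
  assumes w: "\<And>j. j < k \<Longrightarrow> w j \<in> carrier R" and f: "\<And>j \<mu>. j < m \<Longrightarrow> f j \<mu> \<in> carrier R"
  shows "hs R w k d (\<lambda>\<mu>. sumr R (\<lambda>j. f j \<mu>) m) = sumr R (\<lambda>j. hs R w k d (f j)) m"
  using f
proof (induction m)
  case 0
  show ?case by (simp add: hs_zero[OF w])
next
  case (Suc m)
  have "hs R w k d (\<lambda>\<mu>. sumr R (\<lambda>j. f j \<mu>) m \<oplus> f m \<mu>) = hs R w k d (\<lambda>\<mu>. sumr R (\<lambda>j. f j \<mu>) m) \<oplus> hs R w k d (f m)"
    by (rule hs_add[OF w]) (use Suc.prems in \<open>auto intro!: sumr_closed'\<close>)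
  then show ?case using Suc by simp
qed

lemma division_xpows:
  assumes B: "subring B R" and x: "x \<in> vals B n" and t: "t \<le> n"
  shows "\<exists>z Q. z \<in> vals B n \<and> (\<forall>\<nu>. z \<nu> \<noteq> \<zero> \<longrightarrow> (\<forall>i<t. \<nu> i < L)) \<and> (\<forall>i. Q i \<in> vals B n) \<and>
    x = z \<oplus>[n] sumr (PS n) (\<lambda>i. pmono (eunit L i) \<otimes>[n] Q i) t"
  using t
proof (induction t)
  case 0
  interpret P: cring "PS n" by (rule cring_ps)
  show ?case using x vals_carr[OF x] subringE(2)[OF vals_subring[OF B]]
    by (intro exI[of _ x] exI[of _ "\<lambda>_. \<zero>[n]"]) simp
next
  case (Suc t)
  interpret P: cring "PS n" by (rule cring_ps)
  obtain z Q where z: "z \<in> vals B n" "\<forall>\<nu>. z \<nu> \<noteq> \<zero> \<longrightarrow> (\<forall>i<t. \<nu> i < L)" "\<forall>i. Q i \<in> vals B n"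
    "x = z \<oplus>[n] sumr (PS n) (\<lambda>i. pmono (eunit L i) \<otimes>[n] Q i) t" using Suc by auto
  have tn: "t < n" using Suc.prems by simp
  let ?z = "\<lambda>\<nu>. if \<nu> t < L then z \<nu> else \<zero>" and ?q = "\<lambda>\<nu>. z (eadd \<nu> (eunit L t))"
  note s = split_var[OF B z(1) tn, of L]
  let ?Q = "Q(t := ?q)"
  let ?S = "sumr (PS n) (\<lambda>i. pmono (eunit L i) \<otimes>[n] Q i) t"
  have Sc: "?S \<in> PSC n"
  proof (rule P.sumr_closed')
    fix i assume "i < t"
    then show "pmono (eunit L i) \<otimes>[n] Q i \<in> PSC n"
      using mono_closed[OF eunit_mexps[of i n L]] tn vals_carr[OF z(3)[THEN spec, of i]] by simp
  qed
  have "sumr (PS n) (\<lambda>i. pmono (eunit L i) \<otimes>[n] ?Q i) t = ?S"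
    by (rule P.sumr_cong) simp
  then have "sumr (PS n) (\<lambda>i. pmono (eunit L i) \<otimes>[n] ?Q i) (Suc t) = ?S \<oplus>[n] pmono (eunit L t) \<otimes>[n] ?q"
    by simp
  moreover have "?z \<in> PSC n" "pmono (eunit L t) \<otimes>[n] ?q \<in> PSC n"
    using vals_carr[OF s(1)] vals_carr[OF s(2)] mono_closed[OF eunit_mexps[OF tn]] by auto
  then have "(?z \<oplus>[n] pmono (eunit L t) \<otimes>[n] ?q) \<oplus>[n] ?S = ?z \<oplus>[n] (?S \<oplus>[n] pmono (eunit L t) \<otimes>[n] ?q)"
    using Sc by (simp add: P.a_ac)
  ultimately have "x = ?z \<oplus>[n] sumr (PS n) (\<lambda>i. pmono (eunit L i) \<otimes>[n] ?Q i) (Suc t)"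
    unfolding s(3)[symmetric] z(4)[symmetric] by (simp only:)
  moreover have "\<forall>\<nu>. ?z \<nu> \<noteq> \<zero> \<longrightarrow> (\<forall>i<Suc t. \<nu> i < L)" using z(2) by (auto simp: less_Suc_eq)
  moreover have "\<forall>i. ?Q i \<in> vals B n" using z(3) s(1) by simp
  ultimately show ?case using s(2) by (intro exI[of _ ?z] exI[of _ ?Q] conjI)
qed

abbreviation box_exps :: "nat \<Rightarrow> nat \<Rightarrow> (nat \<Rightarrow> nat) set" where
  "box_exps n L \<equiv> {\<beta> \<in> mexps n. \<forall>i<n. \<beta> i < L}"

lemma boxed_expansion:
  assumes f: "f \<in> PSC n" and bij: "bij_betw e {0..<r} (box_exps n L)"
    and box: "\<forall>\<nu>. f \<nu> \<noteq> \<zero> \<longrightarrow> (\<forall>i<n. \<nu> i < L)"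
  shows "f = sumr (PS n) (\<lambda>i. pmono (e i) \<otimes>[n] pconst (f (e i))) r"
proof
  fix \<nu>
  interpret P: cring "PS n" by (rule cring_ps)
  have em: "e i \<in> mexps n" if "i < r" for i using bij that unfolding bij_betw_def by auto
  note fc = ps_coeff_closed[OF f]
  have t: "(pmono (e i) \<otimes>[n] pconst (f (e i))) \<nu> = (if e i = \<nu> then f \<nu> else \<zero>)" if "i < r" for i
    using P.m_comm[OF mono_closed[OF em[OF that]] const_closed[OF fc]] const_mult[OF fc mono_closed[OF em[OF that]]] fc
    by (simp add: pmono_def)
  have s: "sumr (PS n) (\<lambda>i. pmono (e i) \<otimes>[n] pconst (f (e i))) r \<nu> = sumr R (\<lambda>i. if e i = \<nu> then f \<nu> else \<zero>) r"
    unfolding sumr_ps by (rule sumr_cong) (rule t)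
  show "f \<nu> = sumr (PS n) (\<lambda>i. pmono (e i) \<otimes>[n] pconst (f (e i))) r \<nu>"
  proof (cases "\<nu> \<in> e ` {0..<r}")
    case True
    then obtain i where i: "i < r" "e i = \<nu>" by auto
    have "e j = \<nu> \<longleftrightarrow> j = i" if "j < r" for j
      using bij i that unfolding bij_betw_def inj_on_def by auto
    then have "sumr R (\<lambda>i. if e i = \<nu> then f \<nu> else \<zero>) r = sumr R (\<lambda>j. if j = i then f \<nu> else \<zero>) r"
      by (intro sumr_cong) simp
    then show ?thesis using s sumr_delta[OF fc i(1)] by simp
  next
    case False
    then have "\<nu> \<notin> (box_exps n L)" using bij unfolding bij_betw_def by simp
    then have fa: "f \<nu> = \<zero>" using box ps_outside[OF f] by blast
    have "sumr R (\<lambda>i. if e i = \<nu> then f \<nu> else \<zero>) r = \<zero>" for r unfolding fa by (induction r) auto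
    then show ?thesis using s fa by simp
  qed
qed

text \<open>A Weierstrass division for several series. Dividing by the powers of the variables and
  inserting \<open>rel\<close> writes \<open>x\<close> as a remainder supported in the box plus a
  combination of the \<open>w j\<close>; the coefficients of that combination are divided again, and
  so on. The remainders become coefficients of monomials in \<open>w\<close>, and sorting them by
  the finitely many box monomials gives the \<open>b i\<close>.\<close>

theorem power_series_finite:
  assumes B: "subring B R" and w: "small n w m" "\<And>j. j < m \<Longrightarrow> w j \<in> vals B n"
    and c: "\<And>i j. i < n \<Longrightarrow> j < m \<Longrightarrow> c i j \<in> vals B n"
    and rel: "\<And>i. i < n \<Longrightarrow> pmono (eunit L i) = sumr (PS n) (\<lambda>j. w j \<otimes>[n] c i j) m"
    and bij: "bij_betw e {0..<r} (box_exps n L)" and x: "x \<in> vals B n"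
  shows "\<exists>b. (\<forall>i<r. b i \<in> vals B m) \<and> x = sumr (PS n) (\<lambda>i. pmono (e i) \<otimes>[n] ev n w m (b i)) r"
proof -
  interpret P: cring "PS n" by (rule cring_ps)
  note V = subringE[OF vals_subring[OF B, of n]]
  have wc: "w j \<in> PSC n" if "j < m" for j by (rule small_carr[OF w(1) that])
  have cc: "c i j \<in> PSC n" if "i < n" "j < m" for i j by (rule vals_carr[OF c[OF that]])
  let ?D = "\<lambda>x z C. z \<in> vals B n \<and> (\<forall>\<nu>. z \<nu> \<noteq> \<zero> \<longrightarrow> (\<forall>i<n. \<nu> i < L)) \<and> (\<forall>j<m. C j \<in> vals B n) \<and>
      x = z \<oplus>[n] sumr (PS n) (\<lambda>j. w j \<otimes>[n] C j) m"
  have div: "\<exists>z C. x \<in> vals B n \<longrightarrow> ?D x z C" for x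
  proof (cases "x \<in> vals B n")
    case True
    obtain z Q where z: "z \<in> vals B n" "\<forall>\<nu>. z \<nu> \<noteq> \<zero> \<longrightarrow> (\<forall>i<n. \<nu> i < L)" "\<forall>i. Q i \<in> vals B n"
      "x = z \<oplus>[n] sumr (PS n) (\<lambda>i. pmono (eunit L i) \<otimes>[n] Q i) n"
      using division_xpows[OF B True order_refl, of L] by blast
    have Qc: "Q i \<in> PSC n" for i by (rule vals_carr) (use z(3) in blast)
    let ?C = "\<lambda>j. sumr (PS n) (\<lambda>i. c i j \<otimes>[n] Q i) n"
    have "sumr (PS n) (\<lambda>i. pmono (eunit L i) \<otimes>[n] Q i) n = sumr (PS n) (\<lambda>i. sumr (PS n) (\<lambda>j. w j \<otimes>[n] (c i j \<otimes>[n] Q i)) m) n"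
    proof (rule P.sumr_cong)
      fix i assume i: "i < n"
      have "pmono (eunit L i) \<otimes>[n] Q i = Q i \<otimes>[n] sumr (PS n) (\<lambda>j. w j \<otimes>[n] c i j) m"
        unfolding rel[OF i, symmetric] by (rule P.m_comm[OF mono_closed[OF eunit_mexps[OF i]] Qc])
      also have "\<dots> = sumr (PS n) (\<lambda>j. Q i \<otimes>[n] (w j \<otimes>[n] c i j)) m"
        by (rule P.sumr_mult) (simp_all add: wc cc i Qc)
      also have "\<dots> = sumr (PS n) (\<lambda>j. w j \<otimes>[n] (c i j \<otimes>[n] Q i)) m"
        by (rule P.sumr_cong) (simp add: wc cc i Qc P.m_ac)
      finally show "pmono (eunit L i) \<otimes>[n] Q i = sumr (PS n) (\<lambda>j. w j \<otimes>[n] (c i j \<otimes>[n] Q i)) m" .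
    qed
    also have "\<dots> = sumr (PS n) (\<lambda>j. sumr (PS n) (\<lambda>i. w j \<otimes>[n] (c i j \<otimes>[n] Q i)) n) m"
      by (rule P.sumr_swap) (simp add: wc cc Qc)
    also have "\<dots> = sumr (PS n) (\<lambda>j. w j \<otimes>[n] ?C j) m"
      by (rule P.sumr_cong, rule P.sumr_mult[symmetric]) (simp_all add: wc cc Qc)
    finally have "x = z \<oplus>[n] sumr (PS n) (\<lambda>j. w j \<otimes>[n] ?C j) m" using z(4) by simp
    moreover have "\<forall>j<m. ?C j \<in> vals B n"
      by (intro allI impI P.sumr_subring[OF vals_subring[OF B]] V(6)) (use c z(3) in auto)
    ultimately have "?D x z ?C" using z(1,2) by (intro conjI)
    then show ?thesis by (intro exI[of _ z] exI[of _ ?C] impI)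
  qed simp
  have "\<forall>x. \<exists>p. x \<in> vals B n \<longrightarrow> ?D x (fst p) (snd p)"
  proof
    fix x
    obtain z C where "x \<in> vals B n \<longrightarrow> ?D x z C" using div[of x] by (elim exE)
    then show "\<exists>p. x \<in> vals B n \<longrightarrow> ?D x (fst p) (snd p)" by (intro exI[of _ "(z, C)"]) simp
  qed
  \<comment> \<open>A division function is fixed once for all, so that the rounds below are a
    definition by recursion and need no further choices.\<close>
  then have "\<exists>p. \<forall>x. x \<in> vals B n \<longrightarrow> ?D x (fst (p x)) (snd (p x))" by (rule choice)
  then obtain p where p: "\<forall>x. x \<in> vals B n \<longrightarrow> ?D x (fst (p x)) (snd (p x))" ..
  define zf Cf where "zf = (\<lambda>x. fst (p x))" and "Cf = (\<lambda>x. snd (p x))"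
  have D: "?D x (zf x) (Cf x)" if "x \<in> vals B n" for x
    unfolding zf_def Cf_def by (rule p[THEN spec, THEN mp, OF that])
  have zv: "zf x \<in> vals B n" if "x \<in> vals B n" for x using D[OF that] by (rule conjunct1)
  have zbox: "\<forall>\<nu>. zf x \<nu> \<noteq> \<zero> \<longrightarrow> (\<forall>i<n. \<nu> i < L)" if "x \<in> vals B n" for x
    using D[OF that, THEN conjunct2] by (rule conjunct1)
  have Cv: "Cf x j \<in> vals B n" if "x \<in> vals B n" "j < m" for x j
    using D[OF that(1), THEN conjunct2, THEN conjunct2, THEN conjunct1] that(2) by blast
  have De: "x = zf x \<oplus>[n] sumr (PS n) (\<lambda>j. w j \<otimes>[n] Cf x j) m" if "x \<in> vals B n" for x
    using D[OF that, THEN conjunct2, THEN conjunct2] by (rule conjunct2)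
  \<comment> \<open>After \<open>d\<close> rounds, \<open>Y d\<close> holds at an exponent
    \<open>\<mu>\<close> of degree \<open>d\<close> the coefficient of the \<open>w\<close>-monomial
    that still has to be divided. One further round sends the \<open>j\<close>-th quotient to the
    exponent raised at \<open>j\<close>; \<open>nx\<close> collects what arrives at
    \<open>\<mu>\<close>.\<close>
  define nx where "nx = (\<lambda>y \<mu>. sumr (PS n) (\<lambda>j. if \<mu> j > 0 then Cf (y (esub \<mu> (eunit 1 j))) j else \<zero>[n]) m)"
  define Y where "Y = rec_nat (\<lambda>_. x) (\<lambda>d y. nx y)"
  have Y0: "Y 0 = (\<lambda>_. x)" and YS: "Y (Suc d) = nx (Y d)" for d by (simp_all add: Y_def)
  have Yv: "Y d \<mu> \<in> vals B n" for d \<mu>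
  proof (induction d arbitrary: \<mu>)
    case 0
    show ?case using x by (simp add: Y0)
  next
    case (Suc d)
    show ?case unfolding YS nx_def
    proof (rule P.sumr_subring[OF vals_subring[OF B]])
      fix j assume j: "j < m"
      show "(if 0 < \<mu> j then Cf (Y d (esub \<mu> (eunit 1 j))) j else \<zero>[n]) \<in> vals B n"
        using Cv[OF Suc j] V(2) by simp
    qed
  qed
  note zYc = vals_carr[OF zv[OF Yv]]
  note CYc = vals_carr[OF Cv[OF Yv]]
  note Yc = vals_carr[OF Yv]
  have step: "hs (PS n) w m d (Y d) = hs (PS n) w m d (\<lambda>\<mu>. zf (Y d \<mu>)) \<oplus>[n] hs (PS n) w m (Suc d) (Y (Suc d))" for d
  proof -
    have sc: "sumr (PS n) (\<lambda>j. w j \<otimes>[n] Cf (Y d \<mu>) j) m \<in> PSC n" for \<mu>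
      by (rule P.sumr_closed') (simp add: wc CYc)
    have "hs (PS n) w m d (Y d) = hs (PS n) w m d (\<lambda>\<mu>. zf (Y d \<mu>) \<oplus>[n] sumr (PS n) (\<lambda>j. w j \<otimes>[n] Cf (Y d \<mu>) j) m)"
      by (rule P.hs_cong[OF wc]) (simp_all add: De[OF Yv, symmetric] Yc)
    also have "\<dots> = hs (PS n) w m d (\<lambda>\<mu>. zf (Y d \<mu>)) \<oplus>[n] hs (PS n) w m d (\<lambda>\<mu>. sumr (PS n) (\<lambda>j. w j \<otimes>[n] Cf (Y d \<mu>) j) m)"
      by (rule P.hs_add[where w = w and k = m, OF wc zYc sc])
    also have "hs (PS n) w m d (\<lambda>\<mu>. sumr (PS n) (\<lambda>j. w j \<otimes>[n] Cf (Y d \<mu>) j) m)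
       = sumr (PS n) (\<lambda>j. hs (PS n) w m d (\<lambda>\<mu>. w j \<otimes>[n] Cf (Y d \<mu>) j)) m"
      by (rule P.hs_sumr) (simp_all add: wc CYc)
    also have "\<dots> = sumr (PS n) (\<lambda>j. hs (PS n) w m (Suc d) (\<lambda>\<mu>. if \<mu> j > 0 then Cf (Y d (esub \<mu> (eunit 1 j))) j else \<zero>[n])) m"
    proof (rule P.sumr_cong)
      fix j assume j: "j < m"
      have "hs (PS n) w m d (\<lambda>\<mu>. w j \<otimes>[n] Cf (Y d \<mu>) j) = w j \<otimes>[n] hs (PS n) w m d (\<lambda>\<mu>. Cf (Y d \<mu>) j)"
        by (rule P.hs_smult[where w = w and k = m, OF wc, symmetric]) (simp_all add: wc CYc j)
      also have "\<dots> = hs (PS n) w m (Suc d) (\<lambda>\<mu>. if \<mu> j > 0 then Cf (Y d (esub \<mu> (eunit 1 j))) j else \<zero>[n])"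
        by (rule P.hs_shift[where w = w and k = m and y = "\<lambda>\<mu>. Cf (Y d \<mu>) j", OF wc]) (simp_all add: wc CYc j)
      finally show "hs (PS n) w m d (\<lambda>\<mu>. w j \<otimes>[n] Cf (Y d \<mu>) j) = hs (PS n) w m (Suc d) (\<lambda>\<mu>. if \<mu> j > 0 then Cf (Y d (esub \<mu> (eunit 1 j))) j else \<zero>[n])" .
    qed
    also have "\<dots> = hs (PS n) w m (Suc d) (Y (Suc d))"
      unfolding YS nx_def by (rule P.hs_sumr[symmetric]) (simp_all add: wc CYc)
    finally show ?thesis .
  qed
  \<comment> \<open>The remainder belonging to the exponent \<open>\<mu>\<close> is produced in
    round \<open>edeg m \<mu>\<close>, so the degree of the exponent selects the round.\<close>
  define y where "y = (\<lambda>\<mu>. zf (Y (edeg m \<mu>) \<mu>))"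
  have yv: "y \<mu> \<in> vals B n" for \<mu> unfolding y_def by (rule zv[OF Yv])
  note yc = vals_carr[OF yv]
  have hy: "hs (PS n) w m d (\<lambda>\<mu>. zf (Y d \<mu>)) = hs (PS n) w m d y" for d
    by (rule P.hs_cong[where w = w and k = m, OF wc]) (simp_all add: zYc yc, simp add: y_def homog_exps_def)
  have hc: "hs (PS n) w m d y \<in> PSC n" for d by (rule P.hs_closed[where w = w and k = m, OF wc yc])
  have hYc: "hs (PS n) w m d (Y d) \<in> PSC n" for d by (rule P.hs_closed[where w = w and k = m, OF wc Yc])
  have xs: "x = sumr (PS n) (\<lambda>d. hs (PS n) w m d y) T \<oplus>[n] hs (PS n) w m T (Y T)" for T
  proof (induction T)
    case 0
    have "hs (PS n) w m 0 (Y 0) = x" using P.hs_0[of m w "Y 0"] wc vals_carr[OF x] by (simp add: Y0)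
    then show ?case using vals_carr[OF x] by simp
  next
    case (Suc T)
    have "sumr (PS n) (\<lambda>d. hs (PS n) w m d y) T \<in> PSC n" by (rule P.sumr_closed') (rule hc)
    then show ?case using Suc step[of T] hc[of T] hYc[of "Suc T"] by (simp add: hy P.a_assoc)
  qed
  have "x = esum n w m y"
    unfolding esum_def
  proof (rule isum_unique[OF convergent_hs[OF w(1) yc] vals_carr[OF x]])
    fix D
    have "x \<ominus>[n] sumr (PS n) (\<lambda>d. hs (PS n) w m d y) T \<in> fil n D" if "T \<ge> D" for T
    proof -
      have sc: "sumr (PS n) (\<lambda>d. hs (PS n) w m d y) T \<in> PSC n" by (rule P.sumr_closed') (rule hc)
      have "x \<ominus>[n] sumr (PS n) (\<lambda>d. hs (PS n) w m d y) T = hs (PS n) w m T (Y T)"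
        by (rule P.add_eq_imp_diff[OF xs[of T, symmetric] sc hYc])
      then show ?thesis using fil_anti[OF that hs_fil[OF w(1) Yc]] by simp
    qed
    then show "\<exists>T0. \<forall>T\<ge>T0. x \<ominus>[n] sumr (PS n) (\<lambda>d. hs (PS n) w m d y) T \<in> fil n D" by blast
  qed
  also have "\<dots> = sumr (PS n) (\<lambda>i. pmono (e i) \<otimes>[n] esum n w m (\<lambda>\<mu>. pconst (y \<mu> (e i)))) r"
  proof -
    have em: "e i \<in> mexps n" if "i < r" for i using bij that unfolding bij_betw_def by auto
    have pc: "pconst (y \<mu> (e i)) \<in> PSC n" for \<mu> i by (rule const_closed[OF ps_coeff_closed[OF yc]])
    have "hs (PS n) w m d y = sumr (PS n) (\<lambda>i. pmono (e i) \<otimes>[n] hs (PS n) w m d (\<lambda>\<mu>. pconst (y \<mu> (e i)))) r" for d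
    proof -
      have "y = (\<lambda>\<mu>. sumr (PS n) (\<lambda>i. pmono (e i) \<otimes>[n] pconst (y \<mu> (e i))) r)"
      proof (rule ext)
        fix \<mu>
        have "\<forall>\<nu>. y \<mu> \<nu> \<noteq> \<zero> \<longrightarrow> (\<forall>i<n. \<nu> i < L)" unfolding y_def by (rule zbox[OF Yv])
        then show "y \<mu> = sumr (PS n) (\<lambda>i. pmono (e i) \<otimes>[n] pconst (y \<mu> (e i))) r"
          by (rule boxed_expansion[OF yc bij])
      qed
      then have "hs (PS n) w m d y = hs (PS n) w m d (\<lambda>\<mu>. sumr (PS n) (\<lambda>i. pmono (e i) \<otimes>[n] pconst (y \<mu> (e i))) r)"
        by (rule arg_cong)
      also have "\<dots> = sumr (PS n) (\<lambda>i. hs (PS n) w m d (\<lambda>\<mu>. pmono (e i) \<otimes>[n] pconst (y \<mu> (e i)))) r"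
        by (rule P.hs_sumr) (simp_all add: wc pc em)
      also have "\<dots> = sumr (PS n) (\<lambda>i. pmono (e i) \<otimes>[n] hs (PS n) w m d (\<lambda>\<mu>. pconst (y \<mu> (e i)))) r"
        by (rule P.sumr_cong, rule P.hs_smult[where w = w and k = m, OF wc, symmetric]) (simp_all add: pc em)
      finally show ?thesis .
    qed
    then show ?thesis unfolding esum_def
      using isum_sumr[of r n "\<lambda>i d. hs (PS n) w m d (\<lambda>\<mu>. pconst (y \<mu> (e i)))" "\<lambda>i. pmono (e i)"] convergent_hs[OF w(1) pc] em by simp
  qed
  also have "\<dots> = sumr (PS n) (\<lambda>i. pmono (e i) \<otimes>[n] ev n w m (\<lambda>\<mu>. if \<mu> \<in> mexps m then y \<mu> (e i) else \<zero>)) r"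
  proof (rule P.sumr_cong)
    fix i
    have pc: "pconst (y \<mu> (e i)) \<in> PSC n" for \<mu> by (rule const_closed[OF ps_coeff_closed[OF yc]])
    have "esum n w m (\<lambda>\<mu>. pconst (y \<mu> (e i))) = ev n w m (\<lambda>\<mu>. if \<mu> \<in> mexps m then y \<mu> (e i) else \<zero>)"
      unfolding ev_def by (rule esum_cong[OF w(1)]) (simp_all add: pc ps_coeff_closed[OF yc])
    then show "pmono (e i) \<otimes>[n] esum n w m (\<lambda>\<mu>. pconst (y \<mu> (e i))) = pmono (e i) \<otimes>[n] ev n w m (\<lambda>\<mu>. if \<mu> \<in> mexps m then y \<mu> (e i) else \<zero>)"
      by simp
  qed
  finally have main: "x = sumr (PS n) (\<lambda>i. pmono (e i) \<otimes>[n] ev n w m (\<lambda>\<mu>. if \<mu> \<in> mexps m then y \<mu> (e i) else \<zero>)) r" .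
  have "(\<lambda>\<mu>. if \<mu> \<in> mexps m then y \<mu> (e i) else \<zero>) \<in> vals B m" for i
  proof -
    have "y \<mu> (e i) \<in> B" for \<mu> using yv unfolding vals_def by blast
    then show ?thesis using subringE(1,2)[OF B] unfolding vals_def ps_carrier_iff by auto
  qed
  then show ?thesis using main by (intro exI[of _ "\<lambda>i \<mu>. if \<mu> \<in> mexps m then y \<mu> (e i) else \<zero>"]) simp
qed

text \<open>The box monomials generate the series over \<open>B\<close> as a module over the
  substituted series. Multiplication by \<open>s\<close> therefore acts through a finite matrix, and
  \<open>integral_of_finite\<close> applies.\<close>

theorem power_series_integral:
  assumes B: "subring B R" and w: "small n w m" "\<And>j. j < m \<Longrightarrow> w j \<in> vals B n"
    and c: "\<And>i j. i < n \<Longrightarrow> j < m \<Longrightarrow> c i j \<in> vals B n"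
    and rel: "\<And>i. i < n \<Longrightarrow> pmono (eunit L i) = sumr (PS n) (\<lambda>j. w j \<otimes>[n] c i j) m"
    and s: "s \<in> vals B n"
  shows "\<exists>d l. l \<in> low (PS n) (ev n w m ` vals B m) s d \<and> s [^][n] d \<oplus>[n] l = \<zero>[n]"
proof -
  interpret P: cring "PS n" by (rule cring_ps)
  interpret M: cring "PS m" by (rule cring_ps)
  interpret h: ring_hom_cring "PS m" "PS n" "ev n w m" by (rule ev_hom[OF w(1)])
  let ?E = "ev n w m ` vals B m"
  have E: "subring ?E (PS n)"
    by (rule ring_hom_ring.img_is_subring[OF ring_hom_ringI2[OF M.ring_axioms P.ring_axioms h.homh] vals_subring[OF B]])
  have "finite (box_exps n L)"
    by (rule finite_subset[OF _ finite_bounded_exps[of n L]]) (auto intro: less_imp_le)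
  from ex_bij_betw_nat_finite[OF this] obtain e where
    bij: "bij_betw e {0..<card (box_exps n L)} (box_exps n L)" ..
  define r where "r = card (box_exps n L)"
  have bij: "bij_betw e {0..<r} (box_exps n L)" using bij by (simp add: r_def)
  have em: "e i \<in> mexps n" if "i < r" for i using bij that unfolding bij_betw_def by auto
  have pf: "\<exists>b. (\<forall>i<r. b i \<in> vals B m) \<and> x = sumr (PS n) (\<lambda>i. pmono (e i) \<otimes>[n] ev n w m (b i)) r"
    if "x \<in> vals B n" for x
    by (rule power_series_finite[OF B w c rel bij that]; assumption)
  have fin: "\<exists>b. \<forall>i<r. b i \<in> ?E \<and> x = sumr (PS n) (\<lambda>i. b i \<otimes>[n] pmono (e i)) r" if x: "x \<in> vals B n" for x
  proof -
    obtain b where b: "\<forall>i<r. b i \<in> vals B m" "x = sumr (PS n) (\<lambda>i. pmono (e i) \<otimes>[n] ev n w m (b i)) r"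
      using pf[OF x] by (elim exE conjE)
    have "x = sumr (PS n) (\<lambda>i. ev n w m (b i) \<otimes>[n] pmono (e i)) r"
      unfolding b(2)
    proof (rule P.sumr_cong)
      fix i assume i: "i < r"
      have "b i \<in> PSC m" using b(1) i vals_carr by blast
      then show "pmono (e i) \<otimes>[n] ev n w m (b i) = ev n w m (b i) \<otimes>[n] pmono (e i)"
        by (intro P.m_comm mono_closed em[OF i] ev_closed[OF w(1)])
    qed
    then show ?thesis using b(1) by (intro exI[of _ "\<lambda>i. ev n w m (b i)"]) simp
  qed
  have mv: "s \<otimes>[n] pmono (e i) \<in> vals B n" if "i < r" for i
    by (rule subringE(6)[OF vals_subring[OF B] s pmono_vals[OF B em[OF that]]])
  have "\<forall>i. \<exists>b. i < r \<longrightarrow> (\<forall>j<r. b j \<in> ?E \<and> s \<otimes>[n] pmono (e i) = sumr (PS n) (\<lambda>j. b j \<otimes>[n] pmono (e j)) r)"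
  proof
    fix i
    show "\<exists>b. i < r \<longrightarrow> (\<forall>j<r. b j \<in> ?E \<and> s \<otimes>[n] pmono (e i) = sumr (PS n) (\<lambda>j. b j \<otimes>[n] pmono (e j)) r)"
    proof (cases "i < r")
      case True
      from fin[OF mv[OF True]] obtain b where "\<forall>j<r. b j \<in> ?E \<and> s \<otimes>[n] pmono (e i) = sumr (PS n) (\<lambda>j. b j \<otimes>[n] pmono (e j)) r" ..
      then show ?thesis by (intro exI[of _ b] impI)
    qed simp
  qed
  then have "\<exists>b. \<forall>i. i < r \<longrightarrow> (\<forall>j<r. b i j \<in> ?E \<and> s \<otimes>[n] pmono (e i) = sumr (PS n) (\<lambda>j. b i j \<otimes>[n] pmono (e j)) r)"
    by (rule choice)
  then obtain b where b: "\<forall>i. i < r \<longrightarrow> (\<forall>j<r. b i j \<in> ?E \<and> s \<otimes>[n] pmono (e i) = sumr (PS n) (\<lambda>j. b i j \<otimes>[n] pmono (e j)) r)" ..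
  obtain c1 where c1: "\<forall>i<r. c1 i \<in> ?E \<and> \<one>[n] = sumr (PS n) (\<lambda>i. c1 i \<otimes>[n] pmono (e i)) r"
    using fin[OF subringE(3)[OF vals_subring[OF B]]] by (elim exE)
  show ?thesis
  proof (cases "r = 0")
    \<comment> \<open>An empty box arises for \<open>L = 0\<close> with at least one variable. Then
      \<open>1\<close> is an empty sum, and the monic relation of degree zero suffices; the bounded
      statement about \<open>c1\<close> would be vacuous here.\<close>
    case True
    obtain b where "\<one>[n] = sumr (PS n) (\<lambda>i. pmono (e i) \<otimes>[n] ev n w m (b i)) r"
      using pf[OF subringE(3)[OF vals_subring[OF B]]] by (elim exE conjE)
    then have "\<one>[n] = \<zero>[n]" using True by simp
    then have "s [^][n] (0::nat) \<oplus>[n] \<zero>[n] = \<zero>[n]" by simp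
    moreover have "\<zero>[n] \<in> low (PS n) ?E s 0" by simp
    ultimately show ?thesis by blast
  next
    case False
    show ?thesis
    proof (rule P.integral_of_finite[OF E vals_carr[OF s], of r "\<lambda>i. pmono (e i)" b c1])
      show "pmono (e i) \<in> PSC n" if "i < r" for i by (rule mono_closed[OF em[OF that]])
      show "b i j \<in> ?E" if "i < r" "j < r" for i j using b that by blast
      show "s \<otimes>[n] pmono (e i) = sumr (PS n) (\<lambda>j. b i j \<otimes>[n] pmono (e j)) r" if "i < r" for i using b that by blast
      show "c1 j \<in> ?E" if "j < r" for j using c1 that by blast
      show "\<one>[n] = sumr (PS n) (\<lambda>j. c1 j \<otimes>[n] pmono (e j)) r" using c1 False by blast
    qed
  qed
qed

end

section \<open>Dimension theory\<close>

definition weight :: "(nat \<Rightarrow> nat) \<Rightarrow> nat \<Rightarrow> (nat \<Rightarrow> nat) \<Rightarrow> nat" where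
  "weight e k \<beta> = (\<Sum>i<k. \<beta> i * e i)"

lemma weight_eadd: "weight e k (eadd \<beta> \<mu>) = weight e k \<beta> + weight e k \<mu>"
  by (simp add: weight_def sum.distrib distrib_right)

text \<open>A lexicographic minimum, taken from the last coordinate downwards, is realised by
  positive integer weights, also for an infinite set of exponents. The normalisation
  \<open>e 0 = 1\<close> keeps the first variable fixed in
  \<open>parameter_reduction\<close>.\<close>

lemma unique_minimal_weight:
  assumes "A \<subseteq> mexps k" "A \<noteq> {}"
  shows "\<exists>e \<delta>. \<delta> \<in> A \<and> e 0 = 1 \<and> (\<forall>i. 1 \<le> e i) \<and> (\<forall>\<beta>\<in>A. \<beta> \<noteq> \<delta> \<longrightarrow> weight e k \<delta> < weight e k \<beta>)"
  using assms
proof (induction k arbitrary: A)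
  case 0
  then obtain \<delta> where "\<delta> \<in> A" by auto
  moreover have "\<beta> = (\<lambda>_. 0)" if "\<beta> \<in> A" for \<beta> using that 0(1) by (auto simp: mexps_def fun_eq_iff)
  ultimately show ?case by (rule_tac exI[of _ "\<lambda>_. 1"], rule_tac exI[of _ \<delta>]) auto
next
  case (Suc k)
  define c where "c = (LEAST c. \<exists>\<beta>\<in>A. \<beta> k = c)"
  have ex: "\<exists>c. \<exists>\<beta>\<in>A. \<beta> k = c" using Suc.prems(2) by auto
  have c1: "\<exists>\<beta>\<in>A. \<beta> k = c" unfolding c_def by (rule LeastI_ex[OF ex])
  have c2: "c \<le> \<beta> k" if "\<beta> \<in> A" for \<beta> unfolding c_def by (rule Least_le) (use that in auto)
  define A' where "A' = {\<beta>(k := 0) | \<beta>. \<beta> \<in> A \<and> \<beta> k = c}"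
  have A'm: "A' \<subseteq> mexps k"
  proof
    fix x assume "x \<in> A'"
    then obtain \<beta> where "x = \<beta>(k := 0)" "\<beta> \<in> A" unfolding A'_def by auto
    then show "x \<in> mexps k" using Suc.prems(1) by (auto simp: mexps_def)
  qed
  have A'n: "A' \<noteq> {}" using c1 unfolding A'_def by auto
  obtain e \<delta>' where e: "\<delta>' \<in> A'" "e 0 = 1" "\<forall>i. 1 \<le> e i" "\<forall>\<beta>\<in>A'. \<beta> \<noteq> \<delta>' \<longrightarrow> weight e k \<delta>' < weight e k \<beta>"
    using Suc.IH[OF A'm A'n] by blast
  obtain \<delta> where d: "\<delta>' = \<delta>(k := 0)" "\<delta> \<in> A" "\<delta> k = c" using e(1) unfolding A'_def by auto
  \<comment> \<open>One more than the minimal weight on the slice where the last coordinate is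
    smallest: raising that coordinate by one then already costs more than
    \<open>weight e k \<delta>'\<close>. For \<open>k = 0\<close> the new weight is
    \<open>1\<close>, which gives the normalisation.\<close>
  define e' where "e' = e(k := 1 + weight e k \<delta>')"
  have w: "weight e' (Suc k) \<beta> = weight e k (\<beta>(k := 0)) + \<beta> k * (1 + weight e k \<delta>')" for \<beta>
    unfolding weight_def e'_def by (auto intro!: sum.cong)
  show ?case
  proof (rule exI[of _ e'], rule exI[of _ \<delta>], intro conjI ballI impI)
    show "\<delta> \<in> A" by fact
    show "e' 0 = 1" using e(2) by (auto simp: e'_def weight_def)
    show "\<forall>i. 1 \<le> e' i" using e(3) by (auto simp: e'_def)
    fix \<beta> assume b: "\<beta> \<in> A" "\<beta> \<noteq> \<delta>"
    have wd: "weight e' (Suc k) \<delta> = weight e k \<delta>' + c * (1 + weight e k \<delta>')" by (simp add: w d)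
    show "weight e' (Suc k) \<delta> < weight e' (Suc k) \<beta>"
    proof (cases "\<beta> k = c")
      case True
      have "\<beta>(k := 0) \<in> A'" unfolding A'_def using b True by blast
      moreover have "\<beta>(k := 0) \<noteq> \<delta>'"
      proof
        assume "\<beta>(k := 0) = \<delta>'"
        then have "\<beta> x = \<delta> x" for x using d True by (cases "x = k") (auto dest: fun_cong[of _ _ x])
        then show False using b(2) by auto
      qed
      ultimately have "weight e k \<delta>' < weight e k (\<beta>(k := 0))" using e(4) by blast
      then show ?thesis unfolding wd w[of \<beta>] True by simp
    next
      case False
      then have "Suc c \<le> \<beta> k" using c2[OF b(1)] by simp
      then have "Suc c * (1 + weight e k \<delta>') \<le> \<beta> k * (1 + weight e k \<delta>')" by (rule mult_le_mono1)
      then show ?thesis unfolding wd w[of \<beta>] by simp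
    qed
  qed
qed

text \<open>The two crossed sums together weigh twice as much as \<open>\<delta>\<close>, and
  neither weighs less than the minimum, so both equal \<open>\<delta>\<close>. This isolates a
  single decomposition of \<open>\<delta>\<close> in the coefficient of a product.\<close>

lemma weight_unique_sum:
  assumes min: "\<And>\<beta>. \<beta> \<in> C \<Longrightarrow> \<beta> \<noteq> \<delta> \<Longrightarrow> weight e k \<delta> < weight e k \<beta>"
    and "eadd \<beta> \<mu> = \<delta>" "eadd \<beta>' \<mu>' = \<delta>" "eadd \<beta> \<mu>' \<in> C" "eadd \<beta>' \<mu> \<in> C"
  shows "\<beta>' = \<beta>"
proof -
  have "weight e k (eadd \<beta> \<mu>') + weight e k (eadd \<beta>' \<mu>) = weight e k (eadd \<beta> \<mu>) + weight e k (eadd \<beta>' \<mu>')"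
    by (simp add: weight_eadd)
  then have s: "weight e k (eadd \<beta> \<mu>') + weight e k (eadd \<beta>' \<mu>) = weight e k \<delta> + weight e k \<delta>"
    by (simp only: assms(2,3))
  have "eadd \<beta> \<mu>' = \<delta>"
  proof (rule ccontr)
    assume n: "\<not> ?thesis"
    have "weight e k \<delta> \<le> weight e k (eadd \<beta>' \<mu>)" using min[OF assms(5)] by (cases "eadd \<beta>' \<mu> = \<delta>") auto
    then show False using min[OF assms(4) n] s by linarith
  qed
  then have "eadd \<beta> \<mu>' = eadd \<beta>' \<mu>'" using assms(3) by simp
  then show ?thesis by (auto simp: fun_eq_iff)
qed

context cring
begin

lemma lincomb_update_carrier: "lincomb (S\<lparr>carrier := H\<rparr>) cs gs = lincomb S cs gs"
  by (induction S cs gs rule: lincomb.induct) auto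

lemma sumr_update_carrier: "sumr (S\<lparr>carrier := H\<rparr>) f r = sumr S f r"
  by (induction r) auto

lemma low_update_carrier: "low (S\<lparr>carrier := H\<rparr>) E s d = low S E s d"
  by (induction d) simp_all

text \<open>Addition and multiplication are fields of the record, but the additive inverse is a
  description over the carrier, so that subtraction in a subring has to be compared with subtraction
  in the ring.\<close>

lemma minus_update_carrier:
  assumes H: "subring H R" and x: "x \<in> H" and y: "y \<in> H"
  shows "x \<ominus>\<^bsub>R\<lparr>carrier := H\<rparr>\<^esub> y = x \<ominus> y"
proof -
  interpret H: cring "R\<lparr>carrier := H\<rparr>" using subcring_iff[OF subringE(1)[OF H]] subcringI'[OF H] by blast
  have c: "x \<in> carrier R" "y \<in> carrier R" using subringE(1)[OF H] x y by auto
  have "(x \<ominus>\<^bsub>R\<lparr>carrier := H\<rparr>\<^esub> y) \<oplus>\<^bsub>R\<lparr>carrier := H\<rparr>\<^esub> y = x" by (rule H.diff_add_cancel_cring) (use x y in auto)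
  then have e: "(x \<ominus>\<^bsub>R\<lparr>carrier := H\<rparr>\<^esub> y) \<oplus> y = x" by simp
  have d: "x \<ominus>\<^bsub>R\<lparr>carrier := H\<rparr>\<^esub> y \<in> H" using H.minus_closed[of x y] x y by simp
  then have dc: "x \<ominus>\<^bsub>R\<lparr>carrier := H\<rparr>\<^esub> y \<in> carrier R" using subringE(1)[OF H] by auto
  have "y \<oplus> (x \<ominus>\<^bsub>R\<lparr>carrier := H\<rparr>\<^esub> y) = x" using e a_comm[OF dc c(2)] by simp
  from add_eq_imp_diff[OF this c(2) dc] show ?thesis by simp
qed

lemma genideal_smult_mem:
  assumes A: "A \<subseteq> carrier R" and J: "ideal J R" and c: "c \<in> carrier R" and a: "\<And>a. a \<in> A \<Longrightarrow> c \<otimes> a \<in> J"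
    and x: "x \<in> Idl A"
  shows "c \<otimes> x \<in> J"
proof -
  have "Idl A \<subseteq> {x \<in> carrier R. c \<otimes> x \<in> J}"
    by (rule genideal_minimal[OF ideal_smult_preimage[OF J c]]) (use a A in auto)
  then show ?thesis using x by auto
qed

lemma idl_sumr:
  assumes I: "ideal I R" and y: "\<And>l. l < k \<Longrightarrow> y l \<in> carrier R" and x: "x \<in> Idl (I \<union> y ` {..<k})"
  shows "\<exists>u c. u \<in> I \<and> (\<forall>l. c l \<in> carrier R) \<and> x = u \<oplus> sumr R (\<lambda>l. y l \<otimes> c l) k"
  using y x
proof (induction k arbitrary: x)
  case 0
  have "x \<in> I" using 0 genideal_of_ideal[OF I] by simp
  then show ?case using ideal_subset[OF I] by (intro exI[of _ x] exI[of _ "\<lambda>_. \<zero>"]) auto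
next
  case (Suc k)
  have A: "I \<union> y ` {..<k} \<subseteq> carrier R" using ideal_subset[OF I] Suc.prems(1) by auto
  have yk: "y k \<in> carrier R" using Suc.prems(1) by simp
  have "I \<union> y ` {..<Suc k} = insert (y k) (I \<union> y ` {..<k})" by (auto simp: lessThan_Suc)
  then obtain x' a where x': "x = x' \<oplus> a \<otimes> y k" "x' \<in> Idl (I \<union> y ` {..<k})" "a \<in> carrier R"
    using Suc.prems(2) genideal_insert[OF A yk] by auto
  obtain u c where u: "u \<in> I" "\<forall>l. c l \<in> carrier R" "x' = u \<oplus> sumr R (\<lambda>l. y l \<otimes> c l) k"
    using Suc.IH[OF _ x'(2)] Suc.prems(1) by auto
  have e: "sumr R (\<lambda>l. y l \<otimes> (c(k := a)) l) k = sumr R (\<lambda>l. y l \<otimes> c l) k" by (rule sumr_cong) simp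
  have sc: "sumr R (\<lambda>l. y l \<otimes> c l) k \<in> carrier R" by (rule sumr_closed') (use u(2) Suc.prems(1) in auto)
  have "x = u \<oplus> sumr R (\<lambda>l. y l \<otimes> (c(k := a)) l) (Suc k)"
    using x'(1,3) u(1,3) sc yk ideal_subset[OF I] unfolding sumr.simps e fun_upd_same
    by (simp add: a_assoc m_comm subsetD)
  then show ?case using u x'(3) by (intro exI[of _ u] exI[of _ "c(k := a)"]) auto
qed

text \<open>Membership in all primes over \<open>I\<close> and the \<open>y l\<close> puts a power
  of each \<open>x i\<close> into the ideal they generate; one exponent is made to serve all
  \<open>i\<close>.\<close>

lemma rad_sumr:
  fixes x :: "nat \<Rightarrow> 'a"
  assumes I: "ideal I R" and y: "\<And>l. l < k \<Longrightarrow> y l \<in> carrier R" and x: "\<And>i. i < n \<Longrightarrow> x i \<in> carrier R"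
    and rad: "\<And>i P. i < n \<Longrightarrow> primeideal P R \<Longrightarrow> I \<subseteq> P \<Longrightarrow> (\<forall>l<k. y l \<in> P) \<Longrightarrow> x i \<in> P"
  shows "\<exists>L u c. 0 < L \<and> (\<forall>i<n. u i \<in> I \<and> (\<forall>l. c i l \<in> carrier R) \<and> x i [^] (L::nat) = u i \<oplus> sumr R (\<lambda>l. y l \<otimes> c i l) k)"
proof -
  let ?J = "Idl (I \<union> y ` {..<k})"
  have A: "I \<union> y ` {..<k} \<subseteq> carrier R" using ideal_subset[OF I] y by auto
  have J: "ideal ?J R" by (rule genideal_ideal[OF A])
  interpret J: ideal ?J R by (rule J)
  have "\<forall>i. \<exists>K::nat. i < n \<longrightarrow> x i [^] K \<in> ?J"
  proof
    fix i
    show "\<exists>K::nat. i < n \<longrightarrow> x i [^] K \<in> ?J"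
    proof (cases "i < n")
      case True
      have "\<exists>K::nat. x i [^] K \<in> ?J"
      proof (rule mem_primes_imp_power[OF J x[OF True]])
        fix P assume P: "primeideal P R" "?J \<subseteq> P"
        then have "I \<union> y ` {..<k} \<subseteq> P" using genideal_self[OF A] by blast
        then show "x i \<in> P" by (intro rad[OF True P(1)]) auto
      qed
      then show ?thesis by blast
    qed simp
  qed
  then obtain K :: "nat \<Rightarrow> nat" where K: "\<forall>i. i < n \<longrightarrow> x i [^] (K i) \<in> ?J" by (drule_tac choice) (elim exE)
  \<comment> \<open>A common upper bound of the individual exponents. The successor makes it
    positive, which \<open>integral_mod\<close> needs in order to see that the elements
    \<open>u i\<close> have zero constant term.\<close>
  define L where "L = Suc (\<Sum>i<n. K i)"
  have mem: "x i [^] L \<in> ?J" if i: "i < n" for i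
  proof -
    have "K i \<le> L" unfolding L_def using member_le_sum[of i "{..<n}" K] i by simp
    then have "x i [^] L = x i [^] (L - K i) \<otimes> x i [^] K i" using nat_pow_mult[OF x[OF i], of "L - K i" "K i"] by simp
    then show ?thesis using J.I_l_closed[OF K[rule_format, OF i] nat_pow_closed[OF x[OF i]]] by simp
  qed
  have "\<forall>i. \<exists>p. i < n \<longrightarrow> fst p \<in> I \<and> (\<forall>l. snd p l \<in> carrier R) \<and> x i [^] L = fst p \<oplus> sumr R (\<lambda>l. y l \<otimes> snd p l) k"
  proof
    fix i
    show "\<exists>p. i < n \<longrightarrow> fst p \<in> I \<and> (\<forall>l. snd p l \<in> carrier R) \<and> x i [^] L = fst p \<oplus> sumr R (\<lambda>l. y l \<otimes> snd p l) k"
    proof (cases "i < n")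
      case True
      have "\<exists>u c. u \<in> I \<and> (\<forall>l. c l \<in> carrier R) \<and> x i [^] L = u \<oplus> sumr R (\<lambda>l. y l \<otimes> c l) k"
        by (rule idl_sumr[OF I y mem[OF True]]; assumption)
      then obtain u c where "u \<in> I \<and> (\<forall>l. c l \<in> carrier R) \<and> x i [^] L = u \<oplus> sumr R (\<lambda>l. y l \<otimes> c l) k"
        by (elim exE)
      then show ?thesis by (intro exI[of _ "(u, c)"]) simp
    qed simp
  qed
  then obtain p where p: "\<forall>i. i < n \<longrightarrow> fst (p i) \<in> I \<and> (\<forall>l. snd (p i) l \<in> carrier R) \<and> x i [^] L = fst (p i) \<oplus> sumr R (\<lambda>l. y l \<otimes> snd (p i) l) k"
    by (drule_tac choice) (elim exE)
  show ?thesis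
    by (rule exI[of _ L], rule exI[of _ "\<lambda>i. fst (p i)"], rule exI[of _ "\<lambda>i. snd (p i)"]) (use p in \<open>simp add: L_def\<close>)
qed

lemma maximal_unit:
  assumes M: "maximalideal M R" and c: "c \<in> carrier R" "c \<notin> M"
  shows "\<exists>d\<in>carrier R. \<exists>m\<in>M. d \<otimes> c \<oplus> m = \<one>"
proof -
  interpret M: maximalideal M R by fact
  let ?J = "{x \<oplus> d \<otimes> c | x d. x \<in> M \<and> d \<in> carrier R}"
  have J: "ideal ?J R" by (rule ideal_sum_set[OF M.is_ideal c(1)])
  have "M \<subseteq> ?J" proof
    fix x assume x: "x \<in> M"
    then have "x = x \<oplus> \<zero> \<otimes> c" using c(1) M.Icarr by simp
    then show "x \<in> ?J" using x zero_closed by blast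
  qed
  moreover have "c \<in> ?J" proof -
    have "c = \<zero> \<oplus> \<one> \<otimes> c" using c(1) by simp
    then show ?thesis using M.zero_closed one_closed by blast
  qed
  ultimately have "?J = carrier R" using M.I_maximal[OF J] ideal_subset[OF J] c(2) by blast
  then have "\<one> \<in> ?J" by simp
  then obtain x d where "\<one> = x \<oplus> d \<otimes> c" "x \<in> M" "d \<in> carrier R" by blast
  then show ?thesis using c(1) M.Icarr a_comm by (intro bexI[of _ d] bexI[of _ x]) auto
qed

lemma ideal_finsum:
  assumes M: "ideal M R" and f: "\<And>x. x \<in> A \<Longrightarrow> f x \<in> M"
  shows "(\<Oplus>x\<in>A. f x) \<in> M"
proof -
  interpret M: ideal M R by fact
  show ?thesis using f
  proof (induction A rule: infinite_finite_induct)
    case (insert x A)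
    then have "f \<in> insert x A \<rightarrow> carrier R" using M.Icarr by blast
    then show ?case using insert by (simp add: M.a_closed)
  qed (auto simp: finsum_infinite)
qed

lemma finsum_notin_ideal:
  assumes M: "ideal M R" and A: "finite A" "x \<in> A" "\<And>y. y \<in> A \<Longrightarrow> f y \<in> carrier R"
    and x: "f x \<notin> M" and rest: "\<And>y. y \<in> A \<Longrightarrow> y \<noteq> x \<Longrightarrow> f y \<in> M"
  shows "(\<Oplus>y\<in>A. f y) \<notin> M"
proof
  assume s: "(\<Oplus>y\<in>A. f y) \<in> M"
  have r: "(\<Oplus>y\<in>A - {x}. f y) \<in> M" by (rule ideal_finsum[OF M]) (use rest in auto)
  have "(\<Oplus>y\<in>insert x (A - {x}). f y) = f x \<oplus> (\<Oplus>y\<in>A - {x}. f y)"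
    by (rule finsum_insert) (use A in auto)
  moreover have "insert x (A - {x}) = A" using A(2) by auto
  ultimately have e: "f x \<oplus> (\<Oplus>y\<in>A - {x}. f y) = (\<Oplus>y\<in>A. f y)" by simp
  have rc: "(\<Oplus>y\<in>A - {x}. f y) \<in> carrier R" using r ideal_subset[OF M] by auto
  have "f x = (\<Oplus>y\<in>A. f y) \<ominus> (\<Oplus>y\<in>A - {x}. f y)"
    unfolding e[symmetric] using A(2,3) rc by (simp add: minus_eq a_assoc r_neg)
  then show False using ideal_minus[OF M s r] x by simp
qed

end

text \<open>The interface through which the hypotheses on \<open>R\<close> act: dimension zero as
  \<open>prime_maximal\<close>, semilocality as \<open>idempotents\<close>, and the Artinian
  condition as \<open>F_nil\<close>. The other assumptions say that the members are subrings forming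
  a directed cover of \<open>R\<close>.\<close>

locale power_series_family = cring R for R (structure) +
  fixes F :: "'a set set"
  assumes F_ne: "F \<noteq> {}"
    and F_subring: "\<And>B. B \<in> F \<Longrightarrow> subring B R"
    and F_directed: "\<And>B C. B \<in> F \<Longrightarrow> C \<in> F \<Longrightarrow> \<exists>D\<in>F. B \<subseteq> D \<and> C \<subseteq> D"
    and F_cover: "\<And>x. x \<in> carrier R \<Longrightarrow> \<exists>B\<in>F. x \<in> B"
    and F_nil: "\<And>B n f. B \<in> F \<Longrightarrow> f \<in> vals B n \<Longrightarrow> (\<And>\<nu>. \<exists>k::nat. f \<nu> [^] k = \<zero>) \<Longrightarrow> \<exists>k::nat. f [^]\<^bsub>mps R n\<^esub> k = \<zero>\<^bsub>mps R n\<^esub>"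
    and prime_maximal: "\<And>P. primeideal P R \<Longrightarrow> maximalideal P R"
    and idempotents: "\<And>J. J \<subseteq> {M. maximalideal M R} \<Longrightarrow>
      \<exists>e\<in>carrier R. e \<otimes> e = e \<and> (\<forall>M. maximalideal M R \<longrightarrow> (e \<in> M \<longleftrightarrow> M \<notin> J))"
begin

definition SV :: "nat \<Rightarrow> ((nat \<Rightarrow> nat) \<Rightarrow> 'a) set" where
  "SV n = (\<Union>B\<in>F. vals B n)"

abbreviation SS :: "nat \<Rightarrow> ((nat \<Rightarrow> nat) \<Rightarrow> 'a) ring" where
  "SS n \<equiv> (mps R n)\<lparr>carrier := SV n\<rparr>"

abbreviation ss_mult ("(_ \<otimes>{_} _)" [70, 0, 71] 70) where
  "f \<otimes>{n} g \<equiv> f \<otimes>\<^bsub>SS n\<^esub> g"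
abbreviation ss_add ("(_ \<oplus>{_} _)" [65, 0, 66] 65) where
  "f \<oplus>{n} g \<equiv> f \<oplus>\<^bsub>SS n\<^esub> g"
abbreviation ss_minus ("(_ \<ominus>{_} _)" [65, 0, 66] 65) where
  "f \<ominus>{n} g \<equiv> f \<ominus>\<^bsub>SS n\<^esub> g"
abbreviation ss_uminus ("(\<ominus>{_} _)" [0, 81] 80) where
  "\<ominus>{n} f \<equiv> \<ominus>\<^bsub>SS n\<^esub> f"
abbreviation ss_pow ("(_ [^]{_} _)" [76, 0, 75] 75) where
  "f [^]{n} k \<equiv> f [^]\<^bsub>SS n\<^esub> k"
abbreviation ss_zero ("\<zero>{_}") where
  "\<zero>{n} \<equiv> \<zero>\<^bsub>SS n\<^esub>"
abbreviation ss_one ("\<one>{_}") where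
  "\<one>{n} \<equiv> \<one>\<^bsub>SS n\<^esub>"

lemma vals_mono: "B \<subseteq> C \<Longrightarrow> f \<in> vals B n \<Longrightarrow> f \<in> vals C n"
  by (auto simp: vals_def)

lemma vals_SV: "B \<in> F \<Longrightarrow> f \<in> vals B n \<Longrightarrow> f \<in> SV n"
  by (auto simp: SV_def)

lemma SV_carr: "f \<in> SV n \<Longrightarrow> f \<in> PSC n"
  using vals_carr by (auto simp: SV_def)

lemma SV_coeff: "f \<in> SV n \<Longrightarrow> f \<nu> \<in> carrier R"
  by (rule ps_coeff_closed[OF SV_carr])

lemma F_common:
  assumes "finite X" "X \<subseteq> SV n" "finite Y" "Y \<subseteq> SV m"
  shows "\<exists>B\<in>F. X \<subseteq> vals B n \<and> Y \<subseteq> vals B m"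
proof -
  have 1: "\<exists>B\<in>F. X \<subseteq> vals B n" if "finite X" "X \<subseteq> SV n" for X n
    using that
  proof (induction X)
    case empty
    show ?case using F_ne by auto
  next
    case (insert x X)
    obtain B where B: "B \<in> F" "X \<subseteq> vals B n" using insert by auto
    obtain C where C: "C \<in> F" "x \<in> vals C n" using insert by (auto simp: SV_def)
    obtain D where D: "D \<in> F" "B \<subseteq> D" "C \<subseteq> D" using F_directed[OF B(1) C(1)] by blast
    show ?case using D B C vals_mono[of B D] vals_mono[of C D] by blast
  qed
  obtain B where B: "B \<in> F" "X \<subseteq> vals B n" using 1[OF assms(1,2)] by blast
  obtain C where C: "C \<in> F" "Y \<subseteq> vals C m" using 1[OF assms(3,4)] by blast
  obtain D where D: "D \<in> F" "B \<subseteq> D" "C \<subseteq> D" using F_directed[OF B(1) C(1)] by blast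
  show ?thesis using D B C vals_mono[of B D] vals_mono[of C D] by blast
qed

lemma F_common1: "finite X \<Longrightarrow> X \<subseteq> SV n \<Longrightarrow> \<exists>B\<in>F. X \<subseteq> vals B n"
  using F_common[of X n "{}" n] by auto

lemma SV_subring: "subring (SV n) (PS n)"
proof -
  interpret P: cring "PS n" by (rule cring_ps)
  show ?thesis
  proof (rule P.subringI)
    show "SV n \<subseteq> PSC n" using SV_carr by blast
    obtain B where B: "B \<in> F" using F_ne by auto
    show "\<one>[n] \<in> SV n" using subringE(3)[OF vals_subring[OF F_subring[OF B]]] vals_SV[OF B] by blast
    show "\<ominus>[n] h \<in> SV n" if h: "h \<in> SV n" for h
    proof -
      obtain B where B: "B \<in> F" "h \<in> vals B n" using h by (auto simp: SV_def)
      show ?thesis by (rule vals_SV[OF B(1) subringE(5)[OF vals_subring[OF F_subring[OF B(1)]] B(2)]])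
    qed
    fix h1 h2 assume h: "h1 \<in> SV n" "h2 \<in> SV n"
    obtain B where B: "B \<in> F" "{h1, h2} \<subseteq> vals B n" using F_common1[of "{h1,h2}" n] h by auto
    have m: "h1 \<in> vals B n" "h2 \<in> vals B n" using B by auto
    show "h1 \<otimes>[n] h2 \<in> SV n" by (rule vals_SV[OF B(1) subringE(6)[OF vals_subring[OF F_subring[OF B(1)]] m]])
    show "h1 \<oplus>[n] h2 \<in> SV n" by (rule vals_SV[OF B(1) subringE(7)[OF vals_subring[OF F_subring[OF B(1)]] m]])
  qed
qed

lemma cring_ss: "cring (SS n)"
proof -
  interpret P: cring "PS n" by (rule cring_ps)
  show ?thesis using P.subcring_iff[OF subringE(1)[OF SV_subring]] P.subcringI'[OF SV_subring] by blast
qed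

lemmas SV_one = subringE(3)[OF SV_subring]
lemmas SV_zero = subringE(2)[OF SV_subring]
lemmas SV_mult = subringE(6)[OF SV_subring]
lemmas SV_add = subringE(7)[OF SV_subring]
lemmas SV_uminus = subringE(5)[OF SV_subring]

lemma SV_minus: "f \<in> SV n \<Longrightarrow> g \<in> SV n \<Longrightarrow> f \<ominus>[n] g \<in> SV n"
  unfolding a_minus_def by (intro SV_add SV_uminus)

lemma ss_minus: "f \<in> SV n \<Longrightarrow> g \<in> SV n \<Longrightarrow> f \<ominus>{n} g = f \<ominus>[n] g"
  by (rule cring.minus_update_carrier[OF cring_ps SV_subring])

lemma pmono_SV: "\<beta> \<in> mexps n \<Longrightarrow> pmono \<beta> \<in> SV n"
  using F_ne F_subring vals_SV pmono_vals by blast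

lemma xvar_SV: "i < n \<Longrightarrow> xvar i \<in> SV n"
  unfolding xvar_def by (rule pmono_SV) simp

lemma pconst_SV: "c \<in> carrier R \<Longrightarrow> pconst c \<in> SV n"
  using F_cover F_subring vals_SV pconst_vals by blast

lemma pconst_hom: "ring_hom_cring R (SS n) pconst"
proof -
  interpret P: cring "PS n" by (rule cring_ps)
  interpret S: cring "SS n" by (rule cring_ss)
  interpret h: ring_hom_cring R "PS n" pconst by (rule const_hom)
  show ?thesis
    by (rule ring_hom_cring.intro[OF is_cring cring_ss], unfold_locales)
      (auto simp: ring_hom_def pconst_SV const_one)
qed

lemma ev_SV:
  assumes y: "\<And>l. l < k \<Longrightarrow> y l \<in> SV n" "small n y k" and s: "s \<in> SV k"
  shows "ev n y k s \<in> SV n"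
proof -
  obtain B where B: "B \<in> F" "y ` {..<k} \<subseteq> vals B n" "{s} \<subseteq> vals B k"
    using F_common[of "y ` {..<k}" n "{s}" k] y(1) s by blast
  show ?thesis by (rule vals_SV[OF B(1) ev_vals[OF y(2) F_subring[OF B(1)]]]) (use B in auto)
qed

lemma ev_hom_ss:
  assumes y: "\<And>l. l < k \<Longrightarrow> y l \<in> SV n" "small n y k"
  shows "ring_hom_cring (SS k) (SS n) (ev n y k)"
proof -
  interpret P: cring "PS n" by (rule cring_ps)
  interpret h: ring_hom_cring "PS k" "PS n" "ev n y k" by (rule ev_hom[OF y(2)])
  show ?thesis
    by (rule ring_hom_cring.intro[OF cring_ss cring_ss], unfold_locales)
      (auto simp: ring_hom_def ev_SV[OF y] SV_carr)
qed

text \<open>The finitely many series in a linear combination live over one member of the family. The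
  conclusion is given for all larger members, so that several memberships can later be realised over
  a common one.\<close>

lemma ideal_membership_descends:
  assumes gs: "set gs \<subseteq> SV n" and x: "x \<in> genideal (SS n) (set gs)"
  shows "\<exists>B\<in>F. \<forall>C\<in>F. B \<subseteq> C \<longrightarrow> set gs \<subseteq> vals C n \<and> x \<in> genideal (PSB C n) (set gs)"
proof -
  interpret S: cring "SS n" by (rule cring_ss)
  obtain cs where cs: "set cs \<subseteq> SV n" "length cs = length gs" "x = lincomb (PS n) cs gs"
    using S.genideal_lincomb[of gs x] gs x by (auto simp: lincomb_update_carrier)
  obtain B where B: "B \<in> F" "set cs \<union> set gs \<subseteq> vals B n" using F_common1[of "set cs \<union> set gs" n] cs gs by auto
  show ?thesis
  proof (intro bexI[OF _ B(1)] ballI impI)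
    fix C assume C: "C \<in> F" "B \<subseteq> C"
    interpret C: cring "PSB C n" by (rule cring_psb[OF F_subring[OF C(1)]])
    have s: "set cs \<subseteq> vals C n" "set gs \<subseteq> vals C n" using B(2) vals_mono[OF C(2)] by blast+
    then have s': "set gs \<subseteq> carrier (PSB C n)" by simp
    show "set gs \<subseteq> vals C n \<and> x \<in> genideal (PSB C n) (set gs)"
      using C.lincomb_in_genideal[of gs cs "genideal (PSB C n) (set gs)"] s C.genideal_self[OF s']
        C.genideal_ideal[OF s'] cs(3) by (simp add: lincomb_update_carrier)
  qed
qed

lemma genideal_psb_subset:
  assumes C: "C \<in> F" and gs: "set gs \<subseteq> vals C n" and x: "x \<in> genideal (PSB C n) (set gs)"
  shows "x \<in> genideal (SS n) (set gs)"
proof -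
  interpret S: cring "SS n" by (rule cring_ss)
  interpret C: cring "PSB C n" by (rule cring_psb[OF F_subring[OF C]])
  obtain cs where cs: "set cs \<subseteq> vals C n" "length cs = length gs" "x = lincomb (PS n) cs gs"
    using C.genideal_lincomb[of gs x] gs x by (auto simp: lincomb_update_carrier)
  have s: "set cs \<subseteq> SV n" "set gs \<subseteq> SV n" using cs gs vals_SV[OF C] by blast+
  then have s': "set gs \<subseteq> carrier (SS n)" by simp
  show ?thesis
    using S.lincomb_in_genideal[of gs cs "genideal (SS n) (set gs)"] s S.genideal_self[OF s']
      S.genideal_ideal[OF s'] cs(3) by (simp add: lincomb_update_carrier)
qed

end

context cring
begin

lemma ideal_add_cancel:
  assumes J: "ideal J R" and "x \<oplus> y \<in> J" "y \<in> J" "x \<in> carrier R" shows "x \<in> J"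
proof -
  have y: "y \<in> carrier R" using ideal_subset[OF J] assms(3) by auto
  have "y \<oplus> x = x \<oplus> y" using assms(4) y by (rule a_comm[symmetric])
  from add_eq_imp_diff[OF this y assms(4)] have "(x \<oplus> y) \<ominus> y = x" .
  then show ?thesis using ideal_minus[OF J assms(2,3)] by simp
qed

lemma finite_edeg_less: "finite {\<mu> \<in> mexps k. edeg k \<mu> < D}"
proof (rule finite_subset[OF _ finite_bounded_exps[of k D]])
  have "\<mu> i \<le> D" if "edeg k \<mu> < D" "i < k" for \<mu> i using le_edeg[OF that(2), of \<mu>] that(1) by linarith
  then show "{\<mu> \<in> mexps k. edeg k \<mu> < D} \<subseteq> {\<beta> \<in> mexps k. \<forall>i<k. \<beta> i \<le> D}" by blast
qed

lemma eunit_eq_iff: "eunit c i = eunit d i \<longleftrightarrow> c = d"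
  by (auto simp: eunit_def fun_eq_iff)

lemma nilpotent_of_maximals:
  assumes c: "c \<in> carrier R" and m: "\<And>M. maximalideal M R \<Longrightarrow> c \<in> M"
    and pm: "\<And>P. primeideal P R \<Longrightarrow> maximalideal P R"
  shows "\<exists>k::nat. c [^] k = \<zero>"
proof -
  have "\<exists>k::nat. c [^] k \<in> {\<zero>}"
    by (rule mem_primes_imp_power[OF zeroideal c]) (use m pm in blast)
  then show ?thesis by simp
qed

text \<open>The geometric series in \<open>1 - g\<close>; its terms, and hence its sum, have
  coefficients in \<open>B\<close>.\<close>

lemma power_series_inverse:
  assumes B: "subring B R" and g: "g \<in> vals B n" "g ezero = \<one>"
  shows "\<exists>U\<in>vals B n. g \<otimes>[n] U = \<one>[n]"
proof -
  interpret P: cring "PS n" by (rule cring_ps)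
  have gc: "g \<in> PSC n" by (rule vals_carr[OF g(1)])
  define x where "x = \<one>[n] \<ominus>[n] g"
  have xc: "x \<in> PSC n" using gc by (simp add: x_def)
  have xv: "x \<in> vals B n" unfolding x_def a_minus_def
    by (intro subringE(7)[OF vals_subring[OF B]] subringE(5)[OF vals_subring[OF B]] subringE(3)[OF vals_subring[OF B]] g(1))
  have "x ezero = \<zero>" unfolding x_def using gc g(2) by (simp add: ps_minus ps_one minus_eq r_neg)
  then have x1: "x \<in> fil n 1" using xc fil_1_iff by blast
  define u where "u = (\<lambda>s::nat. x [^][n] s)"
  have uf: "u s \<in> fil n s" for s using fil_pow[OF x1, of s] by (simp add: u_def)
  have uc: "convergent n u" unfolding convergent_def
  proof (intro conjI allI)
    show "u s \<in> PSC n" for s using xc by (simp add: u_def)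
    show "\<exists>T. \<forall>s\<ge>T. u s \<in> fil n D" for D using fil_anti[OF _ uf] by blast
  qed
  have uv: "u s \<in> vals B n" for s
    unfolding u_def by (induction s) (use subringE(3,6)[OF vals_subring[OF B]] xv in auto)
  let ?U = "isum n u"
  have Uc: "?U \<in> PSC n" by (rule isum_closed[OF uc])
  have "?U = u 0 \<oplus>[n] isum n (\<lambda>s. u (Suc s))" by (rule isum_Suc[OF uc])
  also have "(\<lambda>s. u (Suc s)) = (\<lambda>s. x \<otimes>[n] u s)" using xc by (auto simp: u_def P.m_comm)
  also have "isum n (\<lambda>s. x \<otimes>[n] u s) = x \<otimes>[n] ?U" by (rule isum_mult[OF uc xc, symmetric])
  also have "u 0 = \<one>[n]" by (simp add: u_def)
  also have "x \<otimes>[n] ?U = ?U \<ominus>[n] g \<otimes>[n] ?U" using Uc gc by (simp add: x_def P.minus_eq P.l_distr P.l_minus)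
  finally have e: "?U = \<one>[n] \<oplus>[n] (?U \<ominus>[n] g \<otimes>[n] ?U)" .
  have gU: "g \<otimes>[n] ?U \<in> PSC n" using Uc gc by simp
  have "?U \<oplus>[n] g \<otimes>[n] ?U = \<one>[n] \<oplus>[n] ((?U \<ominus>[n] g \<otimes>[n] ?U) \<oplus>[n] g \<otimes>[n] ?U)"
    by (subst e) (use Uc gU in \<open>simp add: P.a_assoc\<close>)
  also have "\<dots> = \<one>[n] \<oplus>[n] ?U" by (simp only: P.diff_add_cancel_cring[OF Uc gU])
  also have "\<dots> = ?U \<oplus>[n] \<one>[n]" using Uc by (simp add: P.a_comm)
  finally have f: "?U \<oplus>[n] g \<otimes>[n] ?U = ?U \<oplus>[n] \<one>[n]" .
  have "g \<otimes>[n] ?U = \<one>[n]"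
    using P.add_eq_imp_diff[OF f Uc gU] P.add_eq_imp_diff[OF refl Uc P.one_closed] by simp
  then show ?thesis using isum_vals[OF B uc uv] by blast
qed

end

section \<open>Primes of the series ring over a maximal ideal of the coefficients\<close>

context power_series_family
begin

text \<open>For an ideal \<open>M\<close>, the kernel of reducing coefficients modulo
  \<open>M\<close> and setting the first \<open>i\<close> variables to zero. For \<open>i\<close>
  from \<open>0\<close> to \<open>k\<close> these ideals form the model chain of primes that
  \<open>chain_above\<close> lifts.\<close>

definition vq :: "'a set \<Rightarrow> nat \<Rightarrow> nat \<Rightarrow> ((nat \<Rightarrow> nat) \<Rightarrow> 'a) set" where
  "vq M k i = {s \<in> SV k. \<forall>\<beta>\<in>mexps k. (\<forall>l<i. \<beta> l = 0) \<longrightarrow> s \<beta> \<in> M}"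

lemma vq_0: assumes M: "ideal M R" shows "s \<in> vq M k 0 \<longleftrightarrow> s \<in> SV k \<and> (\<forall>\<beta>. s \<beta> \<in> M)"
proof -
  interpret M: ideal M R by fact
  have "s \<beta> \<in> M" if "s \<in> SV k" "\<beta> \<notin> mexps k" for \<beta> using ps_outside[OF SV_carr[OF that(1)] that(2)] M.zero_closed by simp
  then show ?thesis by (auto simp: vq_def)
qed

lemma vq_ideal:
  assumes M: "ideal M R" shows "ideal (vq M k i) (SS k)"
proof -
  interpret M: ideal M R by fact
  interpret S: cring "SS k" by (rule cring_ss)
  show ?thesis
  proof (rule S.idealI_cring)
    show "vq M k i \<subseteq> carrier (SS k)" by (auto simp: vq_def)
    show "\<zero>{k} \<in> vq M k i" using SV_zero by (simp add: vq_def ps_zero)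
    show "x \<oplus>{k} y \<in> vq M k i" if "x \<in> vq M k i" "y \<in> vq M k i" for x y
      using that SV_add by (simp add: vq_def ps_add M.a_closed)
    fix c x assume c: "c \<in> carrier (SS k)" and x: "x \<in> vq M k i"
    have "(c \<otimes>[k] x) \<beta> \<in> M" if b: "\<beta> \<in> mexps k" "\<forall>l<i. \<beta> l = 0" for \<beta>
      unfolding ps_mult[OF b(1)]
    proof (rule ideal_finsum[OF M])
      fix \<mu> assume g: "\<mu> \<in> below \<beta>"
      have "x (esub \<beta> \<mu>) \<in> M" using x b by (simp add: vq_def)
      then show "c \<mu> \<otimes> x (esub \<beta> \<mu>) \<in> M" using c SV_coeff by (simp add: M.I_l_closed)
    qed
    then show "c \<otimes>{k} x \<in> vq M k i" using c x SV_mult by (simp add: vq_def)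
  qed
qed

lemma one_notin_vq:
  assumes M: "primeideal M R" shows "\<one>[k] \<notin> vq M k i"
proof
  interpret M: primeideal M R by fact
  assume "\<one>[k] \<in> vq M k i"
  then have "\<one>[k] ezero \<in> M" by (simp add: vq_def)
  then show False using M.one_imp_carrier M.I_notcarr by (simp add: ps_one)
qed

text \<open>A form of Gauss's lemma. Among the sums of an exponent of \<open>s\<close> and one of
  \<open>t\<close> whose coefficients are outside \<open>M\<close>, take the sum of uniquely minimal
  weight. In the coefficient of the product at that exponent exactly one term lies outside
  \<open>M\<close>.\<close>

lemma vq_prime:
  assumes M: "primeideal M R" shows "primeideal (vq M k i) (SS k)"
proof (rule primeidealI)
  interpret M: primeideal M R by fact
  show "ideal (vq M k i) (SS k)" by (rule vq_ideal[OF M.is_ideal])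
  show "cring (SS k)" by (rule cring_ss)
  show "carrier (SS k) \<noteq> vq M k i" using one_notin_vq[OF M] SV_one by auto
  fix s t assume st: "s \<in> carrier (SS k)" "t \<in> carrier (SS k)" "s \<otimes>{k} t \<in> vq M k i"
  show "s \<in> vq M k i \<or> t \<in> vq M k i"
  proof (rule ccontr)
    assume n: "\<not> ?thesis"
    define A where "A = {\<beta> \<in> mexps k. (\<forall>l<i. \<beta> l = 0) \<and> s \<beta> \<notin> M}"
    define B where "B = {\<beta> \<in> mexps k. (\<forall>l<i. \<beta> l = 0) \<and> t \<beta> \<notin> M}"
    have "A \<noteq> {}" "B \<noteq> {}" using n st by (auto simp: A_def B_def vq_def)
    define C where "C = {eadd \<beta> \<mu> | \<beta> \<mu>. \<beta> \<in> A \<and> \<mu> \<in> B}"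
    have CI: "eadd \<beta> \<mu> \<in> C" if "\<beta> \<in> A" "\<mu> \<in> B" for \<beta> \<mu>
      unfolding C_def by (rule CollectI, rule exI[of _ \<beta>], rule exI[of _ \<mu>]) (use that in simp)
    have "C \<subseteq> mexps k" unfolding C_def A_def B_def by auto
    moreover have "C \<noteq> {}" using \<open>A \<noteq> {}\<close> \<open>B \<noteq> {}\<close> unfolding C_def by blast
    ultimately obtain e \<delta> where e: "\<delta> \<in> C" "\<forall>\<beta>\<in>C. \<beta> \<noteq> \<delta> \<longrightarrow> weight e k \<delta> < weight e k \<beta>"
      using unique_minimal_weight[of C k] by blast
    obtain \<beta> \<mu> where bg: "\<beta> \<in> A" "\<mu> \<in> B" "\<delta> = eadd \<beta> \<mu>" using e(1) unfolding C_def by blast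
    have dm: "\<delta> \<in> mexps k" "\<forall>l<i. \<delta> l = 0" using bg unfolding A_def B_def by auto
    have bb: "\<beta> \<in> below \<delta>" "esub \<delta> \<beta> = \<mu>" using bg(3) by (auto simp: below_def)
    have "(\<Oplus>\<beta>\<in>below \<delta>. s \<beta> \<otimes> t (esub \<delta> \<beta>)) \<notin> M"
    proof (rule finsum_notin_ideal[OF M.is_ideal finite_below[OF dm(1)] bb(1)])
      show "s \<beta>' \<otimes> t (esub \<delta> \<beta>') \<in> carrier R" for \<beta>' using st SV_coeff by simp
      show "s \<beta> \<otimes> t (esub \<delta> \<beta>) \<notin> M" unfolding bb(2) using M.I_prime[of "s \<beta>" "t \<mu>"] bg st SV_coeff by (auto simp: A_def B_def)
      fix \<beta>' assume b': "\<beta>' \<in> below \<delta>" "\<beta>' \<noteq> \<beta>"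
      let ?\<mu> = "esub \<delta> \<beta>'"
      have m: "\<beta>' \<in> mexps k" "?\<mu> \<in> mexps k" using below_mexps[OF dm(1) b'(1)] dm(1) by auto
      have le: "\<beta>' l \<le> \<delta> l" for l using b'(1) by (simp add: below_def)
      have v: "\<forall>l<i. \<beta>' l = 0" "\<forall>l<i. ?\<mu> l = 0"
      proof (intro allI impI)
        fix l assume "l < i"
        then show "\<beta>' l = 0" using le[of l] dm(2) by simp
      qed (use dm(2) in simp)
      have "s \<beta>' \<in> M \<or> t ?\<mu> \<in> M"
      proof (rule ccontr)
        assume "\<not> ?thesis"
        then have AB: "\<beta>' \<in> A" "?\<mu> \<in> B" using m v by (auto simp: A_def B_def)
        have "\<beta>' = \<beta>"
        proof (rule weight_unique_sum[of C \<delta> e k \<beta> \<mu> \<beta>' ?\<mu>])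
          show "eadd \<beta> \<mu> = \<delta>" using bg(3) by simp
          show "eadd \<beta>' ?\<mu> = \<delta>" by (rule eadd_esub[OF b'(1)])
          show "eadd \<beta> ?\<mu> \<in> C" by (rule CI[OF bg(1) AB(2)])
          show "eadd \<beta>' \<mu> \<in> C" by (rule CI[OF AB(1) bg(2)])
        qed (use e(2) in blast)
        then show False using b'(2) by simp
      qed
      then show "s \<beta>' \<otimes> t ?\<mu> \<in> M" using M.I_l_closed[of "t ?\<mu>" "s \<beta>'"] M.I_r_closed[of "s \<beta>'" "t ?\<mu>"] st SV_coeff by auto
    qed
    then have "(s \<otimes>[k] t) \<delta> \<notin> M" by (simp only: ps_mult[OF dm(1)] not_False_eq_True)
    then show False using st(3) dm by (simp add: vq_def)
  qed
qed

text \<open>The constant term of \<open>h\<close> is invertible modulo \<open>M\<close>. Scaling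
  \<open>h\<close> and adding a constant from \<open>M\<close>, which lies in \<open>P\<close>,
  gives an element of \<open>P\<close> with constant term \<open>1\<close>, and such a series is a
  unit over its own coefficient subring.\<close>

lemma const_unit:
  assumes M: "maximalideal M R" and P: "ideal P (SS n)" "vq M n 0 \<subseteq> P" and h: "h \<in> P" "h ezero \<notin> M"
  shows "\<one>[n] \<in> P"
proof -
  interpret M: maximalideal M R by fact
  interpret Q: cring "PS n" by (rule cring_ps)
  interpret S: cring "SS n" by (rule cring_ss)
  interpret P: ideal P "SS n" by fact
  have hS: "h \<in> SV n" using P.Icarr[OF h(1)] by simp
  obtain d m where d: "d \<in> carrier R" "m \<in> M" "d \<otimes> h ezero \<oplus> m = \<one>"
    using maximal_unit[OF M SV_coeff[OF hS] h(2)] by blast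
  have mc: "m \<in> carrier R" by (rule M.Icarr[OF d(2)])
  let ?g = "pconst d \<otimes>[n] h \<oplus>[n] pconst m"
  have "pconst m \<in> vq M n 0" using pconst_SV[OF mc] d(2) by (simp add: vq_0[OF M.is_ideal]) (simp add: pconst_def)
  then have "?g \<in> P" using P(2) P.I_l_closed[OF h(1), of "pconst d"] pconst_SV[OF d(1)] P.a_closed by auto
  then have gS: "?g \<in> SV n" using P.Icarr by simp
  then obtain B where B: "B \<in> F" "?g \<in> vals B n" unfolding SV_def by blast
  have "?g ezero = \<one>" using d(1,3) SV_carr[OF hS] by (simp add: ps_add const_mult) (simp add: pconst_def)
  then obtain U where U: "U \<in> vals B n" "?g \<otimes>[n] U = \<one>[n]"
    using power_series_inverse[OF F_subring[OF B(1)] B(2)] by blast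
  show ?thesis using P.I_r_closed[OF \<open>?g \<in> P\<close>, of U] vals_SV[OF B(1) U(1)] U(2) by simp
qed

lemma ev_vq:
  assumes M: "ideal M R" and y: "\<And>l. l < k \<Longrightarrow> y l \<in> SV n" "small n y k" and s: "s \<in> vq M k 0"
  shows "ev n y k s \<in> vq M n 0"
proof -
  interpret M: ideal M R by fact
  interpret Q: cring "PS n" by (rule cring_ps)
  have sS: "s \<in> SV k" "\<And>\<beta>. s \<beta> \<in> M" using s by (auto simp: vq_0[OF M])
  have "ev n y k s \<nu> \<in> M" for \<nu>
    unfolding ev_coeff[OF y(2) SV_carr[OF sS(1)]]
  proof (rule ideal_finsum[OF M])
    fix \<mu>
    have "wpow (PS n) y k \<mu> \<in> PSC n" by (rule Q.wpow_closed[of k]) (use y SV_carr in auto)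
    from M.I_r_closed[OF sS(2)[of \<mu>] ps_coeff_closed[OF this, of \<nu>]]
    show "s \<mu> \<otimes> wpow (PS n) y k \<mu> \<nu> \<in> M" .
  qed
  then show ?thesis using ev_SV[OF y sS(1)] by (simp add: vq_0[OF M])
qed

text \<open>Let \<open>N\<close> be the contraction of \<open>Q\<close> and \<open>e\<close> the
  idempotent lying in all maximal ideals except \<open>N\<close>. For a series \<open>f\<close> over
  \<open>N\<close> the coefficients of \<open>e f\<close> lie in every maximal ideal and are
  nilpotent, so \<open>e f\<close> is nilpotent by \<open>F_nil\<close> and belongs to
  \<open>Q\<close>; as \<open>e\<close> does not, \<open>f\<close> does. This is where the Artinian
  hypothesis enters.\<close>

lemma contraction:
  assumes Q: "primeideal Q (SS n)"
  shows "\<exists>M. maximalideal M R \<and> vq M n 0 \<subseteq> Q \<and> (\<forall>c\<in>carrier R. pconst c \<in> Q \<longleftrightarrow> c \<in> M)"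
proof -
  interpret S: cring "SS n" by (rule cring_ss)
  interpret Q: primeideal Q "SS n" by fact
  interpret h: ring_hom_cring R "SS n" pconst by (rule pconst_hom)
  define N where "N = {c \<in> carrier R. pconst c \<in> Q}"
  have N_iff: "c \<in> N \<longleftrightarrow> pconst c \<in> Q" if "c \<in> carrier R" for c using that by (simp add: N_def)
  have M: "maximalideal N R" unfolding N_def by (rule prime_maximal[OF h.ring.primeideal_vimage[OF is_cring Q]])
  then have Mi: "ideal N R" by (simp add: maximalideal_def)
  obtain e where e: "e \<in> carrier R" "\<forall>M. maximalideal M R \<longrightarrow> (e \<in> M \<longleftrightarrow> M \<notin> {N})"
    using idempotents[of "{N}"] M by blast
  have eM: "e \<in> M' \<longleftrightarrow> M' \<noteq> N" if "maximalideal M' R" for M' using e(2) that by blast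
  have "vq N n 0 \<subseteq> Q"
  proof
    fix f assume f: "f \<in> vq N n 0"
    then have fS: "f \<in> SV n" "\<And>\<beta>. f \<beta> \<in> N" using vq_0[OF Mi] by blast+
    obtain B where B: "B \<in> F" "{pconst e \<otimes>[n] f} \<subseteq> vals B n"
      using F_common1[of "{pconst e \<otimes>[n] f}" n] SV_mult[OF pconst_SV[OF e(1)] fS(1)] by auto
    have "\<exists>k::nat. (pconst e \<otimes>[n] f) \<nu> [^] k = \<zero>" for \<nu>
      unfolding const_mult[OF e(1) SV_carr[OF fS(1)]]
    proof (rule nilpotent_of_maximals[OF _ _ prime_maximal])
      have fc: "f \<nu> \<in> carrier R" by (rule SV_coeff[OF fS(1)])
      then show "e \<otimes> f \<nu> \<in> carrier R" using e(1) by simp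
      fix M' assume M': "maximalideal M' R"
      interpret M': maximalideal M' R by fact
      show "e \<otimes> f \<nu> \<in> M'"
      proof (cases "M' = N")
        case True
        then have "f \<nu> \<in> M'" using fS(2)[of \<nu>] by (simp only:)
        then show ?thesis by (rule M'.I_l_closed[OF _ e(1)])
      next
        case False
        then have "e \<in> M'" using eM[OF M'] by simp
        then show ?thesis by (rule M'.I_r_closed[OF _ fc])
      qed
    qed
    then obtain k :: nat where "(pconst e \<otimes>[n] f) [^][n] k = \<zero>[n]" using F_nil[OF B(1), of "pconst e \<otimes>[n] f" n] B(2) by auto
    then have "(pconst e \<otimes>[n] f) [^]{n} k \<in> Q" using Q.zero_closed by simp
    then have "pconst e \<otimes>[n] f \<in> Q"
      using S.primeideal_pow[OF Q, of "pconst e \<otimes>[n] f" k] SV_mult[OF pconst_SV[OF e(1)] fS(1)] by simp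
    then have "pconst e \<in> Q \<or> f \<in> Q" using Q.I_prime[of "pconst e" f] pconst_SV[OF e(1)] fS(1) by simp
    moreover have "pconst e \<notin> Q" using N_iff[OF e(1)] eM[OF M] by simp
    ultimately show "f \<in> Q" by simp
  qed
  then show ?thesis using M N_iff by blast
qed

text \<open>The maximal ideal to which \<open>Q'\<close> contracts lies inside the one for
  \<open>Q\<close>, so the two coincide, and \<open>contraction\<close> applied to \<open>Q'\<close>
  gives the claim.\<close>

lemma vq_subset_mono:
  assumes M: "maximalideal M R" and Q: "primeideal Q (SS n)" "vq M n 0 \<subseteq> Q" and Q': "primeideal Q' (SS n)" "Q' \<subseteq> Q"
  shows "vq M n 0 \<subseteq> Q'"
proof -
  obtain M1 where M1: "maximalideal M1 R" "\<forall>c\<in>carrier R. pconst c \<in> Q \<longleftrightarrow> c \<in> M1" using contraction[OF Q(1)] by blast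
  obtain M2 where M2: "maximalideal M2 R" "vq M2 n 0 \<subseteq> Q'" "\<forall>c\<in>carrier R. pconst c \<in> Q' \<longleftrightarrow> c \<in> M2" using contraction[OF Q'(1)] by blast
  interpret M: maximalideal M R by fact
  interpret M1: maximalideal M1 R by fact
  interpret M2: maximalideal M2 R by fact
  have "M \<subseteq> M1"
  proof
    fix m assume m: "m \<in> M"
    have mc: "m \<in> carrier R" by (rule M.Icarr[OF m])
    have "pconst m \<in> vq M n 0" using pconst_SV[OF mc] m by (simp add: vq_0[OF M.is_ideal]) (simp add: pconst_def)
    then show "m \<in> M1" using Q(2) M1(2) mc by blast
  qed
  moreover have "M2 \<subseteq> M1"
  proof
    fix m assume m: "m \<in> M2"
    then show "m \<in> M1" using M1(2) M2(3) M2.Icarr[OF m] Q'(2) by blast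
  qed
  ultimately have "M1 = M" "M1 = M2"
    using M.I_maximal[OF M1.is_ideal] M2.I_maximal[OF M1.is_ideal] ideal_subset[OF M1.is_ideal] M1.I_notcarr by blast+
  then show ?thesis using M2(2) by simp
qed

text \<open>The change of variables of Noether normalisation, expressed through ideals. Weights
  \<open>e\<close> making one exponent of \<open>a\<close> uniquely minimal are chosen, and every
  \<open>X_i\<close> is identified with the \<open>e i\<close>-th power of \<open>X_0\<close> by
  means of the \<open>z\<close>. What \<open>a\<close> becomes is, modulo \<open>M\<close>, exactly
  of order \<open>D\<close> in \<open>X_0\<close>. A prime containing \<open>a\<close>, the
  \<open>z\<close> and all series over \<open>M\<close> then contains \<open>X_0\<close> and with it
  every variable.\<close>

lemma parameter_reduction:
  assumes M: "maximalideal M R" and a: "a \<in> SV k" "a \<notin> vq M k 0" and k: "k = Suc k'"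
  shows "\<exists>z. (\<forall>i<k'. z i \<in> SV k) \<and> small k z k' \<and>
    (\<forall>P. primeideal P (SS k) \<longrightarrow> vq M k 0 \<subseteq> P \<longrightarrow> a \<in> P \<longrightarrow> (\<forall>i<k'. z i \<in> P) \<longrightarrow> (\<forall>i<k. xvar i \<in> P))"
proof -
  interpret M: maximalideal M R by fact
  interpret Q: cring "PS k" by (rule cring_ps)
  interpret S: cring "SS k" by (rule cring_ss)
  define A where "A = {\<beta> \<in> mexps k. a \<beta> \<notin> M}"
  have "A \<noteq> {}" using a by (auto simp: A_def vq_def)
  moreover have "A \<subseteq> mexps k" by (auto simp: A_def)
  ultimately obtain e \<delta> where e: "\<delta> \<in> A" "e 0 = 1" "\<forall>i. 1 \<le> e i" "\<forall>\<beta>\<in>A. \<beta> \<noteq> \<delta> \<longrightarrow> weight e k \<delta> < weight e k \<beta>"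
    using unique_minimal_weight[of A k] by blast
  define D where "D = weight e k \<delta>"
  have k0: "0 < k" using k by simp
  obtain B where B: "B \<in> F" "{a} \<subseteq> vals B k" using F_common1[of "{a}" k] a(1) by auto
  note BR = F_subring[OF B(1)]
  define v where "v = (\<lambda>i. pmono (eunit (e i) 0) :: (nat \<Rightarrow> nat) \<Rightarrow> 'a)"
  have vm: "eunit (e i) 0 \<in> mexps k" for i by (rule eunit_mexps[OF k0])
  have vB: "v i \<in> vals B k" for i unfolding v_def by (rule pmono_vals[OF BR vm])
  have v1: "v i \<in> fil k 1" for i
  proof -
    have "eunit (e i) 0 0 \<noteq> 0" using e(3)[THEN spec, of i] by (simp add: eunit_def)
    then have "eunit (e i) 0 \<noteq> ezero" by metis
    then have "v i ezero = \<zero>" by (simp add: v_def pmono_eq)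
    then show ?thesis using vals_carr[OF vB] fil_1_iff by blast
  qed
  have vs: "small k v k" using v1 by (simp add: small_def)
  \<comment> \<open>Because \<open>e 0 = 1\<close>, the difference at index \<open>0\<close>
    vanishes; only \<open>k'\<close> differences remain to be used as new elements.\<close>
  have x0: "v 0 = xvar 0" by (simp add: v_def xvar_def e(2))
  obtain h where h: "\<forall>j. h j \<in> vals B k"
    "ev k xvar k a = ev k v k a \<oplus>[k] sumr (PS k) (\<lambda>j. (xvar j \<ominus>[k] v j) \<otimes>[k] h j) k"
    using ev_difference[OF BR small_xvar xvar_vals[OF BR] vs vB, where s = a] B(2) by auto
  define g where "g = ev k v k a"
  define \<sigma> where "\<sigma> = sumr (PS k) (\<lambda>j. (xvar j \<ominus>[k] v j) \<otimes>[k] h j) k"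
  have agh: "a = g \<oplus>[k] \<sigma>" using h(2) ev_xvar[OF SV_carr[OF a(1)]] by (simp add: g_def \<sigma>_def)
  have gB: "g \<in> vals B k" unfolding g_def by (rule ev_vals[OF vs BR vB]) (use B(2) in simp)
  have gS: "g \<in> SV k" by (rule vals_SV[OF B(1) gB])
  have exps: "(\<lambda>l. \<Sum>j<k. \<mu> j * eunit (e j) 0 l) = eunit (weight e k \<mu>) 0" for \<mu>
    by (auto simp: eunit_def weight_def fun_eq_iff)
  have wp: "wpow (PS k) v k \<mu> = pmono (eunit (weight e k \<mu>) 0)" for \<mu>
    using wpow_monomials[where k = k and v = v and m = "\<lambda>j. eunit (e j) 0" and n = k and i = k and \<beta> = \<mu>] vm by (simp add: v_def exps)
  let ?G = "\<lambda>\<nu>. {\<mu> \<in> mexps k. edeg k \<mu> < Suc (edeg k \<nu>)}"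
  have gc: "g \<nu> = (\<Oplus>\<mu>\<in>?G \<nu>. a \<mu> \<otimes> (if eunit (weight e k \<mu>) 0 = \<nu> then \<one> else \<zero>))" for \<nu>
    unfolding g_def ev_coeff[OF vs SV_carr[OF a(1)]] wp pmono_eq ..
  have ac: "a \<mu> \<in> carrier R" for \<mu> by (rule SV_coeff[OF a(1)])
  have gM: "g \<nu> \<in> M" if \<nu>: "\<nu> 0 < D" for \<nu>
    unfolding gc
  proof (rule ideal_finsum[OF M.is_ideal])
    fix \<mu> assume "\<mu> \<in> ?G \<nu>"
    show "a \<mu> \<otimes> (if eunit (weight e k \<mu>) 0 = \<nu> then \<one> else \<zero>) \<in> M"
    proof (cases "eunit (weight e k \<mu>) 0 = \<nu>")
      case True
      then have "weight e k \<mu> < D" using \<nu> by (auto simp: eunit_def)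
      then have "\<mu> \<notin> A" using e(4) unfolding D_def by (cases "\<mu> = \<delta>") auto
      then have "a \<mu> \<in> M" using \<open>\<mu> \<in> ?G \<nu>\<close> by (simp add: A_def)
      then show ?thesis using True ac by simp
    qed (use ac M.zero_closed in simp)
  qed
  have gD: "g (eunit D 0) \<notin> M"
    unfolding gc
  proof (rule finsum_notin_ideal[OF M.is_ideal finite_edeg_less, of \<delta>])
    have "edeg k \<delta> \<le> D" unfolding D_def weight_def edeg_def by (rule sum_mono) (use e(3) in simp)
    then show "\<delta> \<in> ?G (eunit D 0)" using e(1) k0 by (simp add: A_def)
    show "a \<mu> \<otimes> (if eunit (weight e k \<mu>) 0 = eunit D 0 then \<one> else \<zero>) \<in> carrier R" for \<mu> using ac by simp
    show "a \<delta> \<otimes> (if eunit (weight e k \<delta>) 0 = eunit D 0 then \<one> else \<zero>) \<notin> M" using e(1) ac by (simp add: A_def D_def)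
    fix \<mu> assume g: "\<mu> \<in> ?G (eunit D 0)" "\<mu> \<noteq> \<delta>"
    show "a \<mu> \<otimes> (if eunit (weight e k \<mu>) 0 = eunit D 0 then \<one> else \<zero>) \<in> M"
    proof (cases "weight e k \<mu> = D")
      case True
      then have "\<mu> \<notin> A" using e(4) g(2) unfolding D_def by auto
      then have "a \<mu> \<in> M" using g(1) by (simp add: A_def)
      then show ?thesis using True ac by simp
    next
      case False
      then show ?thesis using ac M.zero_closed by (simp add: eunit_eq_iff)
    qed
  qed
  \<comment> \<open>Below order \<open>D\<close> in \<open>X_0\<close> all coefficients lie in
    \<open>M\<close>; the rest is the \<open>D\<close>-th power of \<open>X_0\<close> times a series
    whose constant term is outside \<open>M\<close>.\<close>
  let ?g1 = "\<lambda>\<nu>. if \<nu> 0 < D then g \<nu> else \<zero>" and ?h = "\<lambda>\<nu>. g (eadd \<nu> (eunit D 0))"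
  note sp = split_var[OF BR gB k0, of D]
  have g1: "?g1 \<in> vq M k 0" using vals_SV[OF B(1) sp(2)] gM M.zero_closed by (simp add: vq_0[OF M.is_ideal])
  have hS: "?h \<in> SV k" by (rule vals_SV[OF B(1) sp(1)])
  have h0: "?h ezero \<notin> M" using gD by simp
  define z where "z = (\<lambda>i. xvar (Suc i) \<ominus>[k] v (Suc i))"
  have zS: "z i \<in> SV k" if "i < k'" for i
    unfolding z_def by (rule SV_minus[OF xvar_SV vals_SV[OF B(1) vB]]) (use that k in simp)
  have zs: "small k z k'"
    unfolding small_def z_def a_minus_def
  proof (intro allI impI)
    fix j assume j: "j < k'"
    interpret fi: ideal "fil k 1" "PS k" by (rule fil_ideal)
    show "xvar (Suc j) \<oplus>[k] \<ominus>[k] v (Suc j) \<in> fil k 1"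
      by (intro fi.a_closed Q.ideal_minus_closed2[OF fil_ideal] v1 smallD[OF small_xvar]) (use j k in simp)
  qed
  have vpow: "v i = xvar 0 [^][k] (e i)" for i
    unfolding xvar_def v_def mono_pow[OF eunit_mexps[OF k0]] by (simp add: eunit_def fun_eq_iff if_distrib cong: if_cong)
  have Dpow: "pmono (eunit D 0) = xvar 0 [^][k] D"
    unfolding xvar_def mono_pow[OF eunit_mexps[OF k0]] by (simp add: eunit_def fun_eq_iff if_distrib cong: if_cong)
  show ?thesis
  proof (intro exI[of _ z] conjI allI impI zS zs)
    fix P i assume P: "primeideal P (SS k)" "vq M k 0 \<subseteq> P" "a \<in> P" "\<forall>i<k'. z i \<in> P" and i: "i < k"
    interpret P: primeideal P "SS k" by fact
    have x0S: "xvar 0 \<in> SV k" by (rule xvar_SV[OF k0])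
    have "sumr (SS k) (\<lambda>j. (xvar j \<ominus>[k] v j) \<otimes>{k} h j) k \<in> P"
    proof (rule S.sumr_ideal[OF P.is_ideal])
      fix j assume j: "j < k"
      have "xvar j \<ominus>[k] v j \<in> P"
      proof (cases j)
        case 0
        then show ?thesis using x0 P.zero_closed SV_carr[OF x0S] by (simp add: Q.minus_eq Q.r_neg)
      next
        case (Suc j')
        then show ?thesis using P(4) j k by (simp add: z_def)
      qed
      then show "(xvar j \<ominus>[k] v j) \<otimes>{k} h j \<in> P"
        by (rule P.I_r_closed) (use h(1) vals_SV[OF B(1)] in simp)
    qed
    then have "\<sigma> \<in> P" by (simp add: \<sigma>_def sumr_update_carrier)
    then have gP: "g \<in> P" using S.ideal_add_cancel[OF P.is_ideal, of g \<sigma>] P(3) agh gS by simp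
    have ph: "pmono (eunit D 0) \<otimes>[k] ?h \<in> SV k" by (rule SV_mult[OF pmono_SV[OF eunit_mexps[OF k0]] hS])
    have "?g1 \<in> P" using g1 P(2) by blast
    moreover have "pmono (eunit D 0) \<otimes>[k] ?h \<oplus>[k] ?g1 = g"
      using sp(3) Q.a_comm[OF SV_carr[OF ph] vals_carr[OF sp(2)]] by simp
    ultimately have "pmono (eunit D 0) \<otimes>[k] ?h \<in> P"
      using S.ideal_add_cancel[OF P.is_ideal, of "pmono (eunit D 0) \<otimes>[k] ?h" ?g1] gP ph by simp
    then have "pmono (eunit D 0) \<in> P \<or> ?h \<in> P"
      using P.I_prime[of "pmono (eunit D 0)" ?h] pmono_SV[OF eunit_mexps[OF k0]] hS by simp
    moreover have "?h \<notin> P"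
    proof
      assume "?h \<in> P"
      then have "\<one>[k] \<in> P" using const_unit[OF M P.is_ideal P(2), of ?h] h0 by blast
      then show False using P.one_imp_carrier P.I_notcarr by simp
    qed
    ultimately have "xvar 0 [^]{k} D \<in> P" by (simp add: Dpow)
    then have x0P: "xvar 0 \<in> P" using S.primeideal_pow[OF P(1), of "xvar 0" D] x0S by simp
    show "xvar i \<in> P"
    proof (cases i)
      case 0
      then show ?thesis using x0P by simp
    next
      case (Suc i')
      have "0 < e i" using e(3)[THEN spec, of i] by simp
      then have "xvar 0 [^]{k} (e i) \<in> P" by (rule S.primeideal_pow_iff[OF P(1) x0P])
      then have vP: "v i \<in> P" by (simp add: vpow)
      have "z i' \<in> P" using P(4) Suc i k by simp
      then have "xvar i \<ominus>{k} v i \<in> P" using Suc ss_minus[OF xvar_SV[OF i] vals_SV[OF B(1) vB]] by (simp add: z_def)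
      then show ?thesis by (rule S.ideal_diff_mem[OF P.is_ideal _ vP]) (use xvar_SV[OF i] in simp)
    qed
  qed
qed

end

context cring
begin

lemma wpow_fun_cong: "(\<And>j. j < i \<Longrightarrow> w j = v j) \<Longrightarrow> wpow R w i \<mu> = wpow R v i \<mu>"
  by (induction i) auto

lemma wpow_extend_zero:
  assumes y: "\<And>j. j < k \<Longrightarrow> y j \<in> carrier R"
  shows "wpow R (\<lambda>j. if j < k then y j else \<zero>) (k + m) \<mu> =
    (if \<forall>i. k \<le> i \<and> i < k + m \<longrightarrow> \<mu> i = 0 then wpow R y k \<mu> else \<zero>)"
proof (induction m)
  case 0
  have "wpow R (\<lambda>j. if j < k then y j else \<zero>) k \<mu> = wpow R y k \<mu>" by (rule wpow_fun_cong) simp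
  then show ?case by simp
next
  case (Suc m)
  have c: "wpow R y k \<mu> \<in> carrier R" by (rule wpow_closed[OF y]) auto
  have e: "(\<forall>i. k \<le> i \<and> i < k + Suc m \<longrightarrow> \<mu> i = 0) \<longleftrightarrow> (\<forall>i. k \<le> i \<and> i < k + m \<longrightarrow> \<mu> i = 0) \<and> \<mu> (k + m) = 0"
    using less_Suc_eq by auto
  have "wpow R (\<lambda>j. if j < k then y j else \<zero>) (k + Suc m) \<mu> =
      (if \<forall>i. k \<le> i \<and> i < k + m \<longrightarrow> \<mu> i = 0 then wpow R y k \<mu> else \<zero>) \<otimes> \<zero> [^] \<mu> (k + m)"
    using Suc by simp
  also have "\<dots> = (if \<forall>i. k \<le> i \<and> i < k + Suc m \<longrightarrow> \<mu> i = 0 then wpow R y k \<mu> else \<zero>)"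
    unfolding e using c by (cases "\<mu> (k + m) = 0") (auto simp: nat_pow_zero)
  finally show ?case .
qed

lemma minus_add_cancel':
  assumes "a \<in> carrier R" "b \<in> carrier R" shows "b \<ominus> (a \<oplus> b) = \<ominus> a"
proof -
  have "b \<ominus> (a \<oplus> b) = \<ominus> a \<oplus> (b \<oplus> \<ominus> b)" using assms by (simp add: minus_eq minus_add a_ac)
  then show ?thesis using assms by (simp add: r_neg)
qed

lemma sumr_append:
  assumes "\<And>i. i < k + m \<Longrightarrow> f i \<in> carrier R"
  shows "sumr R f (k + m) = sumr R f k \<oplus> sumr R (\<lambda>j. f (k + j)) m"
  using assms
proof (induction m)
  case 0
  have "sumr R f k \<in> carrier R" by (rule sumr_closed') (use 0 in auto)
  then show ?case by simp
next
  case (Suc m)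
  have "sumr R f k \<in> carrier R" "sumr R (\<lambda>j. f (k + j)) m \<in> carrier R"
    by (rule sumr_closed'; use Suc.prems in auto)+
  then show ?case using Suc by (simp add: a_assoc)
qed

text \<open>Coefficients of a polynomial value are exchanged modulo \<open>I\<close> one power at a
  time; this moves an integral equation from one coefficient subring to another.\<close>

lemma low_congruence:
  assumes I: "ideal I R" and E: "subring E R" and E': "subring E' R" and s: "s \<in> carrier R"
    and b: "\<And>b. b \<in> E \<Longrightarrow> \<exists>b'\<in>E'. \<exists>i\<in>I. b = b' \<oplus> i" and l: "l \<in> low R E s d"
  shows "\<exists>l'\<in>low R E' s d. \<exists>i\<in>I. l = l' \<oplus> i"
  using l
proof (induction d arbitrary: l)
  case 0
  interpret I: ideal I R by fact
  show ?case using 0 I.zero_closed by auto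
next
  case (Suc d)
  interpret I: ideal I R by fact
  obtain l0 b0 where l0: "l = l0 \<oplus> b0 \<otimes> s [^] d" "l0 \<in> low R E s d" "b0 \<in> E" using Suc.prems by auto
  obtain l1 i where l1: "l1 \<in> low R E' s d" "i \<in> I" "l0 = l1 \<oplus> i" using Suc.IH[OF l0(2)] by blast
  obtain b1 j where b1: "b1 \<in> E'" "j \<in> I" "b0 = b1 \<oplus> j" using b[OF l0(3)] by blast
  have c: "l1 \<in> carrier R" "b1 \<in> carrier R" "i \<in> carrier R" "j \<in> carrier R" "s [^] d \<in> carrier R"
    using low_carr[OF E' s l1(1)] subringE(1)[OF E'] b1 l1(2) I.Icarr s by auto
  have "l = (l1 \<oplus> b1 \<otimes> s [^] d) \<oplus> (i \<oplus> j \<otimes> s [^] d)"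
    unfolding l0(1) l1(3) b1(3) using c by (simp add: l_distr a_ac)
  moreover have "i \<oplus> j \<otimes> s [^] d \<in> I" using l1(2) I.I_r_closed[OF b1(2) c(5)] by (rule I.a_closed)
  moreover have "l1 \<oplus> b1 \<otimes> s [^] d \<in> low R E' s (Suc d)" using l1(1) b1(1) by auto
  ultimately show ?case by blast
qed

lemma ev_extend_zero:
  assumes sm: "small n y k" and a: "a \<in> PSC (k + m)"
  shows "ev n (\<lambda>j. if j < k then y j else \<zero>[n]) (k + m) a = ev n y k (\<lambda>\<mu>. if \<mu> \<in> mexps k then a \<mu> else \<zero>)"
proof -
  interpret P: cring "PS n" by (rule cring_ps)
  interpret fi: ideal "fil n 1" "PS n" by (rule fil_ideal)
  let ?v = "\<lambda>j. if j < k then y j else \<zero>[n]" and ?a = "\<lambda>\<mu>. if \<mu> \<in> mexps k then a \<mu> else \<zero>"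
  have yc: "\<And>j. j < k \<Longrightarrow> y j \<in> PSC n" by (rule small_carr[OF sm])
  have vs: "small n ?v (k + m)" using smallD[OF sm] fi.zero_closed by (simp add: small_def)
  have ac: "a \<mu> \<in> carrier R" for \<mu> by (rule ps_coeff_closed[OF a])
  have ac': "?a \<in> PSC k" using ac by (simp add: ps_carrier_iff)
  have sub: "mexps k \<subseteq> mexps (k + m)" by (auto simp: mexps_def)
  have mk: "\<mu> \<in> mexps (k + m) \<Longrightarrow> (\<forall>i. k \<le> i \<and> i < k + m \<longrightarrow> \<mu> i = 0) \<longleftrightarrow> \<mu> \<in> mexps k" for \<mu>
    by (auto simp: mexps_def not_less) (metis not_less)
  have ed: "edeg (k + m) \<mu> = edeg k \<mu>" if "\<mu> \<in> mexps k" for \<mu>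
    unfolding edeg_def by (rule sum.mono_neutral_right) (use that in \<open>auto simp: mexps_def\<close>)
  show ?thesis
  proof
    fix \<nu>
    let ?D = "Suc (edeg n \<nu>)"
    have "ev n ?v (k + m) a \<nu> = (\<Oplus>\<mu>\<in>{\<mu> \<in> mexps (k + m). edeg (k + m) \<mu> < ?D}. a \<mu> \<otimes> wpow (PS n) ?v (k + m) \<mu> \<nu>)"
      by (rule ev_coeff[OF vs a])
    also have "\<dots> = (\<Oplus>\<mu>\<in>{\<mu> \<in> mexps k. edeg k \<mu> < ?D}. ?a \<mu> \<otimes> wpow (PS n) y k \<mu> \<nu>)"
    proof (rule add.finprod_mono_neutral_cong_right[OF finite_edeg_less])
      show "{\<mu> \<in> mexps k. edeg k \<mu> < ?D} \<subseteq> {\<mu> \<in> mexps (k + m). edeg (k + m) \<mu> < ?D}" using sub ed by auto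
      show "a \<mu> \<otimes> wpow (PS n) ?v (k + m) \<mu> \<nu> = \<zero>"
        if g: "\<mu> \<in> {\<mu> \<in> mexps (k + m). edeg (k + m) \<mu> < ?D} - {\<mu> \<in> mexps k. edeg k \<mu> < ?D}" for \<mu>
      proof -
        have "\<mu> \<notin> mexps k" using g ed by auto
        then have "wpow (PS n) ?v (k + m) \<mu> = \<zero>[n]" using P.wpow_extend_zero[OF yc, where m = m and \<mu> = \<mu>] mk g by simp
        then show ?thesis using ac by (simp add: ps_zero)
      qed
      show "a \<mu> \<otimes> wpow (PS n) ?v (k + m) \<mu> \<nu> = ?a \<mu> \<otimes> wpow (PS n) y k \<mu> \<nu>"
        if g: "\<mu> \<in> {\<mu> \<in> mexps k. edeg k \<mu> < ?D}" for \<mu>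
        using P.wpow_extend_zero[OF yc, where m = m and \<mu> = \<mu>] mk[of \<mu>] g sub by auto
      have "wpow (PS n) ?v (k + m) \<mu> \<nu> \<in> carrier R" for \<mu>
        by (rule ps_coeff_closed[OF P.wpow_closed[of "k + m"]]) (use yc in auto)
      then show "(\<lambda>\<mu>. a \<mu> \<otimes> wpow (PS n) ?v (k + m) \<mu> \<nu>) \<in> {\<mu> \<in> mexps (k + m). edeg (k + m) \<mu> < ?D} \<rightarrow> carrier R"
        using ac by simp
    qed
    also have "\<dots> = ev n y k ?a \<nu>" by (rule ev_coeff[OF sm ac', symmetric])
    finally show "ev n ?v (k + m) a \<nu> = ev n y k ?a \<nu>" .
  qed
qed

lemma ev_coeff_ezero:
  assumes sm: "small n y k" and a: "a \<in> PSC k"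
  shows "ev n y k a ezero = a ezero"
proof -
  interpret P: cring "PS n" by (rule cring_ps)
  have "{\<mu> \<in> mexps k. edeg k \<mu> < Suc (edeg n ezero)} = {ezero}" using edeg_0_iff by auto
  then have "ev n y k a ezero = (\<Oplus>\<mu>\<in>{ezero}. a \<mu> \<otimes> wpow (PS n) y k \<mu> ezero)" using ev_coeff[OF sm a, of ezero] by simp
  also have "wpow (PS n) y k ezero ezero = \<one>" using P.wpow_ezero[where i = k and w = y and k = k, OF small_carr[OF sm]] by (simp add: ps_one)
  then have "(\<Oplus>\<mu>\<in>{ezero}. a \<mu> \<otimes> wpow (PS n) y k \<mu> ezero) = a ezero" using ps_coeff_closed[OF a] by simp
  finally show ?thesis .
qed

end

section \<open>Systems of parameters and chains of primes\<close>

context power_series_family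
begin

text \<open>A system of parameters of the quotient by \<open>I\<close>, not necessarily of minimal length.\<close>

definition sop :: "nat \<Rightarrow> ((nat \<Rightarrow> nat) \<Rightarrow> 'a) set \<Rightarrow> nat \<Rightarrow> (nat \<Rightarrow> (nat \<Rightarrow> nat) \<Rightarrow> 'a) \<Rightarrow> bool" where
  "sop n I k y \<longleftrightarrow> (\<forall>l<k. y l \<in> SV n) \<and> small n y k \<and>
     (\<forall>P. primeideal P (SS n) \<longrightarrow> I \<subseteq> P \<longrightarrow> (\<forall>l<k. y l \<in> P) \<longrightarrow> (\<forall>i<n. xvar i \<in> P))"

lemma sop_xvar: "sop n I n xvar"
  by (simp add: sop_def xvar_SV small_xvar)

lemma sop_mono: "sop n I k y \<Longrightarrow> I \<subseteq> J \<Longrightarrow> sop n J k y"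
  unfolding sop_def by (meson subset_trans)

text \<open>Powers of the variables equal a combination of the \<open>y l\<close> only up to
  elements \<open>u i\<close> of \<open>I\<close>, whereas \<open>power_series_integral\<close>
  wants an exact relation. The \<open>u i\<close> are therefore adjoined as further arguments of the
  substitution, and afterwards set to zero at the cost of an error in \<open>I\<close>.\<close>

lemma integral_mod:
  assumes I: "ideal I (SS n)" and sop: "sop n I k y" and s: "s \<in> SV n"
  shows "\<exists>d l. l \<in> low (SS n) (ev n y k ` SV k) s d \<and> s [^][n] d \<oplus>[n] l \<in> I"
proof -
  interpret P: cring "PS n" by (rule cring_ps)
  interpret S: cring "SS n" by (rule cring_ss)
  interpret Sk: cring "SS k" by (rule cring_ss)
  interpret I: ideal I "SS n" by fact
  interpret fi: ideal "fil n 1" "PS n" by (rule fil_ideal)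
  have yS: "y l \<in> SV n" if "l < k" for l using sop that by (simp add: sop_def)
  have ys: "small n y k" using sop by (simp add: sop_def)
  have "\<exists>L u c. 0 < L \<and> (\<forall>i<n. u i \<in> I \<and> (\<forall>l. c i l \<in> carrier (SS n)) \<and>
      xvar i [^]{n} (L::nat) = u i \<oplus>{n} sumr (SS n) (\<lambda>l. y l \<otimes>{n} c i l) k)"
  proof (rule S.rad_sumr[OF I])
    show "y l \<in> carrier (SS n)" if "l < k" for l using yS[OF that] by simp
    show "xvar i \<in> carrier (SS n)" if "i < n" for i using xvar_SV[OF that] by simp
    show "xvar i \<in> P" if "i < n" "primeideal P (SS n)" "I \<subseteq> P" "\<forall>l<k. y l \<in> P" for i P
      using sop that by (simp add: sop_def)
  qed
  then obtain L u c where L: "0 < L" and uc: "\<forall>i<n. u i \<in> I \<and> (\<forall>l. c i l \<in> carrier (SS n)) \<and>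
      xvar i [^]{n} (L::nat) = u i \<oplus>{n} sumr (SS n) (\<lambda>l. y l \<otimes>{n} c i l) k" by (elim exE conjE)
  have uI: "u i \<in> I" if "i < n" for i using uc that by blast
  have uS: "u i \<in> SV n" if "i < n" for i using I.Icarr[OF uI[OF that]] by simp
  have cS: "c i l \<in> SV n" if "i < n" for i l using uc that by simp
  have xL: "pmono (eunit L i) = u i \<oplus>[n] sumr (PS n) (\<lambda>l. y l \<otimes>[n] c i l) k" if i: "i < n" for i
  proof -
    have "xvar i [^]{n} L = pmono (eunit L i)"
      unfolding xvar_def using mono_pow[OF eunit_mexps[OF i], of 1 L] by (simp add: eunit_def if_distrib cong: if_cong)
    then show ?thesis using uc i by (simp add: sumr_update_carrier)
  qed
  \<comment> \<open>All series that enter the division, gathered so that one member \<open>B\<close>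
    of the family contains their coefficients.\<close>
  define X where "X = {s} \<union> u ` {..<n} \<union> y ` {..<k} \<union> (\<lambda>p. c (fst p) (snd p)) ` ({..<n} \<times> {..<k})"
  have "X \<subseteq> SV n" using s uS yS cS unfolding X_def by auto
  moreover have "finite X" unfolding X_def by simp
  ultimately obtain B where B: "B \<in> F" "X \<subseteq> vals B n" using F_common1[of X n] by blast
  note BR = F_subring[OF B(1)]
  note vB = vals_subring[OF BR]
  have sB: "s \<in> vals B n" using B(2) by (simp add: X_def)
  have uB: "u i \<in> vals B n" if "i < n" for i using B(2) that by (auto simp: X_def)
  have yB: "y l \<in> vals B n" if "l < k" for l using B(2) that by (auto simp: X_def)
  have cB: "c i l \<in> vals B n" if "i < n" "l < k" for i l
    using B(2) that unfolding X_def by (metis (mono_tags, lifting) SigmaI UnI2 fst_conv imageI lessThan_iff snd_conv subsetD)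
  \<comment> \<open>Only series with zero constant term may be substituted. Here \<open>L\<close> is
    positive and the \<open>y l\<close> have zero constant term, which leaves none for
    \<open>u i\<close>.\<close>
  have uf: "u i \<in> fil n 1" if i: "i < n" for i
  proof (rule P.ideal_add_cancel[OF fil_ideal])
    have "pmono (eunit L i) \<in> fil n 1"
    proof -
      have "eunit L i i \<noteq> 0" using L by (simp add: eunit_def)
      then have "eunit L i \<noteq> ezero" by metis
      then have "pmono (eunit L i) ezero = \<zero>" by (simp add: pmono_eq)
      then show ?thesis using mono_closed[OF eunit_mexps[OF i]] fil_1_iff by blast
    qed
    then show "u i \<oplus>[n] sumr (PS n) (\<lambda>l. y l \<otimes>[n] c i l) k \<in> fil n 1" using xL[OF i] by simp
    show "sumr (PS n) (\<lambda>l. y l \<otimes>[n] c i l) k \<in> fil n 1"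
    proof (rule P.sumr_ideal[OF fil_ideal])
      fix l assume "l < k"
      then show "y l \<otimes>[n] c i l \<in> fil n 1" using fi.I_r_closed[OF smallD[OF ys] SV_carr[OF cS[OF i]]] by blast
    qed
    show "u i \<in> PSC n" by (rule SV_carr[OF uS[OF i]])
  qed
  \<comment> \<open>The arguments are the parameters followed by the \<open>u i\<close>; the
    coefficient of \<open>u i\<close> in the relation for the \<open>i\<close>-th variable is
    \<open>1\<close>.\<close>
  define w where "w = (\<lambda>j. if j < k then y j else u (j - k))"
  define c' where "c' = (\<lambda>i j. if j < k then c i j else if j - k = i then \<one>[n] else \<zero>[n])"
  have ws: "small n w (k + n)" using smallD[OF ys] uf by (simp add: small_def w_def)
  have wB: "w j \<in> vals B n" if "j < k + n" for j using that yB uB by (simp add: w_def)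
  have c'B: "c' i j \<in> vals B n" if "i < n" "j < k + n" for i j
    using that cB subringE(2,3)[OF vB] by (simp add: c'_def)
  have rel: "pmono (eunit L i) = sumr (PS n) (\<lambda>j. w j \<otimes>[n] c' i j) (k + n)" if i: "i < n" for i
  proof -
    have "sumr (PS n) (\<lambda>j. w j \<otimes>[n] c' i j) (k + n) = sumr (PS n) (\<lambda>j. w j \<otimes>[n] c' i j) k \<oplus>[n]
        sumr (PS n) (\<lambda>j. w (k + j) \<otimes>[n] c' i (k + j)) n"
      by (rule P.sumr_append) (intro P.m_closed vals_carr[OF wB] vals_carr[OF c'B[OF i]])
    also have "sumr (PS n) (\<lambda>j. w j \<otimes>[n] c' i j) k = sumr (PS n) (\<lambda>l. y l \<otimes>[n] c i l) k"
      by (rule P.sumr_cong) (simp add: w_def c'_def)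
    also have "sumr (PS n) (\<lambda>j. w (k + j) \<otimes>[n] c' i (k + j)) n = sumr (PS n) (\<lambda>j. if j = i then u i else \<zero>[n]) n"
      by (rule P.sumr_cong) (use SV_carr[OF uS] in \<open>simp add: w_def c'_def\<close>)
    also have "\<dots> = u i" by (rule P.sumr_delta[OF SV_carr[OF uS[OF i]] i])
    finally show ?thesis using xL[OF i] P.a_comm[OF SV_carr[OF uS[OF i]]] P.sumr_closed'[of k "\<lambda>l. y l \<otimes>[n] c i l"]
      SV_carr[OF yS] SV_carr[OF cS[OF i]] by simp
  qed
  have "\<exists>d l. l \<in> low (PS n) (ev n w (k + n) ` vals B (k + n)) s d \<and> s [^][n] d \<oplus>[n] l = \<zero>[n]"
    by (rule power_series_integral[OF BR ws wB c'B rel sB]; assumption)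
  then obtain d l where l: "l \<in> low (PS n) (ev n w (k + n) ` vals B (k + n)) s d" "s [^][n] d \<oplus>[n] l = \<zero>[n]"
    by (elim exE conjE)
  interpret Sm: cring "SS (k + n)" by (rule cring_ss)
  interpret hk: ring_hom_cring "SS k" "SS n" "ev n y k" by (rule ev_hom_ss[OF yS ys])
  have wS: "w j \<in> SV n" if "j < k + n" for j by (rule vals_SV[OF B(1) wB[OF that]])
  interpret hw: ring_hom_cring "SS (k + n)" "SS n" "ev n w (k + n)" by (rule ev_hom_ss[OF wS ws])
  have E': "subring (ev n y k ` SV k) (SS n)"
    using hk.ring.img_is_subring[OF Sk.carrier_is_subring] by simp
  have vsub: "subring (vals B (k + n)) (SS (k + n))"
  proof -
    have c: "vals B (k + n) \<subseteq> carrier (SS (k + n))" using vals_SV[OF B(1)] by auto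
    have "ring (SS (k + n)\<lparr>carrier := vals B (k + n)\<rparr>)"
      using cring.axioms(1)[OF cring_psb[OF BR, of "k + n"]] by simp
    then show ?thesis using Sm.subring_iff[OF c] by blast
  qed
  have E: "subring (ev n w (k + n) ` vals B (k + n)) (SS n)" by (rule hw.ring.img_is_subring[OF vsub])
  define v where "v = (\<lambda>j. if j < k then y j else \<zero>[n])"
  have vs: "small n v (k + n)" using smallD[OF ys] fi.zero_closed by (simp add: small_def v_def)
  have vvB: "v j \<in> vals B n" for j using yB subringE(2)[OF vB] by (simp add: v_def)
  \<comment> \<open>By \<open>ev_difference\<close>, replacing the arguments \<open>u i\<close> by
    zero changes a substituted series by an element of \<open>I\<close>, and what remains is a
    series in the parameters \<open>y\<close> alone.\<close>
  have cong: "\<exists>b'\<in>ev n y k ` SV k. \<exists>i\<in>I. b = b' \<oplus>{n} i" if b: "b \<in> ev n w (k + n) ` vals B (k + n)" for b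
  proof -
    obtain a where a: "a \<in> vals B (k + n)" "b = ev n w (k + n) a" using b by auto
    let ?a = "\<lambda>\<mu>. if \<mu> \<in> mexps k then a \<mu> else \<zero>"
    have "?a \<in> vals B k" using a(1) subringE(2)[OF BR] by (auto simp: vals_def ps_carrier_iff)
    then have aS: "?a \<in> SV k" by (rule vals_SV[OF B(1)])
    obtain h where h: "\<forall>j. h j \<in> vals B n"
      "ev n w (k + n) a = ev n v (k + n) a \<oplus>[n] sumr (PS n) (\<lambda>j. (w j \<ominus>[n] v j) \<otimes>[n] h j) (k + n)"
      using ev_difference[OF BR ws _ vs vvB a(1)] wB by blast
    have "sumr (SS n) (\<lambda>j. (w j \<ominus>[n] v j) \<otimes>{n} h j) (k + n) \<in> I"
    proof (rule S.sumr_ideal[OF I])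
      fix j assume j: "j < k + n"
      have "w j \<ominus>[n] v j \<in> I"
      proof (cases "j < k")
        case True
        then show ?thesis using I.zero_closed SV_carr[OF yS[OF True]] by (simp add: w_def v_def P.minus_eq P.r_neg)
      next
        case False
        then have jk: "j - k < n" using j by simp
        then show ?thesis using False uI[OF jk] SV_carr[OF uS[OF jk]] by (simp add: w_def v_def P.minus_eq)
      qed
      then show "(w j \<ominus>[n] v j) \<otimes>{n} h j \<in> I" by (rule I.I_r_closed) (use h(1) vals_SV[OF B(1)] in simp)
    qed
    moreover have "ev n v (k + n) a = ev n y k ?a" unfolding v_def by (rule ev_extend_zero[OF ys vals_carr[OF a(1)]])
    ultimately show ?thesis using h(2) a(2) aS by (auto simp: sumr_update_carrier)
  qed
  have "l \<in> low (SS n) (ev n w (k + n) ` vals B (k + n)) s d" using l(1) by (simp add: low_update_carrier)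
  then obtain l' i where l': "l' \<in> low (SS n) (ev n y k ` SV k) s d" "i \<in> I" "l = l' \<oplus>{n} i"
    using S.low_congruence[OF I E E' _ cong, of s l d] s by auto
  have l'c: "l' \<in> SV n" using S.low_carr[OF E' _ l'(1)] s by simp
  have sd: "s [^][n] d \<in> SV n" using S.nat_pow_closed[of s d] s by simp
  have "(s [^][n] d \<oplus>[n] l') \<oplus>[n] i = \<zero>[n]"
    using l(2) l'(3) SV_carr[OF l'c] SV_carr[OF sd] I.Icarr[OF l'(2)] SV_carr by (simp add: P.a_assoc)
  then have "(s [^][n] d \<oplus>[n] l') \<oplus>{n} i \<in> I" using I.zero_closed by simp
  then have "s [^][n] d \<oplus>[n] l' \<in> I"
    by (rule S.ideal_add_cancel[OF I _ l'(2)]) (use SV_add[OF sd l'c] in simp)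
  then show ?thesis using l'(1) by blast
qed

text \<open>A relation modulo \<open>I\<close> between the parameters that is nonzero modulo
  \<open>M\<close> allows one of them to be saved: \<open>parameter_reduction\<close> is applied in
  \<open>SS k\<close> to contracted primes. For \<open>k = 0\<close> such a relation is a constant
  outside \<open>M\<close>, which would make \<open>I\<close> improper.\<close>

lemma sop_reduce:
  assumes M: "maximalideal M R" and I: "ideal I (SS n)" "vq M n 0 \<subseteq> I" "\<one>[n] \<notin> I" and sop: "sop n I k y"
    and a: "a \<in> SV k" "a \<notin> vq M k 0" "ev n y k a \<in> I"
  shows "\<exists>k' y'. k = Suc k' \<and> sop n I k' y'"
proof -
  have yS: "y l \<in> SV n" if "l < k" for l using sop that by (simp add: sop_def)
  have ys: "small n y k" using sop by (simp add: sop_def)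
  have Mi: "ideal M R" using M by (simp add: maximalideal_def)
  interpret h: ring_hom_cring "SS k" "SS n" "ev n y k" by (rule ev_hom_ss[OF yS ys])
  show ?thesis
  proof (cases k)
    case 0
    have "a ezero \<notin> M" using a(1,2) 0 by (auto simp: vq_def mexps_def fun_eq_iff[symmetric])
    then have "ev n y k a ezero \<notin> M" using ev_coeff_ezero[OF ys SV_carr[OF a(1)]] by simp
    then show ?thesis using const_unit[OF M I(1,2) a(3)] I(3) by blast
  next
    case (Suc k')
    obtain z where z: "\<forall>i<k'. z i \<in> SV k" "small k z k'"
      "\<And>P. primeideal P (SS k) \<Longrightarrow> vq M k 0 \<subseteq> P \<Longrightarrow> a \<in> P \<Longrightarrow> \<forall>i<k'. z i \<in> P \<Longrightarrow> \<forall>i<k. xvar i \<in> P"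
      using parameter_reduction[OF M a(1,2) Suc] by blast
    have "sop n I k' (\<lambda>i. ev n y k (z i))"
      unfolding sop_def
    proof (intro conjI allI impI)
      show "ev n y k (z l) \<in> SV n" if "l < k'" for l by (rule ev_SV[OF yS ys]) (use z(1) that in auto)
      show "small n (\<lambda>i. ev n y k (z i)) k'" unfolding small_def using ev_fil[OF ys smallD[OF z(2)]] by blast
      fix P i assume P: "primeideal P (SS n)" "I \<subseteq> P" "\<forall>l<k'. ev n y k (z l) \<in> P" and i: "i < n"
      let ?P = "{r \<in> carrier (SS k). ev n y k r \<in> P}"
      have "\<forall>l<k. xvar l \<in> ?P"
      proof (rule z(3))
        show "primeideal ?P (SS k)" by (rule h.ring.primeideal_vimage[OF cring_ss P(1)])
        show "vq M k 0 \<subseteq> ?P"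
        proof
          fix s assume s: "s \<in> vq M k 0"
          then have "ev n y k s \<in> P" using ev_vq[OF Mi yS ys s] I(2) P(2) by blast
          then show "s \<in> ?P" using s by (simp add: vq_def)
        qed
        show "a \<in> ?P" using a P(2) by auto
        show "\<forall>i<k'. z i \<in> ?P" using z(1) P(3) by simp
      qed
      then have "\<forall>l<k. y l \<in> P" using ev_var[OF ys] by (simp add: xvar_def)
      then show "xvar i \<in> P" using sop P(1,2) i by (simp add: sop_def)
    qed
    then show ?thesis using Suc by blast
  qed
qed

lemma one_notin_prime: "primeideal P (SS n) \<Longrightarrow> \<one>[n] \<notin> P"
proof
  assume P: "primeideal P (SS n)" "\<one>[n] \<in> P"
  interpret P: primeideal P "SS n" by (rule P(1))
  show False using P.one_imp_carrier P.I_notcarr P(2) by simp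
qed

text \<open>An element of \<open>Q\<close> outside \<open>P\<close> is integral over the series in
  \<open>y\<close> modulo \<open>P\<close>. By incomparability \<open>Q\<close> then contains the
  value of a series in \<open>y\<close> that is not in \<open>P\<close>, and this is a relation for
  \<open>sop_reduce\<close>.\<close>

lemma sop_prime_step:
  assumes M: "maximalideal M R" and P: "primeideal P (SS n)" "vq M n 0 \<subseteq> P" and Q: "primeideal Q (SS n)" "P \<subset> Q"
    and sop: "sop n P k y"
  shows "\<exists>k' y'. k = Suc k' \<and> sop n Q k' y'"
proof -
  interpret S: cring "SS n" by (rule cring_ss)
  interpret Sk: cring "SS k" by (rule cring_ss)
  interpret P: primeideal P "SS n" by fact
  interpret Q: primeideal Q "SS n" by fact
  have yS: "y l \<in> SV n" if "l < k" for l using sop that by (simp add: sop_def)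
  have ys: "small n y k" using sop by (simp add: sop_def)
  have Mi: "ideal M R" using M by (simp add: maximalideal_def)
  interpret h: ring_hom_cring "SS k" "SS n" "ev n y k" by (rule ev_hom_ss[OF yS ys])
  have E: "subring (ev n y k ` SV k) (SS n)" using h.ring.img_is_subring[OF Sk.carrier_is_subring] by simp
  obtain s where s: "s \<in> Q" "s \<notin> P" using Q(2) by blast
  have sS: "s \<in> SV n" using Q.Icarr[OF s(1)] by simp
  obtain d l where l: "l \<in> low (SS n) (ev n y k ` SV k) s d" "s [^][n] d \<oplus>[n] l \<in> P"
    using integral_mod[OF P.is_ideal sop sS] by (elim exE conjE)
  have "\<exists>b\<in>ev n y k ` SV k. b \<notin> P \<and> (\<forall>Q. ideal Q (SS n) \<longrightarrow> P \<subseteq> Q \<longrightarrow> s \<in> Q \<longrightarrow> b \<in> Q)"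
    by (rule S.incomparability[OF E _ P(1) s(2) l(1)]) (use sS l(2) in simp_all)
  then obtain b where b: "b \<in> ev n y k ` SV k" "b \<notin> P" "b \<in> Q" using Q.is_ideal Q(2) s(1) by blast
  then obtain a where a: "a \<in> SV k" "b = ev n y k a" by blast
  have "a \<notin> vq M k 0" using ev_vq[OF Mi yS ys, of a] P(2) b(2) a(2) by blast
  then show ?thesis
    using sop_reduce[OF M Q.is_ideal _ one_notin_prime[OF Q(1)] sop_mono[OF sop], of a] P(2) Q(2) a b(3) by blast
qed

text \<open>The \<open>n\<close> variables are parameters for the bottom prime, and each strict
  inclusion consumes one parameter.\<close>

lemma chain_bound:
  assumes M: "maximalideal M R" and C: "\<forall>i\<le>r. primeideal (C i) (SS n)" "\<forall>i<r. C i \<subset> C (Suc i)" "vq M n 0 \<subseteq> C 0"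
  shows "r \<le> n"
proof -
  have "i \<le> r \<Longrightarrow> vq M n 0 \<subseteq> C i \<and> (\<exists>k y. sop n (C i) k y \<and> k + i = n)" for i
  proof (induction i)
    case 0
    show ?case using C(3) sop_xvar[of n "C 0"] by auto
  next
    case (Suc i)
    then obtain k y where k: "vq M n 0 \<subseteq> C i" "sop n (C i) k y" "k + i = n" by auto
    have c: "C i \<subset> C (Suc i)" "primeideal (C i) (SS n)" "primeideal (C (Suc i)) (SS n)" using C Suc.prems by auto
    obtain k' y' where k': "k = Suc k'" "sop n (C (Suc i)) k' y'"
      using sop_prime_step[OF M c(2) k(1) c(3,1) k(2)] by blast
    have "k' + Suc i = n" using k(3) k'(1) by simp
    then show ?case using k'(2) k(1) c(1) by blast
  qed
  from this[of r] show ?thesis by auto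
qed

text \<open>Minimality of \<open>k\<close> makes the substitution injective modulo \<open>I\<close>
  in the sense that only series over \<open>M\<close> are mapped into \<open>I\<close>. The model
  primes \<open>vq M k i\<close> can therefore be lifted: \<open>C i\<close> is chosen maximal among
  ideals avoiding the image of the complement of \<open>vq M k i\<close>, starting above
  \<open>I\<close>. Integrality guarantees that successive lifts differ.\<close>

lemma chain_above:
  assumes M: "maximalideal M R" and I: "ideal I (SS n)" "vq M n 0 \<subseteq> I" "\<one>[n] \<notin> I" and sop: "sop n I k y"
    and min: "\<And>k' y'. sop n I k' y' \<Longrightarrow> k \<le> k'"
  shows "\<exists>C. (\<forall>i\<le>k. primeideal (C i) (SS n)) \<and> (\<forall>i<k. C i \<subset> C (Suc i)) \<and> I \<subseteq> C 0"
proof -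
  interpret S: cring "SS n" by (rule cring_ss)
  interpret Sk: cring "SS k" by (rule cring_ss)
  have yS: "y l \<in> SV n" if "l < k" for l using sop that by (simp add: sop_def)
  have ys: "small n y k" using sop by (simp add: sop_def)
  have Mp: "primeideal M R" by (rule maximalideal_prime[OF M])
  have Mi: "ideal M R" using M by (simp add: maximalideal_def)
  interpret h: ring_hom_cring "SS k" "SS n" "ev n y k" by (rule ev_hom_ss[OF yS ys])
  define E where "E = (\<lambda>i. ev n y k ` (SV k - vq M k i))"
  have E_mult: "a \<otimes>{n} b \<in> E i" if ab: "a \<in> E i" "b \<in> E i" for a b i
  proof -
    obtain s t where st: "a = ev n y k s" "b = ev n y k t" "s \<in> SV k" "t \<in> SV k" "s \<notin> vq M k i" "t \<notin> vq M k i"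
      using ab unfolding E_def by blast
    interpret q: primeideal "vq M k i" "SS k" by (rule vq_prime[OF Mp])
    have "s \<otimes>{k} t \<notin> vq M k i" using q.I_prime[of s t] st by auto
    moreover have "a \<otimes>{n} b = ev n y k (s \<otimes>{k} t)" using st h.hom_mult[of s t] by simp
    ultimately show ?thesis unfolding E_def using SV_mult[OF st(3,4)] by auto
  qed
  have E_carr: "E i \<subseteq> carrier (SS n)" for i unfolding E_def using ev_SV[OF yS ys] by auto
  have E_one: "\<one>{n} \<in> E i" for i
  proof -
    have "\<one>{n} = ev n y k \<one>{k}" using h.hom_one by simp
    then show ?thesis unfolding E_def using one_notin_vq[OF Mp] SV_one by auto
  qed
  have E_Suc: "E (Suc i) \<subseteq> E i" for i unfolding E_def vq_def by auto
  \<comment> \<open>A common element would be a relation between the parameters, and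
    \<open>sop_reduce\<close> would produce a shorter system.\<close>
  have IE: "I \<inter> E 0 = {}"
  proof (rule ccontr)
    assume "I \<inter> E 0 \<noteq> {}"
    then obtain a where a: "a \<in> SV k" "a \<notin> vq M k 0" "ev n y k a \<in> I" unfolding E_def by auto
    obtain k' y' where "k = Suc k'" "sop n I k' y'" using sop_reduce[OF M I sop a] by blast
    then show False using min[of k' y'] by simp
  qed
  \<comment> \<open>Maximality is part of the predicate, since the membership of \<open>y i\<close>
    in the next prime is derived from it.\<close>
  define good where "good = (\<lambda>i P. primeideal P (SS n) \<and> I \<subseteq> P \<and> P \<inter> E i = {} \<and>
      (\<forall>Q. ideal Q (SS n) \<longrightarrow> P \<subseteq> Q \<longrightarrow> Q \<inter> E i = {} \<longrightarrow> Q = P))"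
  have ex: "\<exists>P. good i P \<and> J \<subseteq> P" if J: "ideal J (SS n)" "I \<subseteq> J" "J \<inter> E i = {}" for i J
  proof (rule S.prime_disjoint[OF J(1) E_carr E_one E_mult J(3)])
    fix P assume P: "primeideal P (SS n)" "J \<subseteq> P" "P \<inter> E i = {}"
      "\<And>Q. ideal Q (SS n) \<Longrightarrow> P \<subseteq> Q \<Longrightarrow> Q \<inter> E i = {} \<Longrightarrow> Q = P"
    have "good i P"
      unfolding good_def
      by (intro conjI allI impI, rule P(1), rule subset_trans[OF J(2) P(2)], rule P(3), rule P(4))
    then show "\<exists>P. good i P \<and> J \<subseteq> P" using P(2) by (intro exI[of _ P] conjI)
  qed
  have "\<exists>C. \<forall>i. good i (C i) \<and> C i \<subseteq> C (Suc i)"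
  proof (rule dependent_nat_choice)
    show "\<exists>P. good 0 P" using ex[OF I(1) order_refl IE] by blast
    fix P i assume g: "good i P"
    have "ideal P (SS n)" using g by (simp add: good_def primeideal_def)
    then show "\<exists>Q. good (Suc i) Q \<and> P \<subseteq> Q" by (rule ex) (use g E_Suc[of i] in \<open>auto simp: good_def\<close>)
  qed
  then obtain C where C: "\<And>i. good i (C i)" "\<And>i. C i \<subseteq> C (Suc i)" by blast
  \<comment> \<open>Otherwise adjoining \<open>y i\<close> meets \<open>E (Suc i)\<close>, so some
    \<open>h0\<close> outside \<open>vq M k (Suc i)\<close> is mapped to a multiple
    \<open>c y_i\<close> modulo the prime. Since \<open>c\<close> is integral modulo
    \<open>I\<close>, \<open>going_up_step\<close> places the image of \<open>h0^d + X_i a\<close>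
    in the prime; but that series is still outside \<open>vq M k (Suc i)\<close>, because
    \<open>X_i\<close> is inside.\<close>
  have yi: "y i \<in> C (Suc i)" if i: "i < k" for i
  proof (rule ccontr)
    assume n: "y i \<notin> C (Suc i)"
    let ?P = "C (Suc i)"
    interpret P: primeideal ?P "SS n" using C(1)[of "Suc i"] by (simp add: good_def)
    have yc: "y i \<in> carrier (SS n)" using yS[OF i] by simp
    let ?Q = "{x \<oplus>{n} c \<otimes>{n} y i | x c. x \<in> ?P \<and> c \<in> carrier (SS n)}"
    have Q: "ideal ?Q (SS n)" by (rule S.ideal_sum_set[OF P.is_ideal yc])
    have "?P \<subseteq> ?Q"
    proof
      fix x assume x: "x \<in> ?P"
      have "x = x \<oplus>{n} \<zero>{n} \<otimes>{n} y i" using S.l_null[OF yc] S.r_zero[OF P.Icarr[OF x]] by (simp only:)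
      then show "x \<in> ?Q" using x S.zero_closed by blast
    qed
    moreover have "y i \<in> ?Q"
    proof -
      have "y i = \<zero>{n} \<oplus>{n} \<one>{n} \<otimes>{n} y i" using S.l_one[OF yc] S.l_zero[OF yc] by (simp only:)
      then show ?thesis using P.zero_closed S.one_closed by blast
    qed
    ultimately have "?Q \<inter> E (Suc i) \<noteq> {}" using C(1)[of "Suc i"] Q n unfolding good_def by blast
    then obtain h0 where h0: "h0 \<in> SV k" "h0 \<notin> vq M k (Suc i)" "ev n y k h0 \<in> ?Q" unfolding E_def by auto
    then obtain x c where xc: "ev n y k h0 = x \<oplus>{n} c \<otimes>{n} y i" "x \<in> ?P" "c \<in> carrier (SS n)" by blast
    have cS: "c \<in> SV n" using xc(3) by simp
    have Xc: "xvar i \<in> carrier (SS k)" using xvar_SV[OF i] by simp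
    have ex: "ev n y k (xvar i) = y i" using ev_var[OF ys i] by (simp add: xvar_def)
    have xcar: "x \<in> carrier (SS n)" by (rule P.Icarr[OF xc(2)])
    have cy: "c \<otimes>{n} y i \<in> carrier (SS n)" by (rule S.m_closed[OF xc(3) yc])
    have "y i \<otimes>{n} c \<ominus>{n} (x \<oplus>{n} c \<otimes>{n} y i) = \<ominus>{n} x"
      unfolding S.m_comm[OF yc xc(3)] by (rule S.minus_add_cancel'[OF xcar cy])
    then have eq: "ev n y k (xvar i) \<otimes>{n} c \<ominus>{n} ev n y k h0 \<in> ?P"
      unfolding ex xc(1) using S.ideal_minus_closed2[OF P.is_ideal xc(2)] by (simp only:)
    obtain d l where l: "l \<in> low (SS n) (ev n y k ` SV k) c d" "c [^][n] d \<oplus>[n] l \<in> I"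
      using integral_mod[OF I(1) sop cS] by (elim exE conjE)
    have IP: "I \<subseteq> ?P" using C(1)[of "Suc i"] by (simp add: good_def)
    have l1: "l \<in> low (SS n) (ev n y k ` carrier (SS k)) c d" using l(1) by simp
    have l2: "c [^]{n} d \<oplus>{n} l \<in> ?P" using l(2) IP by auto
    have h0c: "h0 \<in> carrier (SS k)" using h0(1) by simp
    obtain a where a: "a \<in> carrier (SS k)" "ev n y k (h0 [^]{k} d \<oplus>{k} xvar i \<otimes>{k} a) \<in> ?P"
      using S.going_up_step[OF h.ring_hom_cring_axioms P.is_ideal h0c Xc xc(3) eq l1 l2] by blast
    let ?g = "h0 [^]{k} d \<oplus>{k} xvar i \<otimes>{k} a"
    interpret q: primeideal "vq M k (Suc i)" "SS k" by (rule vq_prime[OF Mp])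
    have "xvar i \<in> vq M k (Suc i)"
    proof -
      have "xvar i \<beta> \<in> M" if "\<forall>l<Suc i. \<beta> l = 0" for \<beta>
      proof -
        have "eunit 1 i i \<noteq> \<beta> i" using that by (simp add: eunit_def)
        then have "eunit 1 i \<noteq> \<beta>" by metis
        then show ?thesis using zero_mem_ideal[OF Mi] by (simp add: xvar_def pmono_eq)
      qed
      then show ?thesis using xvar_SV[OF i] by (simp add: vq_def)
    qed
    then have xa: "xvar i \<otimes>{k} a \<in> vq M k (Suc i)" by (rule q.I_r_closed[OF _ a(1)])
    have hd: "h0 [^]{k} d \<in> carrier (SS k)" by (rule Sk.nat_pow_closed[OF h0c])
    have gc: "?g \<in> carrier (SS k)" by (rule Sk.a_closed[OF hd Sk.m_closed[OF Xc a(1)]])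
    have "?g \<notin> vq M k (Suc i)"
    proof
      assume "?g \<in> vq M k (Suc i)"
      then have "h0 [^]{k} d \<in> vq M k (Suc i)" by (rule Sk.ideal_add_cancel[OF q.is_ideal _ xa hd])
      then have "h0 \<in> vq M k (Suc i)" by (rule Sk.primeideal_pow[OF q.primeideal_axioms h0c])
      then show False using h0(2) by simp
    qed
    then have "ev n y k ?g \<in> E (Suc i)" unfolding E_def using gc by simp
    then show False using a(2) C(1)[of "Suc i"] unfolding good_def by blast
  qed
  \<comment> \<open>The variable \<open>X_i\<close> survives modulo \<open>vq M k i\<close>, so its
    image lies in the avoided set \<open>E i\<close>. Thus \<open>y i\<close> witnesses the strict
    step from \<open>C i\<close> to \<open>C (Suc i)\<close>.\<close>
  have yn: "y i \<notin> C i" if i: "i < k" for i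
  proof -
    have "xvar i \<notin> vq M k i"
    proof
      assume "xvar i \<in> vq M k i"
      then have "xvar i (eunit 1 i) \<in> M" using i by (simp add: vq_def eunit_def) (auto simp: mexps_def eunit_def)
      then have "\<one> \<in> M" by (simp add: xvar_def pmono_eq)
      then show False using ideal.one_imp_carrier[OF Mi] M unfolding maximalideal_def maximalideal_axioms_def by blast
    qed
    then have "y i \<in> E i" unfolding E_def using xvar_SV[OF i] ev_var[OF ys i] by (auto simp: xvar_def intro!: image_eqI[of _ _ "pmono (eunit 1 i)"])
    then show ?thesis using C(1)[of i] by (auto simp: good_def)
  qed
  show ?thesis
  proof (rule exI[of _ C], intro conjI allI impI)
    show "primeideal (C i) (SS n)" for i using C(1)[of i] by (simp add: good_def)
    show "C i \<subset> C (Suc i)" if "i < k" for i using C(2)[of i] yi[OF that] yn[OF that] by blast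
    show "I \<subseteq> C 0" using C(1)[of 0] by (simp add: good_def)
  qed
qed

text \<open>With \<open>k\<close> minimal, the chain of \<open>k\<close> steps starting at
  \<open>C 0\<close> is appended to an arbitrary chain ending at \<open>C 0\<close>. The bottom of
  the combined chain still lies over \<open>M\<close>, so its length is at most \<open>n\<close>.
  This gives a bound on the height without any choice of a minimal prime.\<close>

lemma small_height_prime:
  assumes M: "maximalideal M R" and I: "ideal I (SS n)" "vq M n 0 \<subseteq> I" "\<one>[n] \<notin> I"
  shows "\<exists>k y P. sop n I k y \<and> primeideal P (SS n) \<and> I \<subseteq> P \<and>
    (\<forall>r D. (\<forall>i\<le>r. primeideal (D i) (SS n)) \<longrightarrow> (\<forall>i<r. D i \<subset> D (Suc i)) \<longrightarrow> D r = P \<longrightarrow> r + k \<le> n)"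
proof -
  define k where "k = (LEAST k. \<exists>y. sop n I k y)"
  have "\<exists>y. sop n I k y" unfolding k_def by (rule LeastI[of _ n]) (use sop_xvar in blast)
  then obtain y where y: "sop n I k y" ..
  have "k \<le> k'" if "sop n I k' y'" for k' y' unfolding k_def by (rule Least_le) (use that in blast)
  then obtain C where C: "\<forall>i\<le>k. primeideal (C i) (SS n)" "\<forall>i<k. C i \<subset> C (Suc i)" "I \<subseteq> C 0"
    using chain_above[OF M I y] by blast
  have "r + k \<le> n" if D: "\<forall>i\<le>r. primeideal (D i) (SS n)" "\<forall>i<r. D i \<subset> D (Suc i)" "D r = C 0" for r D
  proof -
    have D0: "D 0 \<subseteq> D i" if "i \<le> r" for i using that
    proof (induction i)
      case (Suc i)
      then show ?case using D(2)[rule_format, of i] by auto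
    qed simp
    have pr: "primeideal (C 0) (SS n)" "primeideal (D 0) (SS n)" using C(1) D(1) by auto
    have v0: "vq M n 0 \<subseteq> D 0"
      by (rule vq_subset_mono[OF M pr(1) _ pr(2)]) (use I(2) C(3) D0[of r] D(3) in auto)
    let ?C = "\<lambda>i. if i \<le> r then D i else C (i - r)"
    show ?thesis
    proof (rule chain_bound[OF M, where C = ?C])
      show "\<forall>i\<le>r + k. primeideal (?C i) (SS n)" using C(1) D(1) by auto
      show "vq M n 0 \<subseteq> ?C 0" using v0 by simp
      show "\<forall>i<r + k. ?C i \<subset> ?C (Suc i)"
      proof (intro allI impI)
        fix i assume i: "i < r + k"
        consider "i < r" | "i = r" | "r < i" by linarith
        then show "?C i \<subset> ?C (Suc i)"
        proof cases
          case 1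
          then show ?thesis using D(2) by simp
        next
          case 2
          then have "C 0 \<subset> C (Suc 0)" using C(2) i by simp
          then show ?thesis using 2 D(3) by simp
        next
          case 3
          then have "C (i - r) \<subset> C (Suc (i - r))" using C(2) i by simp
          then show ?thesis using 3 by (simp add: Suc_diff_le)
        qed
      qed
    qed
  qed
  then show ?thesis
    by (intro exI conjI allI impI) (rule y, use C(1) in blast, rule C(3), blast)
qed

end

section \<open>Regularity at one maximal ideal and gluing by idempotents\<close>

context cring
begin

lemma idempotent_complement:
  assumes e: "e \<in> carrier R" "e \<otimes> e = e"
  shows "e \<otimes> (\<one> \<ominus> e) = \<zero>" "(\<one> \<ominus> e) \<otimes> (\<one> \<ominus> e) = \<one> \<ominus> e" "e \<oplus> (\<one> \<ominus> e) = \<one>"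
proof -
  show 1: "e \<otimes> (\<one> \<ominus> e) = \<zero>" using e by (simp add: minus_eq r_distr r_minus r_neg)
  show "(\<one> \<ominus> e) \<otimes> (\<one> \<ominus> e) = \<one> \<ominus> e"
  proof -
    have "(\<one> \<ominus> e) \<otimes> (\<one> \<ominus> e) = (\<one> \<ominus> e) \<ominus> e \<otimes> (\<one> \<ominus> e)"
      using e(1) by (simp add: minus_eq l_distr l_minus)
    then show ?thesis unfolding 1 using e(1) by (simp add: minus_eq)
  qed
  show "e \<oplus> (\<one> \<ominus> e) = \<one>" using diff_add_cancel_cring[of \<one> e] a_comm[of e "\<one> \<ominus> e"] e(1) by simp
qed

lemma idempotent_mix:
  assumes "a \<in> carrier R" "b \<in> carrier R" "x \<in> carrier R" "y \<in> carrier R"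
    and "a \<otimes> a = a" "b \<otimes> b = b" "a \<otimes> b = \<zero>"
  shows "a \<otimes> (a \<otimes> x \<oplus> b \<otimes> y) = a \<otimes> x" "b \<otimes> (a \<otimes> x \<oplus> b \<otimes> y) = b \<otimes> y"
proof -
  have "a \<otimes> (a \<otimes> x \<oplus> b \<otimes> y) = (a \<otimes> a) \<otimes> x \<oplus> (a \<otimes> b) \<otimes> y"
    using assms(1-4) by (simp add: r_distr m_assoc)
  then show "a \<otimes> (a \<otimes> x \<oplus> b \<otimes> y) = a \<otimes> x" using assms by simp
  have "b \<otimes> (a \<otimes> x \<oplus> b \<otimes> y) = (a \<otimes> b) \<otimes> x \<oplus> (b \<otimes> b) \<otimes> y"
    using assms(1-4) by (simp add: r_distr m_ac)
  then show "b \<otimes> (a \<otimes> x \<oplus> b \<otimes> y) = b \<otimes> y" using assms by simp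
qed

lemma prime_height_ge:
  assumes "\<forall>i\<le>k. primeideal (C i) S" "\<forall>i<k. C i \<subset> C (Suc i)" "C k = P"
  shows "enat k \<le> prime_height S P"
  unfolding prime_height_def by (rule SUP_upper) (use assms in blast)

end

context power_series_family
begin

lemma F_upper: "finite X \<Longrightarrow> X \<subseteq> F \<Longrightarrow> \<exists>D\<in>F. \<forall>B\<in>X. B \<subseteq> D"
proof (induction X rule: finite_induct)
  case empty
  then show ?case using F_ne by auto
next
  case (insert B X)
  then obtain D where D: "D \<in> F" "\<forall>B\<in>X. B \<subseteq> D" by auto
  obtain D' where "D' \<in> F" "B \<subseteq> D'" "D \<subseteq> D'" using F_directed[of B D] D(1) insert.prems by auto
  then show ?case using D(2) by (intro bexI[of _ D']) auto
qed

lemma idempotent_at: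
  assumes M: "maximalideal M R"
  shows "\<exists>e\<in>carrier R. e \<otimes> e = e \<and> e \<notin> M \<and> (\<forall>M'. maximalideal M' R \<longrightarrow> M' \<noteq> M \<longrightarrow> e \<in> M')"
proof -
  obtain e where e: "e \<in> carrier R" "e \<otimes> e = e" "\<forall>M'. maximalideal M' R \<longrightarrow> (e \<in> M' \<longleftrightarrow> M' \<notin> {M})"
    using idempotents[of "{M}"] M by blast
  then show ?thesis using M by (intro bexI[of _ e]) blast+
qed

text \<open>The prime contracts to a maximal ideal avoiding \<open>e\<close>, and by assumption only
  \<open>M\<close> can do so.\<close>

lemma prime_over_idempotent:
  assumes others: "\<And>M'. maximalideal M' R \<Longrightarrow> M' \<noteq> M \<Longrightarrow> e \<in> M'" and e: "e \<in> carrier R"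
    and Q: "primeideal Q (SS n)" "pconst e \<notin> Q"
  shows "vq M n 0 \<subseteq> Q"
proof -
  obtain M' where M': "maximalideal M' R" "vq M' n 0 \<subseteq> Q" "\<forall>c\<in>carrier R. pconst c \<in> Q \<longleftrightarrow> c \<in> M'"
    using contraction[OF Q(1)] by blast
  have "M' = M" using others[OF M'(1)] M'(3) e Q(2) by blast
  then show ?thesis using M'(2) by simp
qed

lemma pconst_idempotent:
  assumes e: "e \<in> carrier R" "e \<otimes> e = e"
  shows "pconst e \<in> carrier (SS n)" "pconst (\<one> \<ominus> e) \<in> carrier (SS n)"
    "pconst e \<otimes>{n} pconst e = pconst e" "pconst (\<one> \<ominus> e) \<otimes>{n} pconst (\<one> \<ominus> e) = pconst (\<one> \<ominus> e)"
    "pconst e \<otimes>{n} pconst (\<one> \<ominus> e) = \<zero>{n}" "pconst e \<oplus>{n} pconst (\<one> \<ominus> e) = \<one>{n}"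
proof -
  interpret h: ring_hom_cring R "SS n" pconst by (rule pconst_hom)
  have c: "\<one> \<ominus> e \<in> carrier R" using e(1) by simp
  note ic = idempotent_complement[OF e]
  show "pconst e \<in> carrier (SS n)" "pconst (\<one> \<ominus> e) \<in> carrier (SS n)" using e(1) c h.hom_closed by blast+
  show "pconst e \<otimes>{n} pconst e = pconst e" using h.hom_mult[OF e(1) e(1)] e(2) by (simp only:)
  show "pconst (\<one> \<ominus> e) \<otimes>{n} pconst (\<one> \<ominus> e) = pconst (\<one> \<ominus> e)" using h.hom_mult[OF c c] ic(2) by (simp only:)
  show "pconst e \<otimes>{n} pconst (\<one> \<ominus> e) = \<zero>{n}" using h.hom_mult[OF e(1) c] ic(1) h.hom_zero by (simp only:)
  show "pconst e \<oplus>{n} pconst (\<one> \<ominus> e) = \<one>{n}" using h.hom_add[OF e(1) c] ic(3) h.hom_one by (simp only:)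
qed

lemma xvar_coeff_ezero: "xvar i ezero = \<zero>"
proof -
  have "eunit 1 i i \<noteq> ezero i" by (simp add: eunit_def)
  then have "eunit 1 i \<noteq> ezero" by metis
  then show ?thesis by (simp add: xvar_def pmono_eq)
qed

text \<open>At \<open>M\<close> the sequence \<open>fs\<close> is completed by the parameters to
  \<open>n\<close> series; away from \<open>M\<close> the variables are used. The mixture has
  constant terms nilpotent in \<open>R\<close>, and its ideal contains powers of all variables, so
  it is regular over a large member of the family. Multiplication by \<open>e\<close> carries the
  cancellation back to \<open>fs\<close>.\<close>

theorem local_regularity:
  assumes M: "maximalideal M R" and e: "e \<in> carrier R" "e \<otimes> e = e"
    and others: "\<And>M'. maximalideal M' R \<Longrightarrow> M' \<noteq> M \<Longrightarrow> e \<in> M'"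
    and fs: "set fs \<subseteq> SV n" "\<And>f. f \<in> set fs \<Longrightarrow> f ezero \<in> M"
    and sop: "sop n (set fs \<union> vq M n 0) k y" and kn: "k + length fs \<le> n"
    and i: "i < length fs" and z: "z \<in> SV n" "fs ! i \<otimes>[n] z \<in> genideal (SS n) (set (take i fs))"
  shows "pconst e \<otimes>[n] z \<in> genideal (SS n) (set (take i fs))"
proof -
  interpret P: cring "PS n" by (rule cring_ps)
  interpret S: cring "SS n" by (rule cring_ss)
  interpret M: maximalideal M R by fact
  let ?E = "pconst e :: (nat \<Rightarrow> nat) \<Rightarrow> 'a" and ?E' = "pconst (\<one> \<ominus> e) :: (nat \<Rightarrow> nat) \<Rightarrow> 'a" and ?t = "length fs"
  note E = pconst_idempotent[OF e, of n]
  have yS: "y l \<in> SV n" if "l < k" for l using sop that by (simp add: sop_def)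
  have y0: "y l ezero = \<zero>" if "l < k" for l using sop that fil_1_iff unfolding sop_def small_def by blast
  \<comment> \<open>Zeros fill the positions after the generators and the parameters, so that there
    are \<open>n\<close> series even when \<open>k + length fs\<close> is smaller than
    \<open>n\<close>.\<close>
  define base where "base = (\<lambda>j. if j < ?t then fs ! j else if j - ?t < k then y (j - ?t) else \<zero>[n])"
  have bS: "base j \<in> carrier (SS n)" for j
    using fs(1) yS SV_zero by (auto simp: base_def)
  have b0: "base j ezero \<in> M" for j
    using fs(2) y0 M.zero_closed by (auto simp: base_def ps_zero)
  \<comment> \<open>The variable contributes no constant term, so that of \<open>g j\<close> is
    \<open>e\<close> times an element of \<open>M\<close>; it lies in every maximal ideal and is
    nilpotent.\<close>
  define g where "g = (\<lambda>j. ?E \<otimes>{n} base j \<oplus>{n} ?E' \<otimes>{n} xvar j)"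
  have xS: "xvar j \<in> carrier (SS n)" if "j < n" for j using xvar_SV[OF that] by simp
  have gS: "g j \<in> carrier (SS n)" if "j < n" for j
    unfolding g_def by (intro S.a_closed S.m_closed E bS xS that)
  have Eg: "?E \<otimes>{n} g j = ?E \<otimes>{n} base j" and E'g: "?E' \<otimes>{n} g j = ?E' \<otimes>{n} xvar j" if "j < n" for j
    unfolding g_def using S.idempotent_mix[OF E(1,2) bS xS[OF that] E(3-5), of j] by (simp_all only:)
  define gs where "gs = map g [0..<n]"
  have gsS: "set gs \<subseteq> carrier (SS n)" using gS by (auto simp: gs_def)
  have tn: "?t \<le> n" using kn by simp
  have in_n: "i < n" using i tn by simp
  have nil: "\<exists>N::nat. x ezero [^] N = \<zero>" if x: "x \<in> set gs" for x
  proof -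
    obtain j where j: "x = g j" "j < n" using x by (auto simp: gs_def)
    have bc: "base j \<in> PSC n" using bS SV_carr by simp
    have cc: "base j ezero \<in> carrier R" by (rule M.Icarr[OF b0])
    have "x ezero = e \<otimes> base j ezero"
      unfolding j(1) g_def using e(1) cc SV_carr[OF xvar_SV[OF j(2)]]
      by (simp add: ps_add const_mult[OF _ bc] const_mult xvar_coeff_ezero)
    moreover have "\<exists>N::nat. (e \<otimes> base j ezero) [^] N = \<zero>"
    proof (rule nilpotent_of_maximals[OF _ _ prime_maximal])
      show "e \<otimes> base j ezero \<in> carrier R" using e(1) cc by simp
      fix M' assume M': "maximalideal M' R"
      interpret M': maximalideal M' R by fact
      show "e \<otimes> base j ezero \<in> M'"
      proof (cases "M' = M")
        case True
        then show ?thesis using M.I_l_closed[OF b0 e(1)] by simp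
      next
        case False
        then show ?thesis using M'.I_r_closed[OF others[OF M'] cc] by simp
      qed
    qed
    ultimately show ?thesis by simp
  qed
  \<comment> \<open>A prime over the ideal of \<open>gs\<close> that contains \<open>e\<close>
    avoids \<open>1 - e\<close>, and the mixture yields the variable directly. A prime avoiding
    \<open>e\<close> lies over \<open>M\<close> and contains \<open>fs\<close> and the parameters,
    so the defining property of \<open>sop\<close> applies.\<close>
  have pw: "\<exists>B\<in>F. \<exists>L. \<forall>C\<in>F. B \<subseteq> C \<longrightarrow> pmono (eunit L j) \<in> genideal (PSB C n) (set gs)" if j: "j < n" for j
  proof -
    have "\<exists>L::nat. xvar j [^]{n} L \<in> genideal (SS n) (set gs)"
    proof (rule S.mem_primes_imp_power[OF S.genideal_ideal[OF gsS] xS[OF j]])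
      fix Q assume Q: "primeideal Q (SS n)" "genideal (SS n) (set gs) \<subseteq> Q"
      interpret Q: primeideal Q "SS n" by fact
      have gQ: "g l \<in> Q" if "l < n" for l
      proof -
        have "g l \<in> set gs" using that by (simp add: gs_def)
        then show ?thesis using S.genideal_self[OF gsS] Q(2) by blast
      qed
      show "xvar j \<in> Q"
      proof (cases "?E \<in> Q")
        case True
        have "?E' \<notin> Q"
        proof
          assume c: "?E' \<in> Q"
          from Q.a_closed[OF True c] have "\<one>{n} \<in> Q" unfolding E(6) .
          then show False using Q.one_imp_carrier Q.I_notcarr by blast
        qed
        moreover have "?E' \<otimes>{n} xvar j \<in> Q" unfolding E'g[OF j, symmetric] by (rule Q.I_l_closed[OF gQ[OF j] E(2)])
        ultimately show ?thesis using Q.I_prime[OF E(2) xS[OF j]] by blast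
      next
        case False
        have bQ: "base l \<in> Q" if "l < n" for l
        proof -
          have "?E \<otimes>{n} base l \<in> Q" unfolding Eg[OF that, symmetric] by (rule Q.I_l_closed[OF gQ[OF that] E(1)])
          then show ?thesis using Q.I_prime[OF E(1) bS] False by blast
        qed
        have "set fs \<subseteq> Q"
        proof
          fix f assume "f \<in> set fs"
          then obtain l where l: "l < ?t" "f = fs ! l" by (auto simp: in_set_conv_nth)
          then show "f \<in> Q" using bQ[of l] tn by (simp add: base_def)
        qed
        moreover have "vq M n 0 \<subseteq> Q" by (rule prime_over_idempotent[OF others e(1) Q(1) False])
        moreover have "\<forall>l<k. y l \<in> Q"
        proof (intro allI impI)
          fix l assume "l < k"
          then show "y l \<in> Q" using bQ[of "?t + l"] kn by (simp add: base_def)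
        qed
        ultimately show ?thesis using sop Q(1) j unfolding sop_def by (meson Un_least)
      qed
    qed
    then obtain L :: nat where "xvar j [^]{n} L \<in> genideal (SS n) (set gs)" ..
    moreover have "xvar j [^]{n} L = pmono (eunit L j)"
      unfolding xvar_def using mono_pow[OF eunit_mexps[OF j], of 1 L] by (simp add: eunit_def if_distrib cong: if_cong)
    ultimately have "pmono (eunit L j) \<in> genideal (SS n) (set gs)" by simp
    then obtain B where B: "B \<in> F" "\<forall>C\<in>F. B \<subseteq> C \<longrightarrow> set gs \<subseteq> vals C n \<and> pmono (eunit L j) \<in> genideal (PSB C n) (set gs)"
      using ideal_membership_descends[of gs n "pmono (eunit L j)"] gsS by auto
    then show ?thesis by (intro bexI[OF _ B(1)] exI[of _ L]) blast
  qed
  then have "\<forall>j. \<exists>B. j < n \<longrightarrow> B \<in> F \<and> (\<exists>L. \<forall>C\<in>F. B \<subseteq> C \<longrightarrow> pmono (eunit L j) \<in> genideal (PSB C n) (set gs))" by blast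
  then obtain K where K: "\<forall>j. j < n \<longrightarrow> K j \<in> F \<and> (\<exists>L. \<forall>C\<in>F. K j \<subseteq> C \<longrightarrow> pmono (eunit L j) \<in> genideal (PSB C n) (set gs))"
    by (drule_tac choice) (elim exE)
  let ?Jf = "genideal (SS n) (set (take i fs))" and ?Jg = "genideal (SS n) (set (take i gs))"
  have tf: "set (take i fs) \<subseteq> carrier (SS n)" using fs(1) set_take_subset[of i fs] by auto
  have tg: "set (take i gs) \<subseteq> carrier (SS n)" using gsS set_take_subset[of i gs] by blast
  have Jf: "ideal ?Jf (SS n)" by (rule S.genideal_ideal[OF tf])
  have Jg: "ideal ?Jg (SS n)" by (rule S.genideal_ideal[OF tg])
  have gsnth: "gs ! j = g j" if "j < n" for j using that by (simp add: gs_def)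
  have mg: "g j \<in> set (take i gs)" if "j < i" for j
    using that in_n nth_mem[of j "take i gs"] by (simp add: gsnth gs_def)
  have mf: "fs ! j \<in> set (take i fs)" if "j < i" for j
    using that i nth_mem[of j "take i fs"] by simp
  have base_fs: "base j = fs ! j" if "j < ?t" for j using that by (simp add: base_def)
  have fg: "?E \<otimes>{n} a \<in> ?Jg" if a: "a \<in> set (take i fs)" for a
  proof -
    obtain j where j: "j < i" "a = fs ! j" using a i by (auto simp: in_set_conv_nth)
    have "?E \<otimes>{n} a = ?E \<otimes>{n} g j" using Eg[of j] j i in_n base_fs[of j] by simp
    then show ?thesis using ideal.I_l_closed[OF Jg _ E(1)] S.genideal_self[OF tg] mg[OF j(1)] by auto
  qed
  have gf: "?E \<otimes>{n} a \<in> ?Jf" if a: "a \<in> set (take i gs)" for a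
  proof -
    obtain j where j: "j < i" "a = g j" using a in_n by (auto simp: gs_def in_set_conv_nth)
    have "?E \<otimes>{n} a = ?E \<otimes>{n} fs ! j" using Eg[of j] j i in_n base_fs[of j] by simp
    then show ?thesis using ideal.I_l_closed[OF Jf _ E(1)] S.genideal_self[OF tf] mf[OF j(1)] by auto
  qed
  define z' where "z' = ?E \<otimes>{n} z"
  have zc: "z \<in> carrier (SS n)" using z(1) by simp
  have z'c: "z' \<in> carrier (SS n)" unfolding z'_def by (rule S.m_closed[OF E(1) zc])
  have fic: "fs ! i \<in> carrier (SS n)" using fs(1) nth_mem[OF i] by auto
  have "g i \<otimes>{n} z' = (?E \<otimes>{n} g i) \<otimes>{n} z"
    unfolding z'_def using S.m_assoc[OF gS[OF in_n] E(1) zc] S.m_comm[OF gS[OF in_n] E(1)] by (simp only:)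
  also have "\<dots> = ?E \<otimes>{n} (fs ! i \<otimes>{n} z)"
    unfolding Eg[OF in_n] base_fs[OF i] by (rule S.m_assoc[OF E(1) fic zc])
  also have "\<dots> \<in> ?Jg" by (rule S.genideal_smult_mem[OF tf Jg E(1) fg]) (use z(2) in simp_all)
  finally have "g i \<otimes>{n} z' \<in> ?Jg" .
  then obtain B1 where B1: "B1 \<in> F" "\<forall>C\<in>F. B1 \<subseteq> C \<longrightarrow> g i \<otimes>{n} z' \<in> genideal (PSB C n) (set (take i gs))"
    using ideal_membership_descends[of "take i gs" n "g i \<otimes>{n} z'"] tg by auto
  obtain B2 where B2: "B2 \<in> F" "insert z' (set gs) \<subseteq> vals B2 n" using F_common1[of "insert z' (set gs)" n] gsS z'c by auto
  \<comment> \<open>One member of the family must carry \<open>z'\<close>, the series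
    \<open>gs\<close>, the membership assumption, and the powers of all variables; regularity is
    then obtained over that member.\<close>
  have "{B1, B2} \<union> K ` {..<n} \<subseteq> F" using B1(1) B2(1) K by auto
  then obtain D where D: "D \<in> F" "B1 \<subseteq> D" "B2 \<subseteq> D" "\<forall>j<n. K j \<subseteq> D"
    using F_upper[of "{B1, B2} \<union> K ` {..<n}"] by auto
  have z'D: "z' \<in> vals D n" and gsD: "set gs \<subseteq> vals D n" using B2(2) vals_mono[OF D(3)] by blast+
  interpret D: cring "PSB D n" by (rule cring_psb[OF F_subring[OF D(1)]])
  have "weakly_regular (PSB D n) (rev gs)"
  proof (rule power_series_sop_regular[OF F_subring[OF D(1)]])
    show "set (rev gs) \<subseteq> vals D n" using gsD by simp
    show "length (rev gs) = n" by (simp add: gs_def)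
    show "\<exists>N::nat. x ezero [^] N = \<zero>" if "x \<in> set (rev gs)" for x using nil[of x] that by simp
    show "\<exists>L. pmono (eunit L j) \<in> genideal (PSB D n) (set (rev gs))" if j: "j < n" for j
    proof -
      obtain L where "\<forall>C\<in>F. K j \<subseteq> C \<longrightarrow> pmono (eunit L j) \<in> genideal (PSB C n) (set gs)" using K j by blast
      then have "pmono (eunit L j) \<in> genideal (PSB D n) (set gs)" using D(1,4) j by blast
      then show ?thesis by (intro exI[of _ L]) (simp only: set_rev)
    qed
  qed
  then have "gs ! i \<otimes>\<^bsub>PSB D n\<^esub> z' \<in> genideal (PSB D n) (set (take i gs)) \<longrightarrow> z' \<in> genideal (PSB D n) (set (take i gs))"
    using D.weakly_regular_rev_iff[of gs] in_n z'D by (simp add: gs_def)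
  then have "z' \<in> genideal (PSB D n) (set (take i gs))" using B1(2) D(1,2) gsnth[OF in_n] by simp
  then have z'J: "z' \<in> ?Jg" using genideal_psb_subset[OF D(1)] gsD set_take_subset[of i gs] by blast
  \<comment> \<open>Multiplication by \<open>e\<close> sends the ideal of the first mixed series
    into that of the first members of \<open>fs\<close>, and it fixes \<open>z'\<close>.\<close>
  have "?E \<otimes>{n} z' \<in> ?Jf"
    by (rule S.genideal_smult_mem[OF tg Jf E(1) _ z'J]) (rule gf)
  moreover have "?E \<otimes>{n} z' = z'" unfolding z'_def using S.m_assoc[OF E(1) E(1) zc] E(3) by simp
  ultimately show ?thesis by (simp add: z'_def)
qed

lemma sop_genideal:
  assumes A: "A \<subseteq> SV n" and sop: "sop n (genideal (SS n) A) k y"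
  shows "sop n A k y"
proof -
  interpret S: cring "SS n" by (rule cring_ss)
  have "genideal (SS n) A \<subseteq> P" if "primeideal P (SS n)" "A \<subseteq> P" for P
    using S.genideal_minimal[of P A] that unfolding primeideal_def by blast
  then show ?thesis using sop unfolding sop_def by blast
qed

lemma vq_SV: "vq M n i \<subseteq> SV n"
  by (auto simp: vq_def)

text \<open>If the parameters modulo the ideal were too few, then appending \<open>0\<close> to the generators would still
  satisfy the hypotheses of local regularity, and the idempotent would lie in the ideal.\<close>

lemma height_le_length:
  assumes fs: "set fs \<subseteq> SV n" and one: "\<one>[n] \<notin> genideal (SS n) (set fs)"
  shows "ideal_height (SS n) (genideal (SS n) (set fs)) \<le> enat (length fs)"
proof -
  interpret S: cring "SS n" by (rule cring_ss)
  have fsc: "set fs \<subseteq> carrier (SS n)" using fs by simp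
  let ?I = "genideal (SS n) (set fs)"
  have Ii: "ideal ?I (SS n)" by (rule S.genideal_ideal[OF fsc])
  have "?I \<noteq> carrier (SS n)" using one SV_one by auto
  then obtain P1 where P1: "primeideal P1 (SS n)" "?I \<subseteq> P1" by (rule S.ideal_in_prime[OF Ii])
  have P1i: "ideal P1 (SS n)" using P1(1) by (simp add: primeideal_def)
  obtain M where M: "maximalideal M R" "vq M n 0 \<subseteq> P1" "\<forall>c\<in>carrier R. pconst c \<in> P1 \<longleftrightarrow> c \<in> M"
    using contraction[OF P1(1)] by blast
  have Mi: "ideal M R" using M(1) by (simp add: maximalideal_def)
  have fP: "set fs \<subseteq> P1" using S.genideal_self[OF fsc] P1(2) by blast
  \<comment> \<open>A generator with constant term outside \<open>M\<close> would make the proper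
    ideal \<open>P1\<close> contain \<open>1\<close>.\<close>
  have f0: "f ezero \<in> M" if "f \<in> set fs" for f
    using const_unit[OF M(1) P1i M(2), of f] one_notin_prime[OF P1(1)] fP that by blast
  let ?A = "set fs \<union> vq M n 0"
  have A: "?A \<subseteq> SV n" using fs vq_SV by blast
  then have Ac: "?A \<subseteq> carrier (SS n)" by simp
  let ?J = "genideal (SS n) ?A"
  have J: "ideal ?J (SS n)" by (rule S.genideal_ideal[OF Ac])
  have JP: "?J \<subseteq> P1" by (rule S.genideal_minimal[OF P1i]) (use fP M(2) in blast)
  have AJ: "?A \<subseteq> ?J" by (rule S.genideal_self[OF Ac])
  have oneJ: "\<one>[n] \<notin> ?J" using one_notin_prime[OF P1(1)] JP by blast
  have vJ: "vq M n 0 \<subseteq> ?J" using AJ by blast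
  obtain k y P where P: "sop n ?J k y" "primeideal P (SS n)" "?J \<subseteq> P"
    "\<forall>r D. (\<forall>i\<le>r. primeideal (D i) (SS n)) \<longrightarrow> (\<forall>i<r. D i \<subset> D (Suc i)) \<longrightarrow> D r = P \<longrightarrow> r + k \<le> n"
    using small_height_prime[OF M(1) J vJ oneJ] by (elim exE conjE)
  have nk: "n \<le> k + length fs"
  proof (rule ccontr)
    assume n: "\<not> ?thesis"
    obtain e where e: "e \<in> carrier R" "e \<otimes> e = e" "e \<notin> M" "\<forall>M'. maximalideal M' R \<longrightarrow> M' \<noteq> M \<longrightarrow> e \<in> M'"
      using idempotent_at[OF M(1)] by blast
    let ?fs = "fs @ [\<zero>[n]]"
    have "pconst e \<otimes>[n] \<one>[n] \<in> genideal (SS n) (set (take (length fs) ?fs))"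
    proof (rule local_regularity[OF M(1) e(1,2), where fs = ?fs and i = "length fs" and z = "\<one>[n]"])
      show "e \<in> M'" if "maximalideal M' R" "M' \<noteq> M" for M' using e(4) that by blast
      show "set ?fs \<subseteq> SV n" using fs SV_zero by simp
      show "f ezero \<in> M" if "f \<in> set ?fs" for f
        using f0 that zero_mem_ideal[OF Mi] by (auto simp: ps_zero)
      show "sop n (set ?fs \<union> vq M n 0) k y" by (rule sop_mono[OF sop_genideal[OF A P(1)]]) auto
      show "k + length ?fs \<le> n" using n by simp
      show "length fs < length ?fs" by simp
      show "\<one>[n] \<in> SV n" by (rule SV_one)
      have "\<zero>{n} \<in> ?I" by (rule zero_mem_ideal[OF Ii])
      then show "?fs ! length fs \<otimes>[n] \<one>[n] \<in> genideal (SS n) (set (take (length fs) ?fs))"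
        using S.l_null[OF S.one_closed] by simp
    qed
    then have "pconst e \<otimes>{n} \<one>{n} \<in> P1" using P1(2) by auto
    then have "pconst e \<in> P1" using S.r_one[of "pconst e"] pconst_SV[OF e(1), of n] by simp
    then show False using M(3) e(1,3) by blast
  qed
  \<comment> \<open>Chains ending at \<open>P\<close> have at most \<open>n - k\<close> steps, and
    \<open>nk\<close> bounds \<open>n - k\<close> by the number of generators.\<close>
  have "prime_height (SS n) P \<le> enat (length fs)"
    unfolding prime_height_def
  proof (rule SUP_least)
    fix r assume "r \<in> {k. \<exists>C. (\<forall>i\<le>k. primeideal (C i) (SS n)) \<and> (\<forall>i<k. C i \<subset> C (Suc i)) \<and> C k = P}"
    then have "r + k \<le> n" using P(4) by blast
    then show "enat r \<le> enat (length fs)" using nk by simp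
  qed
  moreover have "ideal_height (SS n) ?I \<le> prime_height (SS n) P"
    unfolding ideal_height_def
    by (rule INF_lower) (use P(2,3) AJ S.genideal_minimal[of P "set fs"] in \<open>auto simp: primeideal_def\<close>)
  ultimately show ?thesis by (rule order_trans[rotated])
qed

text \<open>The sequence itself produces a chain of full length below every prime over its ideal,
  which bounds the height from below; \<open>height_le_length\<close> is the opposite bound.\<close>

lemma regular_imp_height_generated:
  assumes fs: "regular_sequence (SS n) fs"
  shows "height_generated (SS n) (genideal (SS n) (set fs))"
proof -
  interpret S: cring "SS n" by (rule cring_ss)
  have fsc: "set fs \<subseteq> carrier (SS n)" using fs by (simp only: regular_sequence_def)
  have Ii: "ideal (genideal (SS n) (set fs)) (SS n)" by (rule S.genideal_ideal[OF fsc])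
  have wr: "weakly_regular (SS n) (rev fs)" using fs unfolding regular_sequence_def S.weakly_regular_rev_iff by blast
  have one: "\<one>[n] \<notin> genideal (SS n) (set fs)"
    using fs ideal.one_imp_carrier[OF Ii] unfolding regular_sequence_def by auto
  have "enat (length fs) \<le> ideal_height (SS n) (genideal (SS n) (set fs))"
    unfolding ideal_height_def
  proof (rule INF_greatest)
    fix P assume P: "P \<in> {P. primeideal P (SS n) \<and> genideal (SS n) (set fs) \<subseteq> P}"
    then have "set (rev fs) \<subseteq> P" using S.genideal_self[OF fsc] by auto
    then obtain C where "\<forall>i\<le>length fs. primeideal (C i) (SS n)" "\<forall>i<length fs. C i \<subset> C (Suc i)" "C (length fs) = P"
      using S.weakly_regular_prime_chain[OF wr, of P] fsc P by auto
    then show "enat (length fs) \<le> prime_height (SS n) P" by (rule prime_height_ge)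
  qed
  moreover have "ideal_height (SS n) (genideal (SS n) (set fs)) \<le> enat (length fs)"
    by (rule height_le_length[OF _ one]) (use fsc in simp)
  ultimately have "enat (length fs) = ideal_height (SS n) (genideal (SS n) (set fs))" by (rule antisym)
  then show ?thesis unfolding height_generated_def using fsc by (intro exI[of _ fs]) blast
qed

lemma pconst_mult_ideal:
  assumes K: "ideal K (SS n)" and z: "z \<in> carrier (SS n)"
  shows "ideal {c \<in> carrier R. z \<otimes>{n} pconst c \<in> K} R"
proof -
  interpret S: cring "SS n" by (rule cring_ss)
  interpret h: ring_hom_cring R "SS n" pconst by (rule pconst_hom)
  have "ideal {c \<in> carrier R. pconst c \<in> {x \<in> carrier (SS n). z \<otimes>{n} x \<in> K}} R"
    by (rule h.ring.ideal_vimage[OF S.ideal_smult_preimage[OF K z]])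
  moreover have "{c \<in> carrier R. pconst c \<in> {x \<in> carrier (SS n). z \<otimes>{n} x \<in> K}} = {c \<in> carrier R. z \<otimes>{n} pconst c \<in> K}"
    using h.hom_closed by blast
  ultimately show ?thesis by (simp only:)
qed

text \<open>The constants that multiply \<open>z\<close> into \<open>K\<close> form an ideal of
  \<open>R\<close> contained in no maximal ideal, hence they include \<open>1\<close>.\<close>

lemma mem_ideal_locally:
  assumes K: "ideal K (SS n)" and z: "z \<in> carrier (SS n)"
    and loc: "\<And>M. maximalideal M R \<Longrightarrow> \<exists>c\<in>carrier R. c \<notin> M \<and> z \<otimes>{n} pconst c \<in> K"
  shows "z \<in> K"
proof -
  interpret S: cring "SS n" by (rule cring_ss)
  interpret h: ring_hom_cring R "SS n" pconst by (rule pconst_hom)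
  let ?X = "{c \<in> carrier R. z \<otimes>{n} pconst c \<in> K}"
  have X: "ideal ?X R" by (rule pconst_mult_ideal[OF K z])
  have "?X = carrier R"
  proof (rule ccontr)
    assume "?X \<noteq> carrier R"
    then obtain M where "maximalideal M R" "?X \<subseteq> M" by (rule ideal_in_prime[OF X])
    then show False using loc[of M] by blast
  qed
  then have "\<one> \<in> ?X" by simp
  then have "z \<otimes>{n} pconst \<one> \<in> K" by blast
  then show ?thesis unfolding h.hom_one S.r_one[OF z] .
qed

text \<open>Over a maximal ideal outside \<open>J\<close> the ideal \<open>I\<close> is everything,
  yet single generators need not be units there and may fail to be regular. Mixing each generator
  with \<open>1\<close> on that part keeps the ideal and makes multiplication the identity there.
  Over a maximal ideal in \<open>J\<close> the height condition supplies the parameters for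
  \<open>local_regularity\<close>.\<close>

lemma height_generated_imp_regular:
  assumes I: "ideal I (SS n)" "I \<noteq> carrier (SS n)" and hg: "height_generated (SS n) I"
  shows "\<exists>fs. regular_sequence (SS n) fs \<and> genideal (SS n) (set fs) = I"
proof -
  interpret S: cring "SS n" by (rule cring_ss)
  interpret I: ideal I "SS n" by fact
  interpret h: ring_hom_cring R "SS n" pconst by (rule pconst_hom)
  obtain fs where fs: "set fs \<subseteq> carrier (SS n)" "genideal (SS n) (set fs) = I" "enat (length fs) = ideal_height (SS n) I"
    using hg unfolding height_generated_def by blast
  show ?thesis
  proof (cases fs)
    \<comment> \<open>The modified sequence recovers \<open>1 - e\<close> from one of its members,
      which requires at least one generator; the empty sequence is dealt with directly.\<close>
    case Nil
    then have "regular_sequence (SS n) fs" using fs(2) I(2) by (simp add: regular_sequence_def)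
    then show ?thesis using fs(2) by blast
  next
    case (Cons f0 fs0)
    let ?t = "length fs"
    have f0: "f0 \<in> set fs" using Cons by simp
    have fI: "f \<in> I" if "f \<in> set fs" for f using S.genideal_self[OF fs(1)] fs(2) that by blast
    define J where "J = {M. maximalideal M R \<and> (\<forall>f\<in>I. f ezero \<in> M)}"
    have "J \<subseteq> {M. maximalideal M R}" by (auto simp: J_def)
    then obtain e where e: "e \<in> carrier R" "e \<otimes> e = e" "\<forall>M. maximalideal M R \<longrightarrow> (e \<in> M \<longleftrightarrow> M \<notin> J)"
      using idempotents[of J] by blast
    let ?E = "pconst e :: (nat \<Rightarrow> nat) \<Rightarrow> 'a" and ?E' = "pconst (\<one> \<ominus> e) :: (nat \<Rightarrow> nat) \<Rightarrow> 'a"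
    note E = pconst_idempotent[OF e(1,2), of n]
    \<comment> \<open>Checked at each \<open>M\<close>. For \<open>M\<close> in \<open>J\<close> the
      product with \<open>e\<close> is zero. For \<open>M\<close> outside \<open>J\<close>, the
      idempotent \<open>c\<close> at \<open>M\<close> lies in every prime over \<open>I\<close>: a
      prime avoiding \<open>c\<close> lies over \<open>M\<close> and would contain a series with
      constant term outside \<open>M\<close>. Being idempotent, \<open>c\<close> itself is in
      \<open>I\<close>.\<close>
    have E'I: "?E' \<in> I"
    proof (rule mem_ideal_locally[OF I(1) E(2)])
      fix M assume M: "maximalideal M R"
      show "\<exists>c\<in>carrier R. c \<notin> M \<and> ?E' \<otimes>{n} pconst c \<in> I"
      proof (cases "M \<in> J")
        case True
        have "?E' \<otimes>{n} ?E \<in> I" unfolding S.m_comm[OF E(2,1)] E(5) by (rule I.zero_closed)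
        then show ?thesis using e(1,3) M True by (intro bexI[of _ e]) blast+
      next
        case False
        then obtain f where f: "f \<in> I" "f ezero \<notin> M" using M by (auto simp: J_def)
        obtain c where c: "c \<in> carrier R" "c \<otimes> c = c" "c \<notin> M" "\<forall>M'. maximalideal M' R \<longrightarrow> M' \<noteq> M \<longrightarrow> c \<in> M'"
          using idempotent_at[OF M] by blast
        note C = pconst_idempotent[OF c(1,2), of n]
        have "\<exists>k::nat. pconst c [^]{n} k \<in> I"
        proof (rule S.mem_primes_imp_power[OF I(1) C(1)])
          fix P assume P: "primeideal P (SS n)" "I \<subseteq> P"
          have Pi: "ideal P (SS n)" using P(1) by (simp add: primeideal_def)
          show "pconst c \<in> P"
          proof (rule ccontr)
            assume n: "pconst c \<notin> P"
            have "vq M n 0 \<subseteq> P" by (rule prime_over_idempotent[OF _ c(1) P(1) n]) (use c(4) in blast)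
            then have "\<one>[n] \<in> P" using const_unit[OF M Pi, of f] f P(2) by blast
            then show False using one_notin_prime[OF P(1)] by simp
          qed
        qed
        then obtain k :: nat where k: "pconst c [^]{n} k \<in> I" ..
        have "pconst c [^]{n} Suc k = pconst c" for k :: nat
        proof (induction k)
          case 0
          show ?case using S.nat_pow_Suc[of "pconst c" 0] S.l_one[OF C(1)] S.nat_pow_0[of "pconst c"] by (simp only:)
        next
          case (Suc k)
          show ?case using S.nat_pow_Suc[of "pconst c" "Suc k"] Suc C(3) by (simp only:)
        qed
        moreover have "pconst c [^]{n} Suc k \<in> I" unfolding S.nat_pow_Suc by (rule I.I_r_closed[OF k C(1)])
        ultimately have "pconst c \<in> I" by (simp only:)
        then have "?E' \<otimes>{n} pconst c \<in> I" by (rule I.I_l_closed[OF _ E(2)])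
        then show ?thesis using c(1,3) by blast
      qed
    qed
    define g where "g = (\<lambda>f. ?E \<otimes>{n} f \<oplus>{n} ?E' \<otimes>{n} \<one>{n})"
    define gs where "gs = map g fs"
    have gS: "g f \<in> carrier (SS n)" if "f \<in> set fs" for f
    proof -
      have "f \<in> carrier (SS n)" using fs(1) that by blast
      then show ?thesis unfolding g_def by (intro S.a_closed S.m_closed E S.one_closed)
    qed
    have Eg: "?E \<otimes>{n} g f = ?E \<otimes>{n} f" and E'g: "?E' \<otimes>{n} g f = ?E'" if "f \<in> set fs" for f
    proof -
      have fc: "f \<in> carrier (SS n)" using fs(1) that by blast
      note m = S.idempotent_mix[OF E(1,2) fc S.one_closed E(3-5)]
      show "?E \<otimes>{n} g f = ?E \<otimes>{n} f" unfolding g_def by (rule m(1))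
      show "?E' \<otimes>{n} g f = ?E'" unfolding g_def m(2) by (rule S.r_one[OF E(2)])
    qed
    have gI: "g f \<in> I" if "f \<in> set fs" for f
      unfolding g_def S.r_one[OF E(2)] by (rule I.a_closed[OF I.I_l_closed[OF fI[OF that] E(1)] E'I])
    have gsS: "set gs \<subseteq> carrier (SS n)" using gS by (auto simp: gs_def)
    have gsI: "set gs \<subseteq> I" using gI by (auto simp: gs_def)
    have Gi: "ideal (genideal (SS n) (set gs)) (SS n)" by (rule S.genideal_ideal[OF gsS])
    interpret G: ideal "genideal (SS n) (set gs)" "SS n" by (rule Gi)
    have gG: "g f \<in> genideal (SS n) (set gs)" if "f \<in> set fs" for f
    proof -
      have "g f \<in> set gs" using that by (simp add: gs_def)
      then show ?thesis using S.genideal_self[OF gsS] by blast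
    qed
    have gen: "genideal (SS n) (set gs) = I"
    proof
      show "genideal (SS n) (set gs) \<subseteq> I" by (rule S.genideal_minimal[OF I(1) gsI])
      have E'G: "?E' \<in> genideal (SS n) (set gs)" using G.I_l_closed[OF gG[OF f0] E(2)] E'g[OF f0] by (simp only:)
      have "f \<in> genideal (SS n) (set gs)" if f: "f \<in> set fs" for f
      proof -
        have fc: "f \<in> carrier (SS n)" using fs(1) f by blast
        have "?E \<otimes>{n} f \<in> genideal (SS n) (set gs)" using G.I_l_closed[OF gG[OF f] E(1)] Eg[OF f] by (simp only:)
        from G.a_closed[OF this G.I_r_closed[OF E'G fc]]
        have "(?E \<oplus>{n} ?E') \<otimes>{n} f \<in> genideal (SS n) (set gs)" unfolding S.l_distr[OF E(1,2) fc] .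
        then show ?thesis unfolding E(6) S.l_one[OF fc] .
      qed
      then show "I \<subseteq> genideal (SS n) (set gs)" using S.genideal_minimal[OF Gi, of "set fs"] fs(2) by blast
    qed
    have reg: "z \<in> genideal (SS n) (set (take i gs))"
      if i: "i < length gs" and z: "z \<in> carrier (SS n)" "gs ! i \<otimes>{n} z \<in> genideal (SS n) (set (take i gs))" for i z
    proof -
      let ?K = "genideal (SS n) (set (take i gs))"
      have tc: "set (take i gs) \<subseteq> carrier (SS n)" using gsS set_take_subset[of i gs] by blast
      have K: "ideal ?K (SS n)" by (rule S.genideal_ideal[OF tc])
      interpret K: ideal ?K "SS n" by (rule K)
      have gi: "gs ! i = g (fs ! i)" "fs ! i \<in> set fs" using i by (auto simp: gs_def)
      show ?thesis
      proof (rule mem_ideal_locally[OF K z(1)])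
        fix M assume M: "maximalideal M R"
        interpret M: maximalideal M R by fact
        show "\<exists>c\<in>carrier R. c \<notin> M \<and> z \<otimes>{n} pconst c \<in> ?K"
        proof (cases "M \<in> J")
          case False
          have ec: "\<one> \<ominus> e \<in> carrier R" using e(1) by simp
          have "\<one> \<ominus> e \<notin> M"
          proof
            assume "\<one> \<ominus> e \<in> M"
            moreover have "e \<in> M" using e(3) M False by blast
            ultimately have "e \<oplus> (\<one> \<ominus> e) \<in> M" using M.a_closed by blast
            then have "\<one> \<in> M" using idempotent_complement(3)[OF e(1,2)] by simp
            then show False using M.one_imp_carrier M.I_notcarr by blast
          qed
          moreover have "z \<otimes>{n} ?E' \<in> ?K"
          proof -
            have gc: "g (fs ! i) \<in> carrier (SS n)" by (rule gS[OF gi(2)])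
            have "?E' \<otimes>{n} (g (fs ! i) \<otimes>{n} z) \<in> ?K" by (rule K.I_l_closed[OF _ E(2)]) (use z(2) gi(1) in simp)
            then have "(?E' \<otimes>{n} g (fs ! i)) \<otimes>{n} z \<in> ?K" unfolding S.m_assoc[OF E(2) gc z(1)] .
            then show ?thesis unfolding E'g[OF gi(2)] S.m_comm[OF E(2) z(1)] .
          qed
          ultimately show ?thesis using ec by blast
        next
          case True
          obtain c where c: "c \<in> carrier R" "c \<otimes> c = c" "c \<notin> M" "\<forall>M'. maximalideal M' R \<longrightarrow> M' \<noteq> M \<longrightarrow> c \<in> M'"
            using idempotent_at[OF M] by blast
          let ?A = "set gs \<union> vq M n 0"
          have gsV: "set gs \<subseteq> SV n" using gsS by simp
          have A: "?A \<subseteq> SV n" using gsV vq_SV by blast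
          then have Ac: "?A \<subseteq> carrier (SS n)" by simp
          have g0: "x ezero \<in> M" if "x \<in> set gs" for x using that gsI True unfolding J_def by blast
          let ?J = "genideal (SS n) ?A"
          have Ji: "ideal ?J (SS n)" by (rule S.genideal_ideal[OF Ac])
          have AJ: "?A \<subseteq> ?J" by (rule S.genideal_self[OF Ac])
          \<comment> \<open>With all variables set to zero, \<open>vq M n n\<close> consists of the
            series with constant term in \<open>M\<close>; this proper ideal shows that
            \<open>?J\<close> is proper.\<close>
          have "?A \<subseteq> vq M n n"
          proof
            fix x assume x: "x \<in> ?A"
            have ez: "\<beta> = ezero" if "\<beta> \<in> mexps n" "\<forall>l<n. \<beta> l = 0" for \<beta>
              using that by (auto simp: mexps_def fun_eq_iff not_less) (metis not_less)
            have "x ezero \<in> M" using x g0 by (auto simp: vq_def)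
            then show "x \<in> vq M n n" using x A ez by (auto simp: vq_def)
          qed
          then have "?J \<subseteq> vq M n n" by (rule S.genideal_minimal[OF vq_ideal[OF M.is_ideal]])
          then have oneJ: "\<one>[n] \<notin> ?J" using one_notin_vq[OF maximalideal_prime[OF M]] by blast
          have vJ: "vq M n 0 \<subseteq> ?J" using AJ by blast
          obtain k y P where P: "sop n ?J k y" "primeideal P (SS n)" "?J \<subseteq> P"
            "\<forall>r D. (\<forall>i\<le>r. primeideal (D i) (SS n)) \<longrightarrow> (\<forall>i<r. D i \<subset> D (Suc i)) \<longrightarrow> D r = P \<longrightarrow> r + k \<le> n"
            using small_height_prime[OF M Ji vJ oneJ] by (elim exE conjE)
          have Pi: "ideal P (SS n)" using P(2) by (simp add: primeideal_def)
          have "I \<subseteq> P" unfolding gen[symmetric] by (rule S.genideal_minimal[OF Pi]) (use AJ P(3) in blast)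
          then have "ideal_height (SS n) I \<le> prime_height (SS n) P"
            unfolding ideal_height_def by (intro INF_lower) (use P(2) in simp)
          then have ht: "enat ?t \<le> prime_height (SS n) P" by (simp only: fs(3))
          \<comment> \<open>The prime \<open>P\<close> lies over \<open>I\<close> and so has height
            at least \<open>?t\<close>, while its chains have at most \<open>n - k\<close> steps. If
            the claim failed, the height would be at most \<open>?t - 1\<close>, which is absurd
            because \<open>?t\<close> is positive in this case.\<close>
          have "k + ?t \<le> n"
          proof (rule ccontr)
            assume n: "\<not> ?thesis"
            have "prime_height (SS n) P \<le> enat (?t - 1)"
              unfolding prime_height_def
            proof (rule SUP_least)
              fix r assume "r \<in> {k. \<exists>C. (\<forall>i\<le>k. primeideal (C i) (SS n)) \<and> (\<forall>i<k. C i \<subset> C (Suc i)) \<and> C k = P}"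
              then have "r + k \<le> n" using P(4) by blast
              then show "enat r \<le> enat (?t - 1)" using n by simp
            qed
            with ht have "enat ?t \<le> enat (?t - 1)" by (rule order_trans)
            then show False using Cons by simp
          qed
          then have kn: "k + length gs \<le> n" by (simp add: gs_def)
          have "pconst c \<otimes>[n] z \<in> ?K"
          proof (rule local_regularity[OF M c(1,2), where fs = gs and i = i and k = k and y = y])
            show "c \<in> M'" if "maximalideal M' R" "M' \<noteq> M" for M' using c(4) that by blast
            show "x ezero \<in> M" if "x \<in> set gs" for x by (rule g0[OF that])
            show "z \<in> SV n" "gs ! i \<otimes>[n] z \<in> ?K" using z by simp_all
          qed (rule gsV sop_genideal[OF A P(1)] kn i)+
          then have "z \<otimes>{n} pconst c \<in> ?K" using S.m_comm[OF z(1), of "pconst c"] pconst_SV[OF c(1)] by simp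
          then show ?thesis using c(1,3) by blast
        qed
      qed
    qed
    have "regular_sequence (SS n) gs" unfolding regular_sequence_def using gsS gen I(2) reg by blast
    then show ?thesis using gen by blast
  qed
qed

theorem height_generated_iff_regular:
  assumes "ideal I (SS n)" "I \<noteq> carrier (SS n)"
  shows "height_generated (SS n) I \<longleftrightarrow> (\<exists>fs. regular_sequence (SS n) fs \<and> genideal (SS n) (set fs) = I)"
  using height_generated_imp_regular[OF assms] regular_imp_height_generated by blast

end

section \<open>Zero-dimensional and Artinian coefficients\<close>

context cring
begin

lemma maximalideal_not_subset:
  assumes "maximalideal M R" "maximalideal N R" "M \<noteq> N" shows "\<exists>x\<in>M. x \<notin> N"
proof (rule ccontr)
  assume n: "\<not> ?thesis"
  interpret M: maximalideal M R by fact
  interpret N: maximalideal N R by fact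
  have "M \<subseteq> N" using n by blast
  then have "N = M \<or> N = carrier R" by (rule M.I_maximal[OF N.is_ideal _ ideal_subset[OF N.is_ideal]])
  then show False using assms(3) N.I_notcarr by blast
qed

lemma maximalideal_one: "maximalideal M R \<Longrightarrow> \<one> \<notin> M"
  using ideal.one_imp_carrier[of M R] unfolding maximalideal_def maximalideal_axioms_def by blast

lemma avoid_maximal:
  assumes N: "maximalideal N R" and "finite X" "\<And>M. M \<in> X \<Longrightarrow> maximalideal M R \<and> M \<noteq> N"
  shows "\<exists>b\<in>carrier R. b \<notin> N \<and> (\<forall>M\<in>X. b \<in> M)"
  using assms(2,3)
proof (induction X rule: finite_induct)
  case empty
  show ?case using maximalideal_one[OF N] by (intro bexI[of _ \<one>]) auto
next
  case (insert M X)
  obtain b where b: "b \<in> carrier R" "b \<notin> N" "\<forall>M\<in>X. b \<in> M" using insert by auto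
  have M: "maximalideal M R" "M \<noteq> N" using insert.prems by auto
  obtain x where x: "x \<in> M" "x \<notin> N" using maximalideal_not_subset[OF M(1) N M(2)] by blast
  interpret N: primeideal N R by (rule maximalideal_prime[OF N])
  interpret M: maximalideal M R by (rule M(1))
  have xc: "x \<in> carrier R" by (rule M.Icarr[OF x(1)])
  have "x \<otimes> b \<notin> N" using N.I_prime[OF xc b(1)] x(2) b(2) by blast
  moreover have "x \<otimes> b \<in> M'" if "M' \<in> insert M X" for M'
  proof (cases "M' = M")
    case True
    then show ?thesis using M.I_r_closed[OF x(1) b(1)] by simp
  next
    case False
    then have "M' \<in> X" using that by simp
    then have "ideal M' R" "b \<in> M'" using insert.prems b(3) by (auto simp: maximalideal_def)
    then show ?thesis using ideal.I_l_closed[of M' R b x] xc by blast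
  qed
  ultimately show ?case using xc b(1) by (intro bexI[of _ "x \<otimes> b"]) auto
qed

lemma one_minus_mult:
  assumes "x \<in> carrier R" "y \<in> carrier R"
  shows "(\<one> \<ominus> x) \<otimes> (\<one> \<ominus> y) = \<one> \<ominus> ((x \<oplus> y) \<ominus> x \<otimes> y)"
proof -
  have "(\<one> \<ominus> x) \<otimes> (\<one> \<ominus> y) = (\<one> \<ominus> y) \<oplus> \<ominus> (x \<otimes> (\<one> \<ominus> y))"
    using assms by (simp add: minus_eq l_distr l_minus)
  also have "\<dots> = \<one> \<oplus> (\<ominus> x \<oplus> \<ominus> y \<oplus> x \<otimes> y)"
    using assms by (simp add: minus_eq r_distr r_minus minus_add a_ac)
  also have "\<dots> = \<one> \<ominus> ((x \<oplus> y) \<ominus> x \<otimes> y)" using assms by (simp add: minus_eq minus_add)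
  finally show ?thesis .
qed

text \<open>If none of the elements \<open>b^k (1 - c b)\<close> were zero, some prime would avoid
  them all, in particular \<open>b\<close>. That prime is maximal, so \<open>b\<close> is invertible
  modulo it, and \<open>1 - d b\<close> would lie both in the prime and in the avoided set.\<close>

lemma strongly_pi_regular:
  assumes pm: "\<And>P. primeideal P R \<Longrightarrow> maximalideal P R" and b: "b \<in> carrier R"
  shows "\<exists>k::nat. \<exists>c\<in>carrier R. b [^] k \<otimes> (\<one> \<ominus> c \<otimes> b) = \<zero>"
proof (rule ccontr)
  assume n: "\<not> ?thesis"
  let ?E = "{b [^] k \<otimes> (\<one> \<ominus> c \<otimes> b) | (k::nat) c. c \<in> carrier R}"
  have "\<exists>P. primeideal P R \<and> P \<inter> ?E = {}"
  proof (rule prime_disjoint[OF zeroideal, of ?E])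
    show "?E \<subseteq> carrier R" using b by auto
    have "\<one> = b [^] (0::nat) \<otimes> (\<one> \<ominus> \<zero> \<otimes> b)" using b by (simp add: minus_eq)
    then show "\<one> \<in> ?E" using zero_closed by blast
    have "\<zero> \<notin> ?E"
    proof
      assume "\<zero> \<in> ?E"
      then obtain k :: nat and c where kc: "\<zero> = b [^] k \<otimes> (\<one> \<ominus> c \<otimes> b)" "c \<in> carrier R" by blast
      from kc(1)[symmetric] show False using n kc(2) by blast
    qed
    then show "{\<zero>} \<inter> ?E = {}" by blast
    fix x y assume "x \<in> ?E" "y \<in> ?E"
    then obtain k l :: nat and c d where x: "x = b [^] k \<otimes> (\<one> \<ominus> c \<otimes> b)" "c \<in> carrier R"
      and y: "y = b [^] l \<otimes> (\<one> \<ominus> d \<otimes> b)" "d \<in> carrier R" by blast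
    \<comment> \<open>From \<open>(1 - x)(1 - y) = 1 - (x + y - x y)\<close> with
      \<open>x = c b\<close> and \<open>y = d b\<close>, after extracting the factor
      \<open>b\<close>.\<close>
    let ?g = "(c \<oplus> d) \<ominus> c \<otimes> (b \<otimes> d)"
    have g: "?g \<in> carrier R" using x y b by simp
    have cd: "c \<otimes> b \<in> carrier R" "d \<otimes> b \<in> carrier R" using x y b by simp_all
    have "(\<one> \<ominus> c \<otimes> b) \<otimes> (\<one> \<ominus> d \<otimes> b) = \<one> \<ominus> ?g \<otimes> b"
    proof -
      have "?g \<otimes> b = (c \<otimes> b \<oplus> d \<otimes> b) \<ominus> (c \<otimes> b) \<otimes> (d \<otimes> b)"
        using x(2) y(2) b by (simp add: minus_eq l_distr l_minus r_distr r_minus m_ac)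
      then show ?thesis by (simp only: one_minus_mult[OF cd])
    qed
    then have "x \<otimes> y = b [^] (k + l) \<otimes> (\<one> \<ominus> ?g \<otimes> b)"
      using x y b cd by (simp add: nat_pow_mult[symmetric] m_ac)
    then show "x \<otimes> y \<in> ?E" using g by blast
  next
    fix P assume "primeideal P R" "{\<zero>} \<subseteq> P" "P \<inter> ?E = {}"
    then show "\<exists>P. primeideal P R \<and> P \<inter> ?E = {}" by blast
  qed
  then obtain P where P: "primeideal P R" "P \<inter> ?E = {}" by blast
  have "b = b [^] (1::nat) \<otimes> (\<one> \<ominus> \<zero> \<otimes> b)" using b by (simp add: minus_eq)
  then have "b \<in> ?E" using zero_closed by blast
  then have bP: "b \<notin> P" using P(2) by blast
  obtain d m where d: "d \<in> carrier R" "m \<in> P" "d \<otimes> b \<oplus> m = \<one>" using maximal_unit[OF pm[OF P(1)] b bP] by blast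
  have mc: "m \<in> carrier R" using d(2) P(1) ideal_subset unfolding primeideal_def by blast
  have "m = \<one> \<ominus> d \<otimes> b" using add_eq_imp_diff[OF d(3) _ mc] d(1) b by simp
  also have "\<dots> = b [^] (0::nat) \<otimes> (\<one> \<ominus> d \<otimes> b)" using b d(1) by simp
  finally have "m \<in> ?E" using d(1) by blast
  then show False using d(2) P(2) by blast
qed

text \<open>With \<open>u = c b\<close>, strong pi-regularity gives
  \<open>u^(k+1) (1 - u) = 0\<close>. Hence multiplication by \<open>u\<close> fixes
  \<open>u^(k+1)\<close>, which is therefore idempotent. Modulo a maximal ideal avoiding
  \<open>b\<close> the element \<open>u\<close> is \<open>1\<close>, so the idempotent avoids it
  too.\<close>

lemma associated_idempotent:
  assumes pm: "\<And>P. primeideal P R \<Longrightarrow> maximalideal P R" and b: "b \<in> carrier R"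
  shows "\<exists>e\<in>carrier R. e \<otimes> e = e \<and> (\<forall>M. maximalideal M R \<longrightarrow> (e \<in> M \<longleftrightarrow> b \<in> M))"
proof -
  obtain k :: nat and c where c: "c \<in> carrier R" "b [^] k \<otimes> (\<one> \<ominus> c \<otimes> b) = \<zero>" using strongly_pi_regular[OF pm b] by blast
  let ?u = "c \<otimes> b"
  have u: "?u \<in> carrier R" using b c by simp
  define e where "e = ?u [^] Suc k"
  have ec: "e \<in> carrier R" using u by (simp add: e_def)
  have "e \<otimes> (\<one> \<ominus> ?u) = (c [^] Suc k \<otimes> b) \<otimes> (b [^] k \<otimes> (\<one> \<ominus> ?u))"
    using b c(1) by (simp add: e_def nat_pow_distrib m_ac)
  then have z: "e \<otimes> (\<one> \<ominus> ?u) = \<zero>" using c b by simp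
  have eu: "e \<otimes> ?u = e"
  proof -
    have "e \<otimes> ((\<one> \<ominus> ?u) \<oplus> ?u) = e \<otimes> (\<one> \<ominus> ?u) \<oplus> e \<otimes> ?u"
      by (rule r_distr) (use ec u in auto)
    then show ?thesis unfolding z diff_add_cancel_cring[OF one_closed u] using ec u by simp
  qed
  have pe: "e \<otimes> ?u [^] j = e" for j :: nat
    by (induction j) (use ec u eu in \<open>simp_all add: m_assoc[symmetric]\<close>)
  have ee: "e \<otimes> e = e" using pe[of "Suc k"] by (simp only: e_def)
  have "e \<in> M \<longleftrightarrow> b \<in> M" if M: "maximalideal M R" for M
  proof -
    interpret M: primeideal M R by (rule maximalideal_prime[OF M])
    have "e \<in> M" if "b \<in> M"
    proof -
      have "?u \<in> M" by (rule M.I_l_closed[OF that c(1)])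
      then show ?thesis unfolding e_def by (rule primeideal_pow_iff[OF M.primeideal_axioms]) simp
    qed
    moreover have "b \<in> M" if "e \<in> M"
    proof (rule ccontr)
      assume n: "b \<notin> M"
      have uM: "?u \<in> M" by (rule primeideal_pow[OF M.primeideal_axioms u]) (use that e_def in blast)
      have "b [^] k \<otimes> (\<one> \<ominus> ?u) \<in> M" unfolding c(2) by (rule M.zero_closed)
      moreover have "b [^] k \<notin> M" using primeideal_pow[OF M.primeideal_axioms b, of k] n by blast
      ultimately have "\<one> \<ominus> ?u \<in> M" using M.I_prime[of "b [^] k" "\<one> \<ominus> ?u"] b u by auto
      then have "\<one> \<in> M" by (rule ideal_diff_mem[OF M.is_ideal _ uM]) simp
      then show False using maximalideal_one[OF M] by simp
    qed
    ultimately show ?thesis by blast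
  qed
  then show ?thesis using ec ee by blast
qed

text \<open>Finiteness provides, for each maximal ideal, an element outside it that lies in all the
  others. The memberships in \<open>J\<close> are arranged one ideal at a time, and the associated
  idempotent of the result is taken at the end.\<close>

lemma semilocal_idempotents:
  assumes pm: "\<And>P. primeideal P R \<Longrightarrow> maximalideal P R" and fin: "finite {M. maximalideal M R}"
    and J: "J \<subseteq> {M. maximalideal M R}"
  shows "\<exists>e\<in>carrier R. e \<otimes> e = e \<and> (\<forall>M. maximalideal M R \<longrightarrow> (e \<in> M \<longleftrightarrow> M \<notin> J))"
proof -
  have "finite J" by (rule finite_subset[OF J fin])
  then have "\<exists>b\<in>carrier R. \<forall>M. maximalideal M R \<longrightarrow> (b \<in> M \<longleftrightarrow> M \<notin> J)"
    using J
  proof (induction J rule: finite_induct)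
    case empty
    have "\<zero> \<in> M" if "maximalideal M R" for M
      using that additive_subgroup.zero_closed[OF ideal.axioms(1)] unfolding maximalideal_def by blast
    then show ?case by (intro bexI[of _ \<zero>]) auto
  next
    case (insert N J)
    obtain b where b: "b \<in> carrier R" "\<forall>M. maximalideal M R \<longrightarrow> (b \<in> M \<longleftrightarrow> M \<notin> J)" using insert by auto
    have N: "maximalideal N R" using insert.prems by simp
    have "finite ({M. maximalideal M R} - {N})" using fin by simp
    then have "\<exists>x\<in>carrier R. x \<notin> N \<and> (\<forall>M\<in>{M. maximalideal M R} - {N}. x \<in> M)"
      by (rule avoid_maximal[OF N]) blast
    then obtain x where x: "x \<in> carrier R" "x \<notin> N" "\<forall>M\<in>{M. maximalideal M R} - {N}. x \<in> M" by blast
    obtain a where a: "a \<in> carrier R" "a \<otimes> a = a" "\<forall>M. maximalideal M R \<longrightarrow> (a \<in> M \<longleftrightarrow> x \<in> M)"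
    proof -
      have "\<exists>a\<in>carrier R. a \<otimes> a = a \<and> (\<forall>M. maximalideal M R \<longrightarrow> (a \<in> M \<longleftrightarrow> x \<in> M))"
        by (rule associated_idempotent[OF pm x(1)])
      then show ?thesis using that by (elim bexE conjE)
    qed
    have aM: "a \<in> M \<longleftrightarrow> M \<noteq> N" if "maximalideal M R" for M
      using a(3)[THEN spec, THEN mp, OF that] x(2,3) that by (cases "M = N") blast+
    let ?a = "\<one> \<ominus> a"
    note ic = idempotent_complement[OF a(1,2)]
    have c: "?a \<in> carrier R" using a(1) by simp
    \<comment> \<open>The idempotent \<open>a\<close> avoids \<open>N\<close> only. The mixture
      belongs to a maximal ideal exactly when both \<open>a\<close> and \<open>b\<close> do, so it
      avoids \<open>N\<close> and behaves like \<open>b\<close> elsewhere.\<close>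
    let ?b = "a \<oplus> ?a \<otimes> b"
    have "?b \<in> M \<longleftrightarrow> M \<notin> insert N J" if M: "maximalideal M R" for M
    proof -
      interpret M: primeideal M R by (rule maximalideal_prime[OF M])
      have "a \<in> M \<and> b \<in> M" if h: "?b \<in> M"
      proof -
        have "a \<otimes> ?b = a \<otimes> a \<oplus> (a \<otimes> ?a) \<otimes> b" using a(1) b(1) c by (simp add: r_distr m_assoc)
        also have "\<dots> = a" using a(1,2) b(1) ic(1) by simp
        finally have aM': "a \<in> M" using M.I_l_closed[OF h a(1)] by simp
        have "?a \<otimes> b \<oplus> a \<in> M" using h a(1) b(1) c by (simp add: a_comm)
        then have "?a \<otimes> b \<in> M" by (rule ideal_add_cancel[OF M.is_ideal _ aM']) (use b(1) c in simp)
        then have "?a \<in> M \<or> b \<in> M" by (rule M.I_prime[OF c b(1)])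
        moreover have "?a \<notin> M"
        proof
          assume "?a \<in> M"
          from M.a_closed[OF aM' this] have "\<one> \<in> M" unfolding ic(3) .
          then show False using maximalideal_one[OF M] by simp
        qed
        ultimately show ?thesis using aM' by blast
      qed
      moreover have "?b \<in> M" if "a \<in> M" "b \<in> M" using that M.a_closed M.I_l_closed[OF _ c] by blast
      ultimately show ?thesis using aM[OF M] b(2) M by blast
    qed
    then show ?case using a(1) b(1) c by (intro bexI[of _ ?b]) auto
  qed
  then obtain b where b: "b \<in> carrier R" "\<forall>M. maximalideal M R \<longrightarrow> (b \<in> M \<longleftrightarrow> M \<notin> J)" by blast
  obtain e where "e \<in> carrier R" "e \<otimes> e = e" "\<forall>M. maximalideal M R \<longrightarrow> (e \<in> M \<longleftrightarrow> b \<in> M)"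
    using associated_idempotent[OF pm b(1)] by blast
  then show ?thesis using b(2) by blast
qed

text \<open>Submodules are compared through their ideals of leading coefficients.\<close>

lemma low_dcc:
  assumes B: "subring B R" and art: "artinian (R\<lparr>carrier := B\<rparr>)" and a: "a \<in> carrier R"
    and N: "\<And>k. N k \<subseteq> low R B a d" "\<And>k. \<zero> \<in> N k" "\<And>k x y. x \<in> N k \<Longrightarrow> y \<in> N k \<Longrightarrow> x \<oplus> y \<in> N k"
      "\<And>k b x. b \<in> B \<Longrightarrow> x \<in> N k \<Longrightarrow> b \<otimes> x \<in> N k" "\<And>k::nat. N (Suc k) \<subseteq> N k"
  shows "\<exists>K. \<forall>k\<ge>K. N k = N K"
  using N
proof (induction d arbitrary: N)
  case 0
  have "N k = {\<zero>}" for k using 0(1)[of k] 0(2)[of k] by auto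
  then show ?case by simp
next
  case (Suc d)
  note lc = low_carr[OF B a]
  interpret B: cring "R\<lparr>carrier := B\<rparr>" using subcring_iff[OF subringE(1)[OF B]] subcringI'[OF B] by blast
  have Bc: "b \<in> carrier R" if "b \<in> B" for b using subringE(1)[OF B] that by blast
  define I where "I = (\<lambda>k. {b \<in> B. \<exists>l\<in>low R B a d. l \<oplus> b \<otimes> a [^] d \<in> N k})"
  define N' where "N' = (\<lambda>k. N k \<inter> low R B a d)"
  have ad: "a [^] d \<in> carrier R" using a by simp
  have Ii: "ideal (I k) (R\<lparr>carrier := B\<rparr>)" for k
  proof (rule B.idealI_cring)
    show "I k \<subseteq> carrier (R\<lparr>carrier := B\<rparr>)" by (auto simp: I_def)
    have "\<zero> \<oplus> \<zero> \<otimes> a [^] d \<in> N k" using Suc.prems(2) ad by simp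
    then show "\<zero>\<^bsub>R\<lparr>carrier := B\<rparr>\<^esub> \<in> I k" using subringE(2)[OF B] low_zero[OF B a] by (auto simp: I_def)
    show "x \<oplus>\<^bsub>R\<lparr>carrier := B\<rparr>\<^esub> y \<in> I k" if xy: "x \<in> I k" "y \<in> I k" for x y
    proof -
      obtain l m where l: "l \<in> low R B a d" "l \<oplus> x \<otimes> a [^] d \<in> N k" "x \<in> B"
        and m: "m \<in> low R B a d" "m \<oplus> y \<otimes> a [^] d \<in> N k" "y \<in> B" using xy by (auto simp: I_def)
      have "(l \<oplus> x \<otimes> a [^] d) \<oplus> (m \<oplus> y \<otimes> a [^] d) = (l \<oplus> m) \<oplus> (x \<oplus> y) \<otimes> a [^] d"
        using lc[OF l(1)] lc[OF m(1)] Bc l(3) m(3) ad by (simp add: l_distr a_ac)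
      then have "(l \<oplus> m) \<oplus> (x \<oplus> y) \<otimes> a [^] d \<in> N k" using Suc.prems(3)[OF l(2) m(2)] by simp
      then show ?thesis using low_add[OF B a l(1) m(1)] subringE(7)[OF B l(3) m(3)] by (auto simp: I_def)
    qed
    show "c \<otimes>\<^bsub>R\<lparr>carrier := B\<rparr>\<^esub> x \<in> I k" if c: "c \<in> carrier (R\<lparr>carrier := B\<rparr>)" and x: "x \<in> I k" for c x
    proof -
      have cB: "c \<in> B" using c by simp
      obtain l where l: "l \<in> low R B a d" "l \<oplus> x \<otimes> a [^] d \<in> N k" "x \<in> B" using x by (auto simp: I_def)
      have "c \<otimes> (l \<oplus> x \<otimes> a [^] d) = c \<otimes> l \<oplus> (c \<otimes> x) \<otimes> a [^] d"
        using lc[OF l(1)] Bc cB l(3) ad by (simp add: r_distr m_assoc)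
      then have "c \<otimes> l \<oplus> (c \<otimes> x) \<otimes> a [^] d \<in> N k" using Suc.prems(4)[OF cB l(2)] by simp
      then show ?thesis using low_smult[OF B a l(1) cB] subringE(6)[OF B cB l(3)] by (auto simp: I_def)
    qed
  qed
  have "I (Suc k) \<subseteq> I k" for k using Suc.prems(5)[of k] unfolding I_def by blast
  then obtain K1 where K1: "\<forall>k\<ge>K1. I k = I K1" using art Ii unfolding artinian_def by blast
  have "\<exists>K. \<forall>k\<ge>K. N' k = N' K"
  proof (rule Suc.IH)
    show "x \<oplus> y \<in> N' k" if "x \<in> N' k" "y \<in> N' k" for k x y
      using that Suc.prems(3) low_add[OF B a] by (simp add: N'_def)
    show "b \<otimes> x \<in> N' k" if "b \<in> B" "x \<in> N' k" for k b x
      using that Suc.prems(4) low_smult[OF B a] by (simp add: N'_def)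
    show "N' (Suc k) \<subseteq> N' k" for k using Suc.prems(5)[of k] unfolding N'_def by blast
  qed (use Suc.prems(2) low_zero[OF B a] in \<open>auto simp: N'_def\<close>)
  then obtain K2 where K2: "\<forall>k\<ge>K2. N' k = N' K2" by blast
  define K where "K = max K1 K2"
  have anti: "N l \<subseteq> N k" if "k \<le> l" for k l using that by (rule lift_Suc_antimono_le[of N, OF Suc.prems(5)])
  have "N k = N K" if k: "K \<le> k" for k
  proof
    show "N k \<subseteq> N K" by (rule anti[OF k])
    have kK: "K1 \<le> k" "K2 \<le> k" "K1 \<le> K" "K2 \<le> K" using k by (auto simp: K_def)
    have IK: "I k = I K" "N' k = N' K"
      using K1[rule_format, OF kK(1)] K1[rule_format, OF kK(3)] K2[rule_format, OF kK(2)] K2[rule_format, OF kK(4)]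
      by (simp_all only:)
    \<comment> \<open>An element of \<open>N K\<close> has the same leading coefficient as some
      element of \<open>N k\<close>. Their difference has lower degree and lies in
      \<open>N' K\<close>, which equals \<open>N' k\<close>.\<close>
    show "N K \<subseteq> N k"
    proof
      fix x assume x: "x \<in> N K"
      then obtain l b where l: "x = l \<oplus> b \<otimes> a [^] d" "l \<in> low R B a d" "b \<in> B" using Suc.prems(1)[of K] by auto
      then have "b \<in> I K" using x unfolding I_def by blast
      then have "b \<in> I k" by (simp only: IK(1))
      then obtain m where m: "m \<in> low R B a d" "m \<oplus> b \<otimes> a [^] d \<in> N k" unfolding I_def by blast
      let ?y = "m \<oplus> b \<otimes> a [^] d"
      have c: "l \<in> carrier R" "m \<in> carrier R" "b \<otimes> a [^] d \<in> carrier R"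
        using lc[OF l(2)] lc[OF m(1)] m_closed[OF Bc[OF l(3)] ad] by blast+
      have yK: "?y \<in> N K" using m(2) anti[OF k] by blast
      have "(\<ominus> \<one>) \<otimes> ?y \<in> N K" by (rule Suc.prems(4)[OF subringE(5)[OF B subringE(3)[OF B]] yK])
      then have "x \<oplus> \<ominus> ?y \<in> N K" using Suc.prems(3)[OF x] c by (simp add: l_minus)
      moreover have "x \<oplus> \<ominus> ?y = l \<ominus> m"
      proof -
        have "x \<oplus> \<ominus> ?y = (l \<ominus> m) \<oplus> (b \<otimes> a [^] d \<oplus> \<ominus> (b \<otimes> a [^] d))"
          unfolding l(1) using c by (simp add: minus_eq minus_add a_ac)
        then show ?thesis using c by (simp add: r_neg)
      qed
      ultimately have "l \<ominus> m \<in> N' K" using low_minus[OF B a l(2) m(1)] by (simp add: N'_def)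
      then have "l \<ominus> m \<in> N' k" by (simp only: IK(2))
      then have lm: "l \<ominus> m \<in> N k" by (simp add: N'_def)
      have "x = (l \<ominus> m) \<oplus> ?y"
      proof -
        have "(l \<ominus> m) \<oplus> ?y = ((l \<ominus> m) \<oplus> m) \<oplus> b \<otimes> a [^] d" using c by (simp add: a_assoc)
        then show ?thesis unfolding diff_add_cancel_cring[OF c(1,2)] l(1) by simp
      qed
      then show "x \<in> N k" using Suc.prems(3)[OF lm m(2)] by simp
    qed
  qed
  then show ?case by blast
qed

text \<open>Once the \<open>D\<close>-th power of \<open>a\<close> is a combination of lower ones,
  so is every higher power, and the span stops growing at \<open>D\<close>.\<close>

lemma low_reduce:
  assumes B: "subring B R" and a: "a \<in> carrier R" and D: "a [^] D \<in> low R B a D"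
  shows "l \<in> low R B a (D + k) \<Longrightarrow> l \<in> low R B a D"
proof (induction k arbitrary: l)
  case (Suc k)
  have la: "m \<otimes> a \<in> low R B a D" if m: "m \<in> low R B a D" for m
  proof -
    obtain l' b where l': "m \<otimes> a = l' \<oplus> b \<otimes> a [^] D" "l' \<in> low R B a D" "b \<in> B"
      using low_shift[OF B a m] by auto
    show ?thesis unfolding l'(1) by (rule low_add[OF B a l'(2) low_smult[OF B a D l'(3)]])
  qed
  have pw: "a [^] (D + j) \<in> low R B a D" for j
  proof (induction j)
    case (Suc j)
    have "a [^] (D + Suc j) = a [^] (D + j) \<otimes> a" using a by simp
    then show ?case using la[OF Suc] by simp
  qed (use D in simp)
  obtain l' b where l': "l = l' \<oplus> b \<otimes> a [^] (D + k)" "l' \<in> low R B a (D + k)" "b \<in> B" using Suc.prems by auto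
  show ?case unfolding l'(1) by (rule low_add[OF B a Suc.IH[OF l'(2)] low_smult[OF B a pw l'(3)]])
qed simp

text \<open>The ring generated by \<open>a\<close> over \<open>B\<close> is the span of finitely
  many powers of \<open>a\<close>. Its ideals are in particular submodules over \<open>B\<close>, so
  \<open>low_dcc\<close> gives the descending chain condition.\<close>

lemma artinian_adjoin:
  assumes B: "subring B R" and art: "artinian (R\<lparr>carrier := B\<rparr>)" and a: "a \<in> carrier R"
    and l: "l \<in> low R B a d" "a [^] d \<oplus> l = \<zero>"
  shows "\<exists>C. subring C R \<and> artinian (R\<lparr>carrier := C\<rparr>) \<and> B \<subseteq> C \<and> a \<in> C"
proof -
  \<comment> \<open>One more than the degree of the equation, so that the span contains
    \<open>B\<close> even when \<open>d = 0\<close>.\<close>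
  define D where "D = Suc d"
  have lc: "l \<in> carrier R" by (rule low_carr[OF B a l(1)])
  have "l \<oplus> a [^] d = \<zero>" using l(2) lc a by (simp add: a_comm)
  then have "a [^] d = \<ominus> l" using minus_equality[of "a [^] d" l] lc a l(2) by simp
  then have "a [^] d \<in> low R B a d" using low_uminus[OF B a l(1)] by simp
  from low_shift[OF B a this] have aD: "a [^] D \<in> low R B a D" using a by (simp add: D_def)
  let ?C = "low R B a D"
  have red: "x \<in> ?C" if "x \<in> low R B a (D + k)" for x k by (rule low_reduce[OF B a aD that])
  have BC: "B \<subseteq> ?C" using E_low[OF B a] unfolding D_def by blast
  have aC: "a \<in> ?C"
  proof (rule red)
    have "\<one> \<otimes> a [^] (1::nat) \<in> low R B a (D + 1)" by (rule low_pow[OF B a subringE(3)[OF B]]) (simp add: D_def)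
    then show "a \<in> low R B a (D + 1)" using a by simp
  qed
  have C: "subring ?C R"
  proof (rule subringI)
    show "?C \<subseteq> carrier R" using low_carr[OF B a] by blast
    show "\<one> \<in> ?C" using BC subringE(3)[OF B] by blast
    show "\<ominus> h \<in> ?C" if "h \<in> ?C" for h by (rule low_uminus[OF B a that])
    show "h1 \<otimes> h2 \<in> ?C" if "h1 \<in> ?C" "h2 \<in> ?C" for h1 h2 by (rule red[OF low_mult[OF B a that]])
    show "h1 \<oplus> h2 \<in> ?C" if "h1 \<in> ?C" "h2 \<in> ?C" for h1 h2 by (rule low_add[OF B a that])
  qed
  have Cc: "cring (R\<lparr>carrier := ?C\<rparr>)" using subcring_iff[OF subringE(1)[OF C]] subcringI'[OF C] by blast
  have "\<exists>K. \<forall>k\<ge>K. f k = f K" if f: "\<forall>k. ideal (f k) (R\<lparr>carrier := ?C\<rparr>)" "\<forall>k. f (Suc k) \<subseteq> f k" for f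
  proof (rule low_dcc[OF B art a, of f D])
    have i: "ideal (f k) (R\<lparr>carrier := ?C\<rparr>)" for k using f(1) by blast
    show "f k \<subseteq> ?C" for k using cring.ideal_subset[OF Cc i[of k]] by simp
    show "\<zero> \<in> f k" for k using zero_mem_ideal[OF i[of k]] by simp
    show "x \<oplus> y \<in> f k" if "x \<in> f k" "y \<in> f k" for k x y
      using additive_subgroup.a_closed[OF ideal.axioms(1)[OF i[of k]] that] by simp
    show "b \<otimes> x \<in> f k" if "b \<in> B" "x \<in> f k" for k b x
      using ideal.I_l_closed[OF i[of k] that(2), of b] that(1) BC by auto
    show "f (Suc k) \<subseteq> f k" for k using f(2) by blast
  qed
  then have "artinian (R\<lparr>carrier := ?C\<rparr>)" using Cc unfolding artinian_def by blast
  then show ?thesis using C BC aC by blast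
qed

lemma artinian_subring_containing:
  assumes R0: "subring R0 R" "artinian (R\<lparr>carrier := R0\<rparr>)" "integral_over R R0"
    and X: "finite X" "X \<subseteq> carrier R"
  shows "\<exists>C. subring C R \<and> artinian (R\<lparr>carrier := C\<rparr>) \<and> R0 \<union> X \<subseteq> C"
  using X
proof (induction X rule: finite_induct)
  case empty
  then show ?case using R0 by auto
next
  case (insert a X)
  then obtain B where B: "subring B R" "artinian (R\<lparr>carrier := B\<rparr>)" "R0 \<union> X \<subseteq> B" by auto
  have a: "a \<in> carrier R" using insert.prems by simp
  obtain d :: nat and c where c: "\<forall>i<d. c i \<in> R0" "a [^] d \<oplus> (\<Oplus>i\<in>{..<d}. c i \<otimes> a [^] i) = \<zero>"
    using R0(3) a unfolding integral_over_def by blast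
  have "(\<Oplus>i\<in>{..<m}. c i \<otimes> a [^] i) \<in> low R B a m" if "m \<le> d" for m
    using that
  proof (induction m)
    case 0
    show ?case by simp
  next
    case (Suc m)
    have cB: "c i \<in> B" if "i < d" for i using c(1) B(3) that by blast
    have cc: "c i \<in> carrier R" if "i < d" for i using subringE(1)[OF B(1)] cB[OF that] by blast
    have "(\<Oplus>i\<in>{..<Suc m}. c i \<otimes> a [^] i) = c m \<otimes> a [^] m \<oplus> (\<Oplus>i\<in>{..<m}. c i \<otimes> a [^] i)"
      unfolding lessThan_Suc by (rule finsum_insert) (use Suc.prems cc a in auto)
    moreover have "(\<Oplus>i\<in>{..<m}. c i \<otimes> a [^] i) \<in> carrier R" by (rule finsum_closed) (use Suc.prems cc a in auto)
    ultimately have "(\<Oplus>i\<in>{..<Suc m}. c i \<otimes> a [^] i) = (\<Oplus>i\<in>{..<m}. c i \<otimes> a [^] i) \<oplus> c m \<otimes> a [^] m"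
      using cc[of m] Suc.prems a by (simp add: a_comm)
    then show ?case using Suc cB[of m] by auto
  qed
  from this[of d] obtain C where "subring C R" "artinian (R\<lparr>carrier := C\<rparr>)" "B \<subseteq> C" "a \<in> C"
    using artinian_adjoin[OF B(1,2) a _ c(2)] by auto
  then show ?case using B(3) by blast
qed

end

section \<open>Nil ideals of Artinian rings and nilpotent power series\<close>

fun ideal_power :: "('a, 'b) ring_scheme \<Rightarrow> 'a set \<Rightarrow> nat \<Rightarrow> 'a set" where
  "ideal_power R K 0 = carrier R"
| "ideal_power R K (Suc k) = genideal R {a \<otimes>\<^bsub>R\<^esub> b | a b. a \<in> K \<and> b \<in> ideal_power R K k}"

context cring
begin

lemma ideal_power_ideal:
  assumes K: "ideal K R" shows "ideal (ideal_power R K k) R"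
proof (induction k)
  case 0
  show ?case by (simp add: oneideal)
next
  case (Suc k)
  have "{a \<otimes> b | a b. a \<in> K \<and> b \<in> ideal_power R K k} \<subseteq> carrier R"
    using ideal_subset[OF K] ideal_subset[OF Suc] by auto
  then show ?case by (simp add: genideal_ideal)
qed

lemma ideal_power_mult:
  assumes K: "ideal K R" and "a \<in> K" "b \<in> ideal_power R K k"
  shows "a \<otimes> b \<in> ideal_power R K (Suc k)"
proof -
  have "{a \<otimes> b | a b. a \<in> K \<and> b \<in> ideal_power R K k} \<subseteq> carrier R"
    using ideal_subset[OF K] ideal_subset[OF ideal_power_ideal[OF K]] by auto
  from genideal_self[OF this] show ?thesis using assms by auto
qed

lemma artinian_minimal:
  assumes art: "artinian R" and ne: "L \<in> X" and X: "\<And>L. L \<in> X \<Longrightarrow> ideal L R"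
  shows "\<exists>L\<in>X. \<forall>L'\<in>X. L' \<subseteq> L \<longrightarrow> L' = L"
proof (rule ccontr)
  assume n: "\<not> ?thesis"
  have "\<exists>f. \<forall>k::nat. f k \<in> X \<and> f (Suc k) \<subset> f k"
  proof (rule dependent_nat_choice)
    show "\<exists>L. L \<in> X" using ne by blast
    fix L assume "L \<in> X"
    then show "\<exists>L'. L' \<in> X \<and> L' \<subset> L" using n by blast
  qed
  then obtain f where f: "\<forall>k::nat. f k \<in> X \<and> f (Suc k) \<subset> f k" ..
  have "\<forall>k. ideal (f k) R" "\<forall>k. f (Suc k) \<subseteq> f k" using f X by blast+
  then obtain N where N: "\<forall>k\<ge>N. f k = f N" using art unfolding artinian_def by blast
  have "f (Suc N) = f N" by (rule N[rule_format]) simp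
  then show False using f by blast
qed

text \<open>Let \<open>T\<close> be the stable power of \<open>K\<close> and suppose it is nonzero.
  Choose an ideal \<open>L\<close> minimal among those with \<open>L T\<close> nonzero and
  \<open>x\<close> in \<open>L\<close> with \<open>x T\<close> nonzero. Since
  \<open>T = K T\<close>, the ideal \<open>x K\<close> has the same property, so
  \<open>x K = L\<close> and \<open>x = x k\<close> for some nilpotent \<open>k\<close> in
  \<open>K\<close>; iterating gives \<open>x = 0\<close>.\<close>

lemma nil_ideal_nilpotent:
  assumes art: "artinian R" and K: "ideal K R" and nil: "\<And>x. x \<in> K \<Longrightarrow> \<exists>k::nat. x [^] k = \<zero>"
  shows "\<exists>k. ideal_power R K k = {\<zero>}"
proof -
  interpret K: ideal K R by fact
  have Pi: "ideal (ideal_power R K k) R" for k by (rule ideal_power_ideal[OF K])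
  have "ideal_power R K (Suc k) \<subseteq> ideal_power R K k" for k
    by (simp, rule genideal_minimal[OF Pi]) (use ideal.I_l_closed[OF Pi] K.Icarr in blast)
  then obtain N where N: "\<forall>k\<ge>N. ideal_power R K k = ideal_power R K N"
    using art Pi unfolding artinian_def by blast
  have TK: "ideal_power R K (Suc N) = ideal_power R K N" by (rule N[rule_format]) simp
  define T where "T = ideal_power R K N"
  have Ti: "ideal T R" unfolding T_def by (rule Pi)
  have T0: "\<zero> \<in> T" by (rule zero_mem_ideal[OF Ti])
  have TKg: "T = genideal R {a \<otimes> b | a b. a \<in> K \<and> b \<in> T}" using TK unfolding T_def by simp
  have "T = {\<zero>}"
  proof (rule ccontr)
    assume n: "T \<noteq> {\<zero>}"
    define X where "X = {L. ideal L R \<and> (\<exists>x\<in>L. \<exists>t\<in>T. x \<otimes> t \<noteq> \<zero>)}"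
    obtain t where t: "t \<in> T" "t \<noteq> \<zero>" using n T0 by blast
    have "\<one> \<otimes> t \<noteq> \<zero>" using t ideal_subset[OF Ti] by auto
    then have "carrier R \<in> X" unfolding X_def using t(1) oneideal one_closed by blast
    then obtain L where L: "L \<in> X" "\<forall>L'\<in>X. L' \<subseteq> L \<longrightarrow> L' = L"
      using artinian_minimal[OF art, of "carrier R" X] unfolding X_def by blast
    have Li: "ideal L R" using L(1) by (simp add: X_def)
    obtain x s where x: "x \<in> L" "s \<in> T" "x \<otimes> s \<noteq> \<zero>" using L(1) unfolding X_def by blast
    have xc: "x \<in> carrier R" using ideal_subset[OF Li] x(1) by blast
    let ?xK = "{x \<otimes> k | k. k \<in> K}"
    have xKi: "ideal ?xK R"
    proof (rule idealI_cring)
      show "?xK \<subseteq> carrier R" using xc K.Icarr by auto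
      have "\<zero> = x \<otimes> \<zero>" using xc by simp
      then show "\<zero> \<in> ?xK" using K.zero_closed by blast
      show "u \<oplus> v \<in> ?xK" if uv: "u \<in> ?xK" "v \<in> ?xK" for u v
      proof -
        obtain k l where "u = x \<otimes> k" "v = x \<otimes> l" "k \<in> K" "l \<in> K" using uv by blast
        then have "u \<oplus> v = x \<otimes> (k \<oplus> l)" "k \<oplus> l \<in> K" using xc K.Icarr K.a_closed by (auto simp: r_distr)
        then show ?thesis by blast
      qed
      show "c \<otimes> u \<in> ?xK" if c: "c \<in> carrier R" and u: "u \<in> ?xK" for c u
      proof -
        obtain k where k: "u = x \<otimes> k" "k \<in> K" using u by blast
        have "c \<otimes> u = x \<otimes> (c \<otimes> k)" using c xc K.Icarr[OF k(2)] by (simp add: k(1) m_ac)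
        moreover have "c \<otimes> k \<in> K" by (rule K.I_l_closed[OF k(2) c])
        ultimately show ?thesis by blast
      qed
    qed
    \<comment> \<open>If \<open>x K\<close> annihilated \<open>T\<close>, then \<open>x\<close>
      would annihilate all products generating \<open>T = K T\<close>, and hence \<open>T\<close>
      itself.\<close>
    have "\<exists>u\<in>?xK. \<exists>t\<in>T. u \<otimes> t \<noteq> \<zero>"
    proof (rule ccontr)
      assume n: "\<not> ?thesis"
      have "x \<otimes> s \<in> {\<zero>}"
      proof (rule genideal_smult_mem[OF _ zeroideal xc])
        show "{a \<otimes> b | a b. a \<in> K \<and> b \<in> T} \<subseteq> carrier R" using K.Icarr ideal_subset[OF Ti] by auto
        show "s \<in> genideal R {a \<otimes> b | a b. a \<in> K \<and> b \<in> T}" using x(2) TKg by simp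
        fix y assume "y \<in> {a \<otimes> b | a b. a \<in> K \<and> b \<in> T}"
        then obtain a b where ab: "y = a \<otimes> b" "a \<in> K" "b \<in> T" by blast
        have "b \<in> carrier R" using ideal_subset[OF Ti] ab(3) by blast
        then have "x \<otimes> y = (x \<otimes> a) \<otimes> b" using ab xc K.Icarr by (simp add: m_assoc)
        moreover have "x \<otimes> a \<in> ?xK" using ab(2) by blast
        then have "(x \<otimes> a) \<otimes> b = \<zero>" using n ab(3) by blast
        ultimately show "x \<otimes> y \<in> {\<zero>}" by simp
      qed
      then show False using x(3) by simp
    qed
    then have "?xK \<in> X" unfolding X_def using xKi by blast
    moreover have "?xK \<subseteq> L" using ideal.I_r_closed[OF Li x(1)] K.Icarr by blast
    ultimately have "x \<in> ?xK" using L(2) x(1) by blast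
    then obtain k where k: "x = x \<otimes> k" "k \<in> K" by blast
    have kc: "k \<in> carrier R" by (rule K.Icarr[OF k(2)])
    have "x = x \<otimes> k [^] m" for m :: nat
    proof (induction m)
      case (Suc m)
      have "x \<otimes> k [^] Suc m = (x \<otimes> k [^] m) \<otimes> k" using xc kc by (simp add: m_assoc)
      then show ?case using Suc k(1) by simp
    qed (use xc in simp)
    moreover obtain m :: nat where "k [^] m = \<zero>" using nil[OF k(2)] by blast
    ultimately have "x = \<zero>" using xc r_null by metis
    then show False using x(2,3) ideal_subset[OF Ti] by auto
  qed
  then show ?thesis unfolding T_def by blast
qed

lemma finsum_mem_closed:
  assumes "\<zero> \<in> T" "\<And>x y. x \<in> T \<Longrightarrow> y \<in> T \<Longrightarrow> x \<oplus> y \<in> T" "T \<subseteq> carrier R" "\<And>x. x \<in> A \<Longrightarrow> f x \<in> T"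
  shows "(\<Oplus>x\<in>A. f x) \<in> T"
  using assms(4)
proof (induction A rule: infinite_finite_induct)
  case (insert x A)
  then have "f \<in> insert x A \<rightarrow> carrier R" using assms(3) by blast
  then show ?case using insert assms(2) by simp
qed (use assms(1) in \<open>auto simp: finsum_infinite\<close>)

text \<open>Nilpotent coefficients lie in the nilradical of the Artinian subring, and that ideal is
  nilpotent as a whole. Since the coefficients of the \<open>m\<close>-th power of \<open>f\<close>
  lie in its \<open>m\<close>-th power, one exponent kills infinitely many coefficients at
  once.\<close>

lemma nil_coefficients_nilpotent:
  assumes B: "subring B R" and art: "artinian (R\<lparr>carrier := B\<rparr>)" and f: "f \<in> vals B n"
    and nil: "\<And>\<nu>. \<exists>k::nat. f \<nu> [^] k = \<zero>"
  shows "\<exists>k::nat. f [^][n] k = \<zero>[n]"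
proof -
  let ?B = "R\<lparr>carrier := B\<rparr>"
  interpret B: cring ?B using subcring_iff[OF subringE(1)[OF B]] subcringI'[OF B] by blast
  interpret P: cring "PS n" by (rule cring_ps)
  have fc: "f \<in> PSC n" by (rule vals_carr[OF f])
  define K where "K = {x \<in> B. \<forall>M. primeideal M ?B \<longrightarrow> x \<in> M}"
  have Knil: "\<exists>k::nat. x [^] k = \<zero>" if x: "x \<in> K" for x
  proof -
    have "\<exists>k::nat. x [^]\<^bsub>?B\<^esub> k \<in> {\<zero>\<^bsub>?B\<^esub>}"
      by (rule B.mem_primes_imp_power[OF B.zeroideal]) (use x in \<open>auto simp: K_def\<close>)
    then show ?thesis by simp
  qed
  have Ki: "ideal K ?B"
  proof (rule B.idealI_cring)
    show "K \<subseteq> carrier ?B" by (auto simp: K_def)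
    have p: "ideal M ?B" if "primeideal M ?B" for M using that by (simp add: primeideal_def)
    show "\<zero>\<^bsub>?B\<^esub> \<in> K" using B.zero_closed zero_mem_ideal[OF p] by (auto simp: K_def)
    show "x \<oplus>\<^bsub>?B\<^esub> y \<in> K" if "x \<in> K" "y \<in> K" for x y
      using that subringE(7)[OF B, of x y] additive_subgroup.a_closed[OF ideal.axioms(1)[OF p]] by (auto simp: K_def)
    show "c \<otimes>\<^bsub>?B\<^esub> x \<in> K" if "c \<in> carrier ?B" "x \<in> K" for c x
      using that subringE(6)[OF B, of c x] ideal.I_l_closed[OF p] by (auto simp: K_def)
  qed
  have fK: "f \<nu> \<in> K" for \<nu>
  proof -
    have fB: "f \<nu> \<in> B" using f by (simp add: vals_def)
    have "f \<nu> \<in> M" if M: "primeideal M ?B" for M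
    proof -
      obtain k :: nat where "f \<nu> [^] k = \<zero>" using nil by blast
      then have "f \<nu> [^]\<^bsub>?B\<^esub> k \<in> M"
        using additive_subgroup.zero_closed[OF ideal.axioms(1), of M ?B] M by (simp add: primeideal_def)
      then show ?thesis using B.primeideal_pow[OF M, of "f \<nu>" k] fB by simp
    qed
    then show ?thesis using fB by (simp add: K_def)
  qed
  have "\<exists>k. ideal_power ?B K k = {\<zero>\<^bsub>?B\<^esub>}"
    by (rule B.nil_ideal_nilpotent[OF art Ki]) (use Knil in simp)
  then obtain k where k: "ideal_power ?B K k = {\<zero>}" by auto
  have coeff: "(f [^][n] m) \<nu> \<in> ideal_power ?B K m" for m \<nu>
  proof (induction m arbitrary: \<nu>)
    case 0
    show ?case using subringE(2,3)[OF B] by (simp add: ps_one)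
  next
    case (Suc m)
    have Pi: "ideal (ideal_power ?B K (Suc m)) ?B" by (rule B.ideal_power_ideal[OF Ki])
    have z: "\<zero> \<in> ideal_power ?B K (Suc m)" using zero_mem_ideal[OF Pi] by simp
    have e: "f [^][n] Suc m = f \<otimes>[n] f [^][n] m" using fc by (simp add: P.m_comm)
    show ?case
    proof (cases "\<nu> \<in> mexps n")
      case True
      show ?thesis
        unfolding e ps_mult[OF True]
      proof (rule finsum_mem_closed)
        show "ideal_power ?B K (Suc m) \<subseteq> carrier R" using B.ideal_subset[OF Pi] subringE(1)[OF B] by auto
        show "x \<oplus> y \<in> ideal_power ?B K (Suc m)" if "x \<in> ideal_power ?B K (Suc m)" "y \<in> ideal_power ?B K (Suc m)" for x y
          using additive_subgroup.a_closed[OF ideal.axioms(1)[OF Pi] that] by simp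
        show "f \<beta> \<otimes> (f [^][n] m) (esub \<nu> \<beta>) \<in> ideal_power ?B K (Suc m)" if "\<beta> \<in> below \<nu>" for \<beta>
          using B.ideal_power_mult[OF Ki fK Suc] by simp
      qed (rule z)
    next
      case False
      then show ?thesis unfolding e ps_mult_outside[OF False] using z by simp
    qed
  qed
  have "f [^][n] k = \<zero>[n]"
  proof (rule ps_eqI)
    show "f [^][n] k \<in> PSC n" by (rule P.nat_pow_closed[OF fc])
    show "(f [^][n] k) \<nu> = \<zero>[n] \<nu>" for \<nu> using coeff[of k \<nu>] k by (simp add: ps_zero)
  qed simp
  then show ?thesis by blast
qed

lemma power_series_family_fg:
  assumes kd: "krull_dim_zero R" and sl: "semilocal R" and R0: "subring R0 R"
    and art: "artinian (R\<lparr>carrier := R0\<rparr>)" and int: "integral_over R R0"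
  shows "power_series_family R {A. fg_subalgebra R R0 A}"
proof -
  let ?F = "{A. fg_subalgebra R R0 A}"
  have R0c: "R0 \<subseteq> carrier R" by (rule subringE(1)[OF R0])
  have gen: "generate_ring R (R0 \<union> X) \<in> ?F" if "finite X" "X \<subseteq> carrier R" for X
    using that by (auto simp: fg_subalgebra_def)
  have pm: "maximalideal P R" if "primeideal P R" for P using kd that by (simp add: krull_dim_zero_def)
  show ?thesis
  proof (intro power_series_family.intro power_series_family_axioms.intro)
    show "cring R" by (rule is_cring)
    show "?F \<noteq> {}" using gen[of "{}"] by auto
    show "subring B R" if "B \<in> ?F" for B
      using that generate_ring_is_subring R0c by (auto simp: fg_subalgebra_def)
    show "\<exists>D\<in>?F. B \<subseteq> D \<and> C \<subseteq> D" if BC: "B \<in> ?F" "C \<in> ?F" for B C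
    proof -
      obtain X Y where X: "finite X" "X \<subseteq> carrier R" "B = generate_ring R (R0 \<union> X)"
        and Y: "finite Y" "Y \<subseteq> carrier R" "C = generate_ring R (R0 \<union> Y)"
        using BC by (auto simp: fg_subalgebra_def)
      have c: "R0 \<union> (X \<union> Y) \<subseteq> carrier R" using R0c X(2) Y(2) by blast
      have "B \<subseteq> generate_ring R (R0 \<union> (X \<union> Y))" unfolding X(3) by (rule mono_generate_ring[OF _ c]) blast
      moreover have "C \<subseteq> generate_ring R (R0 \<union> (X \<union> Y))" unfolding Y(3) by (rule mono_generate_ring[OF _ c]) blast
      ultimately show ?thesis using gen[of "X \<union> Y"] X(1,2) Y(1,2) by blast
    qed
    show "\<exists>B\<in>?F. x \<in> B" if x: "x \<in> carrier R" for x
    proof -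
      have "x \<in> generate_ring R (R0 \<union> {x})" by (rule generate_ring.incl) simp
      then show ?thesis using gen[of "{x}"] x by blast
    qed
    show "\<exists>k::nat. f [^]\<^bsub>mps R m\<^esub> k = \<zero>\<^bsub>mps R m\<^esub>"
      if B: "B \<in> ?F" and f: "f \<in> vals B m" and nil: "\<And>\<nu>. \<exists>k::nat. f \<nu> [^] k = \<zero>" for B m f
    proof -
      obtain X where X: "finite X" "X \<subseteq> carrier R" "B = generate_ring R (R0 \<union> X)"
        using B by (auto simp: fg_subalgebra_def)
      \<comment> \<open>Nilpotence of \<open>f\<close> does not depend on the subring in which its
        coefficients are placed, so an Artinian subring containing \<open>B\<close>, built by
        adjoining the generators one after the other, serves the purpose.\<close>
      obtain C where C: "subring C R" "artinian (R\<lparr>carrier := C\<rparr>)" "R0 \<union> X \<subseteq> C"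
        using artinian_subring_containing[OF R0 art int X(1,2)] by blast
      have "B \<subseteq> C" unfolding X(3) by (rule generate_ring_min_subring1[OF _ C(1,3)]) (use R0c X(2) in blast)
      then have "f \<in> vals C m" using f by (auto simp: vals_def)
      then show ?thesis by (rule nil_coefficients_nilpotent[OF C(1,2) _ nil])
    qed
    show "maximalideal P R" if "primeideal P R" for P by (rule pm[OF that])
    show "\<exists>e\<in>carrier R. e \<otimes> e = e \<and> (\<forall>M. maximalideal M R \<longrightarrow> (e \<in> M \<longleftrightarrow> M \<notin> J))"
      if "J \<subseteq> {M. maximalideal M R}" for J
      by (rule semilocal_idempotents[OF pm _ that]) (use sl in \<open>simp_all add: semilocal_def\<close>)
  qed
qed

end

theorem theorem6p9:
  fixes R :: "'a ring" and R0 :: "'a set" and n :: nat and I :: "((nat \<Rightarrow> nat) \<Rightarrow> 'a) set"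
  assumes "cring R"
    and "krull_dim_zero R"
    and "semilocal R"
    and "subring R0 R"
    and "artinian (R \<lparr> carrier := R0 \<rparr>)"
    and "integral_over R R0"
    and "ideal I (artinian_mps R R0 n)"
    and "I \<noteq> carrier (artinian_mps R R0 n)"
  shows "height_generated (artinian_mps R R0 n) I \<longleftrightarrow>
    (\<exists>fs. regular_sequence (artinian_mps R R0 n) fs \<and> genideal (artinian_mps R R0 n) (set fs) = I)"
proof -
  interpret cring R by fact
  interpret power_series_family R "{A. fg_subalgebra R R0 A}"
    by (rule power_series_family_fg[OF assms(2-6)])
  have "SV n = {f \<in> mps_carrier R n. \<exists>A. fg_subalgebra R R0 A \<and> (\<forall>\<alpha>. f \<alpha> \<in> A)}"
    by (auto simp: SV_def vals_def mps_def)
  then have S: "artinian_mps R R0 n = SS n" by (simp add: artinian_mps_def)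
  show ?thesis unfolding S by (rule height_generated_iff_regular) (use assms(7,8) S in simp_all)
qed

end
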